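(* Let $k$ be a field, let $A,B,C$ be finite dimensional elementary $k$-algebras with $A$ of finite global dimension, and let $\{e_1,\dots,e_n\}$, $\{f_1,\dots,f_m\}$, $\{g_1,\dots,g_p\}$ be complete sets of orthogonal primitive idempotents of $A$, $B$, $C$ respectively. Let $C_A$ be the Cartan matrix of $A$. Then the following two equivalent statements hold: (1) For every chain endomorphism $\phi$ of a bounded complex $M$ of finite dimensional $B$-$A$-bimodules and every chain endomorphism $\psi$ of a bounded complex $N$ of finite dimensional $C$-$A$-bimodules, $$\underline{\underline{\mathrm{tr}}}(\mathrm{RHom}_A(\phi,\psi)) := \sum_{l\in\mathbb{Z}}(-1)^l\, \underline{\underline{\mathrm{tr}}}(\mathrm{Ext}^l_A(\phi,\psi)) = \langle \underline{\underline{\mathrm{tr}}}\, \phi,\underline{\underline{\mathrm{tr}}}\, \psi \rangle_A,$$ where $\langle -,- \rangle_A : k^{n\times m} \times k^{n\times p} \to k^{m\times p}$, $(x,y)\mapsto x^T C_A^{-T} y$. (2) For every chain endomorphism $\phi$ of a bounded complex $M$ of finite dimensional $B$-$A$-bimodules and every chain endomorphism $\psi$ of a bounded complex $N$ of finite dimensional $A$-$C$-bimodules, $$\underline{\underline{\mathrm{tr}}}(\phi\otimes^L_A\psi) := \sum_{l\in\mathbb{Z}}(-1)^l\, \underline{\underline{\mathrm{tr}}}(\mathrm{Tor}^A_l(\phi,\psi)) = \langle (\underline{\underline{\mathrm{tr}}}\, \psi)^T,\underline{\underline{\mathrm{tr}}}\, \phi \rangle_{A^{\mathrm{op}}},$$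 where $\langle -,- \rangle_{A^{\mathrm{op}}} : k^{n\times p} \times k^{n\times m} \to k^{p \times m}$, $(x,y)\mapsto x^T C_A^{-1} y$.
   Context: $k$ is a fixed field; algebras are associative unital $k$-algebras; $\dim=\dim_k$; $T$ denotes transpose and $C^{-T}=(C^{-1})^T$. A complex $X$ is both a cochain complex $(X^l)$ and a chain complex $(X_l)$ with $X^l=X_{-l}$. A finite dimensional algebra $A$ is elementary if $A/\mathrm{rad}\,A$ is isomorphic to a direct product of finitely many copies of $k$. A $B$-$A$-bimodule is a left $B$-, right $A$-bimodule on which $k$ acts centrally. Cartan matrix: $C_A=(c_{ij})\in\mathbb{Z}^{n\times n}$ with $c_{ij}=\dim\mathrm{Hom}_A(e_iA,e_jA)=\dim e_jAe_i$. When $A$ has finite global dimension, $\det C_A=\pm1$, so $C_A^{-1}$ is an integer matrix; here its entries are regarded in $k$. Trace matrix: if $R,S$ are finite dimensional elementary algebras with chosen complete sets of orthogonal primitive idempotents $\{r_1,\dots,r_a\}$ of $R$ and $\{s_1,\dots,s_b\}$ of $S$, and $\theta$ is an endomorphism of a finite dimensional $S$-$R$-bimodule $X$, then $\underline{\underline{\mathrm{tr}}}\,\theta\in k^{a\times b}$ is the matrix whose $(i,j)$ entry is the trace of the restriction of $\theta$ to $s_jXr_i$. For a chain endomorphism $\theta$ of a bounded complex $X$ of finite dimensional $S$-$R$-bimodules, $\underline{\underline{\mathrm{tr}}}\,\theta:=\sum_{l\in\mathbb{Z}}(-1)^l\,\underline{\underline{\mathrm{tr}}}(\theta^l)$. $\mathrm{Ext}^l_A(M,N):=H^l(\mathrm{RHom}_A(M,N))$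 (over right $A$-modules) is a $C$-$B$-bimodule and $\mathrm{Ext}^l_A(\phi,\psi)$ is its bimodule endomorphism induced by precomposition with $\phi$ and postcomposition with $\psi$; its trace matrix is $m\times p$. $\mathrm{Tor}^A_l(M,N):=H_l(M\otimes^L_AN)$ is a $B$-$C$-bimodule with induced endomorphism $\mathrm{Tor}^A_l(\phi,\psi)$; its trace matrix is $p\times m$. *)

theory Defs
  imports
    "Jordan_Normal_Form.Matrix"
    "HOL-Library.Poly_Mapping"
    "HOL-Library.Function_Algebras"
begin

section \<open>Finite dimensional algebras\<close>

text \<open>
  A \<open>k\<close>-algebra is a type of sort \<open>{ring, monoid_mult}\<close> together with a scalar
  multiplication by the field \<open>k\<close>.  This sort describes associative unital rings in which
  \<open>0 = 1\<close> is not excluded, so that the zero algebra (with no idempotents) is covered.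
\<close>

definition fd_algebra :: "('k::field \<Rightarrow> 'a::{ring,monoid_mult} \<Rightarrow> 'a) \<Rightarrow> bool" where
  "fd_algebra s \<longleftrightarrow>
     vector_space s
   \<and> (\<forall>c x y. s c (x * y) = s c x * y \<and> s c (x * y) = x * s c y)
   \<and> (\<exists>S. finite S \<and> Modules.module.span s S = UNIV)"

definition right_ideal :: "'a::{ring,monoid_mult} set \<Rightarrow> bool" where
  "right_ideal I \<longleftrightarrow>
     0 \<in> I \<and> (\<forall>x\<in>I. \<forall>y\<in>I. x - y \<in> I) \<and> (\<forall>x\<in>I. \<forall>a. x * a \<in> I)"

definition maximal_right_ideal :: "'a::{ring,monoid_mult} set \<Rightarrow> bool" where
  "maximal_right_ideal I \<longleftrightarrow>
     right_ideal I \<and> I \<noteq> UNIV \<and> (\<forall>J. right_ideal J \<and> I \<subseteq> J \<longrightarrow> J = I \<or> J = UNIV)"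

definition jacobson_radical :: "'a::{ring,monoid_mult} set" where
  "jacobson_radical = \<Inter> {I. maximal_right_ideal I}"

text \<open>
  An isomorphism of algebras from \<open>A / rad A\<close> to \<open>k\<^sup>r\<close> is given as a surjective algebra
  homomorphism \<open>h\<close> from \<open>A\<close> to \<open>k\<^sup>r\<close> with kernel \<open>rad A\<close>; only the coordinates \<open>i < r\<close>
  of \<open>h x\<close> are used.
\<close>

definition elementary :: "('k::field \<Rightarrow> 'a::{ring,monoid_mult} \<Rightarrow> 'a) \<Rightarrow> bool" where
  "elementary s \<longleftrightarrow>
     (\<exists>(r::nat) (h :: 'a \<Rightarrow> nat \<Rightarrow> 'k).
        (\<forall>i<r. \<forall>x y. h (x + y) i = h x i + h y i)
      \<and> (\<forall>i<r. \<forall>c x. h (s c x) i = c * h x i)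
      \<and> (\<forall>i<r. \<forall>x y. h (x * y) i = h x i * h y i)
      \<and> (\<forall>i<r. h 1 i = 1)
      \<and> (\<forall>v. \<exists>x. \<forall>i<r. h x i = v i)
      \<and> {x. \<forall>i<r. h x i = 0} = jacobson_radical)"

definition primitive_idempotent :: "'a::{ring,monoid_mult} \<Rightarrow> bool" where
  "primitive_idempotent e \<longleftrightarrow>
     e * e = e \<and> e \<noteq> 0
   \<and> (\<forall>x y. x * x = x \<and> y * y = y \<and> x * y = 0 \<and> y * x = 0 \<and> e = x + y \<longrightarrow> x = 0 \<or> y = 0)"

definition complete_primitive_idempotents :: "nat \<Rightarrow> (nat \<Rightarrow> 'a::{ring,monoid_mult}) \<Rightarrow> bool" where
  "complete_primitive_idempotents n e \<longleftrightarrow>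
     (\<forall>i<n. primitive_idempotent (e i))
   \<and> (\<forall>i<n. \<forall>j<n. i \<noteq> j \<longrightarrow> e i * e j = 0)
   \<and> (\<Sum>i<n. e i) = 1"

definition cartan_matrix ::
  "('k::field \<Rightarrow> 'a::{ring,monoid_mult} \<Rightarrow> 'a) \<Rightarrow> nat \<Rightarrow> (nat \<Rightarrow> 'a) \<Rightarrow> int mat" where
  "cartan_matrix s n e =
     mat n n (\<lambda>(i, j). int (vector_space.dim s (range (\<lambda>x. e j * x * e i))))"

definition inverse_mat :: "'a::comm_ring_1 mat \<Rightarrow> 'a mat" where
  "inverse_mat C =
     (THE D. D \<in> carrier_mat (dim_row C) (dim_row C) \<and> inverts_mat C D \<and> inverts_mat D C)"

text \<open>The inverse is taken over the integers and its entries are then mapped to \<open>k\<close>.\<close>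

definition euler_form :: "int mat \<Rightarrow> 'k::field mat \<Rightarrow> 'k mat \<Rightarrow> 'k mat" where
  "euler_form C x y = transpose_mat x * transpose_mat (map_mat of_int (inverse_mat C)) * y"

definition euler_form_op :: "int mat \<Rightarrow> 'k::field mat \<Rightarrow> 'k mat \<Rightarrow> 'k mat" where
  "euler_form_op C x y = transpose_mat x * map_mat of_int (inverse_mat C) * y"


section \<open>Modules and bimodules\<close>

text \<open>
  The underlying space of a module is a subspace \<open>carr\<close> of an arbitrary ambient \<open>k\<close>-vector
  space; the actions are only relevant on \<open>carr\<close>.
\<close>

record ('k, 'r, 'x) rmod =
  carr :: "'x set"
  scl :: "'k \<Rightarrow> 'x \<Rightarrow> 'x"
  ract :: "'x \<Rightarrow> 'r \<Rightarrow> 'x"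

record ('k, 'r, 'x, 's) bimod = "('k, 'r, 'x) rmod" +
  lact :: "'s \<Rightarrow> 'x \<Rightarrow> 'x"

definition right_module ::
  "('k::field \<Rightarrow> 'r::{ring,monoid_mult} \<Rightarrow> 'r) \<Rightarrow> ('k, 'r, 'x::ab_group_add, 'z) rmod_scheme \<Rightarrow> bool"
where
  "right_module sR X \<longleftrightarrow>
     vector_space (scl X) \<and> Modules.module.subspace (scl X) (carr X)
   \<and> (\<forall>x\<in>carr X. \<forall>r. ract X x r \<in> carr X)
   \<and> (\<forall>x\<in>carr X. \<forall>y\<in>carr X. \<forall>r. ract X (x + y) r = ract X x r + ract X y r)
   \<and> (\<forall>x\<in>carr X. \<forall>r r'. ract X x (r + r') = ract X x r + ract X x r')
   \<and> (\<forall>x\<in>carr X. \<forall>r r'. ract X x (r * r') = ract X (ract X x r) r')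
   \<and> (\<forall>x\<in>carr X. ract X x 1 = x)
   \<and> (\<forall>x\<in>carr X. \<forall>c r. ract X x (sR c r) = scl X c (ract X x r))"

text \<open>An \<open>S\<close>-\<open>R\<close>-bimodule; the last clauses of both definitions say that \<open>k\<close> acts centrally.\<close>

definition bimodule ::
  "('k::field \<Rightarrow> 's::{ring,monoid_mult} \<Rightarrow> 's) \<Rightarrow> ('k \<Rightarrow> 'r::{ring,monoid_mult} \<Rightarrow> 'r)
    \<Rightarrow> ('k, 'r, 'x::ab_group_add, 's) bimod \<Rightarrow> bool"
where
  "bimodule sS sR X \<longleftrightarrow>
     right_module sR X
   \<and> (\<forall>x\<in>carr X. \<forall>s. lact X s x \<in> carr X)
   \<and> (\<forall>x\<in>carr X. \<forall>y\<in>carr X. \<forall>s. lact X s (x + y) = lact X s x + lact X s y)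
   \<and> (\<forall>x\<in>carr X. \<forall>s s'. lact X (s + s') x = lact X s x + lact X s' x)
   \<and> (\<forall>x\<in>carr X. \<forall>s s'. lact X (s * s') x = lact X s (lact X s' x))
   \<and> (\<forall>x\<in>carr X. lact X 1 x = x)
   \<and> (\<forall>x\<in>carr X. \<forall>s r. ract X (lact X s x) r = lact X s (ract X x r))
   \<and> (\<forall>x\<in>carr X. \<forall>c s. lact X (sS c s) x = scl X c (lact X s x))"

definition fin_dim :: "('k::field, 'r, 'x::ab_group_add, 'z) rmod_scheme \<Rightarrow> bool" where
  "fin_dim X \<longleftrightarrow> (\<exists>S. finite S \<and> S \<subseteq> carr X \<and> Modules.module.span (scl X) S = carr X)"

definition rmod_hom ::
  "('k::field, 'r, 'x::ab_group_add, 'z) rmod_scheme \<Rightarrow> ('k, 'r, 'y::ab_group_add, 'w) rmod_scheme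
    \<Rightarrow> ('x \<Rightarrow> 'y) \<Rightarrow> bool"
where
  "rmod_hom X Y f \<longleftrightarrow>
     (\<forall>x\<in>carr X. f x \<in> carr Y)
   \<and> (\<forall>x\<in>carr X. \<forall>y\<in>carr X. f (x + y) = f x + f y)
   \<and> (\<forall>c. \<forall>x\<in>carr X. f (scl X c x) = scl Y c (f x))
   \<and> (\<forall>x\<in>carr X. \<forall>r. f (ract X x r) = ract Y (f x) r)"

definition bimod_hom ::
  "('k::field, 'r, 'x::ab_group_add, 's) bimod \<Rightarrow> ('k, 'r, 'y::ab_group_add, 's) bimod
    \<Rightarrow> ('x \<Rightarrow> 'y) \<Rightarrow> bool"
where
  "bimod_hom X Y f \<longleftrightarrow>
     rmod_hom X Y f \<and> (\<forall>x\<in>carr X. \<forall>s. f (lact X s x) = lact Y s (f x))"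

text \<open>
  Projectivity: every surjection onto \<open>P\<close> splits.  The type \<open>'x \<Rightarrow> 'a\<close> contains the free
  module on the set \<open>carr P\<close>, so testing surjections from modules living there is enough.
\<close>

definition projective ::
  "('k::field \<Rightarrow> 'a::{ring,monoid_mult} \<Rightarrow> 'a) \<Rightarrow> ('k, 'a, 'x::ab_group_add, 'z) rmod_scheme \<Rightarrow> bool"
where
  "projective sA P \<longleftrightarrow>
     right_module sA P
   \<and> (\<forall>(X :: ('k, 'a, 'x \<Rightarrow> 'a) rmod) g.
        right_module sA X \<and> rmod_hom X P g \<and> g ` carr X = carr P
        \<longrightarrow> (\<exists>h. rmod_hom P X h \<and> (\<forall>x\<in>carr P. g (h x) = x)))"

text \<open>
  Global dimension is computed in the category of finite dimensional right modules, in which a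
  module of projective dimension at most \<open>d\<close> has a projective resolution of length at most \<open>d\<close>.
  Every finite dimensional vector space has a copy inside \<open>nat \<Rightarrow> 'k\<close>.
\<close>

definition proj_dim_le ::
  "('k::field \<Rightarrow> 'a::{ring,monoid_mult} \<Rightarrow> 'a) \<Rightarrow> nat \<Rightarrow> ('k, 'a, nat \<Rightarrow> 'k) rmod \<Rightarrow> bool"
where
  "proj_dim_le sA d M \<longleftrightarrow>
     (\<exists>(P :: nat \<Rightarrow> ('k, 'a, nat \<Rightarrow> 'k) rmod) \<delta> \<epsilon>.
        (\<forall>i. projective sA (P i) \<and> fin_dim (P i))
      \<and> (\<forall>i>d. carr (P i) = {0})
      \<and> rmod_hom (P 0) M \<epsilon> \<and> (\<forall>i. rmod_hom (P (Suc i)) (P i) (\<delta> i))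
      \<and> \<epsilon> ` carr (P 0) = carr M
      \<and> {x \<in> carr (P 0). \<epsilon> x = 0} = \<delta> 0 ` carr (P (Suc 0))
      \<and> (\<forall>i. {x \<in> carr (P (Suc i)). \<delta> i x = 0} = \<delta> (Suc i) ` carr (P (Suc (Suc i)))))"

definition finite_global_dimension :: "('k::field \<Rightarrow> 'a::{ring,monoid_mult} \<Rightarrow> 'a) \<Rightarrow> bool" where
  "finite_global_dimension sA \<longleftrightarrow>
     (\<exists>d. \<forall>M :: ('k, 'a, nat \<Rightarrow> 'k) rmod. right_module sA M \<and> fin_dim M \<longrightarrow> proj_dim_le sA d M)"


section \<open>Quotients\<close>

text \<open>
  The quotient of \<open>X\<close> by a sub-bimodule \<open>W\<close> is realised on the complement of \<open>W\<close> cut out by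
  a chosen linear projection with kernel \<open>W\<close>.  This projection plays the role of the quotient map:
  restricted to \<open>carr X\<close> it is a surjective homomorphism of bimodules with kernel \<open>W\<close>.
\<close>

definition quot_proj :: "('k::field \<Rightarrow> 'x::ab_group_add \<Rightarrow> 'x) \<Rightarrow> 'x set \<Rightarrow> 'x \<Rightarrow> 'x" where
  "quot_proj s W =
     (SOME p. Vector_Spaces.linear s s p \<and> (\<forall>x. p x = 0 \<longleftrightarrow> x \<in> W) \<and> (\<forall>x. p (p x) = p x))"

definition quot ::
  "('k::field, 'r, 'x::ab_group_add, 's) bimod \<Rightarrow> 'x set \<Rightarrow> ('k, 'r, 'x, 's) bimod"
where
  "quot X W =
     \<lparr> carr = quot_proj (scl X) W ` carr X,
       scl = scl X,
       ract = (\<lambda>x r. quot_proj (scl X) W (ract X x r)),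
       lact = (\<lambda>s x. quot_proj (scl X) W (lact X s x)) \<rparr>"


section \<open>Complexes of bimodules\<close>

text \<open>Complexes are graded cohomologically; in homological grading \<open>X\<^sub>l = X\<^sup>-\<^sup>l\<close>.\<close>

record ('k, 'r, 'x, 's) cpx =
  ob :: "int \<Rightarrow> ('k, 'r, 'x, 's) bimod"
  df :: "int \<Rightarrow> 'x \<Rightarrow> 'x"

definition bimodule_complex ::
  "('k::field \<Rightarrow> 's::{ring,monoid_mult} \<Rightarrow> 's) \<Rightarrow> ('k \<Rightarrow> 'r::{ring,monoid_mult} \<Rightarrow> 'r)
    \<Rightarrow> ('k, 'r, 'x::ab_group_add, 's) cpx \<Rightarrow> bool"
where
  "bimodule_complex sS sR X \<longleftrightarrow>
     (\<forall>l. bimodule sS sR (ob X l))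
   \<and> (\<forall>l. bimod_hom (ob X l) (ob X (l + 1)) (df X l))
   \<and> (\<forall>l. \<forall>x\<in>carr (ob X l). df X (l + 1) (df X l x) = 0)"

definition bounded_fd_complex ::
  "('k::field \<Rightarrow> 's::{ring,monoid_mult} \<Rightarrow> 's) \<Rightarrow> ('k \<Rightarrow> 'r::{ring,monoid_mult} \<Rightarrow> 'r)
    \<Rightarrow> ('k, 'r, 'x::ab_group_add, 's) cpx \<Rightarrow> bool"
where
  "bounded_fd_complex sS sR X \<longleftrightarrow>
     bimodule_complex sS sR X
   \<and> finite {l. carr (ob X l) \<noteq> {0}}
   \<and> (\<forall>l. fin_dim (ob X l))"

definition chain_map ::
  "('k::field, 'r, 'x::ab_group_add, 's) cpx \<Rightarrow> ('k, 'r, 'y::ab_group_add, 's) cpx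
    \<Rightarrow> (int \<Rightarrow> 'x \<Rightarrow> 'y) \<Rightarrow> bool"
where
  "chain_map X Y f \<longleftrightarrow>
     (\<forall>l. bimod_hom (ob X l) (ob Y l) (f l))
   \<and> (\<forall>l. \<forall>x\<in>carr (ob X l). f (l + 1) (df X l x) = df Y l (f l x))"

definition cocycles :: "('k::field, 'r, 'x::ab_group_add, 's) cpx \<Rightarrow> int \<Rightarrow> 'x set" where
  "cocycles X l = {x \<in> carr (ob X l). df X l x = 0}"

definition coboundaries :: "('k::field, 'r, 'x::ab_group_add, 's) cpx \<Rightarrow> int \<Rightarrow> 'x set" where
  "coboundaries X l = df X (l - 1) ` carr (ob X (l - 1))"

definition cohomology ::
  "('k::field, 'r, 'x::ab_group_add, 's) cpx \<Rightarrow> int \<Rightarrow> ('k, 'r, 'x, 's) bimod"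
where
  "cohomology X l = quot ((ob X l)\<lparr>carr := cocycles X l\<rparr>) (coboundaries X l)"

text \<open>
  The map on cohomology induced by a chain map \<open>f\<close> with target \<open>Y\<close>.  No source complex is needed,
  as elements of \<open>cohomology X l\<close> are represented by cocycles of \<open>X\<close>.
\<close>

definition cohomology_map ::
  "('k::field, 'r, 'y::ab_group_add, 's) cpx \<Rightarrow> (int \<Rightarrow> 'x \<Rightarrow> 'y) \<Rightarrow> int \<Rightarrow> 'x \<Rightarrow> 'y"
where
  "cohomology_map Y f l x = quot_proj (scl (ob Y l)) (coboundaries Y l) (f l x)"

definition quasi_isomorphism ::
  "('k::field, 'r, 'x::ab_group_add, 's) cpx \<Rightarrow> ('k, 'r, 'y::ab_group_add, 's) cpx
    \<Rightarrow> (int \<Rightarrow> 'x \<Rightarrow> 'y) \<Rightarrow> bool"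
where
  "quasi_isomorphism X Y f \<longleftrightarrow>
     chain_map X Y f
   \<and> (\<forall>l. bij_betw (cohomology_map Y f l) (carr (cohomology X l)) (carr (cohomology Y l)))"


section \<open>Derived functors\<close>

text \<open>
  \<open>\<pi> : P \<rightarrow> M\<close> is a quasi-isomorphism of complexes of \<open>B\<close>-\<open>A\<close>-bimodules from a bounded above
  complex whose terms are projective as right \<open>A\<close>-modules.  Every bounded \<open>M\<close> has such
  resolutions, for instance by projective bimodules.  \<open>RHom\<^sub>A(M, N)\<close> and \<open>M \<otimes>\<^sup>L\<^sub>A N\<close> are
  \<open>Hom\<^sub>A(P, N)\<close> and \<open>P \<otimes>\<^sub>A N\<close>, independently of the choice of \<open>P\<close>.
\<close>

definition projective_resolution ::
  "('k::field \<Rightarrow> 'b::{ring,monoid_mult} \<Rightarrow> 'b) \<Rightarrow> ('k \<Rightarrow> 'a::{ring,monoid_mult} \<Rightarrow> 'a)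
    \<Rightarrow> ('k, 'a, 'p::ab_group_add, 'b) cpx \<Rightarrow> ('k, 'a, 'm::ab_group_add, 'b) cpx
    \<Rightarrow> (int \<Rightarrow> 'p \<Rightarrow> 'm) \<Rightarrow> bool"
where
  "projective_resolution sB sA P M \<pi> \<longleftrightarrow>
     bimodule_complex sB sA P
   \<and> (\<exists>u. \<forall>l>u. carr (ob P l) = {0})
   \<and> (\<forall>l. projective sA (ob P l))
   \<and> quasi_isomorphism P M \<pi>"

text \<open>
  \<open>\<Phi>\<close> lifts the chain endomorphism \<open>\<phi>\<close> of \<open>M\<close> to \<open>P\<close>: it is a chain endomorphism of \<open>P\<close> such
  that \<open>\<pi> \<circ> \<Phi>\<close> and \<open>\<phi> \<circ> \<pi>\<close> are homotopic as maps of complexes of right \<open>A\<close>-modules.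
\<close>

definition lifts_endomorphism ::
  "('k::field, 'a, 'p::ab_group_add, 'b) cpx \<Rightarrow> ('k, 'a, 'm::ab_group_add, 'b) cpx
    \<Rightarrow> (int \<Rightarrow> 'p \<Rightarrow> 'm) \<Rightarrow> (int \<Rightarrow> 'm \<Rightarrow> 'm) \<Rightarrow> (int \<Rightarrow> 'p \<Rightarrow> 'p) \<Rightarrow> bool"
where
  "lifts_endomorphism P M \<pi> \<phi> \<Phi> \<longleftrightarrow>
     chain_map P P \<Phi>
   \<and> (\<exists>h. (\<forall>l. rmod_hom (ob P l) (ob M (l - 1)) (h l))
        \<and> (\<forall>l. \<forall>x\<in>carr (ob P l).
             \<pi> l (\<Phi> l x) - \<phi> l (\<pi> l x) = df M (l - 1) (h l x) + h (l + 1) (df P l x)))"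

text \<open>
  \<open>hom_cpx P N\<close> is the total Hom complex \<open>Hom\<^sub>A(P, N)\<close>.  An element of degree \<open>l\<close> is a family of
  \<open>A\<close>-linear maps \<open>f i : P\<^sup>i \<rightarrow> N\<^sup>i\<^sup>+\<^sup>l\<close>, extended by \<open>0\<close> outside \<open>P\<^sup>i\<close> to make it unique.  The actions
  are \<open>(f b) x = f (b x)\<close> and \<open>(c f) x = c (f x)\<close>, and \<open>d f = d\<^sub>N f - (-1)\<^sup>l f d\<^sub>P\<close>.
\<close>

definition hom_cpx ::
  "('k::field, 'a, 'p::ab_group_add, 'b) cpx \<Rightarrow> ('k, 'a, 'n::ab_group_add, 'c) cpx
    \<Rightarrow> ('k, 'b, int \<Rightarrow> 'p \<Rightarrow> 'n, 'c) cpx"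
where
  "hom_cpx P N =
     \<lparr> ob = (\<lambda>l.
         \<lparr> carr = {f. \<forall>i. rmod_hom (ob P i) (ob N (i + l)) (f i)
                        \<and> (\<forall>x. x \<notin> carr (ob P i) \<longrightarrow> f i x = 0)},
           scl = (\<lambda>c f i x. scl (ob N (i + l)) c (f i x)),
           ract = (\<lambda>f b i x. if x \<in> carr (ob P i) then f i (lact (ob P i) b x) else 0),
           lact = (\<lambda>c f i x. if x \<in> carr (ob P i) then lact (ob N (i + l)) c (f i x) else 0) \<rparr>),
       df = (\<lambda>l f i x.
         if x \<in> carr (ob P i)
         then df N (i + l) (f i x)
              - (if even l then f (i + 1) (df P i x) else - f (i + 1) (df P i x))
         else 0) \<rparr>"

definition hom_map ::
  "('k::field, 'a, 'p::ab_group_add, 'b) cpx \<Rightarrow> (int \<Rightarrow> 'p \<Rightarrow> 'p) \<Rightarrow> (int \<Rightarrow> 'n \<Rightarrow> 'n)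
    \<Rightarrow> int \<Rightarrow> (int \<Rightarrow> 'p \<Rightarrow> 'n::ab_group_add) \<Rightarrow> (int \<Rightarrow> 'p \<Rightarrow> 'n)"
where
  "hom_map P \<Phi> \<psi> l f i x = (if x \<in> carr (ob P i) then \<psi> (i + l) (f i (\<Phi> i x)) else 0)"

text \<open>\<open>'z \<Rightarrow>\<^sub>0 'k\<close> is the vector space with basis the type \<open>'z\<close>.\<close>

definition free_scale :: "'k::field \<Rightarrow> ('z \<Rightarrow>\<^sub>0 'k) \<Rightarrow> ('z \<Rightarrow>\<^sub>0 'k)" where
  "free_scale c u = Poly_Mapping.map ((*) c) u"

definition lin_ext :: "('z \<Rightarrow> ('w \<Rightarrow>\<^sub>0 'k)) \<Rightarrow> ('z \<Rightarrow>\<^sub>0 'k::field) \<Rightarrow> ('w \<Rightarrow>\<^sub>0 'k)" where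
  "lin_ext g u = (\<Sum>z\<in>Poly_Mapping.keys u. free_scale (Poly_Mapping.lookup u z) (g z))"

abbreviation gen :: "'z \<Rightarrow> ('z \<Rightarrow>\<^sub>0 'k::field)" where
  "gen z \<equiv> Poly_Mapping.single z 1"

text \<open>
  The degree \<open>l\<close> part of \<open>P \<otimes>\<^sub>A N\<close> is the direct sum of the \<open>P\<^sup>i \<otimes>\<^sub>A N\<^sup>l\<^sup>-\<^sup>i\<close>.  It is the free
  vector space on the triples \<open>(i, x, y)\<close> with \<open>x \<in> P\<^sup>i\<close> and \<open>y \<in> N\<^sup>l\<^sup>-\<^sup>i\<close> (\<open>tensor_free\<close>) modulo the
  \<open>k\<close>-bilinear and \<open>A\<close>-balanced relations (\<open>tensor_rel\<close>).
\<close>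

definition tensor_free ::
  "('k::field, 'a, 'p::ab_group_add, 'b) cpx \<Rightarrow> ('k, 'c, 'n::ab_group_add, 'a) cpx \<Rightarrow> int
    \<Rightarrow> ('k, 'c, (int \<times> 'p \<times> 'n) \<Rightarrow>\<^sub>0 'k, 'b) bimod"
where
  "tensor_free P N l =
     \<lparr> carr = {u. Poly_Mapping.keys u \<subseteq> {(i, x, y). x \<in> carr (ob P i) \<and> y \<in> carr (ob N (l - i))}},
       scl = free_scale,
       ract = (\<lambda>u c. lin_ext (\<lambda>(i, x, y). gen (i, x, ract (ob N (l - i)) y c)) u),
       lact = (\<lambda>b. lin_ext (\<lambda>(i, x, y). gen (i, lact (ob P i) b x, y))) \<rparr>"

definition tensor_rel ::
  "('k::field, 'a, 'p::ab_group_add, 'b) cpx \<Rightarrow> ('k, 'c, 'n::ab_group_add, 'a) cpx \<Rightarrow> int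
    \<Rightarrow> ((int \<times> 'p \<times> 'n) \<Rightarrow>\<^sub>0 'k) set"
where
  "tensor_rel P N l = Modules.module.span free_scale
     ({gen (i, x + x', y) - gen (i, x, y) - gen (i, x', y) | i x x' y.
         x \<in> carr (ob P i) \<and> x' \<in> carr (ob P i) \<and> y \<in> carr (ob N (l - i))}
    \<union> {gen (i, x, y + y') - gen (i, x, y) - gen (i, x, y') | i x y y'.
         x \<in> carr (ob P i) \<and> y \<in> carr (ob N (l - i)) \<and> y' \<in> carr (ob N (l - i))}
    \<union> {gen (i, scl (ob P i) t x, y) - free_scale t (gen (i, x, y)) | i t x y.
         x \<in> carr (ob P i) \<and> y \<in> carr (ob N (l - i))}
    \<union> {gen (i, x, scl (ob N (l - i)) t y) - free_scale t (gen (i, x, y)) | i t x y.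
         x \<in> carr (ob P i) \<and> y \<in> carr (ob N (l - i))}
    \<union> {gen (i, ract (ob P i) x a, y) - gen (i, x, lact (ob N (l - i)) a y) | i x a y.
         x \<in> carr (ob P i) \<and> y \<in> carr (ob N (l - i))})"

text \<open>The differential is \<open>d (x \<otimes> y) = d x \<otimes> y + (-1)\<^sup>i x \<otimes> d y\<close> for \<open>x \<in> P\<^sup>i\<close>.\<close>

definition tensor_cpx ::
  "('k::field, 'a, 'p::ab_group_add, 'b) cpx \<Rightarrow> ('k, 'c, 'n::ab_group_add, 'a) cpx
    \<Rightarrow> ('k, 'c, (int \<times> 'p \<times> 'n) \<Rightarrow>\<^sub>0 'k, 'b) cpx"
where
  "tensor_cpx P N =
     \<lparr> ob = (\<lambda>l. quot (tensor_free P N l) (tensor_rel P N l)),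
       df = (\<lambda>l u. quot_proj free_scale (tensor_rel P N (l + 1))
         (lin_ext (\<lambda>(i, x, y).
            gen (i + 1, df P i x, y)
            + (if even i then gen (i, x, df N (l - i) y) else - gen (i, x, df N (l - i) y))) u)) \<rparr>"

definition tensor_map ::
  "('k::field, 'a, 'p::ab_group_add, 'b) cpx \<Rightarrow> ('k, 'c, 'n::ab_group_add, 'a) cpx
    \<Rightarrow> (int \<Rightarrow> 'p \<Rightarrow> 'p) \<Rightarrow> (int \<Rightarrow> 'n \<Rightarrow> 'n)
    \<Rightarrow> int \<Rightarrow> ((int \<times> 'p \<times> 'n) \<Rightarrow>\<^sub>0 'k) \<Rightarrow> ((int \<times> 'p \<times> 'n) \<Rightarrow>\<^sub>0 'k)"
where
  "tensor_map P N \<Phi> \<psi> l u = quot_proj free_scale (tensor_rel P N l)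
     (lin_ext (\<lambda>(i, x, y). gen (i, \<Phi> i x, \<psi> (l - i) y)) u)"

text \<open>In the following four definitions \<open>P\<close> is a projective resolution of the first argument.\<close>

definition Ext ::
  "('k::field, 'a, 'p::ab_group_add, 'b) cpx \<Rightarrow> ('k, 'a, 'n::ab_group_add, 'c) cpx \<Rightarrow> int
    \<Rightarrow> ('k, 'b, int \<Rightarrow> 'p \<Rightarrow> 'n, 'c) bimod"
where
  "Ext P N l = cohomology (hom_cpx P N) l"

definition Ext_map ::
  "('k::field, 'a, 'p::ab_group_add, 'b) cpx \<Rightarrow> ('k, 'a, 'n::ab_group_add, 'c) cpx
    \<Rightarrow> (int \<Rightarrow> 'p \<Rightarrow> 'p) \<Rightarrow> (int \<Rightarrow> 'n \<Rightarrow> 'n)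
    \<Rightarrow> int \<Rightarrow> (int \<Rightarrow> 'p \<Rightarrow> 'n) \<Rightarrow> (int \<Rightarrow> 'p \<Rightarrow> 'n)"
where
  "Ext_map P N \<Phi> \<psi> l = cohomology_map (hom_cpx P N) (hom_map P \<Phi> \<psi>) l"

definition Tor ::
  "('k::field, 'a, 'p::ab_group_add, 'b) cpx \<Rightarrow> ('k, 'c, 'n::ab_group_add, 'a) cpx \<Rightarrow> int
    \<Rightarrow> ('k, 'c, (int \<times> 'p \<times> 'n) \<Rightarrow>\<^sub>0 'k, 'b) bimod"
where
  "Tor P N l = cohomology (tensor_cpx P N) (- l)"

definition Tor_map ::
  "('k::field, 'a, 'p::ab_group_add, 'b) cpx \<Rightarrow> ('k, 'c, 'n::ab_group_add, 'a) cpx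
    \<Rightarrow> (int \<Rightarrow> 'p \<Rightarrow> 'p) \<Rightarrow> (int \<Rightarrow> 'n \<Rightarrow> 'n)
    \<Rightarrow> int \<Rightarrow> ((int \<times> 'p \<times> 'n) \<Rightarrow>\<^sub>0 'k) \<Rightarrow> ((int \<times> 'p \<times> 'n) \<Rightarrow>\<^sub>0 'k)"
where
  "Tor_map P N \<Phi> \<psi> l = cohomology_map (tensor_cpx P N) (tensor_map P N \<Phi> \<psi>) (- l)"


section \<open>Trace matrices\<close>

definition lin_trace ::
  "('k::field \<Rightarrow> 'x::ab_group_add \<Rightarrow> 'x) \<Rightarrow> 'x set \<Rightarrow> ('x \<Rightarrow> 'x) \<Rightarrow> 'k"
where
  "lin_trace s V \<theta> =
     (let B = (SOME B. \<not> Modules.module.dependent s B \<and> Modules.module.span s B = V)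
      in \<Sum>b\<in>B. Modules.module.representation s B (\<theta> b) b)"

text \<open>
  The trace matrix of an endomorphism of an \<open>S\<close>-\<open>R\<close>-bimodule with respect to idempotents
  \<open>r 0, \<dots>, r (a - 1)\<close> of \<open>R\<close> and \<open>s 0, \<dots>, s (b - 1)\<close> of \<open>S\<close>.
\<close>

definition trace_matrix ::
  "nat \<Rightarrow> (nat \<Rightarrow> 'r) \<Rightarrow> nat \<Rightarrow> (nat \<Rightarrow> 's) \<Rightarrow> ('k::field, 'r, 'x::ab_group_add, 's) bimod
    \<Rightarrow> ('x \<Rightarrow> 'x) \<Rightarrow> 'k mat"
where
  "trace_matrix a r b s X \<theta> =
     mat a b (\<lambda>(i, j). lin_trace (scl X) ((\<lambda>x. ract X (lact X (s j) x) (r i)) ` carr X) \<theta>)"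

definition alternating_sum :: "nat \<Rightarrow> nat \<Rightarrow> (int \<Rightarrow> 'k::field mat) \<Rightarrow> 'k mat" where
  "alternating_sum a b T =
     mat a b (\<lambda>ij. Sum_any (\<lambda>l. (if even l then T l $$ ij else - (T l $$ ij))))"

definition trace_matrix_cpx ::
  "nat \<Rightarrow> (nat \<Rightarrow> 'r) \<Rightarrow> nat \<Rightarrow> (nat \<Rightarrow> 's) \<Rightarrow> ('k::field, 'r, 'x::ab_group_add, 's) cpx
    \<Rightarrow> (int \<Rightarrow> 'x \<Rightarrow> 'x) \<Rightarrow> 'k mat"
where
  "trace_matrix_cpx a r b s X \<theta> = alternating_sum a b (\<lambda>l. trace_matrix a r b s (ob X l) (\<theta> l))"

end

theory Submission
  imports Defs "Jordan_Normal_Form.Determinant"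
begin

text \<open>
  Since \<open>M\<close> has finite dimensional homology and \<open>A\<close> has finite global dimension, the identity of the
  projective resolution \<open>P\<close> is homotopic to an endomorphism \<open>\<epsilon> = 1 - dh - hd\<close> of finite type: in each
  degree \<open>\<epsilon>\<^sup>l\<close> is a finite sum \<open>p \<mapsto> \<Sum>\<^sub>k t\<^sub>k \<xi>\<^sub>k(p)\<close> with \<open>t\<^sub>k \<in> P\<^sup>l\<close> and \<open>\<xi>\<^sub>k : P\<^sup>l \<rightarrow> A\<close> linear over \<open>A\<close>,
  and it vanishes for almost all \<open>l\<close>. Composing with \<open>\<epsilon>\<close> does not change traces on cohomology but makes
  the operators on \<open>P\<close>, on \<open>Hom(P, N)\<close> and on \<open>P \<otimes> N\<close> of finite rank, so that the Hopf trace formula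
  computes all of them degreewise. By cyclicity of the trace, these degreewise traces are the traces of the
  elements \<open>a\<^sub>l = \<Sum>\<^sub>k \<xi>\<^sub>k(\<Phi> t\<^sub>k)\<close> acting on \<open>A\<close> and on \<open>N\<close>. The radical acts nilpotently, hence only the
  residues \<open>\<chi>\<^sub>w(a\<^sub>l)\<close> at the primitive idempotents matter. With \<open>z\<^sub>w = \<Sum>\<^sub>l (-1)\<^sup>l \<chi>\<^sub>w(a\<^sub>l)\<close> one gets
  \<open>tr \<phi> = C\<^sub>A z\<close>, whereas the traces on Ext and Tor are \<open>z\<^sup>T tr \<psi>\<close>. The idempotents of \<open>B\<close> and \<open>C\<close> are
  absorbed into the endomorphisms. Finally, \<open>C\<^sub>A\<close> is invertible because the dimension vectors of the simple
  modules are integral combinations of those of the indecomposable projectives.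
\<close>

section \<open>Finite-rank traces and the Hopf trace formula\<close>

text \<open>\<open>P\<close> is an arbitrary projective resolution: its terms may be infinite
  dimensional and it may be unbounded below, so the degreewise traces of the lift
  \<open>\<Phi>\<close> need not exist. The homotopy \<open>h\<close> is moreover built over
  \<open>A\<close> only. It ignores the left \<open>B\<close>-action, so \<open>\<epsilon>\<close>
  need not preserve the part of \<open>P\<close> cut out by an idempotent of \<open>B\<close>, and a
  matrix entry cannot be computed on a subcomplex of \<open>P\<close>. Instead the idempotents are
  multiplied into the chain endomorphism, and only the resulting operator is corrected by
  \<open>\<epsilon>\<close>; on cocycles the correction is a coboundary. Finite global dimension
  acts twice. Finite dimensional cohomology alone already makes \<open>\<epsilon>\<close> of finite
  type in every degree, but its vanishing far to the left needs a finite resolution of the remaining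
  obstruction. The same resolutions express the simple dimension vectors through the columns of
  \<open>C\<^sub>A\<close>, over the integers and hence in every characteristic. The vector
  \<open>z\<close> depends on \<open>\<Phi>\<close>, \<open>\<epsilon>\<close> and one idempotent of
  \<open>B\<close>, but not on \<open>N\<close>. This is why \<open>tr \<phi>\<close>, Ext and Tor
  share it, and why solving \<open>tr \<phi> = C\<^sub>A z\<close> turns the two trace computations
  into the stated forms.\<close>

definition lin_on ::
  "('k \<Rightarrow> 'x::ab_group_add \<Rightarrow> 'x) \<Rightarrow> 'x set \<Rightarrow> ('k \<Rightarrow> 'y::ab_group_add \<Rightarrow> 'y) \<Rightarrow> ('x \<Rightarrow> 'y) \<Rightarrow> bool"
where
  "lin_on s V s' f \<longleftrightarrow>
     (\<forall>x\<in>V. \<forall>y\<in>V. f (x + y) = f x + f y) \<and> (\<forall>c. \<forall>x\<in>V. f (s c x) = s' c (f x))"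

definition fdim :: "('k::field \<Rightarrow> 'x::ab_group_add \<Rightarrow> 'x) \<Rightarrow> 'x set \<Rightarrow> bool" where
  "fdim s V \<longleftrightarrow> (\<exists>S. finite S \<and> Modules.module.span s S = V)"

abbreviation subsp :: "('k::field \<Rightarrow> 'x::ab_group_add \<Rightarrow> 'x) \<Rightarrow> 'x set \<Rightarrow> bool" where
  "subsp \<equiv> Modules.module.subspace"

text \<open>The space \<open>V\<close> may be infinite dimensional. The trace is taken on the image
  of \<open>\<theta>\<close>, and by \<open>fr_trace_eq\<close> every finite dimensional space
  between the image and \<open>V\<close> gives the same value.\<close>

definition fr_trace ::
  "('k::field \<Rightarrow> 'x::ab_group_add \<Rightarrow> 'x) \<Rightarrow> 'x set \<Rightarrow> ('x \<Rightarrow> 'x) \<Rightarrow> 'k"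
where
  "fr_trace s V \<theta> = lin_trace s (\<theta> ` V) \<theta>"

lemma lin_onI:
  assumes "\<And>x y. x \<in> V \<Longrightarrow> y \<in> V \<Longrightarrow> f (x + y) = f x + f y"
    and "\<And>c x. x \<in> V \<Longrightarrow> f (s c x) = s' c (f x)"
  shows "lin_on s V s' f"
  using assms unfolding lin_on_def by blast

lemma lin_on_add: "lin_on s V s' f \<Longrightarrow> x \<in> V \<Longrightarrow> y \<in> V \<Longrightarrow> f (x + y) = f x + f y"
  unfolding lin_on_def by blast

lemma lin_on_scale: "lin_on s V s' f \<Longrightarrow> x \<in> V \<Longrightarrow> f (s c x) = s' c (f x)"
  unfolding lin_on_def by blast

lemma lin_on_subset: "lin_on s V s' f \<Longrightarrow> W \<subseteq> V \<Longrightarrow> lin_on s W s' f"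
  unfolding lin_on_def by blast

lemma lin_on_comp:
  "lin_on s V s' f \<Longrightarrow> f ` V \<subseteq> W \<Longrightarrow> lin_on s' W s'' g \<Longrightarrow> lin_on s V s'' (\<lambda>x. g (f x))"
  unfolding lin_on_def by (simp add: image_subset_iff)

lemma subspD:
  assumes "vector_space s" "subsp s V"
  shows "0 \<in> V" and "\<And>x y. x \<in> V \<Longrightarrow> y \<in> V \<Longrightarrow> x + y \<in> V"
    and "\<And>x y. x \<in> V \<Longrightarrow> y \<in> V \<Longrightarrow> x - y \<in> V" and "\<And>x. x \<in> V \<Longrightarrow> - x \<in> V"
    and "\<And>c x. x \<in> V \<Longrightarrow> s c x \<in> V"
    and "\<And>I g. (\<And>i. i \<in> I \<Longrightarrow> g i \<in> V) \<Longrightarrow> sum g I \<in> V"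
proof -
  interpret vector_space s by fact
  show "0 \<in> V" using assms(2) by (rule subspace_0)
  show "\<And>x y. x \<in> V \<Longrightarrow> y \<in> V \<Longrightarrow> x + y \<in> V" using assms(2) by (rule subspace_add)
  show "\<And>x y. x \<in> V \<Longrightarrow> y \<in> V \<Longrightarrow> x - y \<in> V" using assms(2) by (rule subspace_diff)
  show "\<And>x. x \<in> V \<Longrightarrow> - x \<in> V" using assms(2) by (rule subspace_neg)
  show "\<And>c x. x \<in> V \<Longrightarrow> s c x \<in> V" using assms(2) by (rule subspace_scale)
  show "\<And>I g. (\<And>i. i \<in> I \<Longrightarrow> g i \<in> V) \<Longrightarrow> sum g I \<in> V" using assms(2) by (rule subspace_sum)
qed

lemma subspI:
  assumes "vector_space s" "0 \<in> V" "\<And>x y. x \<in> V \<Longrightarrow> y \<in> V \<Longrightarrow> x + y \<in> V"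
    "\<And>c x. x \<in> V \<Longrightarrow> s c x \<in> V"
  shows "subsp s V"
proof -
  interpret vector_space s by fact
  show ?thesis using assms by (intro subspaceI) auto
qed

lemma additive_on_0: "(\<forall>x\<in>V. \<forall>y\<in>V. f (x + y) = f x + f y) \<Longrightarrow> (0::'x::ab_group_add) \<in> V \<Longrightarrow> f 0 = (0::'y::ab_group_add)"
  by (metis add_cancel_right_right add.right_neutral)

lemma lin_on_props:
  assumes "vector_space s" "subsp s V" "lin_on s V s' f"
  shows lin_on_0: "f 0 = 0"
    and lin_on_neg: "\<And>x. x \<in> V \<Longrightarrow> f (- x) = - f x"
    and lin_on_diff: "\<And>x y. x \<in> V \<Longrightarrow> y \<in> V \<Longrightarrow> f (x - y) = f x - f y"
    and lin_on_sum: "\<And>I g. (\<And>i. i \<in> I \<Longrightarrow> g i \<in> V) \<Longrightarrow> f (sum g I) = (\<Sum>i\<in>I. f (g i))"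
proof -
  note S = subspD[OF assms(1,2)]
  show 0: "f 0 = 0" using additive_on_0[of V f] assms(3) S(1) unfolding lin_on_def by blast
  show neg: "f (- x) = - f x" if "x \<in> V" for x
    using lin_on_add[OF assms(3) that S(4)[OF that]] 0 by (simp add: eq_neg_iff_add_eq_0 add.commute)
  show "f (x - y) = f x - f y" if "x \<in> V" "y \<in> V" for x y
    using lin_on_add[OF assms(3) that(1) S(4)[OF that(2)]] neg[OF that(2)] by simp
  show "f (sum g I) = (\<Sum>i\<in>I. f (g i))" if "\<And>i. i \<in> I \<Longrightarrow> g i \<in> V" for I g
    using that
  proof (induction I rule: infinite_finite_induct)
    case (insert i I)
    then show ?case using lin_on_add[OF assms(3), of "g i" "sum g I"] S(6)[of I g] by auto
  qed (auto simp: 0)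
qed

lemma lin_on_image:
  assumes "vector_space s" "vector_space s'" "subsp s V" "lin_on s V s' f"
  shows "subsp s' (f ` V)"
proof (rule subspI[OF assms(2)])
  note S = subspD[OF assms(1,3)]
  show "0 \<in> f ` V" using lin_on_0[OF assms(1,3,4)] S(1) by force
  show "x + y \<in> f ` V" if "x \<in> f ` V" "y \<in> f ` V" for x y
    using that lin_on_add[OF assms(4)] S(2) by (auto simp: image_iff) metis
  show "s' c x \<in> f ` V" if "x \<in> f ` V" for x c
    using that lin_on_scale[OF assms(4)] S(5) by (auto simp: image_iff) metis
qed

lemma lin_on_kernel:
  assumes "vector_space s" "vector_space s'" "subsp s V" "lin_on s V s' f"
  shows "subsp s {x \<in> V. f x = 0}"
proof (rule subspI[OF assms(1)])
  interpret vector_space s' by fact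
  note S = subspD[OF assms(1,3)]
  show "0 \<in> {x \<in> V. f x = 0}" using lin_on_0[OF assms(1,3,4)] S(1) by force
qed (use subspD[OF assms(1,3)] lin_on_add[OF assms(4)] lin_on_scale[OF assms(4)] vector_space.scale_eq_0_iff[OF assms(2)] in auto)

lemma lin_on_plus:
  assumes "vector_space s'" "lin_on s V s' f" "lin_on s V s' g"
  shows "lin_on s V s' (\<lambda>x. f x + g x)" "lin_on s V s' (\<lambda>x. f x - g x)" "lin_on s V s' (\<lambda>x. - f x)"
proof -
  interpret vector_space s' by fact
  show "lin_on s V s' (\<lambda>x. f x + g x)" "lin_on s V s' (\<lambda>x. f x - g x)" "lin_on s V s' (\<lambda>x. - f x)"
    using assms(2,3) by (auto simp: lin_on_def scale_right_distrib scale_right_diff_distrib)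
qed

lemma lin_on_sums:
  assumes "vector_space s'" "\<And>i. i \<in> I \<Longrightarrow> lin_on s V s' (f i)"
  shows "lin_on s V s' (\<lambda>x. \<Sum>i\<in>I. f i x)"
proof -
  interpret vector_space s' by fact
  show ?thesis
    using assms(2) by (auto simp: lin_on_def scale_sum_right sum.distrib[symmetric] intro!: sum.cong)
qed

lemma lin_on_scaled:
  assumes "vector_space s'" "lin_on s V s' f"
  shows "lin_on s V s' (\<lambda>x. s' c (f x))"
proof -
  interpret vector_space s' by fact
  show ?thesis
    using assms(2) by (auto simp: lin_on_def scale_right_distrib)
qed

lemma lin_on_id: "lin_on s V s (\<lambda>x. x)"
  by (simp add: lin_on_def)

section \<open>Finite dimensional subspaces of an ambient space\<close>

lemma fdim_basis:
  assumes "vector_space s" "fdim s V"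
  obtains B where "finite B" "\<not> Modules.module.dependent s B" "Modules.module.span s B = V"
proof -
  interpret vector_space s by fact
  obtain S where S: "finite S" "span S = V" using assms(2) unfolding fdim_def by auto
  obtain B where B: "B \<subseteq> S" "independent B" "S \<subseteq> span B" 
    using maximal_independent_subset[of S] by auto
  have "span B = V"
  proof
    show "span B \<subseteq> V" using span_mono[OF B(1)] S(2) by simp
    show "V \<subseteq> span B" using span_minimal[OF B(3) subspace_span] S(2) by simp
  qed
  then show thesis by (rule that[OF finite_subset[OF B(1) S(1)] B(2)])
qed

lemma fdim_subsp: "vector_space s \<Longrightarrow> fdim s V \<Longrightarrow> subsp s V"
  unfolding fdim_def by (metis module.subspace_span module_iff_vector_space)

lemma fdim_subset:
  assumes "vector_space s" "fdim s V" "subsp s W" "W \<subseteq> V"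
  shows "fdim s W"
proof -
  interpret vector_space s by fact
  obtain S where S: "finite S" "span S = V" using assms(2) unfolding fdim_def by auto
  obtain B where B: "B \<subseteq> W" "independent B" "W \<subseteq> span B" 
    using maximal_independent_subset[of W] by auto
  have "finite B" using independent_span_bound[of S B] S B assms(4) by blast
  moreover have "span B = W" using B assms(3) by (simp add: span_subspace)
  ultimately show ?thesis unfolding fdim_def by blast
qed

lemma fdim_image:
  assumes "vector_space s" "vector_space s'" "fdim s V" "lin_on s V s' f"
  shows "fdim s' (f ` V)"
proof -
  interpret v: vector_space s by fact
  interpret w: vector_space s' by fact
  obtain S where S: "finite S" "v.span S = V" using assms(3) unfolding fdim_def by auto
  note sV = fdim_subsp[OF assms(1,3)]
  have "w.subspace (f ` V)" using lin_on_image[OF assms(1,2) sV assms(4)] .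
  moreover have "f ` S \<subseteq> f ` V" using S v.span_superset by blast
  ultimately have 1: "w.span (f ` S) \<subseteq> f ` V" by (simp add: w.span_minimal)
  have "f x \<in> w.span (f ` S)" if "x \<in> V" for x
  proof -
    have "x \<in> V \<and> f x \<in> w.span (f ` S)"
      using that unfolding S(2)[symmetric]
    proof (induction rule: v.span_induct_alt)
      case base
      then show ?case using lin_on_0[OF assms(1) sV assms(4)] v.span_zero w.span_zero by auto
    next
      case (step c x y)
      then have "x \<in> V" "y \<in> V" "s c x \<in> V" using S v.span_base v.span_scale by auto
      then show ?case using step lin_on_add[OF assms(4)] lin_on_scale[OF assms(4)]
        by (simp add: w.span_add w.span_scale w.span_base S subspD(2)[OF assms(1) sV])
    qed
    then show ?thesis by simp
  qed
  then have "w.span (f ` S) = f ` V" using 1 by auto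
  then show ?thesis unfolding fdim_def using S by blast
qed

lemma fdim_sums:
  assumes "vector_space s" "fdim s V" "fdim s W"
  shows "\<exists>U. fdim s U \<and> V \<subseteq> U \<and> W \<subseteq> U \<and> (\<forall>X. subsp s X \<and> V \<subseteq> X \<and> W \<subseteq> X \<longrightarrow> U \<subseteq> X)"
proof -
  interpret vector_space s by fact
  obtain S T where S: "finite S" "span S = V" "finite T" "span T = W"
    using assms(2,3) unfolding fdim_def by auto
  have "fdim s (span (S \<union> T))" using S unfolding fdim_def by blast
  moreover have "V \<subseteq> span (S \<union> T)" "W \<subseteq> span (S \<union> T)" using S span_mono[of _ "S \<union> T"] by blast+
  moreover have "span (S \<union> T) \<subseteq> X" if "subspace X" "V \<subseteq> X" "W \<subseteq> X" for X
    using that S span_superset by (intro span_minimal) auto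
  ultimately show ?thesis by blast
qed

lemma fdim_zero: "vector_space s \<Longrightarrow> fdim s {0}"
  unfolding fdim_def by (intro exI[of _ "{}"]) (simp add: module.span_empty module_iff_vector_space)

lemma fdim_sums_finite:
  assumes "vector_space s" "finite I" "\<And>i. i \<in> I \<Longrightarrow> fdim s (V i)" "subsp s X" "\<And>i. i \<in> I \<Longrightarrow> V i \<subseteq> X"
  shows "\<exists>U. fdim s U \<and> (\<forall>i\<in>I. V i \<subseteq> U) \<and> U \<subseteq> X"
  using assms(2,3,5)
proof (induction I rule: finite_induct)
  case empty
  then show ?case using fdim_zero[OF assms(1)] subspD(1)[OF assms(1,4)] by auto
next
  case (insert i I)
  then obtain U where U: "fdim s U" "\<forall>i\<in>I. V i \<subseteq> U" "U \<subseteq> X" by auto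
  then show ?case using fdim_sums[OF assms(1), of "V i" U] insert(4,5) assms(4)
    by (metis insert_iff subset_trans)
qed

text \<open>\<open>lin_on\<close> constrains a map on \<open>V\<close> only, where module operations
  are meaningful, whereas the library facts on sections concern globally linear maps. A basis of
  \<open>V\<close> bridges the gap.\<close>

lemma lin_on_extend:
  assumes "vector_space s" "vector_space s'" "subsp s V" "lin_on s V s' f"
  obtains g where "Vector_Spaces.linear s s' g" "\<And>x. x \<in> V \<Longrightarrow> g x = f x"
proof -
  interpret vector_space_pair s s' using assms by (simp add: vector_space_pair_def)
  obtain B where B: "B \<subseteq> V" "vs1.independent B" "V \<subseteq> vs1.span B"
    using vs1.maximal_independent_subset[of V] by auto
  obtain g where g: "Vector_Spaces.linear s s' g" "\<forall>x\<in>B. g x = f x"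
    using linear_independent_extend[OF B(2), of f] by auto
  have "g x = f x" if "x \<in> V" for x
  proof -
    have "x \<in> vs1.span B" using that B by auto
    then have "x \<in> V \<and> g x = f x"
    proof (induction rule: vs1.span_induct_alt)
      case base
      show ?case using lin_on_0[OF assms(1,3,4)] linear_0[OF g(1)] subspD[OF assms(1,3)] by simp
    next
      case (step c x y)
      then have "x \<in> V" "s c x \<in> V" using B subspD[OF assms(1,3)] by auto
      then show ?case using step lin_on_add[OF assms(4)] lin_on_scale[OF assms(4)] subspD[OF assms(1,3)]
         linear_add[OF g(1)] linear_scale[OF g(1)] g(2) by simp
    qed
    then show ?thesis by simp
  qed
  then show thesis using that g by blast
qed

lemma lin_on_section:
  assumes "vector_space s" "vector_space s'" "subsp s V" "lin_on s V s' f"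
  obtains g where "lin_on s' (f ` V) s g" "g ` f ` V \<subseteq> V" "\<And>y. y \<in> f ` V \<Longrightarrow> f (g y) = y"
proof -
  interpret vector_space_pair s s' using assms by (simp add: vector_space_pair_def)
  obtain f' where f': "Vector_Spaces.linear s s' f'" "\<And>x. x \<in> V \<Longrightarrow> f' x = f x"
    using lin_on_extend[OF assms] by blast
  obtain g where g: "g ` UNIV \<subseteq> V" "Vector_Spaces.linear s' s g" "\<forall>v\<in>f' ` V. f' (g v) = v"
    using linear_exists_right_inverse_on[OF f'(1) assms(3)] by blast
  interpret g: Vector_Spaces.linear s' s g by fact
  have "f' ` V = f ` V" using f'(2) by auto
  then show thesis using that[of g] g f'(2) by (auto simp: lin_on_def g.add g.scale image_subset_iff)
qed

text \<open>The basis chosen inside \<open>lin_trace\<close> depends on \<open>s\<close> and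
  \<open>V\<close> but not on \<open>\<theta>\<close>. One \<open>B\<close> therefore serves all
  operators on \<open>V\<close> at once, and additivity of the trace follows without proving
  independence of the basis.\<close>

lemma lin_trace_basis:
  assumes "vector_space s" "fdim s V"
  obtains B where "finite B" "\<not> Modules.module.dependent s B" "Modules.module.span s B = V"
    "\<And>\<theta>. lin_trace s V \<theta> = (\<Sum>b\<in>B. Modules.module.representation s B (\<theta> b) b)"
proof -
  interpret vector_space s by fact
  define B where "B = (SOME B. independent B \<and> span B = V)"
  obtain B' where B': "finite B'" "independent B'" "span B' = V" using fdim_basis[OF assms] by auto
  then have B: "independent B \<and> span B = V" unfolding B_def by (metis (mono_tags, lifting) someI_ex)
  have "finite B" using independent_span_bound[of B' B] B B' span_superset by auto
  then show thesis using that[of B] B unfolding lin_trace_def B_def[symmetric] Let_def by blast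
qed

lemma lin_trace_cong:
  assumes "vector_space s" "fdim s V" "\<And>x. x \<in> V \<Longrightarrow> \<theta> x = \<theta>' x"
  shows "lin_trace s V \<theta> = lin_trace s V \<theta>'"
proof -
  interpret vector_space s by fact
  obtain B where B: "finite B" "independent B" "span B = V" 
    "\<And>\<theta>. lin_trace s V \<theta> = (\<Sum>b\<in>B. representation B (\<theta> b) b)"
    using lin_trace_basis[OF assms(1,2)] by blast
  have "b \<in> V" if "b \<in> B" for b using that B(3) span_base by blast
  then show ?thesis unfolding B(4) by (intro sum.cong) (simp_all add: assms(3))
qed

lemma lin_trace_sum:
  assumes "vector_space s" "fdim s V" "finite I" "\<And>i. i \<in> I \<Longrightarrow> \<theta> i ` V \<subseteq> V"
  shows "lin_trace s V (\<lambda>x. \<Sum>i\<in>I. \<theta> i x) = (\<Sum>i\<in>I. lin_trace s V (\<theta> i))"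
proof -
  interpret vector_space s by fact
  obtain B where B: "finite B" "independent B" "span B = V" 
    "\<And>\<theta>. lin_trace s V \<theta> = (\<Sum>b\<in>B. representation B (\<theta> b) b)"
    using lin_trace_basis[OF assms(1,2)] by blast
  have "representation B (\<Sum>i\<in>I. \<theta> i b) b = (\<Sum>i\<in>I. representation B (\<theta> i b) b)" if "b \<in> B" for b
  proof -
    have "b \<in> V" using that B(3) span_base by blast
    then have "\<And>i. i \<in> I \<Longrightarrow> \<theta> i b \<in> span B" using assms(4) B(3) by blast
    then show ?thesis by (subst representation_sum[OF B(2)]) auto
  qed
  then have "(\<Sum>b\<in>B. representation B (\<Sum>i\<in>I. \<theta> i b) b)
      = (\<Sum>b\<in>B. \<Sum>i\<in>I. representation B (\<theta> i b) b)"
    by (rule sum.cong[OF refl])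
  then show ?thesis unfolding B(4) by (simp add: sum.swap[of _ I B])
qed

lemma lin_trace_scale:
  assumes "vector_space s" "fdim s V" "\<theta> ` V \<subseteq> V"
  shows "lin_trace s V (\<lambda>x. s c (\<theta> x)) = c * lin_trace s V \<theta>"
proof -
  interpret vector_space s by fact
  obtain B where B: "finite B" "independent B" "span B = V" 
    "\<And>\<theta>. lin_trace s V \<theta> = (\<Sum>b\<in>B. representation B (\<theta> b) b)"
    using lin_trace_basis[OF assms(1,2)] by blast
  have "representation B (s c (\<theta> b)) b = c * representation B (\<theta> b) b" if "b \<in> B" for b
  proof -
    have "b \<in> V" using that B(3) span_base by blast
    then have "\<theta> b \<in> span B" using assms(3) B(3) by blast
    then show ?thesis by (subst representation_scale[OF B(2)]) auto
  qed
  then show ?thesis unfolding B(4) by (simp add: sum_distrib_left)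
qed

lemma lin_trace_add:
  assumes "vector_space s" "fdim s V" "\<theta> ` V \<subseteq> V" "\<theta>' ` V \<subseteq> V"
  shows "lin_trace s V (\<lambda>x. \<theta> x + \<theta>' x) = lin_trace s V \<theta> + lin_trace s V \<theta>'"
  using lin_trace_sum[of s V "{True, False}" "\<lambda>b. if b then \<theta> else \<theta>'"] assms by simp

lemma lin_trace_id:
  assumes "vector_space s" "fdim s V"
  shows "lin_trace s V (\<lambda>x. x) = of_nat (vector_space.dim s V)"
proof -
  interpret vector_space s by fact
  obtain B where B: "finite B" "independent B" "span B = V" 
    "\<And>\<theta>. lin_trace s V \<theta> = (\<Sum>b\<in>B. representation B (\<theta> b) b)"
    using lin_trace_basis[OF assms(1,2)] by blast
  have "representation B b b = 1" if "b \<in> B" for b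
    using representation_basis[OF B(2) that] by simp
  moreover have "dim V = card B" using B dim_span_eq_card_independent by auto
  ultimately show ?thesis unfolding B(4) by simp
qed

text \<open>Expanding in the two bases turns both sides into the same double sum of products of
  matrix entries. The two spaces may have different types, which is what later lets a trace move
  from \<open>P\<close> to \<open>A\<close> and from Hom or tensor complexes to
  \<open>N\<close>.\<close>

lemma lin_trace_cyclic:
  assumes v: "vector_space s" "vector_space s'" and V: "fdim s V" and W: "fdim s' W"
    and a: "lin_on s V s' \<alpha>" "\<alpha> ` V \<subseteq> W" and b: "lin_on s' W s \<beta>" "\<beta> ` W \<subseteq> V"
  shows "lin_trace s V (\<lambda>x. \<beta> (\<alpha> x)) = lin_trace s' W (\<lambda>x. \<alpha> (\<beta> x))"
proof -
  interpret v: vector_space s by fact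
  interpret w: vector_space s' by fact
  obtain B where B: "finite B" "v.independent B" "v.span B = V" 
    "\<And>\<theta>. lin_trace s V \<theta> = (\<Sum>b\<in>B. v.representation B (\<theta> b) b)"
    using lin_trace_basis[OF v(1) V] by blast
  obtain D where D: "finite D" "w.independent D" "w.span D = W" 
    "\<And>\<theta>. lin_trace s' W \<theta> = (\<Sum>b\<in>D. w.representation D (\<theta> b) b)"
    using lin_trace_basis[OF v(2) W] by blast
  have BV: "\<And>b. b \<in> B \<Longrightarrow> b \<in> V" and DW: "\<And>b. b \<in> D \<Longrightarrow> b \<in> W"
    using B D v.span_base w.span_base by auto
  have sV: "v.subspace V" and sW: "w.subspace W" using fdim_subsp v V W by auto
  have 1: "v.representation B (\<beta> (\<alpha> b)) b
      = (\<Sum>d\<in>D. w.representation D (\<alpha> b) d * v.representation B (\<beta> d) b)" if "b \<in> B" for b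
  proof -
    have "\<alpha> b \<in> W" using a that BV by auto
    then have "\<alpha> b = (\<Sum>d\<in>D. s' (w.representation D (\<alpha> b) d) d)"
      using w.sum_representation_eq[OF D(2) _ D(1), of "\<alpha> b"] D by auto
    then have "\<beta> (\<alpha> b) = \<beta> (\<Sum>d\<in>D. s' (w.representation D (\<alpha> b) d) d)" by simp
    also have "\<dots> = (\<Sum>d\<in>D. \<beta> (s' (w.representation D (\<alpha> b) d) d))"
      by (rule lin_on_sum[OF v(2) sW b(1)]) (simp add: DW subspD[OF v(2) sW])
    also have "\<dots> = (\<Sum>d\<in>D. s (w.representation D (\<alpha> b) d) (\<beta> d))"
      by (rule sum.cong) (auto simp: lin_on_scale[OF b(1)] DW)
    finally have "v.representation B (\<beta> (\<alpha> b)) b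
      = v.representation B (\<Sum>d\<in>D. s (w.representation D (\<alpha> b) d) (\<beta> d)) b" by simp
    also have "\<dots> = (\<Sum>d\<in>D. v.representation B (s (w.representation D (\<alpha> b) d) (\<beta> d)) b)"
      using b(2) DW by (subst v.representation_sum[OF B(2)]) (auto simp: B(3) subspD[OF v(1) sV] image_subset_iff)
    also have "\<dots> = (\<Sum>d\<in>D. w.representation D (\<alpha> b) d * v.representation B (\<beta> d) b)"
      by (rule sum.cong[OF refl], subst v.representation_scale[OF B(2)])
         (use b(2) DW in \<open>auto simp: B(3) image_subset_iff\<close>)
    finally show ?thesis .
  qed
  have 2: "w.representation D (\<alpha> (\<beta> d)) d
      = (\<Sum>b\<in>B. v.representation B (\<beta> d) b * w.representation D (\<alpha> b) d)" if "d \<in> D" for d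
  proof -
    have "\<beta> d \<in> V" using b that DW by auto
    then have "\<beta> d = (\<Sum>b\<in>B. s (v.representation B (\<beta> d) b) b)"
      using v.sum_representation_eq[OF B(2) _ B(1), of "\<beta> d"] B by auto
    then have "\<alpha> (\<beta> d) = \<alpha> (\<Sum>b\<in>B. s (v.representation B (\<beta> d) b) b)" by simp
    also have "\<dots> = (\<Sum>b\<in>B. \<alpha> (s (v.representation B (\<beta> d) b) b))"
      by (rule lin_on_sum[OF v(1) sV a(1)]) (simp add: BV subspD[OF v(1) sV])
    also have "\<dots> = (\<Sum>b\<in>B. s' (v.representation B (\<beta> d) b) (\<alpha> b))"
      by (rule sum.cong) (auto simp: lin_on_scale[OF a(1)] BV)
    finally have "w.representation D (\<alpha> (\<beta> d)) d
      = w.representation D (\<Sum>b\<in>B. s' (v.representation B (\<beta> d) b) (\<alpha> b)) d" by simp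
    also have "\<dots> = (\<Sum>b\<in>B. w.representation D (s' (v.representation B (\<beta> d) b) (\<alpha> b)) d)"
      using a(2) BV by (subst w.representation_sum[OF D(2)]) (auto simp: D(3) subspD[OF v(2) sW] image_subset_iff)
    also have "\<dots> = (\<Sum>b\<in>B. v.representation B (\<beta> d) b * w.representation D (\<alpha> b) d)"
      by (rule sum.cong[OF refl], subst w.representation_scale[OF D(2)])
         (use a(2) BV in \<open>auto simp: D(3) image_subset_iff\<close>)
    finally show ?thesis .
  qed
  show ?thesis unfolding B(4) D(4) using 1 2
    by (simp add: sum.swap[of _ B D] mult.commute)
qed

text \<open>Cyclicity for \<open>\<theta>\<close> viewed as a map from \<open>V\<close> to
  \<open>W\<close>, followed by the inclusion of \<open>W\<close> in \<open>V\<close>.\<close>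

lemma lin_trace_image:
  assumes v: "vector_space s" and V: "fdim s V" and "lin_on s V s \<theta>" "\<theta> ` V \<subseteq> W" "W \<subseteq> V" "subsp s W"
  shows "lin_trace s V \<theta> = lin_trace s W \<theta>"
  using lin_trace_cyclic[OF v v V fdim_subset[OF v V assms(6,5)] assms(3,4), of "\<lambda>x. x"] assms(5)
  by (simp add: lin_on_id)

section \<open>Operators of finite rank\<close>

lemma fr_trace_cong:
  assumes "vector_space s" "fdim s (\<theta> ` V)" "\<theta> ` V \<subseteq> V" "\<And>x. x \<in> V \<Longrightarrow> \<theta> x = \<theta>' x"
  shows "fr_trace s V \<theta> = fr_trace s V \<theta>'"
proof -
  have "\<theta> ` V = \<theta>' ` V" using assms(4) by auto
  then show ?thesis unfolding fr_trace_def using lin_trace_cong[of s "\<theta> ` V" \<theta> \<theta>'] assms by auto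
qed

lemma fr_trace_eq:
  assumes "vector_space s" "subsp s V" "lin_on s V s \<theta>" "\<theta> ` V \<subseteq> W" "W \<subseteq> V" "fdim s W"
  shows "fr_trace s V \<theta> = lin_trace s W \<theta>"
  unfolding fr_trace_def
proof (rule lin_trace_image[symmetric, OF assms(1,6) lin_on_subset[OF assms(3,5)] _ assms(4)])
  show "\<theta> ` W \<subseteq> \<theta> ` V" using assms(5) by blast
  show "subsp s (\<theta> ` V)" by (rule lin_on_image[OF assms(1,1,2,3)])
qed

lemma fr_trace_fdim:
  assumes "vector_space s" "fdim s V" "lin_on s V s \<theta>" "\<theta> ` V \<subseteq> V"
  shows "fr_trace s V \<theta> = lin_trace s V \<theta>"
  by (rule fr_trace_eq[OF assms(1) fdim_subsp[OF assms(1,2)] assms(3,4) order_refl assms(2)])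

lemma fr_trace_cyclic:
  assumes v: "vector_space s" "vector_space s'" and V: "subsp s V" and W: "fdim s' W"
    and a: "lin_on s V s' \<alpha>" "\<alpha> ` V \<subseteq> W" and b: "lin_on s' W s \<beta>" "\<beta> ` W \<subseteq> V"
  shows "fr_trace s V (\<lambda>x. \<beta> (\<alpha> x)) = lin_trace s' W (\<lambda>x. \<alpha> (\<beta> x))"
proof -
  have U: "fdim s (\<beta> ` W)" by (rule fdim_image[OF v(2,1) W b(1)])
  have "fr_trace s V (\<lambda>x. \<beta> (\<alpha> x)) = lin_trace s (\<beta> ` W) (\<lambda>x. \<beta> (\<alpha> x))"
    by (rule fr_trace_eq[OF v(1) V lin_on_comp[OF a b(1)] _ b(2) U]) (use a in auto)
  also have "\<dots> = lin_trace s' W (\<lambda>x. \<alpha> (\<beta> x))"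
    by (rule lin_trace_cyclic[OF v U W lin_on_subset[OF a(1) b(2)] _ b(1)]) (use a b in auto)
  finally show ?thesis .
qed

text \<open>The summands have different images, so their traces live on different spaces. All are
  moved to one finite dimensional \<open>U\<close> that contains every image.\<close>

lemma fr_trace_sum:
  assumes v: "vector_space s" and V: "subsp s V" and "finite I"
    and T: "\<And>i. i \<in> I \<Longrightarrow> lin_on s V s (T i)" "\<And>i. i \<in> I \<Longrightarrow> T i ` V \<subseteq> V" "\<And>i. i \<in> I \<Longrightarrow> fdim s (T i ` V)"
  shows "fr_trace s V (\<lambda>x. \<Sum>i\<in>I. T i x) = (\<Sum>i\<in>I. fr_trace s V (T i))"
    and "fdim s ((\<lambda>x. \<Sum>i\<in>I. T i x) ` V)"
proof -
  obtain U where U: "fdim s U" "\<And>i. i \<in> I \<Longrightarrow> T i ` V \<subseteq> U" "U \<subseteq> V"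
  proof -
    have "\<exists>U. fdim s U \<and> (\<forall>i\<in>I. T i ` V \<subseteq> U) \<and> U \<subseteq> V"
      by (rule fdim_sums_finite[OF v assms(3) T(3) V T(2)])
    then show thesis using that by metis
  qed
  have sU: "subsp s U" using fdim_subsp v U by blast
  have lin: "lin_on s V s (\<lambda>x. \<Sum>i\<in>I. T i x)" by (rule lin_on_sums[OF v T(1)])
  have im: "(\<lambda>x. \<Sum>i\<in>I. T i x) ` V \<subseteq> U"
    using U(2) by (auto intro!: subspD(6)[OF v sU])
  show "fdim s ((\<lambda>x. \<Sum>i\<in>I. T i x) ` V)"
    by (rule fdim_subset[OF v U(1) lin_on_image[OF v v V lin] im])
  have "fr_trace s V (\<lambda>x. \<Sum>i\<in>I. T i x) = lin_trace s U (\<lambda>x. \<Sum>i\<in>I. T i x)"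
    by (rule fr_trace_eq[OF v V lin im U(3,1)])
  also have "\<dots> = (\<Sum>i\<in>I. lin_trace s U (T i))"
    by (rule lin_trace_sum[OF v U(1) assms(3)]) (use U in blast)
  also have "\<dots> = (\<Sum>i\<in>I. fr_trace s V (T i))"
    using fr_trace_eq[OF v V T(1) U(2,3,1)] by simp
  finally show "fr_trace s V (\<lambda>x. \<Sum>i\<in>I. T i x) = (\<Sum>i\<in>I. fr_trace s V (T i))" .
qed

text \<open>With a linear section \<open>g\<close> of \<open>p\<close>, write
  \<open>T = (T - g p T) + g p T\<close>. The first summand maps into the kernel of \<open>p\<close>
  and agrees with \<open>T\<close> there; the trace of the second moves to the image of
  \<open>p\<close> by cyclicity.\<close>

lemma lin_trace_additive:
  assumes v: "vector_space s" "vector_space s'" and V: "fdim s V"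
    and p: "lin_on s V s' p" and T: "lin_on s V s T" "T ` V \<subseteq> V"
    and T': "\<And>x. x \<in> V \<Longrightarrow> T' (p x) = p (T x)"
  shows "lin_trace s V T = lin_trace s {x \<in> V. p x = 0} T + lin_trace s' (p ` V) T'"
proof -
  note sV = fdim_subsp[OF v(1) V]
  note S = subspD[OF v(1) sV]
  obtain g where g: "lin_on s' (p ` V) s g" "g ` p ` V \<subseteq> V" "\<And>y. y \<in> p ` V \<Longrightarrow> p (g y) = y"
    using lin_on_section[OF v sV p] by blast
  let ?W = "{x \<in> V. p x = 0}"
  have W: "fdim s ?W" by (rule fdim_subset[OF v(1) V lin_on_kernel[OF v sV p]]) auto
  have U: "fdim s' (p ` V)" by (rule fdim_image[OF v V p])
  have pT: "lin_on s V s' (\<lambda>x. p (T x))" by (rule lin_on_comp[OF T p])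
  have gpT: "lin_on s V s (\<lambda>x. g (p (T x)))" by (rule lin_on_comp[OF pT _ g(1)]) (use T in auto)
  have gV: "g (p x) \<in> V" if "x \<in> V" for x using that g(2) by auto
  have TV: "T x \<in> V" if "x \<in> V" for x using that T(2) by auto
  have "lin_trace s V T = lin_trace s V (\<lambda>x. (T x - g (p (T x))) + g (p (T x)))" by simp
  also have "\<dots> = lin_trace s V (\<lambda>x. T x - g (p (T x))) + lin_trace s V (\<lambda>x. g (p (T x)))"
    by (rule lin_trace_add[OF v(1) V]) (use gV TV S(3) in auto)
  also have "lin_trace s V (\<lambda>x. T x - g (p (T x))) = lin_trace s ?W (\<lambda>x. T x - g (p (T x)))"
  proof (rule lin_trace_image[OF v(1) V])
    show "lin_on s V s (\<lambda>x. T x - g (p (T x)))" by (rule lin_on_plus[OF v(1) T(1) gpT])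
    show "(\<lambda>x. T x - g (p (T x))) ` V \<subseteq> ?W"
      using gV TV S(3) g(3) lin_on_diff[OF v(1) sV p] by auto
  qed (use lin_on_kernel[OF v sV p] in auto)
  also have "\<dots> = lin_trace s ?W T"
  proof (rule lin_trace_cong[OF v(1) W])
    fix x assume x: "x \<in> ?W"
    have "p (T x) = T' (p x)" using T'[of x] x by simp
    also have "\<dots> = T' (p 0)" using x lin_on_0[OF v(1) sV p] by auto
    also have "\<dots> = 0" using T'[OF S(1)] lin_on_0[OF v(1) sV pT] by simp
    finally have "g (p (T x)) = g 0" by simp
    also have "\<dots> = 0" by (rule lin_on_0[OF v(2) fdim_subsp[OF v(2) U] g(1)])
    finally show "T x - g (p (T x)) = T x" by simp
  qed
  also have "lin_trace s V (\<lambda>x. g (p (T x))) = lin_trace s' (p ` V) (\<lambda>y. p (T (g y)))"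
    by (rule lin_trace_cyclic[OF v V U pT _ g(1,2)]) (use T in auto)
  also have "\<dots> = lin_trace s' (p ` V) T'"
  proof (rule lin_trace_cong[OF v(2) U])
    fix y assume y: "y \<in> p ` V"
    then have "g y \<in> V" using g(2) by auto
    then show "p (T (g y)) = T' y" using T'[of "g y"] g(3)[OF y] by simp
  qed
  finally show ?thesis .
qed

lemma fr_trace_additive:
  assumes v: "vector_space s" "vector_space s'" and V: "subsp s V"
    and p: "lin_on s V s' p" and T: "lin_on s V s T" "T ` V \<subseteq> V" "fdim s (T ` V)"
    and T': "\<And>x. x \<in> V \<Longrightarrow> T' (p x) = p (T x)"
  shows "fr_trace s V T = fr_trace s {x \<in> V. p x = 0} T + fr_trace s' (p ` V) T'"
    and "lin_on s' (p ` V) s' T'" "T' ` p ` V \<subseteq> p ` V" "fdim s' (T' ` p ` V)"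
    and "T ` {x \<in> V. p x = 0} \<subseteq> {x \<in> V. p x = 0}" "fdim s (T ` {x \<in> V. p x = 0})"
proof -
  let ?I = "T ` V" and ?W = "{x \<in> V. p x = 0}"
  note S = subspD[OF v(1) V]
  have W: "subsp s ?W" by (rule lin_on_kernel[OF v V p])
  have pI: "T' ` p ` V = p ` ?I" using T' by (auto simp: image_image)
  have pT0: "p (T x) = 0" if "x \<in> V" "p x = 0" for x
  proof -
    have "p (T x) = T' (p 0)" using T'[OF that(1)] that lin_on_0[OF v(1) V p] by simp
    then show ?thesis using T'[OF S(1)] lin_on_0[OF v(1) V T(1)] lin_on_0[OF v(1) V p] by simp
  qed
  show lT': "lin_on s' (p ` V) s' T'"
  proof (rule lin_onI)
    fix x y assume "x \<in> p ` V" "y \<in> p ` V"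
    then obtain a b where ab: "a \<in> V" "b \<in> V" "x = p a" "y = p b" by auto
    then have "T' (x + y) = T' (p (a + b))" using lin_on_add[OF p] by simp
    also have "\<dots> = p (T (a + b))" using T' ab S by simp
    also have "\<dots> = T' x + T' y" using ab T' lin_on_add[OF lin_on_comp[OF T(1,2) p]] by simp
    finally show "T' (x + y) = T' x + T' y" .
  next
    fix c x assume "x \<in> p ` V"
    then obtain a where ab: "a \<in> V" "x = p a" by auto
    then have "T' (s' c x) = T' (p (s c a))" using lin_on_scale[OF p] by simp
    also have "\<dots> = p (T (s c a))" using T' ab S by simp
    also have "\<dots> = s' c (T' x)" using ab T' lin_on_scale[OF lin_on_comp[OF T(1,2) p]] by simp
    finally show "T' (s' c x) = s' c (T' x)" .
  qed
  show TT: "T' ` p ` V \<subseteq> p ` V" using pI T(2) by auto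
  show fT: "fdim s' (T' ` p ` V)" unfolding pI
    by (rule fdim_image[OF v T(3) lin_on_subset[OF p T(2)]])
  show TW: "T ` ?W \<subseteq> ?W" using T(2) pT0 by auto
  have kI: "fdim s {x \<in> ?I. p x = 0}"
    by (rule fdim_subset[OF v(1) T(3) lin_on_kernel[OF v fdim_subsp[OF v(1) T(3)] lin_on_subset[OF p T(2)]]]) auto
  show fW: "fdim s (T ` ?W)"
    by (rule fdim_subset[OF v(1) T(3) lin_on_image[OF v(1,1) W lin_on_subset[OF T(1)]]]) auto
  have "fr_trace s V T = lin_trace s ?I T" unfolding fr_trace_def ..
  also have "\<dots> = lin_trace s {x \<in> ?I. p x = 0} T + lin_trace s' (p ` ?I) T'"
    by (rule lin_trace_additive[OF v T(3) lin_on_subset[OF p T(2)] lin_on_subset[OF T(1,2)]])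
      (use T(2) T' in auto)
  also have "lin_trace s' (p ` ?I) T' = fr_trace s' (p ` V) T'"
    unfolding fr_trace_def pI ..
  also have "lin_trace s {x \<in> ?I. p x = 0} T = fr_trace s ?W T"
    by (rule fr_trace_eq[symmetric, OF v(1) W lin_on_subset[OF T(1)] _ _ kI]) (use TW T(2) in auto)
  finally show "fr_trace s V T = fr_trace s ?W T + fr_trace s' (p ` V) T'" .
qed

lemma lin_trace_nilpotent:
  assumes v: "vector_space s" and V: "fdim s V" and T: "lin_on s V s T" "T ` V \<subseteq> V"
    and nil: "\<And>x. x \<in> V \<Longrightarrow> (T ^^ m) x = 0"
  shows "lin_trace s V T = 0"
proof -
  have TjV: "(T ^^ j) x \<in> V" if "x \<in> V" for j x
    by (induction j) (use that T(2) in auto)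
  have *: "fdim s ((T ^^ j) ` V) \<and> lin_trace s V T = lin_trace s ((T ^^ j) ` V) T" for j
  proof (induction j)
    case 0
    show ?case using V by simp
  next
    case (Suc j)
    define U where "U = (T ^^ j) ` V"
    have im: "T ` U = (T ^^ Suc j) ` V" unfolding U_def by (simp add: image_comp)
    have UV: "U \<subseteq> V" unfolding U_def using TjV by blast
    have fU: "fdim s U" and eq: "lin_trace s V T = lin_trace s U T" using Suc unfolding U_def by auto
    have U: "lin_on s U s T" by (rule lin_on_subset[OF T(1) UV])
    have fT: "fdim s (T ` U)" by (rule fdim_image[OF v v fU U])
    have sub: "T ` U \<subseteq> U"
    proof
      fix y assume "y \<in> T ` U"
      then obtain x where x: "x \<in> V" "y = T ((T ^^ j) x)" unfolding U_def by blast
      then have "y = (T ^^ j) (T x)" by (simp add: funpow_swap1)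
      then show "y \<in> U" unfolding U_def using x(1) T(2) by blast
    qed
    have "lin_trace s U T = lin_trace s (T ` U) T"
      by (rule lin_trace_image[OF v fU U order_refl sub fdim_subsp[OF v fT]])
    then show ?case using fT eq unfolding im by simp
  qed
  note sV = fdim_subsp[OF v V]
  have S0: "0 \<in> V" by (rule subspD(1)[OF v sV])
  have T0: "T 0 = 0" by (rule lin_on_0[OF v sV T(1)])
  have "(T ^^ m) ` V = {0}" using nil S0 by force
  then have "lin_trace s V T = lin_trace s {0} T" using *[of m] by simp
  also have "\<dots> = lin_trace s {0} (\<lambda>x. s 0 0)"
    by (rule lin_trace_cong[OF v fdim_zero[OF v]])
       (simp add: T0 module.scale_zero_left[OF v[folded module_iff_vector_space]])
  also have "\<dots> = 0 * lin_trace s {0} (\<lambda>x. 0)"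
    by (rule lin_trace_scale[OF v fdim_zero[OF v]]) simp
  finally show ?thesis by simp
qed

text \<open>This is the absorption of an idempotent: an entry of a trace matrix, a trace on the
  summand cut out by \<open>q\<close>, becomes the trace of \<open>T q\<close> on the whole
  space.\<close>

lemma lin_trace_idem:
  assumes v: "vector_space s" and V: "subsp s V" "lin_on s V s q" "q ` V \<subseteq> V"
    and q: "\<And>x. x \<in> V \<Longrightarrow> q (q x) = q x" and f: "fdim s (q ` V)"
    and T: "lin_on s V s T" "T ` V \<subseteq> V" "\<And>x. x \<in> V \<Longrightarrow> q (T x) = T (q x)"
  shows "lin_trace s (q ` V) T = fr_trace s V (\<lambda>x. T (q x))"
proof -
  have "fr_trace s V (\<lambda>x. T (q x)) = lin_trace s (q ` V) (\<lambda>x. T (q x))"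
    by (rule fr_trace_eq[OF v V(1) lin_on_comp[OF V(2,3) T(1)] _ V(3) f])
       (use T in \<open>auto simp: T(3)[symmetric]\<close>)
  also have "\<dots> = lin_trace s (q ` V) T"
    by (rule lin_trace_cong[OF v f]) (use q in auto)
  finally show ?thesis ..
qed

lemma lin_trace_iso:
  assumes v: "vector_space s" "vector_space s'" and V: "fdim s V"
    and p: "lin_on s V s' p" "inj_on p V" and T: "lin_on s V s T" "T ` V \<subseteq> V"
    and T': "\<And>x. x \<in> V \<Longrightarrow> T' (p x) = p (T x)"
  shows "lin_trace s V T = lin_trace s' (p ` V) T'"
proof -
  note sV = fdim_subsp[OF v(1) V]
  have p0: "p 0 = 0" by (rule lin_on_0[OF v(1) sV p(1)])
  then have "{x \<in> V. p x = 0} = {0}" using p(2) subspD(1)[OF v(1) sV] by (auto simp: inj_on_def)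
  moreover have "lin_trace s {0} T = 0"
    by (rule lin_trace_nilpotent[OF v(1) fdim_zero[OF v(1)], of T 1])
       (use lin_on_subset[OF T(1)] subspD(1)[OF v(1) sV] lin_on_0[OF v(1) sV T(1)] in auto)
  ultimately show ?thesis using lin_trace_additive[OF v V p(1) T T'] by simp
qed

section \<open>Alternating sums over the degrees\<close>

definition signed :: "int \<Rightarrow> 'k::ab_group_add \<Rightarrow> 'k" where
  "signed l x = (if even l then x else - x)"

text \<open>\<open>Sum_any\<close> has the value 0 on families with infinite support. Hence
  additivity below carries finiteness hypotheses, while the shift rule holds for all
  families.\<close>

definition euler :: "(int \<Rightarrow> 'k::ab_group_add) \<Rightarrow> 'k" where
  "euler F = Sum_any (\<lambda>l. signed l (F l))"

lemma signed_simps [simp]: "signed l 0 = 0" "signed l x = 0 \<longleftrightarrow> x = 0" "signed (l + 1) x = - signed l x"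
  "signed l (x + y) = signed l x + signed l y"
  by (auto simp: signed_def)

lemma euler_superset:
  assumes "finite A" "\<And>l. l \<notin> A \<Longrightarrow> F l = 0"
  shows "euler F = (\<Sum>l\<in>A. signed l (F l))"
  unfolding euler_def using assms by (intro Sum_any.expand_superset) auto

lemma euler_add:
  assumes "finite {l. F l \<noteq> 0}" "finite {l. G l \<noteq> 0}"
  shows "euler (\<lambda>l. F l + G l) = euler F + euler G"
  unfolding euler_def signed_simps using assms by (intro Sum_any.distrib) simp_all

lemma euler_shift: "euler (\<lambda>l. F (l + 1)) = - euler (F :: int \<Rightarrow> 'k::ab_group_add)"
proof (cases "finite {l. F l \<noteq> 0}")
  case True
  define A where "A = {l. F l \<noteq> 0}"
  have "euler (\<lambda>l. F (l + 1)) = (\<Sum>l\<in>(\<lambda>l. l - 1) ` A. signed l (F (l + 1)))"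
    by (rule euler_superset) (use True in \<open>force simp: A_def image_iff\<close>)+
  also have "\<dots> = (\<Sum>l\<in>A. signed (l - 1) (F l))"
    by (subst sum.reindex) (auto simp: inj_on_def)
  also have "\<dots> = (\<Sum>l\<in>A. - signed l (F l))"
    by (rule sum.cong) (auto simp: signed_def)
  also have "\<dots> = - euler F"
    by (subst euler_superset[of A]) (use True in \<open>auto simp: A_def sum_negf\<close>)
  finally show ?thesis .
next
  \<comment> \<open>Both families have infinite support, so both alternating sums take the default
    value 0.\<close>
  case False
  have "{l. F l \<noteq> 0} = (\<lambda>l. l + 1) ` {l. F (l + 1) \<noteq> 0}"
    by (auto simp: image_iff) (metis diff_add_cancel)
  then have "\<not> finite {l. F (l + 1) \<noteq> 0}" using False by (metis finite_imageI)
  then show ?thesis using False unfolding euler_def by (simp add: Sum_any.infinite)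
qed

lemma euler_telescope:
  assumes "finite {l. F l \<noteq> (0::'k::ab_group_add)}"
  shows "euler (\<lambda>l. F l + F (l + 1)) = 0"
proof -
  have "finite {l. F (l + 1) \<noteq> 0}"
    by (rule finite_subset[of _ "(\<lambda>l. l - 1) ` {l. F l \<noteq> 0}"]) (use assms in \<open>force simp: image_iff\<close>)+
  then show ?thesis using assms by (subst euler_add) (auto simp: euler_shift)
qed

lemma alternating_sum_index:
  assumes "i < a" "j < b"
  shows "alternating_sum a b T $$ (i, j) = euler (\<lambda>l. T l $$ (i, j))"
  unfolding alternating_sum_def euler_def signed_def using assms by simp

text \<open>A linear retraction \<open>g\<close> onto \<open>W\<close> exists, and
  \<open>x - g x\<close> is a projection with kernel \<open>W\<close>. So the choice in
  \<open>quot_proj\<close> is not vacuous and its three properties may be used.\<close>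

lemma quot_proj:
  assumes v: "vector_space s" and W: "subsp s W"
  shows "Vector_Spaces.linear s s (quot_proj s W)" "quot_proj s W x = 0 \<longleftrightarrow> x \<in> W"
    "quot_proj s W (quot_proj s W x) = quot_proj s W x"
proof -
  interpret vector_space_pair s s using v by (simp add: vector_space_pair_def)
  have "Vector_Spaces.linear s s (\<lambda>x. x)" using vs1.linear_ident .
  then obtain g where g: "range g \<subseteq> W" "Vector_Spaces.linear s s g" "\<forall>v\<in>W. g v = v"
    using linear_exists_left_inverse_on[of "\<lambda>x. x" W] W by auto
  interpret g: Vector_Spaces.linear s s g by fact
  define p where "p x = x - g x" for x
  have "Vector_Spaces.linear s s p" unfolding p_def
    using linear_compose_sub[OF vs1.linear_ident g(2)] by simp
  moreover have "p x = 0 \<longleftrightarrow> x \<in> W" for x using g by (auto simp: p_def image_subset_iff) (metis)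
  moreover have "p (p x) = p x" for x using g by (simp add: p_def g.diff image_subset_iff)
  ultimately have "\<exists>p. Vector_Spaces.linear s s p \<and> (\<forall>x. p x = 0 \<longleftrightarrow> x \<in> W) \<and> (\<forall>x. p (p x) = p x)"
    by blast
  from someI_ex[OF this] show "Vector_Spaces.linear s s (quot_proj s W)" "quot_proj s W x = 0 \<longleftrightarrow> x \<in> W"
    "quot_proj s W (quot_proj s W x) = quot_proj s W x"
    unfolding quot_proj_def by blast+
qed

lemma lin_on_linear: "Vector_Spaces.linear s s' f \<Longrightarrow> lin_on s V s' f"
proof -
  assume "Vector_Spaces.linear s s' f"
  then interpret Vector_Spaces.linear s s' f .
  show ?thesis by (simp add: lin_on_def add scale)
qed

lemma quot_proj_diff:
  assumes v: "vector_space s" and W: "subsp s W"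
  shows "quot_proj s W x = quot_proj s W y \<longleftrightarrow> x - y \<in> W"
    "quot_proj s W x - x \<in> W" "x - quot_proj s W x \<in> W"
proof -
  interpret p: Vector_Spaces.linear s s "quot_proj s W" by (rule quot_proj(1)[OF v W])
  show "quot_proj s W x = quot_proj s W y \<longleftrightarrow> x - y \<in> W"
    using quot_proj(2)[OF v W, of "x - y"] by (auto simp: p.diff)
  show "quot_proj s W x - x \<in> W" "x - quot_proj s W x \<in> W"
    using quot_proj(2)[OF v W] quot_proj(3)[OF v W] by (auto simp: p.diff simp flip: quot_proj(2)[OF v W])
qed

lemma quot_proj_in:
  assumes v: "vector_space s" and W: "subsp s W" and Z: "subsp s Z" "W \<subseteq> Z" "x \<in> Z"
  shows "quot_proj s W x \<in> Z"
proof -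
  have "(quot_proj s W x - x) + x \<in> Z"
    using quot_proj_diff(2)[OF v W, of x] Z subspD(2)[OF v Z(1)] by blast
  then show ?thesis by simp
qed

text \<open>Choosing the representative \<open>quot_proj s W x\<close> instead of \<open>x\<close>
  changes the argument of \<open>f\<close> by an element of \<open>W\<close>, which \<open>f\<close>
  keeps in \<open>W\<close>.\<close>

lemma quot_proj_cong:
  assumes v: "vector_space s" and W: "subsp s W" and Z: "subsp s Z" "W \<subseteq> Z" "x \<in> Z"
    and f: "lin_on s Z s f" "f ` W \<subseteq> W"
  shows "quot_proj s W (f (quot_proj s W x)) = quot_proj s W (f x)"
proof -
  have "f (quot_proj s W x) - f x = f (quot_proj s W x - x)"
    using lin_on_diff[OF v Z(1) f(1)] quot_proj_in[OF v W Z] Z by simp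
  also have "\<dots> \<in> W" using quot_proj_diff(2)[OF v W] f(2) by blast
  finally show ?thesis using quot_proj_diff(1)[OF v W] by blast
qed

lemma fr_trace_zero:
  assumes v: "vector_space s" and V: "subsp s V" and "\<And>x. x \<in> V \<Longrightarrow> T x = 0"
  shows "fr_trace s V T = 0"
proof -
  have "T ` V = {0}" using assms(3) subspD(1)[OF v V] by force
  moreover have "T 0 = 0" using assms(3) subspD(1)[OF v V] by blast
  ultimately show ?thesis unfolding fr_trace_def
    using lin_trace_nilpotent[OF v fdim_zero[OF v], of T 1] by (simp add: lin_on_def module.scale_zero_right[OF v[folded module_iff_vector_space]])
qed

lemma lin_trace_quotient_idem:
  assumes v: "vector_space s" and Z: "subsp s Z" and B: "subsp s B" "B \<subseteq> Z"
    and l: "lin_on s Z s \<alpha>" "\<alpha> ` Z \<subseteq> Z" "\<alpha> ` B \<subseteq> B"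
    and r: "lin_on s Z s \<rho>" "\<rho> ` Z \<subseteq> Z" "\<rho> ` B \<subseteq> B"
    and t: "lin_on s Z s \<theta>" "\<theta> ` Z \<subseteq> Z" "\<theta> ` B \<subseteq> B"
    and idem: "\<And>x. x \<in> Z \<Longrightarrow> \<alpha> (\<alpha> x) = \<alpha> x" "\<And>x. x \<in> Z \<Longrightarrow> \<rho> (\<rho> x) = \<rho> x"
    and comm: "\<And>x. x \<in> Z \<Longrightarrow> \<alpha> (\<rho> x) = \<rho> (\<alpha> x)" "\<And>x. x \<in> Z \<Longrightarrow> \<alpha> (\<theta> x) = \<theta> (\<alpha> x)"
      "\<And>x. x \<in> Z \<Longrightarrow> \<rho> (\<theta> x) = \<theta> (\<rho> x)"
    and p: "p = quot_proj s B" and f: "fdim s (p ` Z)"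
    and T: "\<And>x. x \<in> Z \<Longrightarrow> \<theta> (\<rho> (\<alpha> x)) - T x \<in> B"
  shows "lin_trace s ((\<lambda>x. p (\<rho> (p (\<alpha> x)))) ` p ` Z) (\<lambda>x. p (\<theta> x)) = fr_trace s (p ` Z) (\<lambda>x. p (T x))"
proof -
  have pl: "lin_on s V s p" for V unfolding p using lin_on_linear quot_proj(1)[OF v B(1)] by blast
  have pZ: "p x \<in> Z" if "x \<in> Z" for x unfolding p by (rule quot_proj_in[OF v B(1) Z B(2) that])
  note c = quot_proj_cong[OF v B(1) Z B(2), folded p]
  have rl: "lin_on s Z s (\<lambda>x. \<rho> (\<alpha> x))" by (rule lin_on_comp[OF l(1,2) r(1)])
  have rlB: "(\<lambda>x. \<rho> (\<alpha> x)) ` B \<subseteq> B" using l(3) r(3) by blast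
  have q: "p (\<rho> (p (\<alpha> x))) = p (\<rho> (\<alpha> x))" if "x \<in> Z" for x
    using c[OF _ r(1,3), of "\<alpha> x"] that l(2) by blast
  have HZ: "p ` Z \<subseteq> Z" using pZ by blast
  have HS: "subsp s (p ` Z)" by (rule fdim_subsp[OF v f])
  have in_Z: "\<alpha> x \<in> Z" "\<rho> x \<in> Z" "\<theta> x \<in> Z" if "x \<in> Z" for x using that l r t by blast+
  let ?q = "\<lambda>x. p (\<rho> (\<alpha> x))"
  have im: "(\<lambda>x. p (\<rho> (p (\<alpha> x)))) ` p ` Z = ?q ` p ` Z"
    by (rule image_cong[OF refl]) (use q pZ in blast)
  have ql: "lin_on s (p ` Z) s ?q"
    by (rule lin_on_comp[OF lin_on_subset[OF rl HZ] subset_UNIV pl])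
  have tl: "lin_on s (p ` Z) s (\<lambda>x. p (\<theta> x))"
    by (rule lin_on_comp[OF lin_on_subset[OF t(1) HZ] subset_UNIV pl])
  have qim: "?q ` p ` Z \<subseteq> p ` Z" using in_Z pZ by auto
  have "lin_trace s (?q ` p ` Z) (\<lambda>x. p (\<theta> x)) = fr_trace s (p ` Z) (\<lambda>x. p (\<theta> (?q x)))"
  proof (rule lin_trace_idem[OF v HS ql qim])
    fix x assume "x \<in> p ` Z"
    then have x: "x \<in> Z" using HZ by blast
    show "?q (?q x) = ?q x" using c[OF _ rl rlB, of "\<rho> (\<alpha> x)"] x in_Z by (simp add: comm idem)
    have 1: "?q (p (\<theta> x)) = p (\<rho> (\<alpha> (\<theta> x)))" using c[OF _ rl rlB, of "\<theta> x"] x in_Z by simp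
    have 2: "p (\<theta> (?q x)) = p (\<theta> (\<rho> (\<alpha> x)))" using c[OF _ t(1,3), of "\<rho> (\<alpha> x)"] x in_Z by simp
    show "?q (p (\<theta> x)) = p (\<theta> (?q x))" unfolding 1 2 using x in_Z comm by simp
  next
    show "fdim s (?q ` p ` Z)" by (rule fdim_image[OF v v f ql])
    show "lin_on s (p ` Z) s (\<lambda>x. p (\<theta> x))" by (rule tl)
    show "(\<lambda>x. p (\<theta> x)) ` p ` Z \<subseteq> p ` Z" using in_Z pZ by auto
  qed
  also have "\<dots> = fr_trace s (p ` Z) (\<lambda>x. p (T x))"
  proof (rule fr_trace_cong[OF v])
    show "fdim s ((\<lambda>x. p (\<theta> (?q x))) ` p ` Z)"
      by (rule fdim_image[OF v v f lin_on_comp[OF ql qim tl]])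
    show "(\<lambda>x. p (\<theta> (?q x))) ` p ` Z \<subseteq> p ` Z" using in_Z pZ by auto
    fix x assume "x \<in> p ` Z"
    then have x: "x \<in> Z" using HZ by blast
    have 2: "p (\<theta> (?q x)) = p (\<theta> (\<rho> (\<alpha> x)))" using c[OF _ t(1,3), of "\<rho> (\<alpha> x)"] x in_Z by simp
    also have "\<dots> = p (T x)" using T[OF x] quot_proj_diff(1)[OF v B(1)] p by blast
    finally show "p (\<theta> (?q x)) = p (T x)" .
  qed
  finally show ?thesis unfolding im .
qed

text \<open>Every module record carries its own scalar multiplication, hence \<open>s\<close>
  depends on the degree. All degrees share one ambient type, as they do in
  \<open>cpx\<close>.\<close>

locale vs_complex =
  fixes s :: "int \<Rightarrow> 'k::field \<Rightarrow> 'x::ab_group_add \<Rightarrow> 'x" and V :: "int \<Rightarrow> 'x set" and d :: "int \<Rightarrow> 'x \<Rightarrow> 'x"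
  assumes vs: "\<And>l. vector_space (s l)" and V: "\<And>l. subsp (s l) (V l)"
    and d: "\<And>l. lin_on (s l) (V l) (s (l + 1)) (d l)" "\<And>l x. x \<in> V l \<Longrightarrow> d l x \<in> V (l + 1)"
    and dd: "\<And>l x. x \<in> V l \<Longrightarrow> d (l + 1) (d l x) = 0"
begin

definition cyc :: "int \<Rightarrow> 'x set" where "cyc l = {x \<in> V l. d l x = 0}"
definition bd :: "int \<Rightarrow> 'x set" where "bd l = d (l - 1) ` V (l - 1)"
definition pr :: "int \<Rightarrow> 'x \<Rightarrow> 'x" where "pr l = quot_proj (s l) (bd l)"
definition H :: "int \<Rightarrow> 'x set" where "H l = pr l ` cyc l"

definition endo :: "(int \<Rightarrow> 'x \<Rightarrow> 'x) \<Rightarrow> bool" where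
  "endo T \<longleftrightarrow> (\<forall>l. lin_on (s l) (V l) (s l) (T l) \<and> T l ` V l \<subseteq> V l \<and> (\<forall>x\<in>V l. d l (T l x) = T (l + 1) (d l x)))"

lemma cyc_sub: "subsp (s l) (cyc l)" unfolding cyc_def by (rule lin_on_kernel[OF vs vs V d(1)])
lemma bd_sub: "subsp (s l) (bd l)" unfolding bd_def
  using lin_on_image[OF vs vs V d(1), of "l - 1"] by simp
lemma bd_cyc: "bd l \<subseteq> cyc l" unfolding bd_def cyc_def using dd[of _ "l - 1"] d(2)[of _ "l - 1"] by auto
lemma cyc_V: "cyc l \<subseteq> V l" unfolding cyc_def by auto

lemma endoD:
  assumes "endo T"
  shows "lin_on (s l) (V l) (s l) (T l)" "x \<in> V l \<Longrightarrow> T l x \<in> V l"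
    "x \<in> V l \<Longrightarrow> d l (T l x) = T (l + 1) (d l x)" "lin_on (s l) (cyc l) (s l) (T l)"
    "T l ` cyc l \<subseteq> cyc l" "T l ` bd l \<subseteq> bd l" "T l 0 = 0"
proof -
  show l: "lin_on (s l) (V l) (s l) (T l)" and T: "x \<in> V l \<Longrightarrow> T l x \<in> V l"
    and dT: "x \<in> V l \<Longrightarrow> d l (T l x) = T (l + 1) (d l x)" for x l
    using assms unfolding endo_def by blast+
  show "lin_on (s l) (cyc l) (s l) (T l)" by (rule lin_on_subset[OF l cyc_V])
  show 0: "T l 0 = 0" for l by (rule lin_on_0[OF vs V l])
  show "T l ` cyc l \<subseteq> cyc l" using T dT 0 unfolding cyc_def by auto
  show "T l ` bd l \<subseteq> bd l"
  proof
    fix y assume "y \<in> T l ` bd l"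
    then obtain x where "x \<in> V (l - 1)" "y = T l (d (l - 1) x)" unfolding bd_def by auto
    then have "y = d (l - 1) (T (l - 1) x)" "T (l - 1) x \<in> V (l - 1)" using dT[of x "l - 1"] T by auto
    then show "y \<in> bd l" unfolding bd_def by blast
  qed
qed

lemma H_sub: "subsp (s l) (H l)"
  unfolding H_def by (rule lin_on_image[OF vs vs cyc_sub])
    (simp add: pr_def lin_on_linear[OF quot_proj(1)[OF vs bd_sub]])

lemma H_cyc: "H l \<subseteq> cyc l"
  unfolding H_def pr_def using quot_proj_in[OF vs bd_sub cyc_sub bd_cyc] by blast

text \<open>Additivity along the differential splits the trace on \<open>V l\<close> into that on
  cocycles and that on coboundaries of degree \<open>l + 1\<close>; additivity along the quotient
  map splits cocycles into coboundaries and cohomology. The coboundary terms occur in neighbouring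
  degrees and cancel in the alternating sum.\<close>

lemma hopf_trace:
  assumes T: "endo T" and f: "\<And>l. fdim (s l) (T l ` V l)"
    and fin: "finite {l. \<exists>x\<in>V l. T l x \<noteq> 0}"
  shows "euler (\<lambda>l. fr_trace (s l) (V l) (T l)) = euler (\<lambda>l. fr_trace (s l) (H l) (\<lambda>x. pr l (T l x)))"
proof -
  note e = endoD[OF T]
  have TV: "T l ` V l \<subseteq> V l" for l using e(2) by blast
  have b1: "d l ` V l = bd (l + 1)" for l unfolding bd_def by simp
  have 1: "fr_trace (s l) (V l) (T l) = fr_trace (s l) (cyc l) (T l) + fr_trace (s (l + 1)) (bd (l + 1)) (T (l + 1))"
    and fz: "fdim (s l) (T l ` cyc l)" for l
    using fr_trace_additive[OF vs vs V d(1) e(1) TV f, where T' = "T (l + 1)"]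
    unfolding cyc_def b1[symmetric] by (simp_all add: e(3))
  have pl: "lin_on (s l) (cyc l) (s l) (pr l)" for l
    unfolding pr_def using lin_on_linear quot_proj(1)[OF vs bd_sub] by blast
  have 2: "fr_trace (s l) (cyc l) (T l) = fr_trace (s l) (bd l) (T l) + fr_trace (s l) (H l) (\<lambda>x. pr l (T l x))" for l
  proof -
    have "{x \<in> cyc l. pr l x = 0} = bd l"
      unfolding pr_def using quot_proj(2)[OF vs bd_sub] bd_cyc by auto
    moreover have "pr l (T l (pr l x)) = pr l (T l x)" if "x \<in> cyc l" for x
      unfolding pr_def by (rule quot_proj_cong[OF vs bd_sub cyc_sub bd_cyc that e(4,6)])
    ultimately show ?thesis unfolding H_def
      using fr_trace_additive(1)[OF vs vs cyc_sub pl e(4,5) fz, where T' = "\<lambda>x. pr l (T l x)"] by simp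
  qed
  let ?b = "\<lambda>l. fr_trace (s l) (bd l) (T l)"
  let ?h = "\<lambda>l. fr_trace (s l) (H l) (\<lambda>x. pr l (T l x))"
  have p0: "pr l 0 = 0" for l unfolding pr_def
    using quot_proj(2)[OF vs bd_sub] subspD(1)[OF vs bd_sub] by blast
  have fb: "finite {l. ?b l \<noteq> 0}"
  proof (rule finite_subset[OF _ fin], clarify)
    fix l assume "?b l \<noteq> 0"
    then show "\<exists>x\<in>V l. T l x \<noteq> 0" using fr_trace_zero[OF vs bd_sub] bd_cyc cyc_V by blast
  qed
  have fh: "finite {l. ?h l \<noteq> 0}"
  proof (rule finite_subset[OF _ fin], clarify)
    fix l assume "?h l \<noteq> 0"
    then obtain x where "x \<in> H l" "pr l (T l x) \<noteq> 0" using fr_trace_zero[OF vs H_sub] by metis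
    then show "\<exists>x\<in>V l. T l x \<noteq> 0" using p0 H_cyc cyc_V by (metis subsetD)
  qed
  have fbs: "finite {l. ?b l + ?b (l + 1) \<noteq> 0}"
  proof (rule finite_subset)
    show "{l. ?b l + ?b (l + 1) \<noteq> 0} \<subseteq> {l. ?b l \<noteq> 0} \<union> (\<lambda>l. l - 1) ` {l. ?b l \<noteq> 0}"
      by (force simp: image_iff)
  qed (use fb in auto)
  have "euler (\<lambda>l. fr_trace (s l) (V l) (T l)) = euler (\<lambda>l. (?b l + ?b (l + 1)) + ?h l)"
    unfolding 1 2 by (simp add: algebra_simps)
  also have "\<dots> = euler ?h"
    by (subst euler_add[OF fbs fh]) (simp add: euler_telescope[OF fb])
  finally show ?thesis .
qed

text \<open>Each class is represented by an element \<open>E x\<close>, so the finite dimensional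
  image of \<open>E\<close> already covers the cohomology.\<close>

lemma fdim_H:
  assumes "fdim (s l) (E ` V l)" "\<And>x. x \<in> V l \<Longrightarrow> E x \<in> V l" "\<And>x. x \<in> cyc l \<Longrightarrow> E x - x \<in> bd l"
  shows "fdim (s l) (H l)"
proof -
  have pl: "lin_on (s l) X (s l) (pr l)" for X
    unfolding pr_def using lin_on_linear quot_proj(1)[OF vs bd_sub] by blast
  have "fdim (s l) (pr l ` E ` V l)" by (rule fdim_image[OF vs vs assms(1) pl])
  moreover have "H l \<subseteq> pr l ` E ` V l"
  proof
    fix y assume "y \<in> H l"
    then obtain x where x: "x \<in> cyc l" "y = pr l x" unfolding H_def by blast
    have "pr l (E x) = pr l x" unfolding pr_def using quot_proj_diff(1)[OF vs bd_sub] assms(3)[OF x(1)] by blast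
    then show "y \<in> pr l ` E ` V l" using x cyc_V by (metis image_eqI subsetD)
  qed
  ultimately show ?thesis using fdim_subset[OF vs _ H_sub] by blast
qed

text \<open>The common engine for Ext and Tor. The operator \<open>\<theta> \<rho> \<alpha>\<close>
  may have infinite rank on the complex; on cocycles it agrees with the finite rank operator
  \<open>T\<close> up to coboundaries, and the Hopf formula is applied to \<open>T\<close>.\<close>

lemma lefschetz:
  assumes T: "endo T" and f: "\<And>l. fdim (s l) (T l ` V l)"
    and fin: "finite {l. \<exists>x\<in>V l. T l x \<noteq> 0}"
    and L: "endo \<alpha>" and R: "endo \<rho>" and Th: "endo \<theta>"
    and idem: "\<And>l x. x \<in> V l \<Longrightarrow> \<alpha> l (\<alpha> l x) = \<alpha> l x" "\<And>l x. x \<in> V l \<Longrightarrow> \<rho> l (\<rho> l x) = \<rho> l x"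
    and comm: "\<And>l x. x \<in> V l \<Longrightarrow> \<alpha> l (\<rho> l x) = \<rho> l (\<alpha> l x)" "\<And>l x. x \<in> V l \<Longrightarrow> \<alpha> l (\<theta> l x) = \<theta> l (\<alpha> l x)"
      "\<And>l x. x \<in> V l \<Longrightarrow> \<rho> l (\<theta> l x) = \<theta> l (\<rho> l x)"
    and fH: "\<And>l. fdim (s l) (H l)"
    and TT: "\<And>l x. x \<in> cyc l \<Longrightarrow> \<theta> l (\<rho> l (\<alpha> l x)) - T l x \<in> bd l"
  shows "euler (\<lambda>l. lin_trace (s l) ((\<lambda>x. pr l (\<rho> l (pr l (\<alpha> l x)))) ` H l) (\<lambda>x. pr l (\<theta> l x)))
       = euler (\<lambda>l. fr_trace (s l) (V l) (T l))"
proof -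
  have "lin_trace (s l) ((\<lambda>x. pr l (\<rho> l (pr l (\<alpha> l x)))) ` H l) (\<lambda>x. pr l (\<theta> l x))
     = fr_trace (s l) (H l) (\<lambda>x. pr l (T l x))" for l
    unfolding H_def
    by (rule lin_trace_quotient_idem[OF vs cyc_sub bd_sub bd_cyc endoD(4,5,6)[OF L] endoD(4,5,6)[OF R] endoD(4,5,6)[OF Th]
         _ _ _ _ _ pr_def fH[unfolded H_def] TT])
       (use idem comm cyc_V in blast)+
  then show ?thesis unfolding hopf_trace[OF T f fin] by simp
qed

end

section \<open>Dimension counts\<close>

abbreviation dm :: "('k::field \<Rightarrow> 'x::ab_group_add \<Rightarrow> 'x) \<Rightarrow> 'x set \<Rightarrow> nat" where
  "dm \<equiv> vector_space.dim"

lemma dim_psubset_less: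
  assumes v: "vector_space s" and V: "fdim s V" and W: "subsp s W" "W \<subset> V"
  shows "dm s W < dm s V"
proof -
  interpret vector_space s by fact
  have fW: "fdim s W" using fdim_subset[OF v V W(1)] W(2) by blast
  obtain B where B: "finite B" "independent B" "span B = W" using fdim_basis[OF v fW] by blast
  have BV: "B \<subseteq> V" using B span_superset W by blast
  obtain C where C: "B \<subseteq> C" "C \<subseteq> V" "independent C" "V \<subseteq> span C"
    using maximal_independent_subset_extend[OF BV B(2)] by blast
  obtain D where D: "finite D" "independent D" "span D = V" using fdim_basis[OF v V] by blast
  have fC: "finite C" using independent_span_bound[of D C] C D by blast
  have "B \<noteq> C" using B C W by blast
  then have "card B < card C" using C fC psubset_card_mono by blast
  moreover have "dim W = card B" using B dim_span_eq_card_independent by blast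
  moreover have "dim V = card C" using C basis_card_eq_dim by metis
  ultimately show ?thesis by simp
qed

lemma descending_chain_stops:
  assumes v: "vector_space s" and "fdim s (V 0)" and V: "\<And>i. subsp s (V i)" "\<And>i. V (Suc i) \<subseteq> V i"
  obtains i where "V (Suc i) = V i"
proof (rule ccontr)
  assume "\<not> thesis"
  then have ne: "V (Suc i) \<subset> V i" for i using that V(2) by blast
  have f: "fdim s (V i)" for i
    by (induction i) (use assms fdim_subset[OF v _ V(1) V(2)] in auto)
  have "dm s (V i) + i \<le> dm s (V 0)" for i
  proof (induction i)
    case (Suc i)
    then show ?case using dim_psubset_less[OF v f V(1) ne[of i]] by simp
  qed simp
  from this[of "Suc (dm s (V 0))"] show False by simp
qed

text \<open>Dimension vectors must be compared as integers. The additivity of traces proved above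
  would give this equation only in \<open>k\<close>, that is, modulo the characteristic, so a basis
  of the kernel is completed by lifts of a basis of the image.\<close>

lemma rank_nullity:
  assumes v: "vector_space s" "vector_space s'" and V: "fdim s V" and p: "lin_on s V s' p"
  shows "dm s V = dm s {x \<in> V. p x = 0} + dm s' (p ` V)"
proof -
  interpret vector_space s by fact
  interpret w: vector_space s' by fact
  note sV = fdim_subsp[OF v(1) V]
  let ?W = "{x \<in> V. p x = 0}"
  obtain g where g: "lin_on s' (p ` V) s g" "g ` p ` V \<subseteq> V" "\<And>y. y \<in> p ` V \<Longrightarrow> p (g y) = y"
    using lin_on_section[OF v sV p] by blast
  have W: "fdim s ?W" by (rule fdim_subset[OF v(1) V lin_on_kernel[OF v sV p]]) auto
  have U: "fdim s' (p ` V)" by (rule fdim_image[OF v V p])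
  obtain B where B: "finite B" "independent B" "span B = ?W" using fdim_basis[OF v(1) W] by blast
  obtain D where D: "finite D" "w.independent D" "w.span D = p ` V" using fdim_basis[OF v(2) U] by blast
  have DV: "y \<in> p ` V" if "y \<in> D" for y using that D w.span_superset by blast
  have BW: "b \<in> V \<and> p b = 0" if "b \<in> B" for b using that B span_base by blast
  have inj: "inj_on g D" by (rule inj_on_inverseI[of _ p]) (use g DV in auto)
  have disj: "B \<inter> g ` D = {}"
  proof -
    have "p (g y) \<noteq> 0" if "y \<in> D" for y using that g(3)[OF DV[OF that]] D(2) w.dependent_zero by metis
    then show ?thesis using BW by auto
  qed
  have gV: "g y \<in> V" if "y \<in> D" for y using g(2) DV that by blast
  have "independent (B \<union> g ` D)"
  proof (rule independent_if_scalars_zero)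
    show "finite (B \<union> g ` D)" using B D by simp
    fix f x assume 0: "(\<Sum>x\<in>B \<union> g ` D. s (f x) x) = 0" and x: "x \<in> B \<union> g ` D"
    have split: "(\<Sum>x\<in>B \<union> g ` D. s (f x) x) = (\<Sum>x\<in>B. s (f x) x) + (\<Sum>y\<in>D. s (f (g y)) (g y))"
      using B D disj inj by (simp add: sum.union_disjoint sum.reindex)
    have "0 = p (\<Sum>x\<in>B \<union> g ` D. s (f x) x)" unfolding 0 using lin_on_0[OF v(1) sV p] by simp
    also have "\<dots> = (\<Sum>x\<in>B \<union> g ` D. p (s (f x) x))"
      by (rule lin_on_sum[OF v(1) sV p]) (use BW gV subspD(5)[OF v(1) sV] in blast)
    also have "\<dots> = (\<Sum>x\<in>B \<union> g ` D. s' (f x) (p x))"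
      by (rule sum.cong) (use BW gV lin_on_scale[OF p] in auto)
    also have "\<dots> = (\<Sum>y\<in>D. s' (f (g y)) y)"
      using B D disj inj BW g(3)[OF DV] by (simp add: sum.union_disjoint sum.reindex)
    finally have fD: "f (g y) = 0" if "y \<in> D" for y
      using w.independentD[OF D(2,1) order_refl, of "\<lambda>y. f (g y)"] that by metis
    then have "(\<Sum>x\<in>B. s (f x) x) = 0" using 0 unfolding split by simp
    then have "f b = 0" if "b \<in> B" for b
      using independentD[OF B(2,1) order_refl, of f] that by metis
    then show "f x = 0" using fD x by auto
  qed
  moreover have "V \<subseteq> span (B \<union> g ` D)"
  proof
    fix x assume x: "x \<in> V"
    have px: "p x \<in> p ` V" using x by blast
    have gp: "g (p x) \<in> V" using g(2) px by blast
    have "x - g (p x) \<in> ?W" using x gp g(3)[OF px] lin_on_diff[OF v(1) sV p] subspD(3)[OF v(1) sV] by simp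
    then have 1: "x - g (p x) \<in> span (B \<union> g ` D)" using B span_mono[of B "B \<union> g ` D"] by blast
    have "p x = (\<Sum>d\<in>D. s' (w.representation D (p x) d) d)"
      using w.sum_representation_eq[OF D(2) _ D(1)] D(3) px by auto
    then have "g (p x) = g (\<Sum>d\<in>D. s' (w.representation D (p x) d) d)" by simp
    also have "\<dots> = (\<Sum>d\<in>D. g (s' (w.representation D (p x) d) d))"
      by (rule lin_on_sum[OF v(2) fdim_subsp[OF v(2) U] g(1)]) (use DV subspD(5)[OF v(2) fdim_subsp[OF v(2) U]] in blast)
    also have "\<dots> = (\<Sum>d\<in>D. s (w.representation D (p x) d) (g d))"
      by (rule sum.cong) (use DV lin_on_scale[OF g(1)] in auto)
    also have "\<dots> \<in> span (B \<union> g ` D)"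
      by (intro span_sum span_scale span_base) auto
    finally have "x - g (p x) + g (p x) \<in> span (B \<union> g ` D)" using 1 span_add by blast
    then show "x \<in> span (B \<union> g ` D)" by simp
  qed
  moreover have "B \<union> g ` D \<subseteq> V" using BW gV by blast
  ultimately have "card (B \<union> g ` D) = dm s V" using basis_card_eq_dim by blast
  moreover have "card (B \<union> g ` D) = card B + card D"
    using B D disj inj by (simp add: card_Un_disjoint card_image)
  moreover have "dm s ?W = card B" using B dim_span_eq_card_independent by metis
  moreover have "dm s' (p ` V) = card D" using D w.dim_span_eq_card_independent by metis
  ultimately show ?thesis by simp
qed

section \<open>Characters of an elementary algebra\<close>

locale fd_alg =
  fixes sA :: "'k::field \<Rightarrow> 'a::{ring,monoid_mult} \<Rightarrow> 'a"
  assumes fd_alg: "fd_algebra sA"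
begin

lemma vsA: "vector_space sA" using fd_alg unfolding fd_algebra_def by blast
lemma scale_mult: "sA c x * y = sA c (x * y)" "x * sA c y = sA c (x * y)"
  using fd_alg unfolding fd_algebra_def by metis+
lemma fdim_UNIV: "fdim sA UNIV" using fd_alg unfolding fd_algebra_def fdim_def by blast

text \<open>Zorn's lemma for right ideals avoiding 1. Unions of chains stay in this family because
  properness is expressed by the single element 1.\<close>

lemma maximal_right_ideal_exists:
  assumes I: "right_ideal (I :: 'a set)" "1 \<notin> I"
  obtains N where "maximal_right_ideal N" "I \<subseteq> N" "1 \<notin> N"
proof -
  let ?A = "{N. right_ideal N \<and> I \<subseteq> N \<and> (1::'a) \<notin> N}"
  have "\<exists>M\<in>?A. \<forall>X\<in>?A. M \<subseteq> X \<longrightarrow> X = M"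
  proof (rule subset_Zorn)
    fix \<C> assume c: "subset.chain ?A \<C>"
    show "\<exists>U\<in>?A. \<forall>X\<in>\<C>. X \<subseteq> U"
    proof (cases "\<C> = {}")
      case True
      then show ?thesis using I by blast
    next
      case False
      have ri: "right_ideal X" "I \<subseteq> X" "1 \<notin> X" if "X \<in> \<C>" for X
        using c that unfolding subset.chain_def by blast+
      have "right_ideal (\<Union>\<C>)"
        unfolding right_ideal_def
      proof (intro conjI ballI allI)
        show "0 \<in> \<Union>\<C>" using False ri(1) unfolding right_ideal_def by blast
        fix x y assume "x \<in> \<Union>\<C>" "y \<in> \<Union>\<C>"
        then obtain X Y where XY: "X \<in> \<C>" "x \<in> X" "Y \<in> \<C>" "y \<in> Y" by blast
        then have "X \<subseteq> Y \<or> Y \<subseteq> X" using c unfolding subset.chain_def by blast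
        then obtain X where "X \<in> \<C>" "x \<in> X" "y \<in> X" using XY by blast
        then show "x - y \<in> \<Union>\<C>" using ri(1) unfolding right_ideal_def by blast
      next
        fix x a assume "x \<in> \<Union>\<C>"
        then show "x * a \<in> \<Union>\<C>" using ri(1) unfolding right_ideal_def by blast
      qed
      moreover have "I \<subseteq> \<Union>\<C>" using False ri(2) by blast
      ultimately show ?thesis using ri(3) by (intro bexI[of _ "\<Union>\<C>"]) auto
    qed
  qed
  then obtain N where NA: "N \<in> ?A" and max: "\<forall>X\<in>?A. N \<subseteq> X \<longrightarrow> X = N" by (rule bexE)
  from NA have N: "right_ideal N" "I \<subseteq> N" "1 \<notin> N" by simp_all
  have N4: "X = N" if "right_ideal X" "N \<subseteq> X" "1 \<notin> X" for X
  proof -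
    have "X \<in> ?A" using that N(2) by simp
    then show ?thesis using max that(2) by simp
  qed
  have "X = N \<or> X = UNIV" if "right_ideal X" "N \<subseteq> X" for X
  proof (cases "1 \<in> X")
    case True
    have "\<forall>x\<in>X. \<forall>a. x * a \<in> X" using that(1) unfolding right_ideal_def by simp
    from bspec[OF this True] have "\<forall>a. a \<in> X" by simp
    then show ?thesis by blast
  next
    case False
    then show ?thesis using N4[OF that] by simp
  qed
  then have "maximal_right_ideal N" unfolding maximal_right_ideal_def using N by blast
  then show thesis using that N by blast
qed

text \<open>If the right ideal generated by \<open>1 - x\<close> were proper, a maximal right ideal
  above it would contain \<open>1 - x\<close> and also the radical element \<open>x\<close>, hence
  1.\<close>

lemma radical_right_inverse:
  assumes "(x::'a) \<in> jacobson_radical"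
  obtains y where "(1 - x) * y = 1"
proof (rule ccontr)
  assume no: "\<not> thesis"
  define I where "I = range (\<lambda>y. (1 - x) * y)"
  have "right_ideal I" unfolding right_ideal_def I_def
    by (auto simp: image_iff mult.assoc intro: exI[of _ 0]) (metis right_diff_distrib)
  moreover have "1 \<notin> I" unfolding I_def using no that by (metis rangeE)
  ultimately obtain N where N: "maximal_right_ideal N" "I \<subseteq> N" "1 \<notin> N"
    using maximal_right_ideal_exists by blast
  have "x \<in> N" using assms N(1) unfolding jacobson_radical_def by blast
  have rN: "right_ideal N" using N(1) unfolding maximal_right_ideal_def by blast
  have "(1 - x) * 1 \<in> N" using N(2) unfolding I_def by blast
  then have "(1 - x) \<in> N" by simp
  moreover have "0 - x \<in> N" using rN \<open>x \<in> N\<close> unfolding right_ideal_def by blast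
  ultimately have "(1 - x) - (0 - x) \<in> N" using rN unfolding right_ideal_def by blast
  then show False using N(3) by simp
qed

end

locale elem_alg = fd_alg sA for sA :: "'k::field \<Rightarrow> 'a::{ring,monoid_mult} \<Rightarrow> 'a" +
  fixes r :: nat and h :: "'a \<Rightarrow> nat \<Rightarrow> 'k"
  assumes h_add: "\<And>i x y. i < r \<Longrightarrow> h (x + y) i = h x i + h y i"
    and h_scale: "\<And>i c x. i < r \<Longrightarrow> h (sA c x) i = c * h x i"
    and h_mult: "\<And>i x y. i < r \<Longrightarrow> h (x * y) i = h x i * h y i"
    and h_one: "\<And>i. i < r \<Longrightarrow> h 1 i = 1"
    and h_surj: "\<And>v. \<exists>x. \<forall>i<r. h x i = v i"
    and h_rad: "{x. \<forall>i<r. h x i = 0} = jacobson_radical"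
begin

abbreviation J :: "'a set" where "J \<equiv> jacobson_radical"

lemma J_iff: "x \<in> J \<longleftrightarrow> (\<forall>i<r. h x i = 0)" using h_rad by blast

lemma h_0: "i < r \<Longrightarrow> h 0 i = 0" using h_scale[of i 0 0] module.scale_zero_left[OF vsA[folded module_iff_vector_space]] by simp
lemma h_neg: "i < r \<Longrightarrow> h (- x) i = - h x i" using h_add[of i x "- x"] h_0 by (metis add.right_inverse minus_unique)
lemma h_diff: "i < r \<Longrightarrow> h (x - y) i = h x i - h y i" using h_add[of i x "- y"] h_neg by simp
lemma h_sum: "i < r \<Longrightarrow> h (sum f I) i = (\<Sum>j\<in>I. h (f j) i)"
  by (induction I rule: infinite_finite_induct) (auto simp: h_0 h_add)

lemma J_ideal: "x \<in> J \<Longrightarrow> x * a \<in> J" "x \<in> J \<Longrightarrow> a * x \<in> J" "x \<in> J \<Longrightarrow> y \<in> J \<Longrightarrow> x + y \<in> J" "0 \<in> J"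
  "x \<in> J \<Longrightarrow> sA c x \<in> J"
  unfolding J_iff by (auto simp: h_add h_mult h_0 h_scale)

text \<open>The chain of right ideals generated by \<open>x ^ i\<close> stops for dimension reasons,
  which gives \<open>x ^ i * (1 - x * a) = 0\<close>. As \<open>x * a\<close> is again in the
  radical, \<open>1 - x * a\<close> has a right inverse and can be cancelled.\<close>

lemma J_nilpotent:
  assumes "x \<in> J"
  obtains m where "x ^ m = 0"
proof -
  define V where "V i = range (\<lambda>a. x ^ i * a)" for i
  have lin: "lin_on sA UNIV sA (\<lambda>a. x ^ i * a)" for i
    by (simp add: lin_on_def distrib_left scale_mult)
  have sub: "subsp sA (V i)" for i unfolding V_def
    by (rule lin_on_image[OF vsA vsA _ lin]) (simp add: module.subspace_UNIV module_iff_vector_space vsA)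
  have "x ^ Suc i * a = x ^ i * (x * a)" for i a by (simp add: power_Suc2 mult.assoc del: power_Suc)
  then have "V (Suc i) \<subseteq> V i" for i unfolding V_def by (metis image_subsetI rangeI)
  moreover have "fdim sA (V 0)" unfolding V_def using fdim_UNIV by simp
  ultimately obtain i where i: "V (Suc i) = V i" using descending_chain_stops[OF vsA _ sub, of "\<lambda>i. i"] by blast
  have "x ^ i * 1 \<in> V i" unfolding V_def by blast
  then have "x ^ i * 1 \<in> range (\<lambda>a. x ^ Suc i * a)" using i unfolding V_def by blast
  then obtain a where "x ^ i * 1 = x ^ Suc i * a" by blast
  then have "x ^ i * (1 - x * a) = 0" by (simp add: power_Suc2 mult.assoc right_diff_distrib del: power_Suc)
  moreover obtain y where "(1 - x * a) * y = 1" using radical_right_inverse[OF J_ideal(1)[OF assms]] by blast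
  ultimately have "x ^ i = 0" by (metis mult.assoc mult.right_neutral mult_zero_left)
  then show thesis using that by blast
qed

lemma idempotent_in_J: "x * x = x \<Longrightarrow> x \<in> J \<Longrightarrow> x = 0"
proof -
  assume x: "x * x = x" "x \<in> J"
  obtain m where m: "x ^ m = 0" using J_nilpotent x by blast
  have "x ^ Suc k = x" for k by (induction k) (use x in auto)
  then show ?thesis using m by (metis mult_zero_right power_Suc)
qed

text \<open>Newton iteration for the equation \<open>y * y = y\<close>, by induction on the exponent
  that kills the error. The conditions with \<open>a\<close> keep the lift in the corner
  \<open>a A a\<close>, as needed to split a given idempotent.\<close>

lemma lift_idempotent:
  assumes "(y * y - y) ^ m = 0" "\<And>i. i < r \<Longrightarrow> h y i * h y i = h y i" "a * y = y" "y * a = y"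
  obtains z where "z * z = z" "\<And>i. i < r \<Longrightarrow> h z i = h y i" "a * z = z" "z * a = z"
  using assms
proof (induction m arbitrary: y thesis rule: less_induct)
  case (less m)
  define z where "z = y * y - y"
  \<comment> \<open>The Newton step: \<open>y'\<close> equals three times the square of
    \<open>y\<close> minus twice its cube.\<close>
  define y' where "y' = y + z - (y * z + y * z)"
  have zy: "z * y = y * z" unfolding z_def by (simp add: algebra_simps)
  show ?case
  proof (cases "m \<le> 1")
    case True
    then have "z = 0" using less.prems(2) z_def 
    proof (cases m)
      case 0
      then have "(1::'a) = 0" using less.prems(2) by simp
      then show ?thesis by (metis mult.left_neutral mult_zero_left)
    qed auto
    then have "y * y = y" unfolding z_def by simp
    then show ?thesis using less.prems(1)[of y] less.prems(4,5) by blast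
  next
    case False
    \<comment> \<open>The error of \<open>y'\<close> is the square of the old error \<open>z\<close>
      times the factor \<open>4 z - 3\<close>.\<close>
    define c where "c = z + z + z + z - (1 + 1 + 1)"
    have hs_char: "y' * y' - y' = (z * z) * c"
    proof -
      have yy: "y * y = y + z" unfolding z_def by simp
      have yyu: "y * (y * u) = y * u + z * u" for u unfolding mult.assoc[symmetric] yy by (rule distrib_right)
      have zyu: "z * (y * u) = y * (z * u)" for u unfolding mult.assoc[symmetric] zy ..
      show ?thesis
        unfolding y'_def c_def
        by (simp add: distrib_left distrib_right left_diff_distrib right_diff_distrib mult.assoc yy yyu zy zyu)
    qed
    have cz: "c * z = z * c" unfolding c_def
      by (simp add: distrib_left distrib_right left_diff_distrib right_diff_distrib mult.assoc)
    have pc: "c * z ^ j = z ^ j * c" for j by (rule power_commuting_commutes[symmetric]) (simp add: cz)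
    have "((z * z) * c) ^ j = z ^ (2 * j) * c ^ j" for j
    proof (induction j)
      case (Suc j)
      have e: "2 * Suc j = Suc (Suc (2 * j))" by simp
      have "((z * z) * c) ^ Suc j = (z * z) * (c * z ^ (2 * j)) * c ^ j"
        unfolding power_Suc Suc by (simp add: mult.assoc)
      also have "\<dots> = (z * z * z ^ (2 * j)) * (c * c ^ j)" unfolding pc by (simp add: mult.assoc)
      finally show ?case unfolding e power_Suc by (simp add: mult.assoc)
    qed simp
    \<comment> \<open>Since \<open>m\<close> is at least 2, squaring the error already lowers the
      killing exponent from \<open>m\<close> to \<open>m - 1\<close>, which suffices for the
      induction.\<close>
    moreover have "z ^ (2 * (m - 1)) = z ^ m * z ^ (m - 2)"
      unfolding power_add[symmetric] by (rule arg_cong[where f = "\<lambda>k. z ^ k"]) (use False in simp)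
    ultimately have "(y' * y' - y') ^ (m - 1) = 0" unfolding hs_char using less.prems(2) z_def by simp
    moreover have hy: "h y' i = h y i" if "i < r" for i
    proof -
      have "h z i = 0" unfolding z_def using that less.prems(3)[OF that] by (simp add: h_diff h_mult)
      then show ?thesis unfolding y'_def using that by (simp add: h_add h_diff h_mult)
    qed
    moreover have ay: "a * y' = y'"
    proof -
      have "a * (y * u) = y * u" for u using less.prems(4) by (simp add: mult.assoc[symmetric])
      then show ?thesis unfolding y'_def z_def using less.prems(4)
        by (simp add: distrib_left right_diff_distrib)
    qed
    moreover have ya: "y' * a = y'"
      unfolding y'_def z_def using less.prems(5)
      by (simp add: distrib_right left_diff_distrib mult.assoc)
    moreover have "m - 1 < m" using False by simp
    moreover have "h y' i * h y' i = h y' i" if "i < r" for i using hy[OF that] less.prems(3)[OF that] by simp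
    ultimately obtain w where w: "w * w = w" "\<And>i. i < r \<Longrightarrow> h w i = h y' i" "a * w = w" "w * a = w"
      using less.IH[of "m - 1" y'] by blast
    show ?thesis by (rule less.prems(1)[of w]) (use w hy in simp_all)
  qed
qed

text \<open>The image of \<open>x\<close> in the product of fields is a vector of zeros and ones,
  and it is not zero because an idempotent in the radical vanishes. Two ones are impossible: lifting
  one coordinate idempotent into the corner of \<open>x\<close> would split
  \<open>x\<close>.\<close>

lemma primitive_character:
  assumes "primitive_idempotent x"
  obtains i where "i < r" "\<And>j. j < r \<Longrightarrow> h x j = (if j = i then 1 else 0)"
proof -
  have x: "x * x = x" "x \<noteq> 0" using assms unfolding primitive_idempotent_def by auto
  have 01: "h x j = 0 \<or> h x j = 1" if "j < r" for j
    using h_mult[OF that, of x x] x by (simp add: algebra_simps)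
  obtain i where i: "i < r" "h x i \<noteq> 0" using idempotent_in_J[OF x(1)] x(2) J_iff by blast
  have i1: "h x i = 1" using 01 i by blast
  have "h x j = 0" if j: "j < r" "j \<noteq> i" for j
  proof (rule ccontr)
    assume "h x j \<noteq> 0"
    then have j1: "h x j = 1" using 01 j by blast
    obtain u where u: "\<And>l. l < r \<Longrightarrow> h u l = (if l = i then 1 else 0)"
      using h_surj[of "\<lambda>l. if l = i then 1 else 0"] by blast
    \<comment> \<open>The element \<open>u\<close> lifts the coordinate vector \<open>i\<close>;
      multiplication by \<open>x\<close> on both sides moves it into the corner without changing the
      coordinate vector, since \<open>h x i = 1\<close>.\<close>
    define y where "y = x * u * x"
    have hy: "h y l = (if l = i then 1 else 0)" if "l < r" for l
      unfolding y_def using that u i1 by (simp add: h_mult)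
    have "y * y - y \<in> J" unfolding J_iff by (simp add: h_diff h_mult hy)
    then obtain m where m: "(y * y - y) ^ m = 0" using J_nilpotent by blast
    have "x * y = y" "y * x = y" unfolding y_def using x(1) by (simp_all add: mult.assoc) (simp add: mult.assoc[symmetric])
    moreover have "h y l * h y l = h y l" if "l < r" for l using hy[OF that] by simp
    ultimately obtain z where z: "z * z = z" "\<And>l. l < r \<Longrightarrow> h z l = h y l" "x * z = z" "z * x = z"
      using lift_idempotent[OF m, of x] by blast
    have "z * (x - z) = 0" "(x - z) * z = 0" "(x - z) * (x - z) = x - z" "x = z + (x - z)"
      by (simp_all add: left_diff_distrib right_diff_distrib z(1,3,4) x(1))
    then have "z = 0 \<or> x - z = 0" using assms z(1) unfolding primitive_idempotent_def by blast
    moreover have "h z i = 1" using z(2) hy i by simp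
    moreover have "h (x - z) j = 1" using z(2) hy j j1 by (simp add: h_diff)
    ultimately show False using h_0 i j by auto
  qed
  then show thesis using that[of i] i i1 by auto
qed

text \<open>Orthogonality makes \<open>\<sigma>\<close> injective: two idempotents with the same
  coordinate would have a nonzero product. It is surjective because the idempotents sum to 1, whose
  coordinates are all 1.\<close>

lemma characters:
  assumes e: "complete_primitive_idempotents n e"
  obtains \<sigma> where "bij_betw \<sigma> {..<n} {..<r}" "\<And>v w. v < n \<Longrightarrow> w < n \<Longrightarrow> h (e w) (\<sigma> v) = (if v = w then 1 else 0)"
proof -
  have pr: "primitive_idempotent (e v)" if "v < n" for v
    using e that unfolding complete_primitive_idempotents_def by blast
  have orth: "e v * e w = 0" if "v < n" "w < n" "v \<noteq> w" for v w
    using e that unfolding complete_primitive_idempotents_def by blast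
  have sum1: "(\<Sum>v<n. e v) = 1" using e unfolding complete_primitive_idempotents_def by blast
  have "\<forall>v. \<exists>i. v < n \<longrightarrow> i < r \<and> (\<forall>j<r. h (e v) j = (if j = i then 1 else 0))"
    using primitive_character pr by metis
  then obtain \<sigma> where \<sigma>: "\<And>v. v < n \<Longrightarrow> \<sigma> v < r"
    "\<And>v j. v < n \<Longrightarrow> j < r \<Longrightarrow> h (e v) j = (if j = \<sigma> v then 1 else 0)" by metis
  have inj: "v = w" if "v < n" "w < n" "\<sigma> v = \<sigma> w" for v w
  proof (rule ccontr)
    assume "v \<noteq> w"
    then have "h (e v * e w) (\<sigma> v) = 0" using orth that \<sigma>(1) h_0 by simp
    then show False using \<sigma> that by (simp add: h_mult)
  qed
  have "i \<in> \<sigma> ` {..<n}" if "i < r" for i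
  proof (rule ccontr)
    assume "i \<notin> \<sigma> ` {..<n}"
    then have "(\<Sum>v<n. h (e v) i) = 0" using \<sigma>(2) that by (intro sum.neutral) auto
    then show False using h_one[OF that] h_sum[OF that] sum1 by (metis zero_neq_one)
  qed
  then have "bij_betw \<sigma> {..<n} {..<r}" unfolding bij_betw_def inj_on_def using inj \<sigma>(1) by auto
  moreover have "h (e w) (\<sigma> v) = (if v = w then 1 else 0)" if "v < n" "w < n" for v w
    using \<sigma> inj that by auto
  ultimately show thesis using that by blast
qed

end

text \<open>The form in which elementarity is used from here on: the characters are indexed by the
  given idempotents and dual to them, their common kernel is the radical, and radical elements are
  nilpotent.\<close>

locale basic_alg = fd_alg sA for sA :: "'k::field \<Rightarrow> 'a::{ring,monoid_mult} \<Rightarrow> 'a" +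
  fixes n :: nat and e :: "nat \<Rightarrow> 'a" and \<chi> :: "nat \<Rightarrow> 'a \<Rightarrow> 'k"
  assumes e_idem: "\<And>v. v < n \<Longrightarrow> e v * e v = e v"
    and e_orth: "\<And>v w. v < n \<Longrightarrow> w < n \<Longrightarrow> v \<noteq> w \<Longrightarrow> e v * e w = 0"
    and e_sum: "(\<Sum>v<n. e v) = 1"
    and chi_add: "\<And>v x y. v < n \<Longrightarrow> \<chi> v (x + y) = \<chi> v x + \<chi> v y"
    and chi_scale: "\<And>v c x. v < n \<Longrightarrow> \<chi> v (sA c x) = c * \<chi> v x"
    and chi_mult: "\<And>v x y. v < n \<Longrightarrow> \<chi> v (x * y) = \<chi> v x * \<chi> v y"
    and chi_one: "\<And>v. v < n \<Longrightarrow> \<chi> v 1 = 1"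
    and chi_e: "\<And>v w. v < n \<Longrightarrow> w < n \<Longrightarrow> \<chi> v (e w) = (if v = w then 1 else 0)"
    and rad: "\<And>x. x \<in> jacobson_radical \<longleftrightarrow> (\<forall>v<n. \<chi> v x = 0)"
    and rad_nil: "\<And>x :: 'a. x \<in> jacobson_radical \<Longrightarrow> \<exists>m. x ^ m = 0"

lemma elementary_basic_alg:
  fixes sA :: "'k::field \<Rightarrow> 'a::{ring,monoid_mult} \<Rightarrow> 'a"
  assumes "fd_algebra sA" "elementary sA" "complete_primitive_idempotents n e"
  obtains \<chi> where "basic_alg sA n e \<chi>"
proof -
  obtain r h where "elem_alg sA r h"
  proof -
    obtain r and h :: "'a \<Rightarrow> nat \<Rightarrow> 'k" where
        "(\<forall>i<r. \<forall>x y. h (x + y) i = h x i + h y i)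
      \<and> (\<forall>i<r. \<forall>c x. h (sA c x) i = c * h x i)
      \<and> (\<forall>i<r. \<forall>x y. h (x * y) i = h x i * h y i)
      \<and> (\<forall>i<r. h 1 i = 1)
      \<and> (\<forall>v. \<exists>x. \<forall>i<r. h x i = v i)
      \<and> {x. \<forall>i<r. h x i = 0} = jacobson_radical"
      using assms(2) unfolding elementary_def by (elim exE)
    then have "elem_alg sA r h"
      by (intro elem_alg.intro fd_alg.intro elem_alg_axioms.intro assms(1)) simp_all
    then show thesis by (rule that)
  qed
  then interpret elem_alg sA r h .
  obtain \<sigma> where \<sigma>: "bij_betw \<sigma> {..<n} {..<r}" "\<And>v w. v < n \<Longrightarrow> w < n \<Longrightarrow> h (e w) (\<sigma> v) = (if v = w then 1 else 0)"
    using characters[OF assms(3)] by blast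
  have \<sigma>r: "\<sigma> v < r" if "v < n" for v using \<sigma>(1) that unfolding bij_betw_def by auto
  have ex: "\<exists>v<n. i = \<sigma> v" if "i < r" for i
  proof -
    have "i \<in> \<sigma> ` {..<n}" using \<sigma>(1) that unfolding bij_betw_def by auto
    then show ?thesis by auto
  qed
  have "basic_alg sA n e (\<lambda>v x. h x (\<sigma> v))"
  proof unfold_locales
    show "e v * e v = e v" if "v < n" for v
      using assms(3) that unfolding complete_primitive_idempotents_def primitive_idempotent_def by blast
    show "e v * e w = 0" if "v < n" "w < n" "v \<noteq> w" for v w
      using assms(3) that unfolding complete_primitive_idempotents_def by blast
    show "(\<Sum>v<n. e v) = 1" using assms(3) unfolding complete_primitive_idempotents_def by blast
    show "x \<in> jacobson_radical \<longleftrightarrow> (\<forall>v<n. h x (\<sigma> v) = 0)" for x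
    proof
      assume "x \<in> jacobson_radical"
      then show "\<forall>v<n. h x (\<sigma> v) = 0" unfolding J_iff using \<sigma>r by blast
    next
      assume 0: "\<forall>v<n. h x (\<sigma> v) = 0"
      have "h x i = 0" if "i < r" for i using ex[OF that] 0 by blast
      then show "x \<in> jacobson_radical" unfolding J_iff by blast
    qed
    show "\<exists>m. x ^ m = 0" if "x \<in> jacobson_radical" for x :: 'a by (rule J_nilpotent[OF that]) blast
  qed (use \<sigma>r \<sigma>(2) in \<open>simp_all add: h_add h_scale h_mult h_one\<close>)
  then show thesis using that by blast
qed

context basic_alg
begin

abbreviation J :: "'a set" where "J \<equiv> jacobson_radical"

lemma chi_0: "v < n \<Longrightarrow> \<chi> v 0 = 0" using chi_scale[of v 0 0] module.scale_zero_left[OF vsA[folded module_iff_vector_space]] by simp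
lemma chi_neg: "v < n \<Longrightarrow> \<chi> v (- x) = - \<chi> v x" using chi_add[of v x "- x"] chi_0 by (metis add.right_inverse minus_unique)
lemma chi_diff: "v < n \<Longrightarrow> \<chi> v (x - y) = \<chi> v x - \<chi> v y" using chi_add[of v x "- y"] chi_neg by simp
lemma chi_sum: "v < n \<Longrightarrow> \<chi> v (sum f I) = (\<Sum>j\<in>I. \<chi> v (f j))"
  by (induction I rule: infinite_finite_induct) (auto simp: chi_0 chi_add)

lemma J_ideal: "x \<in> J \<Longrightarrow> x * a \<in> J" "x \<in> J \<Longrightarrow> a * x \<in> J" "x \<in> J \<Longrightarrow> y \<in> J \<Longrightarrow> x + y \<in> J" "0 \<in> J"
  "x \<in> J \<Longrightarrow> - x \<in> J"
  unfolding rad by (auto simp: chi_add chi_mult chi_0 chi_neg)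

lemma J_decomp: "a - (\<Sum>v<n. sA (\<chi> v a) (e v)) \<in> J"
  unfolding rad
proof (intro allI impI)
  fix w assume w: "w < n"
  have "\<chi> w (\<Sum>v<n. sA (\<chi> v a) (e v)) = (\<Sum>v<n. \<chi> v a * (if w = v then 1 else 0))"
    unfolding chi_sum[OF w] by (rule sum.cong) (auto simp: chi_scale chi_e w)
  also have "\<dots> = (\<Sum>v<n. if w = v then \<chi> v a else 0)" by (rule sum.cong) auto
  also have "\<dots> = \<chi> w a" using w by (simp add: sum.delta')
  finally show "\<chi> w (a - (\<Sum>v<n. sA (\<chi> v a) (e v))) = 0" by (simp add: chi_diff w)
qed

text \<open>Modulo the radical, \<open>a\<close> is a combination of the \<open>e v\<close>. A
  radical element \<open>j\<close> acts by a nilpotent operator, and since \<open>\<psi>\<close>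
  commutes with the action the product with \<open>\<psi>\<close> is nilpotent too. The action is
  required to respect only powers of a single element, a condition that left and right actions both
  satisfy.\<close>

lemma trace_action:
  assumes v: "vector_space s" and V: "fdim s V"
    and \<rho>: "\<And>a. lin_on s V s (\<rho> a)" "\<And>a x. x \<in> V \<Longrightarrow> \<rho> a x \<in> V"
      "\<And>a b x. x \<in> V \<Longrightarrow> \<rho> (a + b) x = \<rho> a x + \<rho> b x" "\<And>c a x. x \<in> V \<Longrightarrow> \<rho> (sA c a) x = s c (\<rho> a x)"
      "\<And>a m x. x \<in> V \<Longrightarrow> \<rho> (a ^ Suc m) x = \<rho> a (\<rho> (a ^ m) x)" "\<And>x. x \<in> V \<Longrightarrow> \<rho> 1 x = x"
    and \<psi>: "lin_on s V s \<psi>" "\<And>x. x \<in> V \<Longrightarrow> \<psi> x \<in> V" "\<And>a x. x \<in> V \<Longrightarrow> \<psi> (\<rho> a x) = \<rho> a (\<psi> x)"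
  shows "lin_trace s V (\<lambda>x. \<rho> a (\<psi> x)) = (\<Sum>v<n. \<chi> v a * lin_trace s V (\<lambda>x. \<rho> (e v) (\<psi> x)))"
proof -
  note sV = fdim_subsp[OF v V]
  have \<rho>0: "\<rho> 0 x = 0" if "x \<in> V" for x using \<rho>(3)[OF that, of 0 0] by simp
  have \<rho>sum: "\<rho> (sum f I) x = (\<Sum>i\<in>I. \<rho> (f i) x)" if "x \<in> V" for f x and I :: "nat set"
    by (induction I rule: infinite_finite_induct) (auto simp: \<rho>0 \<rho>(3) that)
  have im: "(\<lambda>x. \<rho> a (\<psi> x)) ` V \<subseteq> V" for a using \<rho>(2) \<psi>(2) by blast
  have lin: "lin_on s V s (\<lambda>x. \<rho> a (\<psi> x))" for a by (rule lin_on_comp[OF \<psi>(1) _ \<rho>(1)]) (use \<psi>(2) in blast)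
  have nil: "lin_trace s V (\<lambda>x. \<rho> j (\<psi> x)) = 0" if j: "j \<in> J" for j
  proof -
    obtain m where m: "j ^ m = 0" using rad_nil[OF j] by blast
    have \<psi>V: "(\<psi> ^^ k) x \<in> V" if "x \<in> V" for k x by (induction k) (use that \<psi>(2) in auto)
    \<comment> \<open>Commutation of \<open>\<psi>\<close> with \<open>\<rho> j\<close> separates
      the two factors of the power.\<close>
    have "((\<lambda>x. \<rho> j (\<psi> x)) ^^ k) x = \<rho> (j ^ k) ((\<psi> ^^ k) x)" if "x \<in> V" for k x
    proof (induction k)
      case (Suc k)
      have "((\<lambda>x. \<rho> j (\<psi> x)) ^^ Suc k) x = \<rho> j (\<rho> (j ^ k) (\<psi> ((\<psi> ^^ k) x)))"
        using Suc \<psi>(3)[OF \<psi>V[OF that]] by simp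
      also have "\<dots> = \<rho> (j ^ Suc k) (\<psi> ((\<psi> ^^ k) x))" using \<rho>(5) \<psi>V[OF that] \<psi>(2) by simp
      finally show ?case by simp
    qed (use that \<rho>(6) in simp)
    then show ?thesis
      using lin_trace_nilpotent[OF v V lin im, of m j] m \<rho>0 \<psi>V by simp
  qed
  define j where "j = a - (\<Sum>v<n. sA (\<chi> v a) (e v))"
  have a: "\<rho> a (\<psi> x) = (\<Sum>v<n. s (\<chi> v a) (\<rho> (e v) (\<psi> x))) + \<rho> j (\<psi> x)" if "x \<in> V" for x
  proof -
    have "\<rho> a (\<psi> x) = \<rho> ((\<Sum>v<n. sA (\<chi> v a) (e v)) + j) (\<psi> x)" unfolding j_def by simp
    then show ?thesis using \<psi>(2)[OF that] by (simp add: \<rho>(3,4) \<rho>sum)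
  qed
  have "lin_trace s V (\<lambda>x. \<rho> a (\<psi> x)) = lin_trace s V (\<lambda>x. (\<Sum>v<n. s (\<chi> v a) (\<rho> (e v) (\<psi> x))) + \<rho> j (\<psi> x))"
    by (rule lin_trace_cong[OF v V a])
  also have "\<dots> = lin_trace s V (\<lambda>x. \<Sum>v<n. s (\<chi> v a) (\<rho> (e v) (\<psi> x))) + lin_trace s V (\<lambda>x. \<rho> j (\<psi> x))"
    by (rule lin_trace_add[OF v V _ im]) (auto intro!: subspD(5,6)[OF v sV] \<rho>(2) \<psi>(2))
  also have "lin_trace s V (\<lambda>x. \<rho> j (\<psi> x)) = 0" by (rule nil) (simp add: j_def J_decomp)
  also have "lin_trace s V (\<lambda>x. \<Sum>v<n. s (\<chi> v a) (\<rho> (e v) (\<psi> x)))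
      = (\<Sum>v<n. lin_trace s V (\<lambda>x. s (\<chi> v a) (\<rho> (e v) (\<psi> x))))"
    by (rule lin_trace_sum[OF v V]) (use \<rho>(2) \<psi>(2) subspD(5)[OF v sV] in auto)
  also have "\<dots> = (\<Sum>v<n. \<chi> v a * lin_trace s V (\<lambda>x. \<rho> (e v) (\<psi> x)))"
    by (rule sum.cong[OF refl lin_trace_scale[OF v V im]])
  finally show ?thesis by simp
qed

end

section \<open>Projective modules and maps of finite type\<close>

lemma hom_lin: "rmod_hom X Y f \<Longrightarrow> lin_on (scl X) (carr X) (scl Y) f"
  unfolding rmod_hom_def lin_on_def by blast

lemma hom_in: "rmod_hom X Y f \<Longrightarrow> x \<in> carr X \<Longrightarrow> f x \<in> carr Y"
  unfolding rmod_hom_def by blast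

lemma hom_ract: "rmod_hom X Y f \<Longrightarrow> x \<in> carr X \<Longrightarrow> f (ract X x r) = ract Y (f x) r"
  unfolding rmod_hom_def by blast

lemma homI:
  assumes "lin_on (scl X) (carr X) (scl Y) f" "\<And>x. x \<in> carr X \<Longrightarrow> f x \<in> carr Y"
    "\<And>x r. x \<in> carr X \<Longrightarrow> f (ract X x r) = ract Y (f x) r"
  shows "rmod_hom X Y f"
  using assms unfolding rmod_hom_def lin_on_def by simp

lemma hom_comp: "rmod_hom X Y f \<Longrightarrow> rmod_hom Y Z g \<Longrightarrow> rmod_hom X Z (\<lambda>x. g (f x))"
  unfolding rmod_hom_def by simp

lemma hom_id: "rmod_hom X X (\<lambda>x. x)"
  unfolding rmod_hom_def by simp

lemma fin_dim_fdim: "vector_space (scl X) \<Longrightarrow> fin_dim X \<longleftrightarrow> fdim (scl X) (carr X)"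
  unfolding fin_dim_def fdim_def using module.span_superset[of "scl X"] module_iff_vector_space by metis

context fd_alg
begin

definition regm :: "('k, 'a, 'a) rmod" where
  "regm = \<lparr>carr = UNIV, scl = sA, ract = (*)\<rparr>"

lemma regm_simps [simp]: "carr regm = UNIV" "scl regm = sA" "ract regm = (*)"
  by (simp_all add: regm_def)

lemma rmD:
  assumes "right_module sA X"
  shows rm_vs: "vector_space (scl X)" and rm_sub: "subsp (scl X) (carr X)"
    and rm_in: "\<And>x r. x \<in> carr X \<Longrightarrow> ract X x r \<in> carr X"
    and rm_add: "\<And>x y r. x \<in> carr X \<Longrightarrow> y \<in> carr X \<Longrightarrow> ract X (x + y) r = ract X x r + ract X y r"
    and rm_add_r: "\<And>x r r'. x \<in> carr X \<Longrightarrow> ract X x (r + r') = ract X x r + ract X x r'"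
    and rm_mult: "\<And>x r r'. x \<in> carr X \<Longrightarrow> ract X x (r * r') = ract X (ract X x r) r'"
    and rm_one: "\<And>x. x \<in> carr X \<Longrightarrow> ract X x 1 = x"
    and rm_scale_r: "\<And>x c r. x \<in> carr X \<Longrightarrow> ract X x (sA c r) = scl X c (ract X x r)"
  using assms unfolding right_module_def by blast+

lemma rm_scale:
  assumes "right_module sA X" "x \<in> carr X"
  shows "ract X (scl X c x) r = scl X c (ract X x r)"
proof -
  have "scl X c x = ract X x (sA c 1)" using rmD(7,8)[OF assms(1)] assms(2) by simp
  then have "ract X (scl X c x) r = ract X x (sA c 1 * r)" using rmD(6)[OF assms] by simp
  also have "\<dots> = scl X c (ract X x r)" using rmD(8)[OF assms] by (simp add: scale_mult)
  finally show ?thesis .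
qed

lemma rm_lin: "right_module sA X \<Longrightarrow> lin_on (scl X) (carr X) (scl X) (\<lambda>x. ract X x r)"
  by (intro lin_onI) (simp_all add: rmD(4) rm_scale)

lemma rm_lin_r: "right_module sA X \<Longrightarrow> x \<in> carr X \<Longrightarrow> lin_on sA UNIV (scl X) (ract X x)"
  by (intro lin_onI) (simp_all add: rmD(5) rmD(8))

lemma vsA_UNIV: "subsp sA UNIV"
  by (simp add: module.subspace_UNIV module_iff_vector_space vsA)

lemma rm_0: "right_module sA X \<Longrightarrow> ract X 0 r = 0"
  by (rule lin_on_0[OF rmD(1) rmD(2) rm_lin])

lemma rm_0_r: "right_module sA X \<Longrightarrow> x \<in> carr X \<Longrightarrow> ract X x 0 = 0"
  by (rule lin_on_0[OF vsA vsA_UNIV rm_lin_r])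

lemma rm_sum: "right_module sA X \<Longrightarrow> (\<And>i. i \<in> I \<Longrightarrow> f i \<in> carr X) \<Longrightarrow> ract X (sum f I) r = (\<Sum>i\<in>I. ract X (f i) r)"
  using lin_on_sum[OF rmD(1) rmD(2) rm_lin] by blast

lemma rm_sum_r: "right_module sA X \<Longrightarrow> x \<in> carr X \<Longrightarrow> ract X x (sum f I) = (\<Sum>i\<in>I. ract X x (f i))"
  using lin_on_sum[OF vsA vsA_UNIV rm_lin_r] by (metis UNIV_I)

lemma regm_module: "right_module sA regm"
  unfolding right_module_def using vsA vsA_UNIV by (simp add: algebra_simps scale_mult)

lemma hom_plus:
  assumes "right_module sA Y" "rmod_hom X Y f" "rmod_hom X Y g"
  shows "rmod_hom X Y (\<lambda>x. f x + g x)" "rmod_hom X Y (\<lambda>x. f x - g x)"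
proof -
  note S = subspD[OF rmD(1,2)[OF assms(1)]]
  note l = hom_lin[OF assms(2)] hom_lin[OF assms(3)]
  show "rmod_hom X Y (\<lambda>x. f x + g x)"
    by (rule homI[OF lin_on_plus(1)[OF rmD(1)[OF assms(1)] l]])
      (use assms in \<open>simp_all add: hom_in hom_ract S rmD(4)\<close>)
  show "rmod_hom X Y (\<lambda>x. f x - g x)"
    by (rule homI[OF lin_on_plus(2)[OF rmD(1)[OF assms(1)] l]])
      (use assms in \<open>simp_all add: hom_in hom_ract S lin_on_diff[OF rmD(1) rmD(2) rm_lin]\<close>)
qed

lemma hom_zero: "right_module sA X \<Longrightarrow> right_module sA Y \<Longrightarrow> rmod_hom X Y (\<lambda>x. 0)"
  by (rule homI) (simp_all add: lin_on_def rm_0 subspD[OF rmD(1) rmD(2)] module.scale_zero_right[OF rmD(1)[folded module_iff_vector_space]])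

text \<open>The generating family is the whole carrier: every element \<open>x\<close> is its own
  basis vector, and \<open>\<xi> x\<close> is the coordinate belonging to it.\<close>

definition dual_basis :: "('k, 'a, 'x::ab_group_add, 'z) rmod_scheme \<Rightarrow> ('x \<Rightarrow> 'x \<Rightarrow> 'a) \<Rightarrow> bool" where
  "dual_basis P \<xi> \<longleftrightarrow> (\<forall>x. rmod_hom P regm (\<xi> x)) \<and>
     (\<forall>p\<in>carr P. finite {x. \<xi> x p \<noteq> 0} \<and> {x. \<xi> x p \<noteq> 0} \<subseteq> carr P
        \<and> p = (\<Sum>x | \<xi> x p \<noteq> 0. ract P x (\<xi> x p)))"

lemma projective_module: "projective sA P \<Longrightarrow> right_module sA P"
  unfolding projective_def by blast

lemma finite_supp_add: "finite {x. u x \<noteq> (0::'c::monoid_add)} \<Longrightarrow> finite {x. v x \<noteq> 0} \<Longrightarrow> finite {x. u x + v x \<noteq> 0}"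
  by (rule finite_subset[of _ "{x. u x \<noteq> 0} \<union> {x. v x \<noteq> 0}"]) auto

text \<open>The free module on the set \<open>carr P\<close> consists of the finitely supported
  functions in \<open>'x \<Rightarrow> 'a\<close>, the type over which projectivity is tested. A
  splitting of its canonical surjection onto \<open>P\<close> yields the coordinates.\<close>

lemma projective_dual_basis:
  fixes P :: "('k, 'a, 'x::ab_group_add, 'z) rmod_scheme"
  assumes P: "projective sA P"
  obtains \<xi> where "dual_basis P \<xi>"
proof -
  note rP = projective_module[OF P]
  note z = module.scale_zero_right[OF vsA[folded module_iff_vector_space]]
  interpret A: vector_space sA by (rule vsA)
  define F :: "('k, 'a, 'x \<Rightarrow> 'a) rmod" where
    "F = \<lparr>carr = {u. finite {x. u x \<noteq> 0} \<and> (\<forall>x. x \<notin> carr P \<longrightarrow> u x = 0)},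
          scl = (\<lambda>c u x. sA c (u x)), ract = (\<lambda>u a x. u x * a)\<rparr>"
  define g where "g u = (\<Sum>x | u x \<noteq> 0. ract P x (u x))" for u :: "'x \<Rightarrow> 'a"
  have vF: "vector_space (scl F)"
    by unfold_locales (auto simp: F_def fun_eq_iff A.scale_right_distrib A.scale_left_distrib)
  have sF: "subsp (scl F) (carr F)"
  proof (rule subspI[OF vF])
    show "0 \<in> carr F" by (simp add: F_def)
    show "u + v \<in> carr F" if "u \<in> carr F" "v \<in> carr F" for u v
      using that finite_supp_add[of u v] by (simp add: F_def)
    show "scl F c u \<in> carr F" if "u \<in> carr F" for c u
      using that by (auto simp: F_def z intro: finite_subset[of _ "{x. u x \<noteq> 0}"])
  qed
  have "right_module sA F"
    unfolding right_module_def using vF sF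
    by (auto simp: F_def fun_eq_iff algebra_simps scale_mult elim!: rev_finite_subset)
  have gS: "g u = (\<Sum>x\<in>S. ract P x (u x))" if "u \<in> carr F" "finite S" "{x. u x \<noteq> 0} \<subseteq> S" "S \<subseteq> carr P" for u S
    unfolding g_def by (rule sum.mono_neutral_left) (use that rm_0_r[OF rP] in auto)
  have suppP: "{x. u x \<noteq> 0} \<subseteq> carr P" "finite {x. u x \<noteq> 0}" if "u \<in> carr F" for u
    using that by (auto simp: F_def)
  have hom: "rmod_hom F P g"
  proof (rule homI)
    show "lin_on (scl F) (carr F) (scl P) g"
    proof (rule lin_onI)
      fix u v assume u: "u \<in> carr F" and v: "v \<in> carr F"
      let ?S = "{x. u x \<noteq> 0} \<union> {x. v x \<noteq> 0}"
      have uv: "u + v \<in> carr F" using subspD(2)[OF vF sF u v] .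
      have S: "finite ?S" "?S \<subseteq> carr P" using suppP u v by auto
      have "g (u + v) = (\<Sum>x\<in>?S. ract P x ((u + v) x))" by (rule gS[OF uv S(1) _ S(2)]) auto
      also have "\<dots> = (\<Sum>x\<in>?S. ract P x (u x) + ract P x (v x))"
        by (rule sum.cong) (use S rmD(5)[OF rP] in auto)
      also have "\<dots> = g u + g v" unfolding sum.distrib
        using gS[OF u S(1) _ S(2)] gS[OF v S(1) _ S(2)] by auto
      finally show "g (u + v) = g u + g v" .
    next
      fix c u assume u: "u \<in> carr F"
      let ?S = "{x. u x \<noteq> 0}"
      have "g (scl F c u) = (\<Sum>x\<in>?S. ract P x (scl F c u x))"
        by (rule gS[OF subspD(5)[OF vF sF u]]) (use suppP[OF u] z in \<open>auto simp: F_def\<close>)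
      also have "\<dots> = (\<Sum>x\<in>?S. scl P c (ract P x (u x)))"
        by (rule sum.cong) (use suppP[OF u] rmD(8)[OF rP] in \<open>auto simp: F_def\<close>)
      also have "\<dots> = scl P c (g u)" unfolding g_def
        by (rule module.scale_sum_right[symmetric]) (simp add: module_iff_vector_space rmD(1)[OF rP])
      finally show "g (scl F c u) = scl P c (g u)" .
    qed
    show "g u \<in> carr P" if "u \<in> carr F" for u
      unfolding g_def by (rule subspD(6)[OF rmD(1,2)[OF rP]]) (use suppP[OF that] rmD(3)[OF rP] in auto)
    fix u a assume u: "u \<in> carr F"
    let ?S = "{x. u x \<noteq> 0}"
    have "ract F u a \<in> carr F" using \<open>right_module sA F\<close> u rmD(3) by blast
    then have "g (ract F u a) = (\<Sum>x\<in>?S. ract P x (ract F u a x))"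
      by (rule gS) (use suppP[OF u] in \<open>auto simp: F_def\<close>)
    also have "\<dots> = (\<Sum>x\<in>?S. ract P (ract P x (u x)) a)"
      by (rule sum.cong) (use suppP[OF u] rmD(6)[OF rP] in \<open>auto simp: F_def\<close>)
    also have "\<dots> = ract P (g u) a" unfolding g_def
      by (rule rm_sum[OF rP, symmetric]) (use suppP[OF u] rmD(3)[OF rP] in auto)
    finally show "g (ract F u a) = ract P (g u) a" .
  qed
  have "carr P \<subseteq> g ` carr F"
  proof
    fix x assume x: "x \<in> carr P"
    let ?u = "\<lambda>y. if y = x then (1::'a) else 0"
    have u: "?u \<in> carr F" using x by (auto simp: F_def intro: finite_subset[of _ "{x}"])
    have "g ?u = (\<Sum>y\<in>{x}. ract P y (?u y))" by (rule gS[OF u]) (use x in auto)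
    then have "g ?u = x" using rmD(7)[OF rP x] by simp
    then show "x \<in> g ` carr F" using u by force
  qed
  then have "g ` carr F = carr P" using hom_in[OF hom] by blast
  then obtain h where h: "rmod_hom P F h" "\<forall>x\<in>carr P. g (h x) = x"
    using P \<open>right_module sA F\<close> hom unfolding projective_def by blast
  have "dual_basis P (\<lambda>x p. h p x)"
    unfolding dual_basis_def
  proof (intro conjI allI ballI)
    fix x
    show "rmod_hom P regm (\<lambda>p. h p x)"
      using h(1) unfolding rmod_hom_def by (simp add: F_def)
  next
    fix p assume p: "p \<in> carr P"
    then have "h p \<in> carr F" using h(1) hom_in by blast
    then show "finite {x. h p x \<noteq> 0}" "{x. h p x \<noteq> 0} \<subseteq> carr P" using suppP by blast+
    show "p = (\<Sum>x | h p x \<noteq> 0. ract P x (h p x))" using h(2) p unfolding g_def by simp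
  qed
  then show thesis by (rule that)
qed

text \<open>As on a free module, values may be prescribed arbitrarily at the basis vectors;
  linearity comes from the coordinates alone. In general the resulting map does not send
  \<open>x\<close> to \<open>y x\<close>, because a dual basis is not a basis.\<close>

lemma dual_basis_hom:
  assumes db: "dual_basis P \<xi>" and P: "right_module sA P" and Y: "right_module sA Y"
    and y: "\<And>x. x \<in> carr P \<Longrightarrow> y x \<in> carr Y"
  shows "rmod_hom P Y (\<lambda>p. \<Sum>x | \<xi> x p \<noteq> 0. ract Y (y x) (\<xi> x p))"
proof -
  define E where "E p = (\<Sum>x | \<xi> x p \<noteq> 0. ract Y (y x) (\<xi> x p))" for p
  have \<xi>: "rmod_hom P regm (\<xi> x)" for x using db unfolding dual_basis_def by blast
  have supp: "finite {x. \<xi> x p \<noteq> 0}" "{x. \<xi> x p \<noteq> 0} \<subseteq> carr P" if "p \<in> carr P" for p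
    using db that unfolding dual_basis_def by blast+
  have ES: "E p = (\<Sum>x\<in>S. ract Y (y x) (\<xi> x p))" if "p \<in> carr P" "finite S" "{x. \<xi> x p \<noteq> 0} \<subseteq> S" "S \<subseteq> carr P" for p S
    unfolding E_def by (rule sum.mono_neutral_left) (use that rm_0_r[OF Y] y in auto)
  note SP = subspD[OF rmD(1,2)[OF P]]
  have "rmod_hom P Y E"
  proof (rule homI)
    show "lin_on (scl P) (carr P) (scl Y) E"
    proof (rule lin_onI)
      fix p q assume p: "p \<in> carr P" and q: "q \<in> carr P"
      let ?S = "{x. \<xi> x p \<noteq> 0} \<union> {x. \<xi> x q \<noteq> 0}"
      have S: "finite ?S" "?S \<subseteq> carr P" using supp p q by auto
      have \<xi>a: "\<xi> x (p + q) = \<xi> x p + \<xi> x q" for x using lin_on_add[OF hom_lin[OF \<xi>] p q] .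
      have "E (p + q) = (\<Sum>x\<in>?S. ract Y (y x) (\<xi> x (p + q)))" by (rule ES[OF SP(2)[OF p q] S(1) _ S(2)]) (auto simp: \<xi>a)
      also have "\<dots> = (\<Sum>x\<in>?S. ract Y (y x) (\<xi> x p) + ract Y (y x) (\<xi> x q))"
        by (rule sum.cong) (use S y rmD(5)[OF Y] in \<open>auto simp: \<xi>a\<close>)
      also have "\<dots> = E p + E q" unfolding sum.distrib
        using ES[OF p S(1) _ S(2)] ES[OF q S(1) _ S(2)] by auto
      finally show "E (p + q) = E p + E q" .
    next
      fix c p assume p: "p \<in> carr P"
      let ?S = "{x. \<xi> x p \<noteq> 0}"
      have \<xi>c: "\<xi> x (scl P c p) = sA c (\<xi> x p)" for x using lin_on_scale[OF hom_lin[OF \<xi>] p] by simp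
      have "E (scl P c p) = (\<Sum>x\<in>?S. ract Y (y x) (\<xi> x (scl P c p)))"
        by (rule ES[OF SP(5)[OF p]]) (use supp[OF p] in \<open>auto simp: \<xi>c module.scale_zero_right[OF vsA[folded module_iff_vector_space]]\<close>)
      also have "\<dots> = (\<Sum>x\<in>?S. scl Y c (ract Y (y x) (\<xi> x p)))"
        by (rule sum.cong) (use supp[OF p] y rmD(8)[OF Y] in \<open>auto simp: \<xi>c\<close>)
      also have "\<dots> = scl Y c (E p)" unfolding E_def
        by (rule module.scale_sum_right[symmetric]) (simp add: module_iff_vector_space rmD(1)[OF Y])
      finally show "E (scl P c p) = scl Y c (E p)" .
    qed
    show "E p \<in> carr Y" if "p \<in> carr P" for p
      unfolding E_def by (rule subspD(6)[OF rmD(1,2)[OF Y]]) (use supp[OF that] y rmD(3)[OF Y] in auto)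
    fix p a assume p: "p \<in> carr P"
    let ?S = "{x. \<xi> x p \<noteq> 0}"
    have \<xi>c: "\<xi> x (ract P p a) = \<xi> x p * a" for x using hom_ract[OF \<xi> p] by simp
    have "E (ract P p a) = (\<Sum>x\<in>?S. ract Y (y x) (\<xi> x (ract P p a)))"
      by (rule ES[OF rmD(3)[OF P p]]) (use supp[OF p] in \<open>auto simp: \<xi>c\<close>)
    also have "\<dots> = (\<Sum>x\<in>?S. ract Y (ract Y (y x) (\<xi> x p)) a)"
      by (rule sum.cong) (use supp[OF p] y rmD(6)[OF Y] in \<open>auto simp: \<xi>c\<close>)
    also have "\<dots> = ract Y (E p) a" unfolding E_def
      by (rule rm_sum[OF Y, symmetric]) (use supp[OF p] y rmD(3)[OF Y] in auto)
    finally show "E (ract P p a) = ract Y (E p) a" .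
  qed
  then show ?thesis unfolding E_def .
qed

lemma hom_dual_basis:
  assumes db: "dual_basis P \<xi>" and P: "right_module sA P" and f: "rmod_hom P Z f" and p: "p \<in> carr P"
  shows "f p = (\<Sum>x | \<xi> x p \<noteq> 0. ract Z (f x) (\<xi> x p))"
proof -
  have supp: "{x. \<xi> x p \<noteq> 0} \<subseteq> carr P" and eq: "p = (\<Sum>x | \<xi> x p \<noteq> 0. ract P x (\<xi> x p))"
    using db p unfolding dual_basis_def by blast+
  have "f p = f (\<Sum>x | \<xi> x p \<noteq> 0. ract P x (\<xi> x p))" using eq by simp
  also have "\<dots> = (\<Sum>x | \<xi> x p \<noteq> 0. f (ract P x (\<xi> x p)))"
    by (rule lin_on_sum[OF rmD(1,2)[OF P] hom_lin[OF f]]) (use supp rmD(3)[OF P] in auto)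
  also have "\<dots> = (\<Sum>x | \<xi> x p \<noteq> 0. ract Z (f x) (\<xi> x p))"
    by (rule sum.cong) (use supp hom_ract[OF f] in auto)
  finally show ?thesis .
qed

text \<open>A lifting property modulo a finitely generated part: the decomposition of
  \<open>f x\<close> is chosen pointwise, with no linearity, and \<open>dual_basis_hom\<close> makes
  both the coefficients and the lift \<open>A\<close>-linear. It is the source of every finite type
  map and of every homotopy below.\<close>

lemma projective_split:
  fixes r :: nat
  assumes pr: "projective sA P" and Y: "right_module sA Y" and Z: "right_module sA Z"
    and f: "rmod_hom P Z f" and g: "rmod_hom Y Z g" and t: "\<And>k. k < r \<Longrightarrow> t k \<in> carr Z"
    and ex: "\<And>x. x \<in> carr P \<Longrightarrow> \<exists>c y. y \<in> carr Y \<and> f x = (\<Sum>k<r. ract Z (t k) (c k)) + g y"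
  obtains \<xi> h where "\<And>k. rmod_hom P regm (\<xi> k)" "rmod_hom P Y h"
    "\<And>p. p \<in> carr P \<Longrightarrow> f p = (\<Sum>k<r. ract Z (t k) (\<xi> k p)) + g (h p)"
proof -
  note P = projective_module[OF pr]
  obtain \<xi> where db: "dual_basis P \<xi>" using projective_dual_basis[OF pr] by blast
  have "\<forall>x. \<exists>c y. x \<in> carr P \<longrightarrow> y \<in> carr Y \<and> f x = (\<Sum>k<r. ract Z (t k) (c k)) + g y" using ex by blast
  then obtain c y where cy: "\<forall>x. x \<in> carr P \<longrightarrow> y x \<in> carr Y \<and> f x = (\<Sum>k<r. ract Z (t k) (c x k)) + g (y x)"
    by (subst (asm) choice_iff, subst (asm) choice_iff) (elim exE, rule that, assumption)
  have yY: "y x \<in> carr Y" and fx: "f x = (\<Sum>k<r. ract Z (t k) (c x k)) + g (y x)" if "x \<in> carr P" for x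
    using cy that by blast+
  define \<xi>' where "\<xi>' k p = (\<Sum>x | \<xi> x p \<noteq> 0. ract regm (c x k) (\<xi> x p))" for k p
  define h where "h p = (\<Sum>x | \<xi> x p \<noteq> 0. ract Y (y x) (\<xi> x p))" for p
  have 1: "rmod_hom P regm (\<xi>' k)" for k unfolding \<xi>'_def by (rule dual_basis_hom[OF db P regm_module]) simp
  have 2: "rmod_hom P Y h" unfolding h_def by (rule dual_basis_hom[OF db P Y yY])
  have 3: "f p = (\<Sum>k<r. ract Z (t k) (\<xi>' k p)) + g (h p)" if p: "p \<in> carr P" for p
  proof -
    have supp: "{x. \<xi> x p \<noteq> 0} \<subseteq> carr P" using db p unfolding dual_basis_def by blast
    have rt: "ract Z (t k) a \<in> carr Z" if "k < r" for k a using t[OF that] rmD(3)[OF Z] by blast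
    have "f p = (\<Sum>x | \<xi> x p \<noteq> 0. ract Z (f x) (\<xi> x p))" by (rule hom_dual_basis[OF db P f p])
    also have "\<dots> = (\<Sum>x | \<xi> x p \<noteq> 0. (\<Sum>k<r. ract Z (t k) (c x k * \<xi> x p)) + g (ract Y (y x) (\<xi> x p)))"
    proof (rule sum.cong[OF refl])
      fix x assume "x \<in> {x. \<xi> x p \<noteq> 0}"
      then have x: "x \<in> carr P" using supp by blast
      have "ract Z (f x) (\<xi> x p) = ract Z (\<Sum>k<r. ract Z (t k) (c x k)) (\<xi> x p) + ract Z (g (y x)) (\<xi> x p)"
        unfolding fx[OF x] by (rule rmD(4)[OF Z])
          (use rt hom_in[OF g yY[OF x]] in \<open>auto intro!: subspD(6)[OF rmD(1,2)[OF Z]]\<close>)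
      also have "ract Z (\<Sum>k<r. ract Z (t k) (c x k)) (\<xi> x p) = (\<Sum>k<r. ract Z (t k) (c x k * \<xi> x p))"
        by (subst rm_sum[OF Z]) (use rt t rmD(6)[OF Z] in auto)
      also have "ract Z (g (y x)) (\<xi> x p) = g (ract Y (y x) (\<xi> x p))" using hom_ract[OF g yY[OF x]] by simp
      finally show "ract Z (f x) (\<xi> x p) = (\<Sum>k<r. ract Z (t k) (c x k * \<xi> x p)) + g (ract Y (y x) (\<xi> x p))" .
    qed
    also have "\<dots> = (\<Sum>k<r. \<Sum>x | \<xi> x p \<noteq> 0. ract Z (t k) (c x k * \<xi> x p))
        + (\<Sum>x | \<xi> x p \<noteq> 0. g (ract Y (y x) (\<xi> x p)))"
      unfolding sum.distrib by (simp add: sum.swap[of _ "{x. \<xi> x p \<noteq> 0}"])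
    also have "(\<Sum>x | \<xi> x p \<noteq> 0. g (ract Y (y x) (\<xi> x p))) = g (h p)"
      unfolding h_def by (rule lin_on_sum[OF rmD(1,2)[OF Y] hom_lin[OF g], symmetric]) (use supp yY rmD(3)[OF Y] in auto)
    also have "(\<Sum>k<r. \<Sum>x | \<xi> x p \<noteq> 0. ract Z (t k) (c x k * \<xi> x p)) = (\<Sum>k<r. ract Z (t k) (\<xi>' k p))"
      unfolding \<xi>'_def using t by (simp add: rm_sum_r[OF Z])
    finally show ?thesis .
  qed
  show thesis by (rule that[OF 1 2 3])
qed

text \<open>The ordinary lifting property, obtained as the case of no generators
  \<open>t\<close>.\<close>

lemma projective_lift:
  assumes "projective sA P" "right_module sA Y" "right_module sA Z"
    "rmod_hom P Z f" "rmod_hom Y Z g" "\<And>x. x \<in> carr P \<Longrightarrow> f x \<in> g ` carr Y"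
  obtains h where "rmod_hom P Y h" "\<And>p. p \<in> carr P \<Longrightarrow> g (h p) = f p"
proof -
  have ex: "\<exists>c y. y \<in> carr Y \<and> f x = (\<Sum>k<(0::nat). ract Z 0 (c k)) + g y" if x: "x \<in> carr P" for x
  proof -
    obtain y where "y \<in> carr Y" "f x = g y" using assms(6)[OF x] by blast
    then show ?thesis by (intro exI[of _ "\<lambda>_. 0"] exI[of _ y]) simp
  qed
  show thesis
  proof (rule projective_split[OF assms(1-5), of "0::nat" "\<lambda>_. 0"])
    fix \<xi> h assume "rmod_hom P Y h" "\<And>p. p \<in> carr P \<Longrightarrow> f p = (\<Sum>k<0::nat. ract Z 0 (\<xi> k p)) + g (h p)"
    then show thesis by (intro that[of h]) simp_all
  qed (use ex in simp_all)
qed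

text \<open>The maps that factor through a finite free module, that is, the image of
  \<open>Y \<otimes> Hom(X, A)\<close> in \<open>Hom(X, Y)\<close>. For such a map the
  Hattori--Stallings trace makes sense.\<close>

definition ftype :: "('k, 'a, 'x::ab_group_add, 'z) rmod_scheme \<Rightarrow> ('k, 'a, 'y::ab_group_add, 'w) rmod_scheme \<Rightarrow> ('x \<Rightarrow> 'y) \<Rightarrow> bool" where
  "ftype X Y f \<longleftrightarrow> (\<exists>(r::nat) t \<xi>. (\<forall>k<r. t k \<in> carr Y) \<and> (\<forall>k<r. rmod_hom X regm (\<xi> k)) \<and>
     (\<forall>x\<in>carr X. f x = (\<Sum>k<r. ract Y (t k) (\<xi> k x))))"

lemma ftypeI:
  fixes r :: nat
  assumes "\<And>k. k < r \<Longrightarrow> t k \<in> carr Y" "\<And>k. k < r \<Longrightarrow> rmod_hom X regm (\<xi> k)"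
    "\<And>x. x \<in> carr X \<Longrightarrow> f x = (\<Sum>k<r. ract Y (t k) (\<xi> k x))"
  shows "ftype X Y f"
  unfolding ftype_def using assms by (intro exI[of _ r] exI[of _ t] exI[of _ \<xi>]) blast

lemma ftype_comp:
  assumes f: "ftype X Y f" and Y: "right_module sA Y" and a: "rmod_hom X' X a" and b: "rmod_hom Y Y' b"
  shows "ftype X' Y' (\<lambda>x. b (f (a x)))"
proof -
  from f obtain r :: nat and t \<xi> where "(\<forall>k<r. t k \<in> carr Y) \<and> (\<forall>k<r. rmod_hom X regm (\<xi> k)) \<and>
     (\<forall>x\<in>carr X. f x = (\<Sum>k<r. ract Y (t k) (\<xi> k x)))"
    unfolding ftype_def by (elim exE)
  then have t: "\<And>k. k < r \<Longrightarrow> t k \<in> carr Y" "\<And>k. k < r \<Longrightarrow> rmod_hom X regm (\<xi> k)"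
    "\<And>x. x \<in> carr X \<Longrightarrow> f x = (\<Sum>k<r. ract Y (t k) (\<xi> k x))" by simp_all
  show ?thesis
  proof (rule ftypeI[of r "\<lambda>k. b (t k)" _ _ "\<lambda>k x. \<xi> k (a x)"])
    fix x assume "x \<in> carr X'"
    then have "b (f (a x)) = b (\<Sum>k<r. ract Y (t k) (\<xi> k (a x)))" using t(3) hom_in[OF a] by simp
    also have "\<dots> = (\<Sum>k<r. b (ract Y (t k) (\<xi> k (a x))))"
      by (rule lin_on_sum[OF rmD(1,2)[OF Y] hom_lin[OF b]]) (use t rmD(3)[OF Y] in auto)
    also have "\<dots> = (\<Sum>k<r. ract Y' (b (t k)) (\<xi> k (a x)))"
      by (rule sum.cong) (use t hom_ract[OF b] in auto)
    finally show "b (f (a x)) = (\<Sum>k<r. ract Y' (b (t k)) (\<xi> k (a x)))" .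
  qed (use t hom_in[OF b] hom_comp[OF a t(2)] in auto)
qed

lemma ftype_fdim:
  assumes f: "ftype X Y f" and Y: "right_module sA Y"
  shows "\<exists>U. fdim (scl Y) U \<and> f ` carr X \<subseteq> U \<and> U \<subseteq> carr Y"
proof -
  from f obtain r :: nat and t \<xi> where "(\<forall>k<r. t k \<in> carr Y) \<and> (\<forall>k<r. rmod_hom X regm (\<xi> k)) \<and>
     (\<forall>x\<in>carr X. f x = (\<Sum>k<r. ract Y (t k) (\<xi> k x)))"
    unfolding ftype_def by (elim exE)
  then have t: "\<And>k. k < r \<Longrightarrow> t k \<in> carr Y" "\<And>k. k < r \<Longrightarrow> rmod_hom X regm (\<xi> k)"
    "\<And>x. x \<in> carr X \<Longrightarrow> f x = (\<Sum>k<r. ract Y (t k) (\<xi> k x))" by simp_all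
  have "\<exists>U. fdim (scl Y) U \<and> (\<forall>k\<in>{..<r}. range (ract Y (t k)) \<subseteq> U) \<and> U \<subseteq> carr Y"
    by (rule fdim_sums_finite[OF rmD(1)[OF Y] _ _ rmD(2)[OF Y]])
      (use t rmD(3)[OF Y] fdim_image[OF vsA rmD(1)[OF Y] fdim_UNIV rm_lin_r[OF Y]] in auto)
  then obtain U where U: "fdim (scl Y) U" "\<forall>k\<in>{..<r}. range (ract Y (t k)) \<subseteq> U" "U \<subseteq> carr Y" by (elim exE conjE)
  have "f x \<in> U" if "x \<in> carr X" for x
    unfolding t(3)[OF that] by (rule subspD(6)[OF rmD(1)[OF Y] fdim_subsp[OF rmD(1)[OF Y] U(1)]]) (use U in auto)
  then show ?thesis using U by blast
qed

text \<open>A \<open>k\<close>-basis generates the module. Splitting the identity with respect to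
  this basis and with the zero map as second part gives the finite dual basis.\<close>

lemma fd_projective_ftype:
  assumes P: "projective sA R" and f: "fin_dim R"
  shows "ftype R R (\<lambda>x. x)"
proof -
  note R = projective_module[OF P]
  interpret vector_space "scl R" by (rule rmD(1)[OF R])
  have "fdim (scl R) (carr R)" using f fin_dim_fdim[OF rmD(1)[OF R]] by blast
  then obtain B where B: "finite B" "independent B" "span B = carr R" by (rule fdim_basis[OF rmD(1)[OF R]])
  obtain t where t0: "bij_betw t {0..<card B} B" using ex_bij_betw_nat_finite[OF B(1)] by blast
  define r where "r = card B"
  have t: "bij_betw t {..<r} B" using t0 unfolding r_def atLeast0LessThan .
  have BR: "B \<subseteq> carr R" using span_superset[of B] B(3) by simp
  have tR: "t k \<in> carr R" if "k < r" for k
    using bij_betwE[OF t] that BR by auto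
  have "\<exists>c y. y \<in> carr R \<and> x = (\<Sum>k<r. ract R (t k) (c k)) + 0" if "x \<in> carr R" for x
  proof -
    have "x = (\<Sum>b\<in>B. scl R (representation B x b) b)"
      using sum_representation_eq[OF B(2) _ B(1)] B(3) that by auto
    also have "\<dots> = (\<Sum>k<r. scl R (representation B x (t k)) (t k))"
      by (rule sum.reindex_bij_betw[OF t, symmetric])
    also have "\<dots> = (\<Sum>k<r. ract R (t k) (sA (representation B x (t k)) 1))"
      by (rule sum.cong) (use tR rmD(7,8)[OF R] in auto)
    finally show ?thesis using that by auto
  qed
  note ex = this
  show ?thesis
  proof (rule projective_split[OF P R R hom_id hom_zero[OF R R], of r t])
    fix \<xi> h assume "\<And>k. rmod_hom R regm (\<xi> k)"
      "\<And>p. p \<in> carr R \<Longrightarrow> p = (\<Sum>k<r. ract R (t k) (\<xi> k p)) + 0"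
    then show ?thesis by (intro ftypeI[of r t _ _ \<xi>]) (simp_all add: tR)
  qed (use tR ex in simp_all)
qed

end

section \<open>Invertibility of the Cartan matrix\<close>

lemma dm_zero: "vector_space s \<Longrightarrow> dm s {0} = 0"
proof -
  assume "vector_space s"
  then interpret vector_space s .
  show ?thesis using dim_span_eq_card_independent[OF independent_empty] by simp
qed

context fd_alg
begin

text \<open>Finite global dimension speaks only of modules carried by
  \<open>nat \<Rightarrow> 'k\<close>. The coordinates with respect to a basis copy any finite
  dimensional module to that type.\<close>

lemma fin_dim_transport:
  fixes X :: "('k, 'a, 'x::ab_group_add, 'z) rmod_scheme"
  assumes X: "right_module sA X" and f: "fin_dim X"
  obtains M :: "('k, 'a, nat \<Rightarrow> 'k) rmod" and \<iota>
  where "right_module sA M \<and> fin_dim M \<and> rmod_hom M X \<iota> \<and> inj_on \<iota> (carr M) \<and> \<iota> ` carr M = carr X"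
proof -
  interpret vector_space "scl X" by (rule rmD(1)[OF X])
  note S = subspD[OF rmD(1,2)[OF X]]
  have fX: "fdim (scl X) (carr X)" using f fin_dim_fdim[OF rmD(1)[OF X]] by simp
  obtain B where B: "finite B" "independent B" "span B = carr X" by (rule fdim_basis[OF rmD(1)[OF X] fX])
  define N where "N = card B"
  obtain b where "bij_betw b {0..<card B} B" using ex_bij_betw_nat_finite[OF B(1)] by blast
  then have b: "bij_betw b {..<N} B" unfolding N_def atLeast0LessThan .
  have bB: "b j \<in> B" if "j < N" for j using bij_betwE[OF b] that by simp
  have bX: "b j \<in> carr X" if "j < N" for j using bB[OF that] span_superset[of B] B(3) by blast
  define co where "co x j = (if j < N then representation B x (b j) else 0)" for x and j :: nat
  define \<iota> where "\<iota> v = (\<Sum>j<N. scl X (v j) (b j))" for v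
  define C where "C = {v :: nat \<Rightarrow> 'k. \<forall>j\<ge>N. v j = 0}"
  define sc where "sc c v j = (c :: 'k) * v j" for c v and j :: nat
  have \<iota>X: "\<iota> v \<in> carr X" for v unfolding \<iota>_def by (rule S(6)) (use S(5) bX in auto)
  have \<iota>add: "\<iota> (u + v) = \<iota> u + \<iota> v" for u v unfolding \<iota>_def by (simp add: scale_left_distrib sum.distrib)
  have \<iota>sc: "\<iota> (sc c v) = scl X c (\<iota> v)" for c v unfolding \<iota>_def sc_def by (simp add: scale_sum_right)
  have \<iota>co: "\<iota> (co x) = x" if "x \<in> carr X" for x
  proof -
    have "\<iota> (co x) = (\<Sum>j<N. scl X (representation B x (b j)) (b j))" unfolding \<iota>_def co_def by simp
    also have "\<dots> = (\<Sum>c\<in>B. scl X (representation B x c) c)" by (rule sum.reindex_bij_betw[OF b])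
    also have "\<dots> = x" using sum_representation_eq[OF B(2) _ B(1)] B(3) that by simp
    finally show ?thesis .
  qed
  have coC: "co x \<in> C" for x unfolding co_def C_def by simp
  have inj: "u = v" if "u \<in> C" "v \<in> C" "\<iota> u = \<iota> v" for u v
  proof
    fix j
    show "u j = v j"
    proof (cases "j < N")
      case True
      have rep: "representation B (\<iota> w) (b j) = w j" for w
      proof -
        have "representation B (\<iota> w) (b j) = (\<Sum>i<N. representation B (scl X (w i) (b i)) (b j))"
          unfolding \<iota>_def by (subst representation_sum[OF B(2)]) (use S(5) bX B(3) in auto)
        also have "\<dots> = (\<Sum>i<N. if i = j then w i else 0)"
        proof (rule sum.cong[OF refl])
          fix i assume i: "i \<in> {..<N}"
          have "(b i = b j) = (i = j)" using b i True by (auto simp: bij_betw_def inj_on_def)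
          then show "representation B (scl X (w i) (b i)) (b j) = (if i = j then w i else 0)"
            using representation_scale[OF B(2), of "b i"] representation_basis[OF B(2) bB] i bX B(3) by auto
        qed
        also have "\<dots> = w j" using True by simp
        finally show ?thesis .
      qed
      show ?thesis using rep[of u] rep[of v] that(3) by simp
    next
      case False
      then show ?thesis using that unfolding C_def by simp
    qed
  qed
  define M :: "('k, 'a, nat \<Rightarrow> 'k) rmod" where
    "M = \<lparr>carr = C, scl = sc, ract = (\<lambda>v a. co (ract X (\<iota> v) a))\<rparr>"
  have \<iota>r: "\<iota> (ract M v a) = ract X (\<iota> v) a" for v a
    unfolding M_def by (simp add: \<iota>co rmD(3)[OF X \<iota>X])
  have vs: "vector_space sc"
    by unfold_locales (simp_all add: sc_def fun_eq_iff algebra_simps)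
  have sub: "subsp sc C"
    by (rule subspI[OF vs]) (simp_all add: C_def sc_def)
  note SC = subspD[OF vs sub]
  have rC: "ract M v a \<in> C" for v a unfolding M_def by (simp add: coC)
  have M: "right_module sA M"
    unfolding right_module_def
  proof (intro conjI ballI allI)
    show "vector_space (scl M)" "subsp (scl M) (carr M)" using vs sub by (simp_all add: M_def)
    show "ract M x r \<in> carr M" for x r using rC by (simp add: M_def)
    show "ract M (x + y) r = ract M x r + ract M y r" for x y r
      by (rule inj) (use rC SC in \<open>simp_all add: \<iota>r \<iota>add rmD(4)[OF X \<iota>X \<iota>X]\<close>)
    show "ract M x (r + r') = ract M x r + ract M x r'" for x r r'
      by (rule inj) (use rC SC in \<open>simp_all add: \<iota>r \<iota>add rmD(5)[OF X \<iota>X]\<close>)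
    show "ract M x (r * r') = ract M (ract M x r) r'" for x r r'
      by (rule inj) (use rC SC in \<open>simp_all add: \<iota>r rmD(6)[OF X \<iota>X]\<close>)
    show "ract M x 1 = x" if "x \<in> carr M" for x
      by (rule inj) (use rC SC that in \<open>simp_all add: \<iota>r rmD(7)[OF X \<iota>X], simp add: M_def\<close>)
    show "ract M x (sA c r) = scl M c (ract M x r)" for x c r
    proof -
      have "scl M = sc" by (simp add: M_def)
      then show ?thesis by (intro inj) (use rC SC in \<open>simp_all add: \<iota>r \<iota>sc rmD(8)[OF X \<iota>X]\<close>)
    qed
  qed
  have hom: "rmod_hom M X \<iota>"
    unfolding rmod_hom_def using \<iota>X \<iota>r \<iota>add \<iota>sc by (simp add: M_def)
  have injM: "inj_on \<iota> (carr M)" by (rule inj_onI) (use inj in \<open>simp add: M_def\<close>)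
  have im: "\<iota> ` carr M = carr X"
  proof
    show "\<iota> ` carr M \<subseteq> carr X" using \<iota>X by blast
    show "carr X \<subseteq> \<iota> ` carr M"
    proof
      fix x assume "x \<in> carr X"
      then have "x = \<iota> (co x)" by (simp add: \<iota>co)
      then show "x \<in> \<iota> ` carr M" using coC by (simp add: M_def)
    qed
  qed
  have "carr M = co ` carr X"
  proof
    show "co ` carr X \<subseteq> carr M" using coC by (auto simp: M_def)
    show "carr M \<subseteq> co ` carr X"
    proof
      fix v assume v: "v \<in> carr M"
      have "co (\<iota> v) = v" by (rule inj) (use v coC \<iota>co \<iota>X in \<open>simp_all add: M_def\<close>)
      then show "v \<in> co ` carr X" using \<iota>X[of v] by (metis image_eqI)
    qed
  qed
  moreover have "lin_on (scl X) (carr X) sc co"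
    by (rule lin_onI) (rule inj, simp_all add: coC SC \<iota>co \<iota>add \<iota>sc S)+
  ultimately have "fdim sc (carr M)" using fdim_image[OF rmD(1)[OF X] vs fX] by simp
  then have "fin_dim M" using fin_dim_fdim[OF rmD(1)[OF M]] by (simp add: M_def)
  then show thesis using that[of M \<iota>] M hom injM im by simp
qed

text \<open>The clauses of \<open>proj_dim_le\<close>, with a resolved module of arbitrary type;
  only the terms \<open>R i\<close> stay in the type \<open>nat \<Rightarrow> 'k\<close>.\<close>

definition resolution ::
  "nat \<Rightarrow> (nat \<Rightarrow> ('k, 'a, nat \<Rightarrow> 'k) rmod) \<Rightarrow> (nat \<Rightarrow> (nat \<Rightarrow> 'k) \<Rightarrow> (nat \<Rightarrow> 'k))
    \<Rightarrow> ((nat \<Rightarrow> 'k) \<Rightarrow> 'x) \<Rightarrow> ('k, 'a, 'x::ab_group_add, 'z) rmod_scheme \<Rightarrow> bool"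
where
  "resolution d R \<delta> \<epsilon> X \<longleftrightarrow>
      (\<forall>i. projective sA (R i) \<and> fin_dim (R i))
    \<and> (\<forall>i>d. carr (R i) = {0})
    \<and> rmod_hom (R 0) X \<epsilon> \<and> (\<forall>i. rmod_hom (R (Suc i)) (R i) (\<delta> i))
    \<and> \<epsilon> ` carr (R 0) = carr X
    \<and> {x \<in> carr (R 0). \<epsilon> x = 0} = \<delta> 0 ` carr (R (Suc 0))
    \<and> (\<forall>i. {x \<in> carr (R (Suc i)). \<delta> i x = 0} = \<delta> (Suc i) ` carr (R (Suc (Suc i))))"

lemma resolution_exists:
  fixes X :: "('k, 'a, 'x::ab_group_add, 'z) rmod_scheme"
  assumes g: "finite_global_dimension sA" and X: "right_module sA X" "fin_dim X"
  obtains d R \<delta> \<epsilon> where "resolution d R \<delta> \<epsilon> X"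
proof -
  obtain M :: "('k, 'a, nat \<Rightarrow> 'k) rmod" and \<iota> where
    M: "right_module sA M \<and> fin_dim M \<and> rmod_hom M X \<iota> \<and> inj_on \<iota> (carr M) \<and> \<iota> ` carr M = carr X"
    by (rule fin_dim_transport[OF X])
  from g obtain d where "\<forall>M :: ('k, 'a, nat \<Rightarrow> 'k) rmod. right_module sA M \<and> fin_dim M \<longrightarrow> proj_dim_le sA d M"
    unfolding finite_global_dimension_def by (elim exE)
  then have "proj_dim_le sA d M" using M by simp
  then obtain R \<delta> \<epsilon> where R: "resolution d R \<delta> \<epsilon> M" unfolding proj_dim_le_def resolution_def by (elim exE)
  have \<epsilon>: "rmod_hom (R 0) M \<epsilon>" using R unfolding resolution_def by simp
  have \<iota>: "rmod_hom M X \<iota>" using M by simp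
  have "\<iota> 0 = 0" using M lin_on_0[OF rmD(1,2) hom_lin[OF \<iota>]] by blast
  then have k: "{x \<in> carr (R 0). \<iota> (\<epsilon> x) = 0} = {x \<in> carr (R 0). \<epsilon> x = 0}"
  proof -
    have z: "0 \<in> carr M" using M subspD(1)[OF rmD(1,2)] by blast
    have "\<iota> (\<epsilon> x) = 0 \<longleftrightarrow> \<epsilon> x = 0" if "x \<in> carr (R 0)" for x
      using M hom_in[OF \<epsilon> that] z \<open>\<iota> 0 = 0\<close> unfolding inj_on_def by metis
    then show ?thesis by blast
  qed
  have im: "(\<lambda>x. \<iota> (\<epsilon> x)) ` carr (R 0) = carr X"
  proof -
    have "\<epsilon> ` carr (R 0) = carr M" using R unfolding resolution_def by simp
    then show ?thesis using M by (simp flip: image_image)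
  qed
  have "resolution d R \<delta> (\<lambda>x. \<iota> (\<epsilon> x)) X"
    using R unfolding resolution_def k im by (simp add: hom_comp[OF \<epsilon> \<iota>])
  then show thesis by (rule that)
qed

end

section \<open>Decomposing projectives into the modules \<open>e w A\<close>\<close>

context basic_alg
begin

text \<open>Nakayama's lemma in elementwise form, by induction on the number of generators:
  \<open>t r (1 - j r)\<close> is a combination of the other generators, and \<open>1 - j r\<close>
  has a right inverse, so \<open>t r\<close> can be eliminated.\<close>

lemma nakayama:
  fixes r :: nat
  assumes X: "right_module sA X" and t: "\<And>k. k < r \<Longrightarrow> t k \<in> carr X"
    and ex: "\<And>x. x \<in> carr X \<Longrightarrow> \<exists>c. (\<forall>k<r. c k \<in> J) \<and> x = (\<Sum>k<r. ract X (t k) (c k))"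
  shows "carr X = {0}"
  using t ex
proof (induction r)
  case 0
  then show ?case using subspD(1)[OF rmD(1,2)[OF X]] by fastforce
next
  case (Suc r)
  have tr: "t r \<in> carr X" using Suc.prems(1) by simp
  have tk: "t k \<in> carr X" if "k < r" for k using Suc.prems(1) that by simp
  obtain j where j: "\<forall>k<Suc r. j k \<in> J" "t r = (\<Sum>k<Suc r. ract X (t k) (j k))"
    using Suc.prems(2)[OF tr] by blast
  have jr: "j r \<in> J" using j(1) by simp
  obtain u where u: "(1 - j r) * u = 1" by (rule radical_right_inverse[OF jr])
  have split: "t r = (\<Sum>k<r. ract X (t k) (j k)) + ract X (t r) (j r)" using j(2) by simp
  have "ract X (t r) 1 = ract X (t r) (1 - j r + j r)" by simp
  also have "\<dots> = ract X (t r) (1 - j r) + ract X (t r) (j r)" by (rule rmD(5)[OF X tr])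
  finally have "t r = ract X (t r) (1 - j r) + ract X (t r) (j r)" unfolding rmD(7)[OF X tr] .
  then have "ract X (t r) (1 - j r) = t r - ract X (t r) (j r)" by (metis add_diff_cancel_right')
  also have "\<dots> = (\<Sum>k<r. ract X (t k) (j k))" using split by (metis add_diff_cancel_right')
  finally have 1: "ract X (t r) (1 - j r) = (\<Sum>k<r. ract X (t k) (j k))" .
  have "t r = ract X (ract X (t r) (1 - j r)) u"
    using rmD(6)[OF X tr, of "1 - j r" u] u rmD(7)[OF X tr] by simp
  also have "\<dots> = (\<Sum>k<r. ract X (ract X (t k) (j k)) u)"
    unfolding 1 by (rule rm_sum[OF X]) (use tk rmD(3)[OF X] in auto)
  also have "\<dots> = (\<Sum>k<r. ract X (t k) (j k * u))"
    by (rule sum.cong) (use tk rmD(6)[OF X] in auto)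
  finally have 2: "t r = (\<Sum>k<r. ract X (t k) (j k * u))" .
  show ?case
  proof (rule Suc.IH)
    fix x assume "x \<in> carr X"
    from Suc.prems(2)[OF this] obtain c where c: "\<forall>k<Suc r. c k \<in> J" "x = (\<Sum>k<Suc r. ract X (t k) (c k))" by blast
    have "x = (\<Sum>k<r. ract X (t k) (c k)) + ract X (t r) (c r)" using c(2) by simp
    also have "ract X (t r) (c r) = (\<Sum>k<r. ract X (ract X (t k) (j k * u)) (c r))"
      by (subst 2, rule rm_sum[OF X]) (use tk rmD(3)[OF X] in auto)
    also have "\<dots> = (\<Sum>k<r. ract X (t k) (j k * u * c r))"
      by (rule sum.cong) (use tk rmD(6)[OF X] in auto)
    also have "(\<Sum>k<r. ract X (t k) (c k)) + \<dots> = (\<Sum>k<r. ract X (t k) (c k + j k * u * c r))"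
      unfolding sum.distrib[symmetric] by (rule sum.cong) (use tk rmD(5)[OF X] in auto)
    finally have "x = (\<Sum>k<r. ract X (t k) (c k + j k * u * c r))" .
    moreover have "\<forall>k<r. c k + j k * u * c r \<in> J" using c(1) j(1) J_ideal by simp
    ultimately show "\<exists>c. (\<forall>k<r. c k \<in> J) \<and> x = (\<Sum>k<r. ract X (t k) (c k))"
      by (intro exI[of _ "\<lambda>k. c k + j k * u * c r"] conjI)
  qed (use tk in simp)
qed

text \<open>The corner ring at \<open>e w\<close> is local. With \<open>c\<close> the residue of
  \<open>a\<close>, the difference \<open>a - c e w\<close> lies in the radical, and
  \<open>1 + j / c\<close> has a right inverse.\<close>

lemma local_inverse:
  assumes w: "w < n" and c: "\<chi> w a \<noteq> 0" and a: "e w * a * e w = a"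
  obtains b where "a * b = e w"
proof -
  define c where "c = \<chi> w a"
  define j where "j = a - sA c (e w)"
  interpret A: vector_space sA by (rule vsA)
  have "\<chi> v j = 0" if v: "v < n" for v
  proof (cases "v = w")
    case True
    then show ?thesis using v by (simp add: j_def c_def chi_diff chi_scale chi_e)
  next
    case False
    have "\<chi> v a = \<chi> v (e w * a * e w)" using a by simp
    also have "\<dots> = 0" using False v w by (simp add: chi_mult chi_e)
    finally show ?thesis using False v w by (simp add: j_def chi_diff chi_scale chi_e)
  qed
  then have j: "j \<in> J" unfolding rad by blast
  have "\<chi> v (- sA (inverse c) j) = 0" if "v < n" for v
    using j that unfolding rad by (simp add: chi_neg chi_scale)
  then have "- sA (inverse c) j \<in> J" unfolding rad by blast
  then obtain y where y: "(1 - - sA (inverse c) j) * y = 1" by (rule radical_right_inverse)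
  have ea: "e w * a = a"
  proof -
    have "e w * a = e w * (e w * a * e w)" using a by simp
    also have "\<dots> = e w * e w * a * e w" by (simp add: mult.assoc)
    finally show ?thesis using a e_idem[OF w] by simp
  qed
  have ej: "e w * j = j" unfolding j_def by (simp add: right_diff_distrib scale_mult ea e_idem[OF w])
  have "e w = e w * ((1 + sA (inverse c) j) * y)" using y by simp
  also have "\<dots> = (e w + sA (inverse c) j) * y"
    by (simp add: mult.assoc[symmetric] distrib_left scale_mult ej)
  also have "e w + sA (inverse c) j = sA (inverse c) a"
    unfolding j_def using c by (simp add: A.scale_right_diff_distrib c_def)
  finally have "a * sA (inverse c) y = e w" by (simp add: scale_mult)
  then show thesis by (rule that)
qed

text \<open>By Nakayama some coordinate functional takes a value outside the radical. Multiplied by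
  \<open>e w\<close> and with its argument corrected by a local inverse, it becomes a split
  surjection of \<open>R\<close> onto \<open>e w A\<close>, with \<open>q\<close> the image of
  \<open>e w\<close> under a section.\<close>

lemma split_off:
  assumes R: "right_module sA R" and f: "ftype R R (\<lambda>x. x)" and ne: "carr R \<noteq> {0}"
  obtains w q \<zeta> where "w < n" "q \<in> carr R" "rmod_hom R regm \<zeta>" "\<zeta> q = e w" "\<And>x. e w * \<zeta> x = \<zeta> x"
proof -
  from f obtain r :: nat and t \<xi> where t: "(\<forall>k<r. t k \<in> carr R) \<and> (\<forall>k<r. rmod_hom R regm (\<xi> k)) \<and>
     (\<forall>x\<in>carr R. x = (\<Sum>k<r. ract R (t k) (\<xi> k x)))"
    unfolding ftype_def by (elim exE)
  have "\<exists>k<r. \<exists>x\<in>carr R. \<xi> k x \<notin> J"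
  proof (rule ccontr)
    assume no: "\<not> ?thesis"
    have "carr R = {0}"
    proof (rule nakayama[OF R, of r t])
      show "t k \<in> carr R" if "k < r" for k using t that by simp
      fix x assume x: "x \<in> carr R"
      show "\<exists>c. (\<forall>k<r. c k \<in> J) \<and> x = (\<Sum>k<r. ract R (t k) (c k))"
        by (rule exI[of _ "\<lambda>k. \<xi> k x"]) (use t x no in blast)
    qed
    then show False using ne by simp
  qed
  then obtain k x where k: "k < r" "x \<in> carr R" "\<xi> k x \<notin> J" by blast
  then obtain w where w: "w < n" "\<chi> w (\<xi> k x) \<noteq> 0" unfolding rad by blast
  have \<xi>: "rmod_hom R regm (\<xi> k)" using t k by simp
  define a where "a = e w * \<xi> k x * e w"
  have ww: "e w * e w = e w" by (rule e_idem[OF w(1)])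
  have wwu: "e w * (e w * u) = e w * u" for u using ww by (simp add: mult.assoc[symmetric])
  have "e w * a * e w = a" unfolding a_def by (simp add: mult.assoc ww wwu)
  moreover have "\<chi> w a \<noteq> 0" unfolding a_def using w by (simp add: chi_mult chi_e)
  ultimately obtain b where b: "a * b = e w" using local_inverse[OF w(1)] by blast
  \<comment> \<open>Chosen so that the new functional takes the value \<open>a * b * e w\<close> at
    \<open>q\<close>, which equals \<open>e w\<close>.\<close>
  define q where "q = ract R x (e w * (b * e w))"
  have q: "q \<in> carr R" unfolding q_def by (rule rmD(3)[OF R k(2)])
  have hom: "rmod_hom R regm (\<lambda>z. e w * \<xi> k z)"
    using \<xi> unfolding rmod_hom_def by (simp add: distrib_left scale_mult mult.assoc)
  have "e w * \<xi> k q = a * b * e w" unfolding q_def a_def using hom_ract[OF \<xi> k(2)] by (simp add: mult.assoc)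
  also have "\<dots> = e w" unfolding b by (rule ww)
  finally have "e w * \<xi> k q = e w" .
  then show thesis by (rule that[OF w(1) q hom]) (rule wwu)
qed

text \<open>Column \<open>w\<close> is the dimension vector of the indecomposable projective
  \<open>e w A\<close>; the indices agree with those of \<open>cartan_matrix\<close>.\<close>

definition cart :: "nat \<Rightarrow> nat \<Rightarrow> int" where
  "cart v w = int (dm sA (range (\<lambda>x. e w * x * e v)))"

text \<open>The subset \<open>U\<close> is separate from the record \<open>X\<close>, so that
  kernels and images have dimension vectors without forming new module records.\<close>

definition dim_vector :: "('k, 'a, 'x::ab_group_add, 'z) rmod_scheme \<Rightarrow> 'x set \<Rightarrow> nat \<Rightarrow> int" where
  "dim_vector X U v = int (dm (scl X) ((\<lambda>x. ract X x (e v)) ` U))"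

text \<open>Rank and nullity are taken on the part \<open>X e v\<close>. Because \<open>e v\<close>
  is idempotent, the kernel of \<open>f\<close> on that part is the same part of the kernel of
  \<open>f\<close>.\<close>

lemma dim_vector_hom:
  assumes X: "right_module sA X" and Y: "right_module sA Y" and f: "rmod_hom X Y f" and fd: "fdim (scl X) (carr X)"
    and v: "v < n"
  shows "dim_vector X (carr X) v = dim_vector X {x \<in> carr X. f x = 0} v + dim_vector Y (f ` carr X) v"
proof -
  let ?V = "(\<lambda>x. ract X x (e v)) ` carr X"
  note S = subspD[OF rmD(1,2)[OF X]]
  have V: "fdim (scl X) ?V" by (rule fdim_image[OF rmD(1)[OF X] rmD(1)[OF X] fd rm_lin[OF X]])
  have VX: "?V \<subseteq> carr X" using rmD(3)[OF X] by blast
  have "dm (scl X) ?V = dm (scl X) {x \<in> ?V. f x = 0} + dm (scl Y) (f ` ?V)"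
    by (rule rank_nullity[OF rmD(1)[OF X] rmD(1)[OF Y] V lin_on_subset[OF hom_lin[OF f] VX]])
  moreover have "{x \<in> ?V. f x = 0} = (\<lambda>x. ract X x (e v)) ` {x \<in> carr X. f x = 0}"
  proof (intro equalityI subsetI)
    fix x assume "x \<in> {x \<in> ?V. f x = 0}"
    then obtain y where y: "y \<in> carr X" "x = ract X y (e v)" "f x = 0" by blast
    have "x = ract X x (e v)" unfolding y(2) rmD(6)[OF X y(1), symmetric] e_idem[OF v] ..
    moreover have "x \<in> carr X" using y rmD(3)[OF X] by simp
    ultimately show "x \<in> (\<lambda>x. ract X x (e v)) ` {x \<in> carr X. f x = 0}" using y(3) by blast
  next
    fix x assume "x \<in> (\<lambda>x. ract X x (e v)) ` {x \<in> carr X. f x = 0}"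
    then obtain y where y: "y \<in> carr X" "x = ract X y (e v)" "f y = 0" by blast
    then have "f x = 0" using hom_ract[OF f y(1)] rm_0[OF Y] by simp
    then show "x \<in> {x \<in> ?V. f x = 0}" using y by blast
  qed
  moreover have "f ` ?V = (\<lambda>x. ract Y x (e v)) ` f ` carr X"
    unfolding image_image by (rule image_cong[OF refl]) (rule hom_ract[OF f])
  ultimately show ?thesis unfolding dim_vector_def by simp
qed

text \<open>Induction on the dimension, splitting off one \<open>e w A\<close> each time;
  \<open>z w\<close> counts how often. The induction carries the finite type of the identity rather
  than projectivity, since the former passes to the kernel of \<open>\<zeta>\<close> just by
  projecting the generators.\<close>

lemma dim_vector_projective:
  assumes "right_module sA R" "fdim (scl R) (carr R)" "ftype R R (\<lambda>x. x)"
  shows "\<exists>z. \<forall>v<n. dim_vector R (carr R) v = (\<Sum>w<n. cart v w * z w)"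
  using assms
proof (induction "dm (scl R) (carr R)" arbitrary: R rule: less_induct)
  case less
  note R = less.prems(1) and fd = less.prems(2)
  note S = subspD[OF rmD(1,2)[OF R]]
  show ?case
  proof (cases "carr R = {0}")
    case True
    then have "dim_vector R (carr R) v = 0" for v
      unfolding dim_vector_def by (simp add: rm_0[OF R] dm_zero[OF rmD(1)[OF R]])
    then show ?thesis by (intro exI[of _ "\<lambda>_. 0"]) simp
  next
    case False
    obtain w q \<zeta> where w: "w < n" and q: "q \<in> carr R" and \<zeta>: "rmod_hom R regm \<zeta>" "\<zeta> q = e w" "\<And>x. e w * \<zeta> x = \<zeta> x"
      by (rule split_off[OF R less.prems(3) False]) blast
    define K where "K = {x \<in> carr R. \<zeta> x = 0}"
    define R' where "R' = R\<lparr>carr := K\<rparr>"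
    have R's: "carr R' = K" "scl R' = scl R" "ract R' = ract R" by (simp_all add: R'_def)
    have K: "subsp (scl R) K" unfolding K_def
      using lin_on_kernel[OF rmD(1)[OF R] vsA rmD(2)[OF R]] hom_lin[OF \<zeta>(1)] by simp
    have KR: "K \<subseteq> carr R" unfolding K_def by blast
    have Kr: "ract R x a \<in> K" if "x \<in> K" for x a
      using that rmD(3)[OF R] hom_ract[OF \<zeta>(1)] unfolding K_def by simp
    have R': "right_module sA R'"
      unfolding right_module_def R's
      using rmD(1)[OF R] K Kr KR rmD(4-8)[OF R] by (simp add: subset_iff)
    have ftR: "ftype R' R' (\<lambda>x. x)"
    proof -
      from less.prems(3) obtain r :: nat and t \<xi> where t: "(\<forall>k<r. t k \<in> carr R) \<and> (\<forall>k<r. rmod_hom R regm (\<xi> k)) \<and>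
         (\<forall>x\<in>carr R. x = (\<Sum>k<r. ract R (t k) (\<xi> k x)))"
        unfolding ftype_def by (elim exE)
      \<comment> \<open>The projection of \<open>R\<close> onto the kernel of \<open>\<zeta>\<close>
        along \<open>q A\<close>.\<close>
      define pi where "pi x = x - ract R q (\<zeta> x)" for x
      have pi: "rmod_hom R R pi" unfolding pi_def
        by (rule hom_plus(2)[OF R hom_id])
          (use \<zeta>(1) q rmD(3,5,6,8)[OF R q] in \<open>simp add: rmod_hom_def\<close>)
      have piK: "pi x \<in> K" if "x \<in> carr R" for x
      proof -
        have "\<zeta> (pi x) = \<zeta> x - \<zeta> (ract R q (\<zeta> x))" unfolding pi_def
          using lin_on_diff[OF rmD(1,2)[OF R] hom_lin[OF \<zeta>(1)] that rmD(3)[OF R q]] by simp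
        also have "\<dots> = 0" using hom_ract[OF \<zeta>(1) q] \<zeta>(2,3) by simp
        finally show ?thesis unfolding K_def using hom_in[OF pi that] by simp
      qed
      show ?thesis
      proof (rule ftypeI[of r "\<lambda>k. pi (t k)" _ _ \<xi>])
        show "pi (t k) \<in> carr R'" if "k < r" for k using that t piK R's by simp
        show "rmod_hom R' regm (\<xi> k)" if "k < r" for k
          using t that KR unfolding rmod_hom_def R's by (simp add: subset_iff)
        fix x assume "x \<in> carr R'"
        then have x: "x \<in> carr R" "\<zeta> x = 0" unfolding R's K_def by simp_all
        have "x = pi x" unfolding pi_def using x rm_0_r[OF R q] by simp
        also have "pi x = pi (\<Sum>k<r. ract R (t k) (\<xi> k x))" using t x by metis
        also have "\<dots> = (\<Sum>k<r. pi (ract R (t k) (\<xi> k x)))"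
          by (rule lin_on_sum[OF rmD(1,2)[OF R] hom_lin[OF pi]]) (use t rmD(3)[OF R] in auto)
        also have "\<dots> = (\<Sum>k<r. ract R' (pi (t k)) (\<xi> k x))"
          unfolding R's by (rule sum.cong) (use t hom_ract[OF pi] in auto)
        finally show "x = (\<Sum>k<r. ract R' (pi (t k)) (\<xi> k x))" .
      qed
    qed
    have "K \<noteq> carr R"
    proof
      assume "K = carr R"
      then have "\<zeta> q = 0" using q unfolding K_def by blast
      then have "\<chi> w (e w) = 0" using \<zeta>(2) chi_0[OF w] by simp
      then show False using chi_e[OF w w] by simp
    qed
    then have lt: "dm (scl R') (carr R') < dm (scl R) (carr R)"
      unfolding R's using dim_psubset_less[OF rmD(1)[OF R] fd K] KR by blast
    have fd': "fdim (scl R') (carr R')" unfolding R's by (rule fdim_subset[OF rmD(1)[OF R] fd K KR])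
    from less.hyps[OF lt R' fd' ftR] obtain z where z: "\<forall>v<n. dim_vector R' (carr R') v = (\<Sum>w<n. cart v w * z w)" by (elim exE)
    have im: "\<zeta> ` carr R = range (\<lambda>x. e w * x)"
    proof (intro equalityI subsetI)
      fix x assume "x \<in> \<zeta> ` carr R"
      then show "x \<in> range (\<lambda>x. e w * x)" using \<zeta>(3) by (metis imageE rangeI)
    next
      fix x assume "x \<in> range (\<lambda>x. e w * x)"
      then obtain y where "x = e w * y" by blast
      then have "x = \<zeta> (ract R q y)" using hom_ract[OF \<zeta>(1) q] \<zeta>(2) by simp
      then show "x \<in> \<zeta> ` carr R" using rmD(3)[OF R q] by blast
    qed
    have "dim_vector R (carr R) v = (\<Sum>u<n. cart v u * (if u = w then z u + 1 else z u))" if v: "v < n" for v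
    proof -
      have "dim_vector R (carr R) v = dim_vector R K v + dim_vector regm (\<zeta> ` carr R) v"
        unfolding K_def by (rule dim_vector_hom[OF R regm_module \<zeta>(1) fd v])
      also have "dim_vector R K v = (\<Sum>u<n. cart v u * z u)" using z v unfolding R's dim_vector_def by simp
      also have "dim_vector regm (\<zeta> ` carr R) v = cart v w"
        unfolding dim_vector_def cart_def im by (simp add: image_image)
      also have "(\<Sum>u<n. cart v u * z u) + cart v w = (\<Sum>u<n. cart v u * z u + (if u = w then cart v u else 0))"
        unfolding sum.distrib using w by simp
      also have "\<dots> = (\<Sum>u<n. cart v u * (if u = w then z u + 1 else z u))"
        by (rule sum.cong) (auto simp: algebra_simps)
      finally show ?thesis .
    qed
    then show ?thesis by (intro exI[of _ "\<lambda>u. if u = w then z u + 1 else z u"]) blast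
  qed
qed

text \<open>Membership in the lattice spanned by the columns of the Cartan matrix over the integers;
  coordinates outside the first \<open>n\<close> are ignored.\<close>

definition cart_span :: "(nat \<Rightarrow> int) \<Rightarrow> bool" where
  "cart_span y \<longleftrightarrow> (\<exists>z. \<forall>v<n. y v = (\<Sum>w<n. cart v w * z w))"

lemma cart_span_diff: "cart_span x \<Longrightarrow> cart_span y \<Longrightarrow> (\<And>v. v < n \<Longrightarrow> u v = x v - y v) \<Longrightarrow> cart_span u"
proof -
  assume "cart_span x" "cart_span y" and u: "\<And>v. v < n \<Longrightarrow> u v = x v - y v"
  then obtain a b where "\<forall>v<n. x v = (\<Sum>w<n. cart v w * a w)" "\<forall>v<n. y v = (\<Sum>w<n. cart v w * b w)"
    unfolding cart_span_def by (elim exE)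
  then show ?thesis unfolding cart_span_def using u
    by (intro exI[of _ "\<lambda>w. a w - b w"]) (simp add: algebra_simps sum_subtractf)
qed

text \<open>Along a finite projective resolution the dimension vector is an alternating sum of those
  of projectives. The images of the differentials are treated one after another, starting at the
  left end where the image is zero.\<close>

lemma cart_span_module:
  assumes g: "finite_global_dimension sA" and X: "right_module sA X" "fin_dim X"
  shows "cart_span (dim_vector X (carr X))"
proof -
  obtain d R \<delta> \<epsilon> where res: "resolution d R \<delta> \<epsilon> X" by (rule resolution_exists[OF g X])
  have pr: "projective sA (R i)" and fin: "fin_dim (R i)" and \<delta>: "rmod_hom (R (Suc i)) (R i) (\<delta> i)"
    and ex: "{x \<in> carr (R (Suc i)). \<delta> i x = 0} = \<delta> (Suc i) ` carr (R (Suc (Suc i)))" for i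
    using res unfolding resolution_def by simp_all
  have zero: "carr (R i) = {0}" if "i > d" for i using res that unfolding resolution_def by simp
  have \<epsilon>: "rmod_hom (R 0) X \<epsilon>" "\<epsilon> ` carr (R 0) = carr X" "{x \<in> carr (R 0). \<epsilon> x = 0} = \<delta> 0 ` carr (R (Suc 0))"
    using res unfolding resolution_def by simp_all
  note rm = projective_module[OF pr]
  have fd: "fdim (scl (R i)) (carr (R i))" for i using fin_dim_fdim[OF rmD(1)[OF rm]] fin by blast
  have R: "cart_span (dim_vector (R i) (carr (R i)))" for i
    unfolding cart_span_def by (rule dim_vector_projective[OF rm fd fd_projective_ftype[OF pr fin]])
  \<comment> \<open>The index runs down from \<open>d\<close>. For \<open>i \<ge> d\<close> the
    truncated subtraction stays at 0, where the induction step has nothing to prove.\<close>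
  have im: "cart_span (dim_vector (R (d - i)) (\<delta> (d - i) ` carr (R (Suc (d - i)))))" for i
  proof (induction i)
    case 0
    have "\<delta> d 0 = 0" by (rule lin_on_0[OF rmD(1,2)[OF rm] hom_lin[OF \<delta>]])
    then have "dim_vector (R d) (\<delta> d ` carr (R (Suc d))) v = 0" for v
      using zero[of "Suc d"] unfolding dim_vector_def by (simp add: rm_0[OF rm] dm_zero[OF rmD(1)[OF rm]])
    then show ?case unfolding cart_span_def by (intro exI[of _ "\<lambda>_. 0"]) simp
  next
    case (Suc i)
    show ?case
    proof (cases "i < d")
      case True
      define j where "j = d - Suc i"
      have j: "d - i = Suc j" using True unfolding j_def by simp
      have "dim_vector (R (Suc j)) (carr (R (Suc j))) v =
          dim_vector (R (Suc j)) (\<delta> (Suc j) ` carr (R (Suc (Suc j)))) v + dim_vector (R j) (\<delta> j ` carr (R (Suc j))) v" if "v < n" for v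
        using dim_vector_hom[OF rm rm \<delta> fd that, of j] unfolding ex .
      then show ?thesis unfolding j_def[symmetric]
        using cart_span_diff[OF R[of "Suc j"] Suc.IH[unfolded j]] by simp
    next
      case False
      then show ?thesis using Suc.IH by simp
    qed
  qed
  have "dim_vector (R 0) (carr (R 0)) v = dim_vector (R 0) (\<delta> 0 ` carr (R (Suc 0))) v + dim_vector X (carr X) v" if "v < n" for v
    using dim_vector_hom[OF rm X(1) \<epsilon>(1) fd that] unfolding \<epsilon> .
  then show ?thesis using cart_span_diff[OF R[of 0] im[of d, simplified]] by simp
qed

text \<open>The simple module given by the character \<open>\<chi> u\<close> is one dimensional, and
  its dimension vector is the unit vector at \<open>u\<close>. So all unit vectors lie in the column
  lattice, and their coefficients form the columns of \<open>Z\<close>.\<close>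

lemma cart_right_inverse:
  assumes g: "finite_global_dimension sA"
  obtains Z :: "nat \<Rightarrow> nat \<Rightarrow> int" where "\<And>v u. v < n \<Longrightarrow> u < n \<Longrightarrow> (\<Sum>w<n. cart v w * Z w u) = (if v = u then 1 else 0)"
proof -
  have vk: "vector_space ((*) :: 'k \<Rightarrow> 'k \<Rightarrow> 'k)" by unfold_locales (simp_all add: algebra_simps)
  interpret K: vector_space "(*) :: 'k \<Rightarrow> 'k \<Rightarrow> 'k" by (rule vk)
  have "\<exists>z. \<forall>v<n. (if v = u then 1 else 0) = (\<Sum>w<n. cart v w * z w)" if u: "u < n" for u
  proof -
    define X :: "('k, 'a, 'k) rmod" where "X = \<lparr>carr = UNIV, scl = (*), ract = (\<lambda>x a. x * \<chi> u a)\<rparr>"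
    have X: "right_module sA X"
      unfolding right_module_def X_def rmod.simps
    proof (intro conjI ballI allI)
      show "vector_space ((*) :: 'k \<Rightarrow> 'k \<Rightarrow> 'k)" by (rule vk)
      show "K.subspace UNIV" by (rule K.subspace_UNIV)
    qed (simp_all add: distrib_left distrib_right chi_add[OF u] chi_mult[OF u] chi_one[OF u] chi_scale[OF u])
    have one: "fdim (*) (UNIV :: 'k set)" unfolding fdim_def
      by (intro exI[of _ "{1}"]) (auto simp: K.span_singleton)
    then have "fin_dim X" using fin_dim_fdim[OF rmD(1)[OF X]] by (simp add: X_def)
    then have "cart_span (dim_vector X (carr X))" by (rule cart_span_module[OF g X])
    moreover have "dim_vector X (carr X) v = (if v = u then 1 else 0)" if v: "v < n" for v
    proof (cases "v = u")
      case True
      have "K.dim (UNIV :: 'k set) = K.dim (K.span {1})" by (simp add: K.span_singleton)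
      also have "\<dots> = 1" using K.dim_span_eq_card_independent[of "{1}"] K.dependent_single[of 1] by simp
      finally show ?thesis using True v by (simp add: dim_vector_def X_def chi_e)
    next
      case False
      then have "(\<lambda>x. x * \<chi> u (e v)) ` UNIV = {0}" using u v by (auto simp: chi_e)
      then show ?thesis using False dm_zero[OF vk] by (simp add: dim_vector_def X_def)
    qed
    ultimately show ?thesis unfolding cart_span_def by simp
  qed
  then have "\<forall>u. \<exists>z. u < n \<longrightarrow> (\<forall>v<n. (if v = u then 1 else 0) = (\<Sum>w<n. cart v w * z w))" by blast
  then obtain z where z: "\<forall>u. u < n \<longrightarrow> (\<forall>v<n. (if v = u then 1 else 0) = (\<Sum>w<n. cart v w * z u w))"
    by (subst (asm) choice_iff) (elim exE)
  show thesis by (rule that[of "\<lambda>w u. z u w"]) (use z in simp)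
qed

end

section \<open>Homotopy to an endomorphism of finite type\<close>

lemma fdim_list:
  assumes v: "vector_space s" and V: "fdim s V"
  shows "\<exists>(r::nat) t. (\<forall>k<r. t k \<in> V) \<and> (\<forall>x\<in>V. \<exists>c. x = (\<Sum>k<r. s (c k) (t k)))"
proof -
  interpret vector_space s by (rule v)
  obtain B where B: "finite B" "independent B" "span B = V" by (rule fdim_basis[OF v V])
  obtain t where "bij_betw t {0..<card B} B" using ex_bij_betw_nat_finite[OF B(1)] by blast
  then have t: "bij_betw t {..<card B} B" unfolding atLeast0LessThan .
  have BV: "B \<subseteq> V" using span_superset[of B] B(3) by simp
  have "\<exists>c. x = (\<Sum>k<card B. s (c k) (t k))" if "x \<in> V" for x
  proof -
    have "x = (\<Sum>b\<in>B. s (representation B x b) b)"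
      using sum_representation_eq[OF B(2) _ B(1)] B(3) that by simp
    also have "\<dots> = (\<Sum>k<card B. s (representation B x (t k)) (t k))"
      by (rule sum.reindex_bij_betw[OF t, symmetric])
    finally show ?thesis by (rule exI[of _ "\<lambda>k. representation B x (t k)"])
  qed
  moreover have "\<forall>k<card B. t k \<in> V" using bij_betwE[OF t] BV by auto
  ultimately show ?thesis by (intro exI[of _ "card B"] exI[of _ t]) simp
qed

text \<open>Finite dimensional cohomology is expressed by a space \<open>T\<close> of
  representatives in each degree; it need not be a complement of the coboundaries. Below
  \<open>L\<close> the complex is exact and above \<open>u\<close> it vanishes.\<close>

locale proj_complex = fd_alg sA for sA :: "'k::field \<Rightarrow> 'a::{ring,monoid_mult} \<Rightarrow> 'a" +
  fixes X :: "int \<Rightarrow> ('k, 'a, 'p::ab_group_add, 'z) rmod_scheme" and d :: "int \<Rightarrow> 'p \<Rightarrow> 'p"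
    and u L :: int
  assumes proj: "\<And>l. projective sA (X l)"
    and dhom: "\<And>l. rmod_hom (X l) (X (l + 1)) (d l)"
    and dd: "\<And>l x. x \<in> carr (X l) \<Longrightarrow> d (l + 1) (d l x) = 0"
    and above: "\<And>l. l > u \<Longrightarrow> carr (X l) = {0}"
    and coh: "\<And>l. \<exists>T. fdim (scl (X l)) T \<and> T \<subseteq> carr (X l) \<and>
      (\<forall>z\<in>carr (X l). d l z = 0 \<longrightarrow> (\<exists>b\<in>carr (X (l - 1)). z - d (l - 1) b \<in> T))"
    and exact: "\<And>l z. l \<le> L \<Longrightarrow> z \<in> carr (X l) \<Longrightarrow> d l z = 0 \<Longrightarrow> z \<in> d (l - 1) ` carr (X (l - 1))"
    and gldim: "finite_global_dimension sA"
begin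

lemmas rmX = projective_module[OF proj]
lemmas vsX = rmD(1)[OF rmX]
lemmas subX = rmD(2)[OF rmX]

lemma dhom': "rmod_hom (X (l - 1)) (X l) (d (l - 1))"
  using dhom[of "l - 1"] by simp

lemma dd': "x \<in> carr (X (l - 1)) \<Longrightarrow> d l (d (l - 1) x) = 0"
  using dd[of x "l - 1"] by simp

definition eps :: "(int \<Rightarrow> 'p \<Rightarrow> 'p) \<Rightarrow> int \<Rightarrow> 'p \<Rightarrow> 'p" where
  "eps h l p = p - d (l - 1) (h l p) - h (l + 1) (d l p)"

lemma theta_hom:
  assumes "rmod_hom (X (l + 1)) (X l) h"
  shows "rmod_hom (X l) (X l) (\<lambda>p. p - h (d l p))"
  by (rule hom_plus(2)[OF rmX hom_id hom_comp[OF dhom assms]])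

lemma dtheta:
  assumes h: "rmod_hom (X (l + 1)) (X l) h" and p: "p \<in> carr (X l)"
  shows "d l (p - h (d l p)) = d l p - d l (h (d l p))"
  by (rule lin_on_diff[OF vsX subX hom_lin[OF dhom] p]) (rule hom_in[OF h hom_in[OF dhom p]])

text \<open>For \<open>\<theta> = 1 - h d\<close> the image of \<open>d \<theta>\<close> is finite
  dimensional. Hence, modulo coboundaries, the image of \<open>\<theta>\<close> is spanned by
  finitely many lifts of that image together with the cocycle representatives.
  \<open>projective_split\<close> then removes the coboundary part linearly in the form
  \<open>d h'\<close>.\<close>

lemma homotopy_step:
  assumes h: "rmod_hom (X (l + 1)) (X l) h"
    and fd: "\<exists>U. fdim (scl (X (l + 1))) U \<and> (\<forall>p\<in>carr (X l). d l p - d l (h (d l p)) \<in> U)"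
  shows "\<exists>h'. rmod_hom (X l) (X (l - 1)) h' \<and> ftype (X l) (X l) (\<lambda>p. p - d (l - 1) (h' p) - h (d l p))"
proof -
  let ?s = "scl (X l)"
  define \<theta> where "\<theta> p = p - h (d l p)" for p
  have \<theta>: "rmod_hom (X l) (X l) \<theta>" unfolding \<theta>_def by (rule theta_hom[OF h])
  have d\<theta>: "rmod_hom (X l) (X (l + 1)) (\<lambda>p. d l (\<theta> p))" by (rule hom_comp[OF \<theta> dhom])
  define W where "W = (\<lambda>p. d l (\<theta> p)) ` carr (X l)"
  obtain U where U: "fdim (scl (X (l + 1))) U" "\<forall>p\<in>carr (X l). d l p - d l (h (d l p)) \<in> U" using fd by (elim exE conjE)
  have W: "fdim (scl (X (l + 1))) W"
  proof (rule fdim_subset[OF vsX U(1)])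
    show "subsp (scl (X (l + 1))) W" unfolding W_def by (rule lin_on_image[OF vsX vsX subX hom_lin[OF d\<theta>]])
    show "W \<subseteq> U" unfolding W_def \<theta>_def using U(2) dtheta[OF h] by auto
  qed
  obtain g where g: "lin_on (scl (X (l + 1))) W ?s g" "g ` W \<subseteq> carr (X l)" "\<And>y. y \<in> W \<Longrightarrow> d l (\<theta> (g y)) = y"
    using lin_on_section[OF vsX vsX subX hom_lin[OF d\<theta>]] unfolding W_def by blast
  have gW: "lin_on (scl (X (l + 1))) W ?s (\<lambda>y. \<theta> (g y))"
    by (rule lin_on_comp[OF g(1,2) hom_lin[OF \<theta>]])
  have F1: "fdim ?s ((\<lambda>y. \<theta> (g y)) ` W)" by (rule fdim_image[OF vsX vsX W gW])
  obtain T where T: "fdim ?s T" "T \<subseteq> carr (X l)"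
    "\<forall>z\<in>carr (X l). d l z = 0 \<longrightarrow> (\<exists>b\<in>carr (X (l - 1)). z - d (l - 1) b \<in> T)"
    using coh[of l] by (elim exE conjE)
  have F1X: "(\<lambda>y. \<theta> (g y)) ` W \<subseteq> carr (X l)" using g(2) hom_in[OF \<theta>] by auto
  \<comment> \<open>\<open>V\<close> collects the lifts of \<open>W\<close> and the representatives
    \<open>T\<close>; a spanning list of \<open>V\<close> provides the finitely many generators
    \<open>t\<close>.\<close>
  obtain V where V: "fdim ?s V" "(\<lambda>y. \<theta> (g y)) ` W \<subseteq> V" "T \<subseteq> V" "V \<subseteq> carr (X l)"
    using fdim_sums[OF vsX F1 T(1)] F1X T(2) subX[of l] by metis
  note SV = subspD[OF vsX fdim_subsp[OF vsX V(1)]]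
  obtain r :: nat and t where t: "(\<forall>k<r. t k \<in> V) \<and> (\<forall>x\<in>V. \<exists>c. x = (\<Sum>k<r. ?s (c k) (t k)))"
    using fdim_list[OF vsX V(1)] by (elim exE)
  have tX: "t k \<in> carr (X l)" if "k < r" for k using t V(4) that by blast
  have ex: "\<exists>c y. y \<in> carr (X (l - 1)) \<and> \<theta> p = (\<Sum>k<r. ract (X l) (t k) (c k)) + d (l - 1) y"
    if p: "p \<in> carr (X l)" for p
  proof -
    define y where "y = d l (\<theta> p)"
    have yW: "y \<in> W" unfolding y_def W_def using p by blast
    have gy: "g y \<in> carr (X l)" using g(2) yW by blast
    \<comment> \<open>Since \<open>g\<close> is a section of \<open>d \<theta>\<close>, this is a
      cocycle, hence an element of \<open>T\<close> up to a coboundary.\<close>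
    define z where "z = \<theta> p - \<theta> (g y)"
    have zX: "z \<in> carr (X l)" unfolding z_def
      by (rule subspD(3)[OF vsX subX hom_in[OF \<theta> p] hom_in[OF \<theta> gy]])
    have "d l z = d l (\<theta> p) - d l (\<theta> (g y))" unfolding z_def
      by (rule lin_on_diff[OF vsX subX hom_lin[OF dhom] hom_in[OF \<theta> p] hom_in[OF \<theta> gy]])
    then have "d l z = 0" using g(3)[OF yW] unfolding y_def by simp
    then obtain b where b: "b \<in> carr (X (l - 1))" "z - d (l - 1) b \<in> T" using T(3) zX by blast
    define v where "v = (z - d (l - 1) b) + \<theta> (g y)"
    have "v \<in> V" unfolding v_def by (rule SV(2)) (use b(2) V yW in auto)
    then obtain c where c: "v = (\<Sum>k<r. ?s (c k) (t k))" using t by blast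
    have "\<theta> p = v + d (l - 1) b" unfolding v_def z_def by simp
    also have "v = (\<Sum>k<r. ract (X l) (t k) (sA (c k) 1))" unfolding c
      by (rule sum.cong) (use tX rmD(7,8)[OF rmX] in auto)
    finally show ?thesis using b(1) by (intro exI[of _ "\<lambda>k. sA (c k) 1"] exI[of _ b]) simp
  qed
  show ?thesis
  proof (rule projective_split[OF proj rmX rmX \<theta> dhom', of r t])
    fix \<xi> h' assume \<xi>: "\<And>k. rmod_hom (X l) regm (\<xi> k)" and h': "rmod_hom (X l) (X (l - 1)) h'"
      and eq: "\<And>p. p \<in> carr (X l) \<Longrightarrow> \<theta> p = (\<Sum>k<r. ract (X l) (t k) (\<xi> k p)) + d (l - 1) (h' p)"
    have "p - d (l - 1) (h' p) - h (d l p) = (\<Sum>k<r. ract (X l) (t k) (\<xi> k p))" if "p \<in> carr (X l)" for p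
      using eq[OF that] unfolding \<theta>_def by (simp add: algebra_simps)
    then have "ftype (X l) (X l) (\<lambda>p. p - d (l - 1) (h' p) - h (d l p))"
      by (intro ftypeI[of r t _ _ \<xi>]) (simp_all add: tX \<xi>)
    then show ?thesis using h' by blast
  qed (use tX ex in simp_all)
qed

text \<open>Descending induction from the zero part above \<open>u\<close>, with \<open>m\<close>
  counting the degrees treated. It reaches any given degree, but it does not make \<open>eps\<close>
  vanish in low degrees.\<close>

lemma homotopy_upper:
  "\<exists>h. (\<forall>l. rmod_hom (X l) (X (l - 1)) (h l)) \<and> (\<forall>l \<ge> u + 1 - int m. ftype (X l) (X l) (eps h l))"
proof (induction m)
  case 0
  have "ftype (X l) (X l) (eps (\<lambda>_ _. 0) l)" if "l \<ge> u + 1" for l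
  proof (rule ftypeI[of 0])
    fix p assume "p \<in> carr (X l)"
    then have "p = 0" using above[of l] that by simp
    then show "eps (\<lambda>_ _. 0) l p = (\<Sum>k<(0::nat). ract (X l) ((\<lambda>_. 0) k) ((\<lambda>_ _. 0) k p))"
      using lin_on_0[OF vsX subX hom_lin[OF dhom], of "l - 1"] by (simp add: eps_def)
  qed auto
  then show ?case using hom_zero[OF rmX rmX] by (intro exI[of _ "\<lambda>_ _. 0"]) simp
next
  case (Suc m)
  then obtain h where h: "\<And>l. rmod_hom (X l) (X (l - 1)) (h l)"
    and e: "\<And>l. l \<ge> u + 1 - int m \<Longrightarrow> ftype (X l) (X l) (eps h l)" by blast
  define i where "i = u - int m"
  have hi: "rmod_hom (X (i + 1)) (X i) (h (i + 1))" using h[of "i + 1"] by simp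
  have "ftype (X (i + 1)) (X (i + 1)) (eps h (i + 1))" by (rule e) (simp add: i_def)
  then obtain U where U: "fdim (scl (X (i + 1))) U" "eps h (i + 1) ` carr (X (i + 1)) \<subseteq> U"
    using ftype_fdim[OF _ rmX] by blast
  have "d i p - d i (h (i + 1) (d i p)) \<in> U" if p: "p \<in> carr (X i)" for p
  proof -
    have "h (i + 1 + 1) 0 = 0" by (rule lin_on_0[OF vsX subX hom_lin[OF h]])
    then have "eps h (i + 1) (d i p) = d i p - d i (h (i + 1) (d i p))"
      unfolding eps_def using dd[OF p] by simp
    then show ?thesis using U(2) hom_in[OF dhom p] by (metis image_subset_iff)
  qed
  then obtain h' where h': "rmod_hom (X i) (X (i - 1)) h'"
    "ftype (X i) (X i) (\<lambda>p. p - d (i - 1) (h' p) - h (i + 1) (d i p))"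
    using homotopy_step[OF hi] U(1) by blast
  show ?case
  \<comment> \<open>A change of \<open>h\<close> in degree \<open>i\<close> affects
    \<open>eps\<close> only in degrees \<open>i\<close> and \<open>i - 1\<close>, so nothing already
    achieved above \<open>i\<close> is lost.\<close>
  proof (intro exI[of _ "h(i := h')"] conjI allI impI)
    show "rmod_hom (X l) (X (l - 1)) ((h(i := h')) l)" for l using h h'(1) by simp
    fix l assume l: "u + 1 - int (Suc m) \<le> l"
    show "ftype (X l) (X l) (eps (h(i := h')) l)"
    proof (cases "l = i")
      case True
      have "eps (h(i := h')) i = (\<lambda>p. p - d (i - 1) (h' p) - h (i + 1) (d i p))"
        by (simp add: eps_def fun_eq_iff)
      then show ?thesis using h'(2) True by simp
    next
      case False
      then have "eps (h(i := h')) l = eps h l" using l by (simp add: eps_def fun_eq_iff i_def)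
      then show ?thesis using e[of l] False l by (simp add: i_def)
    qed
  qed
qed

text \<open>The homotopy is continued downwards through the exact degrees: the obstruction left in degree \<open>l\<close>
  factors through \<open>R j\<close>, and \<open>j\<close> grows as \<open>l\<close> falls, so it disappears beyond the length of the resolution.\<close>

definition ladder ::
  "(nat \<Rightarrow> ('k, 'a, nat \<Rightarrow> 'k) rmod) \<Rightarrow> (nat \<Rightarrow> (nat \<Rightarrow> 'k) \<Rightarrow> (nat \<Rightarrow> 'k)) \<Rightarrow> nat \<Rightarrow> int
    \<Rightarrow> ('p \<Rightarrow> nat \<Rightarrow> 'k) \<Rightarrow> ((nat \<Rightarrow> 'k) \<Rightarrow> 'p) \<Rightarrow> ('p \<Rightarrow> 'p) \<Rightarrow> bool"
where
  "ladder R \<delta> j l a b h \<longleftrightarrow> rmod_hom (X l) (R j) a \<and> rmod_hom (R j) (X l) b \<and> rmod_hom (X l) (X (l - 1)) h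
    \<and> (\<forall>p\<in>carr (X (l - 1)). a (d (l - 1) p) \<in> \<delta> j ` carr (R (Suc j)))
    \<and> (\<forall>x\<in>carr (R (Suc j)). d l (b (\<delta> j x)) = 0)
    \<and> (\<forall>p\<in>carr (X (l - 1)). d (l - 1) p - d (l - 1) (h (d (l - 1) p)) = b (a (d (l - 1) p)))"

text \<open>In degree \<open>l - 1\<close> the map \<open>a d\<close> is lifted through the
  differential of \<open>R\<close> and \<open>b \<delta>\<close> through the differential of
  \<open>X\<close>. The defect of \<open>1 - h d\<close> from the new composite \<open>b' a'\<close>
  consists of cocycles, and exactness makes it \<open>d h'\<close>.\<close>

lemma ladder_step:
  assumes pr: "\<And>i. projective sA (R i)" and \<delta>: "\<And>i. rmod_hom (R (Suc i)) (R i) (\<delta> i)"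
    and ex: "\<And>i. {x \<in> carr (R (Suc i)). \<delta> i x = 0} = \<delta> (Suc i) ` carr (R (Suc (Suc i)))"
    and lad: "ladder R \<delta> j l a b h" and l: "l \<le> L"
  shows "\<exists>a' b' h'. ladder R \<delta> (Suc j) (l - 1) a' b' h'
     \<and> (\<forall>p\<in>carr (X (l - 1)). p - d (l - 1 - 1) (h' p) - h (d (l - 1) p) = b' (a' p))"
proof -
  note rmR = projective_module[OF pr]
  define m where "m = l - 1"
  have a: "rmod_hom (X l) (R j) a" and b: "rmod_hom (R j) (X l) b" and h: "rmod_hom (X l) (X m) h"
    and 1: "\<And>p. p \<in> carr (X m) \<Longrightarrow> a (d m p) \<in> \<delta> j ` carr (R (Suc j))"
    and 2: "\<And>x. x \<in> carr (R (Suc j)) \<Longrightarrow> d l (b (\<delta> j x)) = 0"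
    and 3: "\<And>p. p \<in> carr (X m) \<Longrightarrow> d m p - d m (h (d m p)) = b (a (d m p))"
    using lad unfolding ladder_def m_def by simp_all
  have dm: "rmod_hom (X m) (X l) (d m)" using dhom[of m] unfolding m_def by simp
  have exl: "z \<in> d m ` carr (X m)" if "z \<in> carr (X l)" "d l z = 0" "l \<le> L" for z using exact[of l z] that unfolding m_def by simp
  have exm: "z \<in> d (m - 1) ` carr (X (m - 1))" if "z \<in> carr (X m)" "d m z = 0" for z
    using exact[of m z] that l unfolding m_def by simp
  have "\<exists>a'. rmod_hom (X m) (R (Suc j)) a' \<and> (\<forall>p\<in>carr (X m). \<delta> j (a' p) = a (d m p))"
    by (rule projective_lift[OF proj rmR rmR hom_comp[OF dm a] \<delta> 1]) blast+
  then obtain a' where a': "rmod_hom (X m) (R (Suc j)) a'" "\<And>p. p \<in> carr (X m) \<Longrightarrow> \<delta> j (a' p) = a (d m p)" by blast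
  have bd: "b (\<delta> j x) \<in> d m ` carr (X m)" if x: "x \<in> carr (R (Suc j))" for x
    by (rule exl[OF hom_in[OF b hom_in[OF \<delta> x]] 2[OF x] l])
  have "\<exists>b'. rmod_hom (R (Suc j)) (X m) b' \<and> (\<forall>x\<in>carr (R (Suc j)). d m (b' x) = b (\<delta> j x))"
    by (rule projective_lift[OF pr rmX rmX hom_comp[OF \<delta> b] dm bd]) blast+
  then obtain b' where b': "rmod_hom (R (Suc j)) (X m) b'" "\<And>x. x \<in> carr (R (Suc j)) \<Longrightarrow> d m (b' x) = b (\<delta> j x)" by blast
  \<comment> \<open>The lifting equations give \<open>d b' a' = b a d\<close>, which is exactly what
    the ladder condition says about \<open>d - d h d\<close>; so \<open>d f = 0\<close>.\<close>
  define f where "f p = p - h (d m p) - b' (a' p)" for p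
  have ba: "rmod_hom (X m) (X m) (\<lambda>p. b' (a' p))" by (rule hom_comp[OF a'(1) b'(1)])
  have hd: "rmod_hom (X m) (X m) (\<lambda>p. h (d m p))" by (rule hom_comp[OF dm h])
  have f: "rmod_hom (X m) (X m) f" unfolding f_def
    by (rule hom_plus(2)[OF rmX hom_plus(2)[OF rmX hom_id hd] ba])
  have df: "f p \<in> d (m - 1) ` carr (X (m - 1))" if p: "p \<in> carr (X m)" for p
  proof (rule exm[OF hom_in[OF f p]])
    have p1: "p - h (d m p) \<in> carr (X m)" by (rule subspD(3)[OF vsX subX p hom_in[OF hd p]])
    have "d m (f p) = d m (p - h (d m p)) - d m (b' (a' p))"
      unfolding f_def by (rule lin_on_diff[OF vsX subX hom_lin[OF dm] p1 hom_in[OF ba p]])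
    also have "d m (p - h (d m p)) = d m p - d m (h (d m p))"
      by (rule lin_on_diff[OF vsX subX hom_lin[OF dm] p hom_in[OF hd p]])
    also have "d m (b' (a' p)) = b (a (d m p))" using b'(2)[OF hom_in[OF a'(1) p]] a'(2)[OF p] by simp
    finally show "d m (f p) = 0" using 3[OF p] by simp
  qed
  have dm1: "rmod_hom (X (m - 1)) (X m) (d (m - 1))" by (rule dhom')
  have "\<exists>h'. rmod_hom (X m) (X (m - 1)) h' \<and> (\<forall>p\<in>carr (X m). d (m - 1) (h' p) = f p)"
    by (rule projective_lift[OF proj rmX rmX f dm1 df]) blast+
  then obtain h' where h': "rmod_hom (X m) (X (m - 1)) h'" "\<And>p. p \<in> carr (X m) \<Longrightarrow> d (m - 1) (h' p) = f p" by blast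
  have R0: "a 0 = 0" by (rule lin_on_0[OF vsX subX hom_lin[OF a]])
  have h0: "h 0 = 0" by (rule lin_on_0[OF vsX subX hom_lin[OF h]])
  have dd1: "d m (d (m - 1) p) = 0" if "p \<in> carr (X (m - 1))" for p using dd'[OF that] .
  have "ladder R \<delta> (Suc j) m a' b' h'"
    unfolding ladder_def
  proof (intro conjI ballI)
    show "rmod_hom (X m) (R (Suc j)) a'" "rmod_hom (R (Suc j)) (X m) b'" "rmod_hom (X m) (X (m - 1)) h'"
      by (rule a'(1), rule b'(1), rule h'(1))
    fix p assume p: "p \<in> carr (X (m - 1))"
    have dp: "d (m - 1) p \<in> carr (X m)" by (rule hom_in[OF dm1 p])
    have "\<delta> j (a' (d (m - 1) p)) = 0" using a'(2)[OF dp] dd1[OF p] R0 by simp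
    then show "a' (d (m - 1) p) \<in> \<delta> (Suc j) ` carr (R (Suc (Suc j)))"
      using ex[of j] hom_in[OF a'(1) dp] by blast
    have "d (m - 1) (h' (d (m - 1) p)) = d (m - 1) p - b' (a' (d (m - 1) p))"
      using h'(2)[OF dp] dd1[OF p] h0 unfolding f_def by simp
    then show "d (m - 1) p - d (m - 1) (h' (d (m - 1) p)) = b' (a' (d (m - 1) p))" by simp
  next
    fix x assume x: "x \<in> carr (R (Suc (Suc j)))"
    have "\<delta> (Suc j) x \<in> {x \<in> carr (R (Suc j)). \<delta> j x = 0}" unfolding ex using x by blast
    then show "d m (b' (\<delta> (Suc j) x)) = 0"
      using b'(2) lin_on_0[OF rmD(1,2)[OF rmR] hom_lin[OF b]] by simp
  qed
  moreover have "p - d (m - 1) (h' p) - h (d m p) = b' (a' p)" if "p \<in> carr (X m)" for p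
    using h'(2)[OF that] unfolding f_def by (simp add: algebra_simps)
  ultimately show ?thesis unfolding m_def by blast
qed

text \<open>Above degree \<open>i\<close> the homotopy of \<open>homotopy_upper\<close> is kept. The
  finite dimensional image \<open>M\<close> of \<open>d \<theta>\<close> in degree
  \<open>i + 1\<close> is the only obstruction to a contraction further down; resolving
  \<open>M\<close> starts the ladder, which carries the obstruction through the terms of the
  resolution.\<close>

lemma homotopy_exists:
  "\<exists>h. (\<forall>l. rmod_hom (X l) (X (l - 1)) (h l)) \<and> (\<forall>l. ftype (X l) (X l) (eps h l))
     \<and> (\<exists>L'. \<forall>l<L'. \<forall>p\<in>carr (X l). eps h l p = 0)"
proof -
  \<comment> \<open>At most \<open>L\<close> for exactness from here downwards, at most
    \<open>u\<close> so that the natural number \<open>m\<close> below hits degree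
    \<open>i + 1\<close> exactly.\<close>
  define i where "i = min L u"
  have iL: "i \<le> L" unfolding i_def by simp
  define m where "m = nat (u - i)"
  have m: "u + 1 - int m = i + 1" unfolding m_def i_def by simp
  from homotopy_upper[of m] obtain h1 where h1: "\<And>l. rmod_hom (X l) (X (l - 1)) (h1 l)"
    "\<And>l. l \<ge> i + 1 \<Longrightarrow> ftype (X l) (X l) (eps h1 l)" unfolding m by blast
  define h0 where "h0 = h1 (i + 1)"
  have h0: "rmod_hom (X (i + 1)) (X i) h0" using h1(1)[of "i + 1"] unfolding h0_def by simp
  define \<theta> where "\<theta> p = p - h0 (d i p)" for p
  have \<theta>: "rmod_hom (X i) (X i) \<theta>" unfolding \<theta>_def by (rule theta_hom[OF h0])
  have d\<theta>: "rmod_hom (X i) (X (i + 1)) (\<lambda>p. d i (\<theta> p))" by (rule hom_comp[OF \<theta> dhom])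
  \<comment> \<open>\<open>d \<theta>\<close> is \<open>eps\<close> of degree \<open>i + 1\<close>
    restricted to coboundaries, so its image lies in the finite dimensional range of a finite type
    map.\<close>
  define U where "U = (\<lambda>p. d i (\<theta> p)) ` carr (X i)"
  define M where "M = (X (i + 1))\<lparr>carr := U\<rparr>"
  have Ms: "carr M = U" "scl M = scl (X (i + 1))" "ract M = ract (X (i + 1))" by (simp_all add: M_def)
  have UX: "U \<subseteq> carr (X (i + 1))" unfolding U_def using hom_in[OF d\<theta>] by blast
  have sU: "subsp (scl (X (i + 1))) U" unfolding U_def by (rule lin_on_image[OF vsX vsX subX hom_lin[OF d\<theta>]])
  have rU: "ract (X (i + 1)) x a \<in> U" if "x \<in> U" for x a
  proof -
    from that obtain p where p: "p \<in> carr (X i)" "x = d i (\<theta> p)" unfolding U_def by blast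
    then have "ract (X (i + 1)) x a = d i (\<theta> (ract (X i) p a))" using hom_ract[OF d\<theta> p(1)] by simp
    then show ?thesis unfolding U_def using rmD(3)[OF rmX p(1)] by blast
  qed
  have M: "right_module sA M"
    unfolding right_module_def Ms
    using vsX sU rU UX rmD(4-8)[OF rmX] by (simp add: subset_iff)
  have fM: "fin_dim M"
  proof -
    have "ftype (X (i + 1)) (X (i + 1)) (eps h1 (i + 1))" by (rule h1(2)) simp
    then obtain W where W: "fdim (scl (X (i + 1))) W" "eps h1 (i + 1) ` carr (X (i + 1)) \<subseteq> W"
      using ftype_fdim[OF _ rmX] by blast
    have "d i (\<theta> p) \<in> W" if p: "p \<in> carr (X i)" for p
    proof -
      have "h1 (i + 1 + 1) 0 = 0" by (rule lin_on_0[OF vsX subX hom_lin[OF h1(1)]])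
      then have "eps h1 (i + 1) (d i p) = d i p - d i (h0 (d i p))"
        unfolding eps_def h0_def using dd[OF p] by simp
      also have "\<dots> = d i (\<theta> p)" unfolding \<theta>_def using dtheta[OF h0 p] by simp
      finally show ?thesis using W(2) hom_in[OF dhom p] by (metis image_subset_iff)
    qed
    then have "U \<subseteq> W" unfolding U_def by blast
    then show ?thesis using fin_dim_fdim[OF rmD(1)[OF M]] fdim_subset[OF vsX W(1) sU] unfolding Ms by simp
  qed
  obtain n R \<delta> \<epsilon> where res: "resolution n R \<delta> \<epsilon> M" by (rule resolution_exists[OF gldim M fM])
  have pr: "projective sA (R j)" and fin: "fin_dim (R j)" and \<delta>: "rmod_hom (R (Suc j)) (R j) (\<delta> j)"
    and ex: "{x \<in> carr (R (Suc j)). \<delta> j x = 0} = \<delta> (Suc j) ` carr (R (Suc (Suc j)))" for j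
    using res unfolding resolution_def by simp_all
  have zero: "carr (R j) = {0}" if "j > n" for j using res that unfolding resolution_def by simp
  have \<epsilon>: "rmod_hom (R 0) M \<epsilon>" "\<epsilon> ` carr (R 0) = U" "{x \<in> carr (R 0). \<epsilon> x = 0} = \<delta> 0 ` carr (R (Suc 0))"
    using res unfolding resolution_def Ms by simp_all
  note rmR = projective_module[OF pr]
  have \<epsilon>X: "rmod_hom (R 0) (X (i + 1)) \<epsilon>" using \<epsilon>(1) UX unfolding rmod_hom_def Ms by (simp add: subset_iff)
  have dU: "d i (\<theta> p) \<in> \<epsilon> ` carr (R 0)" if "p \<in> carr (X i)" for p unfolding \<epsilon>(2) U_def using that by blast
  have "\<exists>a. rmod_hom (X i) (R 0) a \<and> (\<forall>p\<in>carr (X i). \<epsilon> (a p) = d i (\<theta> p))"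
    by (rule projective_lift[OF proj rmR rmX d\<theta> \<epsilon>X dU]) blast+
  then obtain a where a: "rmod_hom (X i) (R 0) a" "\<And>p. p \<in> carr (X i) \<Longrightarrow> \<epsilon> (a p) = d i (\<theta> p)" by blast
  have \<epsilon>d: "\<epsilon> x \<in> d i ` carr (X i)" if "x \<in> carr (R 0)" for x
    using \<epsilon>(2) that hom_in[OF \<theta>] unfolding U_def by blast
  have "\<exists>b. rmod_hom (R 0) (X i) b \<and> (\<forall>x\<in>carr (R 0). d i (b x) = \<epsilon> x)"
    by (rule projective_lift[OF pr rmX rmX \<epsilon>X dhom \<epsilon>d]) blast+
  then obtain b where b: "rmod_hom (R 0) (X i) b" "\<And>x. x \<in> carr (R 0) \<Longrightarrow> d i (b x) = \<epsilon> x" by blast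
  define f where "f p = \<theta> p - b (a p)" for p
  have ba: "rmod_hom (X i) (X i) (\<lambda>p. b (a p))" by (rule hom_comp[OF a(1) b(1)])
  have f: "rmod_hom (X i) (X i) f" unfolding f_def by (rule hom_plus(2)[OF rmX \<theta> ba])
  have df: "f p \<in> d (i - 1) ` carr (X (i - 1))" if p: "p \<in> carr (X i)" for p
  proof (rule exact[OF iL hom_in[OF f p]])
    have "d i (f p) = d i (\<theta> p) - d i (b (a p))"
      unfolding f_def by (rule lin_on_diff[OF vsX subX hom_lin[OF dhom] hom_in[OF \<theta> p] hom_in[OF ba p]])
    then show "d i (f p) = 0" using b(2)[OF hom_in[OF a(1) p]] a(2)[OF p] by simp
  qed
  have "\<exists>h. rmod_hom (X i) (X (i - 1)) h \<and> (\<forall>p\<in>carr (X i). d (i - 1) (h p) = f p)"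
    by (rule projective_lift[OF proj rmX rmX f dhom' df]) blast+
  then obtain h where h: "rmod_hom (X i) (X (i - 1)) h" "\<And>p. p \<in> carr (X i) \<Longrightarrow> d (i - 1) (h p) = f p" by blast
  have h00: "h0 0 = 0" by (rule lin_on_0[OF vsX subX hom_lin[OF h0]])
  have d0: "d i 0 = 0" by (rule lin_on_0[OF vsX subX hom_lin[OF dhom]])
  have \<theta>d: "\<theta> (d (i - 1) p) = d (i - 1) p" if "p \<in> carr (X (i - 1))" for p
    unfolding \<theta>_def using dd'[OF that] h00 by simp
  have lad0: "ladder R \<delta> 0 i a b h"
    unfolding ladder_def
  proof (intro conjI ballI)
    show "rmod_hom (X i) (R 0) a" "rmod_hom (R 0) (X i) b" "rmod_hom (X i) (X (i - 1)) h"
      by (rule a(1), rule b(1), rule h(1))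
    fix p assume p: "p \<in> carr (X (i - 1))"
    have dp: "d (i - 1) p \<in> carr (X i)" by (rule hom_in[OF dhom' p])
    have "\<epsilon> (a (d (i - 1) p)) = 0" using a(2)[OF dp] \<theta>d[OF p] dd'[OF p] by simp
    then show "a (d (i - 1) p) \<in> \<delta> 0 ` carr (R (Suc 0))"
      using \<epsilon>(3) hom_in[OF a(1) dp] by blast
    have "d (i - 1) (h (d (i - 1) p)) = d (i - 1) p - b (a (d (i - 1) p))"
      using h(2)[OF dp] \<theta>d[OF p] unfolding f_def by simp
    then show "d (i - 1) p - d (i - 1) (h (d (i - 1) p)) = b (a (d (i - 1) p))" by simp
  next
    fix x assume x: "x \<in> carr (R (Suc 0))"
    have "\<delta> 0 x \<in> {x \<in> carr (R 0). \<epsilon> x = 0}" unfolding \<epsilon>(3) using x by blast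
    then show "d i (b (\<delta> 0 x)) = 0" using b(2) by simp
  qed
  define Pr where "Pr j s = (case s of (a, b, h) \<Rightarrow> ladder R \<delta> j (i - int j) a b h)" for j s
  define Q where "Q j s s' = (case s of (a, b, h) \<Rightarrow> case s' of (a', b', h') \<Rightarrow>
      (\<forall>p\<in>carr (X (i - int j - 1)). p - d (i - int j - 1 - 1) (h' p) - h (d (i - int j - 1) p) = b' (a' p)))"
    for j and s s' :: "('p \<Rightarrow> nat \<Rightarrow> 'k) \<times> ((nat \<Rightarrow> 'k) \<Rightarrow> 'p) \<times> ('p \<Rightarrow> 'p)"
  have "\<exists>s. (\<forall>j. Pr j (s j)) \<and> (\<forall>j. Q j (s j) (s (Suc j))) \<and> s 0 = (a, b, h)"
  proof -
    \<comment> \<open>Dependent choice does not prescribe the first element, but the gluing in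
      degree \<open>i\<close> needs the specific triple \<open>(a, b, h)\<close>; it is therefore
      built into the predicate.\<close>
    define Pr' where "Pr' j s \<longleftrightarrow> Pr j s \<and> (j = 0 \<longrightarrow> s = (a, b, h))" for j s
    have "\<exists>s. \<forall>j. Pr' j (s j) \<and> Q j (s j) (s (Suc j))"
    proof (rule dependent_nat_choice)
      show "\<exists>s. Pr' 0 s" unfolding Pr'_def Pr_def using lad0 by (intro exI[of _ "(a, b, h)"]) simp
      fix s j assume "Pr' j s"
      obtain aj bj hj where s: "s = (aj, bj, hj)" by (cases s) auto
      have lad: "ladder R \<delta> j (i - int j) aj bj hj" using \<open>Pr' j s\<close> unfolding Pr'_def Pr_def s by simp
      have il: "i - int j \<le> L" using iL by simp
      obtain a' b' h' where n: "ladder R \<delta> (Suc j) (i - int j - 1) a' b' h'"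
        "\<forall>p\<in>carr (X (i - int j - 1)). p - d (i - int j - 1 - 1) (h' p) - hj (d (i - int j - 1) p) = b' (a' p)"
        using ladder_step[OF pr \<delta> ex lad il] by blast
      have e: "i - int (Suc j) = i - int j - 1" by simp
      show "\<exists>s'. Pr' (Suc j) s' \<and> Q j s s'"
        unfolding Pr'_def Pr_def Q_def s e using n by (intro exI[of _ "(a', b', h')"]) simp
    qed
    then obtain s where s: "\<And>j. Pr' j (s j)" "\<And>j. Q j (s j) (s (Suc j))" by blast
    show ?thesis
    proof (intro exI[of _ s] conjI allI)
      show "Pr j (s j)" for j using s(1)[of j] unfolding Pr'_def by simp
      show "Q j (s j) (s (Suc j))" for j by (rule s(2))
      show "s 0 = (a, b, h)" using s(1)[of 0] unfolding Pr'_def by simp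
    qed
  qed
  then obtain s where s: "\<forall>j. Pr j (s j)" "\<forall>j. Q j (s j) (s (Suc j))" "s 0 = (a, b, h)" by blast
  define sa where "sa j = fst (s j)" for j
  define sb where "sb j = fst (snd (s j))" for j
  define sh where "sh j = snd (snd (s j))" for j
  have sj: "s j = (sa j, sb j, sh j)" for j by (simp add: sa_def sb_def sh_def)
  have lad: "ladder R \<delta> j (i - int j) (sa j) (sb j) (sh j)" for j using s(1) unfolding Pr_def sj by simp
  have Qj: "p - d (i - int j - 1 - 1) (sh (Suc j) p) - sh j (d (i - int j - 1) p) = sb (Suc j) (sa (Suc j) p)"
    if "p \<in> carr (X (i - int j - 1))" for p j
    using s(2) that unfolding Q_def sj by simp
  have s0: "sa 0 = a" "sb 0 = b" "sh 0 = h" using s(3) by (simp_all add: sa_def sb_def sh_def)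
  \<comment> \<open>Degree \<open>i\<close> already belongs to the ladder. There \<open>eps\<close>
    combines the new \<open>h\<close> with \<open>h1 (i + 1)\<close>, the map used to form
    \<open>\<theta>\<close>.\<close>
  define H where "H l = (if l > i then h1 l else sh (nat (i - l)))" for l
  have Hhom: "rmod_hom (X l) (X (l - 1)) (H l)" for l
  proof (cases "l > i")
    case True
    then show ?thesis unfolding H_def using h1(1) by simp
  next
    case False
    then have "i - int (nat (i - l)) = l" by simp
    then show ?thesis unfolding H_def using False lad[of "nat (i - l)"] unfolding ladder_def by simp
  qed
  have low: "eps H l p = sb (nat (i - l)) (sa (nat (i - l)) p)" if l: "l \<le> i" and p: "p \<in> carr (X l)" for l p
  proof (cases "l = i")
    case True
    have "eps H i p = \<theta> p - d (i - 1) (h p)" if "p \<in> carr (X i)" for p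
      by (simp add: eps_def H_def s0 h0_def \<theta>_def)
    then show ?thesis using True p h(2) by (simp add: f_def s0)
  next
    case False
    define j where "j = nat (i - l - 1)"
    have l': "l = i - int j - 1" and jj: "nat (i - l) = Suc j" "nat (i - (l + 1)) = j" using l False unfolding j_def by auto
    have "H l = sh (Suc j)" "H (l + 1) = sh j" unfolding H_def jj using l False by simp_all
    then show ?thesis unfolding eps_def jj using Qj[of p j] p unfolding l'[symmetric] by simp
  qed
  have ft: "ftype (X l) (X l) (eps H l)" for l
  proof (cases "l > i")
    case True
    then have "eps H l = eps h1 l" by (simp add: eps_def H_def fun_eq_iff)
    then show ?thesis using h1(2) True by simp
  next
    case False
    define j where "j = nat (i - l)"
    have l': "i - int j = l" using False unfolding j_def by simp
    have "ftype (X l) (X l) (\<lambda>p. sb j (sa j p))"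
    proof (rule ftype_comp[OF fd_projective_ftype[OF pr fin] rmR])
      show "rmod_hom (X l) (R j) (sa j)" "rmod_hom (R j) (X l) (sb j)"
        using lad[of j] unfolding l' ladder_def by simp_all
    qed
    then show ?thesis
      unfolding ftype_def using low False j_def by simp
  qed
  have "eps H l p = 0" if l: "l < i - int n" and p: "p \<in> carr (X l)" for l p
  proof -
    define j where "j = nat (i - l)"
    have l': "i - int j = l" and jn: "j > n" using l unfolding j_def by auto
    have la: "rmod_hom (X l) (R j) (sa j)" and lb: "rmod_hom (R j) (X l) (sb j)"
      using lad[of j] unfolding ladder_def l' by simp_all
    have "sa j p \<in> carr (R j)" by (rule hom_in[OF la p])
    then have "sa j p = 0" using zero[OF jn] by simp
    then have "sb j (sa j p) = 0" using lin_on_0[OF rmD(1,2)[OF rmR] hom_lin[OF lb]] by simp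
    then show ?thesis using low[of l p] l p j_def by simp
  qed
  then show ?thesis using Hhom ft by blast
qed

end

section \<open>Hattori--Stallings traces\<close>

lemma fdim_inj:
  assumes v: "vector_space s" "vector_space s'" and V: "subsp s V" and f: "lin_on s V s' f" "inj_on f V"
    and fd: "fdim s' (f ` V)"
  shows "fdim s V"
proof -
  obtain g where g: "lin_on s' (f ` V) s g" "g ` f ` V \<subseteq> V" "\<And>y. y \<in> f ` V \<Longrightarrow> f (g y) = y"
    using lin_on_section[OF v V f(1)] by blast
  have "g (f x) = x" if "x \<in> V" for x
    using inj_onD[OF f(2) g(3)] g(2) that by blast
  then have "g ` f ` V = V" by (force simp: image_iff)
  then show ?thesis using fdim_image[OF v(2,1) fd g(1)] by simp
qed

lemma (in vs_complex) endoI: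
  assumes "\<And>l. lin_on (s l) (V l) (s l) (T l)" "\<And>l x. x \<in> V l \<Longrightarrow> T l x \<in> V l"
    "\<And>l x. x \<in> V l \<Longrightarrow> d l (T l x) = T (l + 1) (d l x)"
  shows "endo T"
  unfolding endo_def using assms by blast

lemma (in vs_complex) endo_comp:
  assumes S: "endo S" and T: "endo T"
  shows "endo (\<lambda>l x. S l (T l x))"
proof (rule endoI)
  show "lin_on (s l) (V l) (s l) (\<lambda>x. S l (T l x))" for l
    by (rule lin_on_comp[OF endoD(1)[OF T] _ endoD(1)[OF S]]) (use endoD(2)[OF T] in auto)
  show "S l (T l x) \<in> V l" if "x \<in> V l" for l x by (rule endoD(2)[OF S endoD(2)[OF T that]])
  show "d l (S l (T l x)) = S (l + 1) (T (l + 1) (d l x))" if "x \<in> V l" for l x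
    using endoD(3)[OF S endoD(2)[OF T that]] endoD(3)[OF T that] by simp
qed

section \<open>Complexes of bimodules as complexes of vector spaces\<close>

context fd_alg
begin

lemma bmD:
  assumes "bimodule sS sA X"
  shows bm_rm: "right_module sA X"
    and bm_in: "\<And>x s. x \<in> carr X \<Longrightarrow> lact X s x \<in> carr X"
    and bm_add: "\<And>x y s. x \<in> carr X \<Longrightarrow> y \<in> carr X \<Longrightarrow> lact X s (x + y) = lact X s x + lact X s y"
    and bm_add_s: "\<And>x s s'. x \<in> carr X \<Longrightarrow> lact X (s + s') x = lact X s x + lact X s' x"
    and bm_mult: "\<And>x s s'. x \<in> carr X \<Longrightarrow> lact X (s * s') x = lact X s (lact X s' x)"
    and bm_one: "\<And>x. x \<in> carr X \<Longrightarrow> lact X 1 x = x"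
    and bm_comm: "\<And>x s r. x \<in> carr X \<Longrightarrow> ract X (lact X s x) r = lact X s (ract X x r)"
    and bm_scale_s: "\<And>x c s. x \<in> carr X \<Longrightarrow> lact X (sS c s) x = scl X c (lact X s x)"
  using assms unfolding bimodule_def by simp_all

lemma bm_scale:
  assumes "bimodule sS sA X" "x \<in> carr X"
  shows "lact X s (scl X c x) = scl X c (lact X s x)"
proof -
  note r = bmD(1)[OF assms(1)]
  have "scl X c x = ract X x (sA c 1)" using rmD(7,8)[OF r] assms(2) by simp
  then have "lact X s (scl X c x) = ract X (lact X s x) (sA c 1)" using bmD(7)[OF assms] by simp
  also have "\<dots> = scl X c (lact X s x)" using rmD(7,8)[OF r bmD(2)[OF assms]] by simp
  finally show ?thesis .
qed

lemma bm_hom: "bimodule sS sA X \<Longrightarrow> rmod_hom X X (lact X s)"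
  by (rule homI) (auto simp: lin_on_def bmD(2,3) bm_scale bmD(7))

lemma bcD:
  assumes "bimodule_complex sS sA X"
  shows "\<And>l. bimodule sS sA (ob X l)" "\<And>l. rmod_hom (ob X l) (ob X (l + 1)) (df X l)"
    "\<And>l x s. x \<in> carr (ob X l) \<Longrightarrow> df X l (lact (ob X l) s x) = lact (ob X (l + 1)) s (df X l x)"
    "\<And>l x. x \<in> carr (ob X l) \<Longrightarrow> df X (l + 1) (df X l x) = 0"
    "\<And>l. right_module sA (ob X l)"
  using assms unfolding bimodule_complex_def bimod_hom_def by (simp_all add: bimodule_def)

lemma complex_vs:
  assumes "bimodule_complex sS sA X"
  shows "vs_complex (\<lambda>l. scl (ob X l)) (\<lambda>l. carr (ob X l)) (df X)"
proof (rule vs_complex.intro)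
  show "vector_space (scl (ob X l))" "subsp (scl (ob X l)) (carr (ob X l))" for l
    by (rule rmD(1,2)[OF bcD(5)[OF assms]])+
  show "lin_on (scl (ob X l)) (carr (ob X l)) (scl (ob X (l + 1))) (df X l)" for l
    by (rule hom_lin[OF bcD(2)[OF assms]])
  show "df X l x \<in> carr (ob X (l + 1))" if "x \<in> carr (ob X l)" for l x
    by (rule hom_in[OF bcD(2)[OF assms] that])
  show "df X (l + 1) (df X l x) = 0" if "x \<in> carr (ob X l)" for l x
    by (rule bcD(4)[OF assms that])
qed

lemma cmD:
  assumes "chain_map X Y f"
  shows "\<And>l. rmod_hom (ob X l) (ob Y l) (f l)"
    "\<And>l x s. x \<in> carr (ob X l) \<Longrightarrow> f l (lact (ob X l) s x) = lact (ob Y l) s (f l x)"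
    "\<And>l x. x \<in> carr (ob X l) \<Longrightarrow> f (l + 1) (df X l x) = df Y l (f l x)"
  using assms unfolding chain_map_def bimod_hom_def by simp_all

lemma complex_endos:
  assumes X: "bimodule_complex sS sA X"
  shows "vs_complex.endo (\<lambda>l. scl (ob X l)) (\<lambda>l. carr (ob X l)) (df X) (\<lambda>l. lact (ob X l) b)"
    "vs_complex.endo (\<lambda>l. scl (ob X l)) (\<lambda>l. carr (ob X l)) (df X) (\<lambda>l x. ract (ob X l) x r)"
    "chain_map X X f \<Longrightarrow> vs_complex.endo (\<lambda>l. scl (ob X l)) (\<lambda>l. carr (ob X l)) (df X) f"
proof -
  interpret vs_complex "\<lambda>l. scl (ob X l)" "\<lambda>l. carr (ob X l)" "df X" by (rule complex_vs[OF X])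
  note b = bcD[OF X]
  show "endo (\<lambda>l. lact (ob X l) b)"
    by (rule endoI) (use hom_lin[OF bm_hom[OF b(1)]] bmD(2)[OF b(1)] b(3) in blast)+
  show "endo (\<lambda>l x. ract (ob X l) x r)"
    by (rule endoI) (use rm_lin[OF b(5)] rmD(3)[OF b(5)] hom_ract[OF b(2)] in blast)+
  show "endo f" if f: "chain_map X X f"
    by (rule endoI) (use hom_lin[OF cmD(1)[OF f]] hom_in[OF cmD(1)[OF f]] cmD(3)[OF f, symmetric] in blast)+
qed

text \<open>Brings an entry of the trace matrix on cohomology into the shape of the left side of
  \<open>lefschetz\<close>, with the projections interleaved between the two actions.\<close>

lemma trace_cohomology:
  assumes X: "vs_complex (\<lambda>l. scl (ob X l)) (\<lambda>l. carr (ob X l)) (df X)" and "i < a" "j < b"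
  shows "trace_matrix a r b s (cohomology X l) \<theta> $$ (i, j) =
     lin_trace (scl (ob X l)) ((\<lambda>x. vs_complex.pr (\<lambda>l. scl (ob X l)) (\<lambda>l. carr (ob X l)) (df X) l
        (ract (ob X l) (vs_complex.pr (\<lambda>l. scl (ob X l)) (\<lambda>l. carr (ob X l)) (df X) l (lact (ob X l) (s j) x)) (r i)))
        ` vs_complex.H (\<lambda>l. scl (ob X l)) (\<lambda>l. carr (ob X l)) (df X) l) \<theta>"
proof -
  interpret vs_complex "\<lambda>l. scl (ob X l)" "\<lambda>l. carr (ob X l)" "df X" by (rule X)
  show ?thesis using assms
    by (simp add: trace_matrix_def cohomology_def quot_def H_def pr_def bd_def cyc_def coboundaries_def cocycles_def)
qed

lemma cohomology_map_pr:
  assumes X: "vs_complex (\<lambda>l. scl (ob X l)) (\<lambda>l. carr (ob X l)) (df X)"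
  shows "cohomology_map X f l x = vs_complex.pr (\<lambda>l. scl (ob X l)) (\<lambda>l. carr (ob X l)) (df X) l (f l x)"
proof -
  interpret vs_complex "\<lambda>l. scl (ob X l)" "\<lambda>l. carr (ob X l)" "df X" by (rule X)
  show ?thesis by (simp add: cohomology_map_def pr_def bd_def coboundaries_def)
qed

text \<open>Each summand factors through \<open>A\<close>: first \<open>p\<close> goes to
  \<open>\<xi> k p * c\<close>, and then \<open>x\<close> to \<open>t k x\<close>. By cyclicity its
  trace is that of the reversed composite on \<open>A\<close>, which sends \<open>x\<close> to
  \<open>\<xi> k (t k) * x * c\<close>.\<close>

lemma ftype_trace:
  fixes r :: nat
  assumes Y: "right_module sA Y" and t: "\<And>k. k < r \<Longrightarrow> t k \<in> carr Y" and \<xi>: "\<And>k. k < r \<Longrightarrow> rmod_hom Y regm (\<xi> k)"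
    and T: "\<And>p. p \<in> carr Y \<Longrightarrow> T p = (\<Sum>k<r. ract Y (t k) (\<xi> k p * c))"
  shows "fr_trace (scl Y) (carr Y) T = lin_trace sA UNIV (\<lambda>x. (\<Sum>k<r. \<xi> k (t k)) * x * c)"
proof -
  note v = rmD(1)[OF Y] and sub = rmD(2)[OF Y]
  have \<alpha>: "lin_on (scl Y) (carr Y) sA (\<lambda>p. \<xi> k p * c)" if "k < r" for k
    using hom_lin[OF \<xi>[OF that]] by (simp add: lin_on_def distrib_right scale_mult)
  have \<beta>: "lin_on sA UNIV (scl Y) (ract Y (t k))" if "k < r" for k by (rule rm_lin_r[OF Y t[OF that]])
  have in_Y: "ract Y (t k) x \<in> carr Y" if "k < r" for k x by (rule rmD(3)[OF Y t[OF that]])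
  have lin: "lin_on (scl Y) (carr Y) (scl Y) (\<lambda>p. ract Y (t k) (\<xi> k p * c))" if "k < r" for k
    by (rule lin_on_comp[OF \<alpha>[OF that] subset_UNIV \<beta>[OF that]])
  have fd: "fdim (scl Y) ((\<lambda>p. ract Y (t k) (\<xi> k p * c)) ` carr Y)" if "k < r" for k
    by (rule fdim_subset[OF v fdim_image[OF vsA v fdim_UNIV \<beta>[OF that]] lin_on_image[OF v v sub lin[OF that]]]) blast
  have sums: "fr_trace (scl Y) (carr Y) (\<lambda>p. \<Sum>k\<in>{..<r}. ract Y (t k) (\<xi> k p * c))
      = (\<Sum>k\<in>{..<r}. fr_trace (scl Y) (carr Y) (\<lambda>p. ract Y (t k) (\<xi> k p * c)))"
    "fdim (scl Y) ((\<lambda>p. \<Sum>k\<in>{..<r}. ract Y (t k) (\<xi> k p * c)) ` carr Y)"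
    by (rule fr_trace_sum[OF v sub], use lin fd in_Y in auto)+
  have "fr_trace (scl Y) (carr Y) T = fr_trace (scl Y) (carr Y) (\<lambda>p. \<Sum>k\<in>{..<r}. ract Y (t k) (\<xi> k p * c))"
    by (rule fr_trace_cong[OF v sums(2), symmetric]) (use T in_Y in \<open>auto intro!: subspD(6)[OF v sub]\<close>)
  also have "\<dots> = (\<Sum>k\<in>{..<r}. lin_trace sA UNIV (\<lambda>x. \<xi> k (ract Y (t k) x) * c))"
    unfolding sums(1)
    by (rule sum.cong[OF refl], rule fr_trace_cyclic[OF v vsA sub fdim_UNIV \<alpha> subset_UNIV \<beta>]) (use in_Y in auto)
  also have "\<dots> = (\<Sum>k\<in>{..<r}. lin_trace sA UNIV (\<lambda>x. \<xi> k (t k) * x * c))"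
    by (rule sum.cong[OF refl]) (use hom_ract[OF \<xi>] t in simp)
  also have "\<dots> = lin_trace sA UNIV (\<lambda>x. \<Sum>k\<in>{..<r}. \<xi> k (t k) * x * c)"
    by (rule lin_trace_sum[OF vsA fdim_UNIV, symmetric]) auto
  finally show ?thesis by (simp add: sum_distrib_right)
qed

end

context basic_alg
begin

text \<open>This is where the Cartan matrix enters: left multiplication by \<open>a\<close> reduces
  to the \<open>e w\<close>, and \<open>x \<mapsto> e w * x * e v\<close> is an idempotent operator
  whose trace is its rank, a Cartan entry read in \<open>k\<close>.\<close>

lemma trace_regular:
  assumes v: "v < n"
  shows "lin_trace sA UNIV (\<lambda>x. a * x * e v) = (\<Sum>w<n. of_int (cart v w) * \<chi> w a)"
proof -
  have "lin_trace sA UNIV (\<lambda>x. a * (x * e v)) = (\<Sum>w<n. \<chi> w a * lin_trace sA UNIV (\<lambda>x. e w * (x * e v)))"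
    by (rule trace_action[OF vsA fdim_UNIV]) (auto simp: lin_on_def distrib_left distrib_right scale_mult mult.assoc)
  also have "\<dots> = (\<Sum>w<n. of_int (cart v w) * \<chi> w a)"
  proof (rule sum.cong[OF refl])
    fix w assume "w \<in> {..<n}"
    then have w: "w < n" by simp
    let ?q = "\<lambda>x. e w * (x * e v)"
    have q: "lin_on sA UNIV sA ?q" by (simp add: lin_on_def distrib_left distrib_right scale_mult)
    have ww: "e w * (e w * u) = e w * u" for u using e_idem[OF w] by (simp add: mult.assoc[symmetric])
    have f: "fdim sA (range ?q)" by (rule fdim_image[OF vsA vsA fdim_UNIV q])
    have "lin_trace sA (range ?q) (\<lambda>x. x) = fr_trace sA UNIV (\<lambda>x. ?q x)"
      by (rule lin_trace_idem[OF vsA vsA_UNIV q subset_UNIV _ f lin_on_id])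
        (simp_all add: mult.assoc ww e_idem[OF v])
    also have "\<dots> = lin_trace sA UNIV ?q" by (rule fr_trace_fdim[OF vsA fdim_UNIV q subset_UNIV])
    finally have "lin_trace sA UNIV ?q = of_nat (dm sA (range ?q))" using lin_trace_id[OF vsA f] by simp
    then show "\<chi> w a * lin_trace sA UNIV ?q = of_int (cart v w) * \<chi> w a"
      by (simp add: cart_def mult.assoc)
  qed
  finally show ?thesis by (simp add: mult.assoc)
qed

end

text \<open>A single idempotent \<open>bb\<close> of \<open>B\<close> is fixed, because the trace
  matrices are compared entry by entry.\<close>

locale res_data = basic_alg sA n e \<chi>
  for sA :: "'k::field \<Rightarrow> 'a::{ring,monoid_mult} \<Rightarrow> 'a" and n e \<chi> +
  fixes sB :: "'k \<Rightarrow> 'b::{ring,monoid_mult} \<Rightarrow> 'b" and M :: "('k, 'a, 'm::ab_group_add, 'b) cpx" and \<phi>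
    and P :: "('k, 'a, 'p::ab_group_add, 'b) cpx" and \<pi> \<Phi> and bb :: 'b
  assumes gl: "finite_global_dimension sA"
    and M: "bounded_fd_complex sB sA M" and phi: "chain_map M M \<phi>"
    and P: "projective_resolution sB sA P M \<pi>" and lift: "lifts_endomorphism P M \<pi> \<phi> \<Phi>"
    and bb: "bb * bb = bb"
begin

lemma Mc: "bimodule_complex sB sA M" using M unfolding bounded_fd_complex_def by blast
lemma Pc: "bimodule_complex sB sA P" using P unfolding projective_resolution_def by blast
lemma Pproj: "projective sA (ob P l)" using P unfolding projective_resolution_def by blast
lemma Phi: "chain_map P P \<Phi>" using lift unfolding lifts_endomorphism_def by blast
lemma qi: "chain_map P M \<pi>" "bij_betw (cohomology_map M \<pi> l) (carr (cohomology P l)) (carr (cohomology M l))"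
  using P unfolding projective_resolution_def quasi_isomorphism_def by blast+

sublocale PC: vs_complex "\<lambda>l. scl (ob P l)" "\<lambda>l. carr (ob P l)" "df P" by (rule complex_vs[OF Pc])
sublocale MC: vs_complex "\<lambda>l. scl (ob M l)" "\<lambda>l. carr (ob M l)" "df M" by (rule complex_vs[OF Mc])

lemma M_fdim: "fdim (scl (ob M l)) (carr (ob M l))"
  using M fin_dim_fdim[OF MC.vs] unfolding bounded_fd_complex_def by blast

definition cm :: "int \<Rightarrow> 'p \<Rightarrow> 'm" where "cm l x = MC.pr l (\<pi> l x)"

lemma cm_bij: "bij_betw (cm l) (PC.H l) (MC.H l)"
proof -
  have "carr (cohomology P l) = PC.H l"
    by (simp add: cohomology_def quot_def PC.H_def PC.pr_def PC.bd_def PC.cyc_def coboundaries_def cocycles_def)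
  moreover have "carr (cohomology M l) = MC.H l"
    by (simp add: cohomology_def quot_def MC.H_def MC.pr_def MC.bd_def MC.cyc_def coboundaries_def cocycles_def)
  moreover have "cohomology_map M \<pi> l = cm l"
    by (rule ext) (simp add: cm_def cohomology_map_pr[OF complex_vs[OF Mc]])
  ultimately show ?thesis using qi(2)[of l] by simp
qed

lemma pi_cyc: "x \<in> PC.cyc l \<Longrightarrow> \<pi> l x \<in> MC.cyc l"
proof -
  assume "x \<in> PC.cyc l"
  then have x: "x \<in> carr (ob P l)" "df P l x = 0" unfolding PC.cyc_def by simp_all
  have "df M l (\<pi> l x) = \<pi> (l + 1) 0" using cmD(3)[OF qi(1) x(1)] x(2) by simp
  also have "\<dots> = 0" by (rule lin_on_0[OF PC.vs PC.V hom_lin[OF cmD(1)[OF qi(1)]]])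
  finally show ?thesis unfolding MC.cyc_def using hom_in[OF cmD(1)[OF qi(1)] x(1)] by simp
qed

lemma pi_bd: "x \<in> PC.bd l \<Longrightarrow> \<pi> l x \<in> MC.bd l"
proof -
  assume "x \<in> PC.bd l"
  then obtain y where y: "y \<in> carr (ob P (l - 1))" "x = df P (l - 1) y" unfolding PC.bd_def by blast
  then have "\<pi> l x = df M (l - 1) (\<pi> (l - 1) y)" using cmD(3)[OF qi(1), of y "l - 1"] by simp
  then show ?thesis unfolding MC.bd_def using hom_in[OF cmD(1)[OF qi(1)] y(1)] by blast
qed

lemma pr_lin: "lin_on (scl (ob M l)) U (scl (ob M l)) (MC.pr l)" "lin_on (scl (ob P l)) U' (scl (ob P l)) (PC.pr l)"
  unfolding MC.pr_def PC.pr_def using lin_on_linear quot_proj(1)[OF MC.vs MC.bd_sub] quot_proj(1)[OF PC.vs PC.bd_sub] by blast+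

lemma cm_lin: "lin_on (scl (ob P l)) (carr (ob P l)) (scl (ob M l)) (cm l)"
  unfolding cm_def by (rule lin_on_comp[OF hom_lin[OF cmD(1)[OF qi(1)]] subset_UNIV pr_lin(1)])

lemma H_P: "PC.H l \<subseteq> PC.cyc l" "PC.H l \<subseteq> carr (ob P l)"
  using PC.H_cyc PC.cyc_V by blast+

lemma H_M_fdim: "fdim (scl (ob M l)) (MC.H l)"
  by (rule MC.fdim_H[of _ "\<lambda>x. x"]) (use M_fdim subspD(1)[OF MC.vs MC.bd_sub] in auto)

lemma H_P_fdim: "fdim (scl (ob P l)) (PC.H l)"
  by (rule fdim_inj[OF PC.vs MC.vs PC.H_sub lin_on_subset[OF cm_lin H_P(2)]])
    (use cm_bij[of l] H_M_fdim in \<open>auto simp: bij_betw_def\<close>)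

text \<open>Cohomology is realised as a subspace of the cocycles, so it serves as its own space of
  representatives.\<close>

lemma P_coh: "\<exists>T. fdim (scl (ob P l)) T \<and> T \<subseteq> carr (ob P l) \<and>
      (\<forall>z\<in>carr (ob P l). df P l z = 0 \<longrightarrow> (\<exists>b\<in>carr (ob P (l - 1)). z - df P (l - 1) b \<in> T))"
proof (intro exI[of _ "PC.H l"] conjI ballI impI)
  fix z assume "z \<in> carr (ob P l)" "df P l z = 0"
  then have z: "z \<in> PC.cyc l" unfolding PC.cyc_def by simp
  have "z - PC.pr l z \<in> PC.bd l" unfolding PC.pr_def by (rule quot_proj_diff(3)[OF PC.vs PC.bd_sub])
  then obtain b where b: "b \<in> carr (ob P (l - 1))" "z - PC.pr l z = df P (l - 1) b" unfolding PC.bd_def by blast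
  have "z - df P (l - 1) b = PC.pr l z" unfolding b(2)[symmetric] by simp
  then show "\<exists>b\<in>carr (ob P (l - 1)). z - df P (l - 1) b \<in> PC.H l" using b(1) z unfolding PC.H_def by blast
qed (use H_P_fdim H_P in auto)

lemma M_bounded: "\<exists>L. \<forall>l\<le>L. carr (ob M l) = {0}"
proof -
  have fin: "finite {l. carr (ob M l) \<noteq> {0}}" using M unfolding bounded_fd_complex_def by blast
  define L where "L = Min (insert 0 {l. carr (ob M l) \<noteq> {0}}) - 1"
  have "carr (ob M l) = {0}" if "l \<le> L" for l
  proof (rule ccontr)
    assume "carr (ob M l) \<noteq> {0}"
    then have "Min (insert 0 {l. carr (ob M l) \<noteq> {0}}) \<le> l" by (intro Min_le) (use fin in auto)
    then show False using that unfolding L_def by simp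
  qed
  then show ?thesis by blast
qed

text \<open>Where \<open>M\<close> vanishes its cohomology vanishes, and the quasi-isomorphism
  transfers this to \<open>P\<close>.\<close>

lemma P_exact:
  assumes "carr (ob M l) = {0}" "z \<in> carr (ob P l)" "df P l z = 0"
  shows "z \<in> df P (l - 1) ` carr (ob P (l - 1))"
proof -
  have z: "z \<in> PC.cyc l" unfolding PC.cyc_def using assms by simp
  have "MC.H l \<subseteq> {0}" using MC.H_cyc MC.cyc_V assms(1) by blast
  then have "cm l x = 0" if "x \<in> PC.H l" for x using cm_bij[of l] that unfolding bij_betw_def by blast
  moreover have z0: "0 \<in> PC.H l" by (rule subspD(1)[OF PC.vs PC.H_sub])
  moreover have pz: "PC.pr l z \<in> PC.H l" unfolding PC.H_def using z by blast
  ultimately have "PC.pr l z = 0" using cm_bij[of l] unfolding bij_betw_def inj_on_def by metis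
  then show ?thesis using quot_proj(2)[OF PC.vs PC.bd_sub, of l z] unfolding PC.pr_def PC.bd_def by blast
qed

lemma homotopy_data:
  "\<exists>h. (\<forall>l. rmod_hom (ob P l) (ob P (l - 1)) (h l))
     \<and> (\<forall>l. ftype (ob P l) (ob P l) (\<lambda>p. p - df P (l - 1) (h l p) - h (l + 1) (df P l p)))
     \<and> (\<exists>F. finite F \<and> (\<forall>l. l \<notin> F \<longrightarrow> (\<forall>p\<in>carr (ob P l). p - df P (l - 1) (h l p) - h (l + 1) (df P l p) = 0)))"
proof -
  obtain L where L: "\<And>l. l \<le> L \<Longrightarrow> carr (ob M l) = {0}" using M_bounded by blast
  from P obtain u where u: "\<forall>l>u. carr (ob P l) = {0}" unfolding projective_resolution_def by blast
  interpret pc: proj_complex sA "ob P" "df P" u L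
  proof unfold_locales
    show "projective sA (ob P l)" for l by (rule Pproj)
    show "rmod_hom (ob P l) (ob P (l + 1)) (df P l)" for l by (rule bcD(2)[OF Pc])
    show "df P (l + 1) (df P l x) = 0" if "x \<in> carr (ob P l)" for l x by (rule bcD(4)[OF Pc that])
    show "carr (ob P l) = {0}" if "u < l" for l using u that by blast
    show "z \<in> df P (l - 1) ` carr (ob P (l - 1))" if "l \<le> L" "z \<in> carr (ob P l)" "df P l z = 0" for l z
      by (rule P_exact[OF L[OF that(1)] that(2,3)])
    show "finite_global_dimension sA" by (rule gl)
  qed (rule P_coh)
  obtain h L' where h: "\<forall>l. rmod_hom (ob P l) (ob P (l - 1)) (h l)" "\<forall>l. ftype (ob P l) (ob P l) (pc.eps h l)"
    "\<forall>l<L'. \<forall>p\<in>carr (ob P l). pc.eps h l p = 0" using pc.homotopy_exists by blast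
  have "pc.eps h l p = 0" if "l \<notin> {L'..u}" "p \<in> carr (ob P l)" for l p
  proof (cases "l < L'")
    case True
    then show ?thesis using h(3) that(2) by blast
  next
    case False
    then have "carr (ob P l) = {0}" using u that(1) by simp
    then have "p = 0" using that(2) by simp
    moreover have "h l 0 = 0" "h (l + 1) 0 = 0"
      using lin_on_0[OF PC.vs PC.V hom_lin] h(1) by blast+
    ultimately show ?thesis
      unfolding pc.eps_def using lin_on_0[OF PC.vs PC.V PC.d(1), of "l - 1"] lin_on_0[OF PC.vs PC.V PC.d(1), of l] by simp
  qed
  moreover have "pc.eps h l = (\<lambda>p. p - df P (l - 1) (h l p) - h (l + 1) (df P l p))" for l
    by (rule ext) (simp add: pc.eps_def)
  ultimately show ?thesis
    using h(1,2) by (intro exI[of _ h] conjI exI[of _ "{L'..u}"]) simp_all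
qed

text \<open>The finite presentations of \<open>eps\<close> are chosen for all degrees at once, with
  no generators outside the finite set \<open>F\<close>; this makes all later sums over degrees
  finite.\<close>

lemma finite_data:
  "\<exists>h (r :: int \<Rightarrow> nat) t \<xi> F. (\<forall>l. rmod_hom (ob P l) (ob P (l - 1)) (h l))
     \<and> (\<forall>l. \<forall>k<r l. t l k \<in> carr (ob P l)) \<and> (\<forall>l. \<forall>k<r l. rmod_hom (ob P l) regm (\<xi> l k))
     \<and> (\<forall>l. \<forall>p\<in>carr (ob P l). p - df P (l - 1) (h l p) - h (l + 1) (df P l p) = (\<Sum>k<r l. ract (ob P l) (t l k) (\<xi> l k p)))
     \<and> finite F \<and> (\<forall>l. l \<notin> F \<longrightarrow> r l = 0)"
proof -
  obtain h F where h: "\<forall>l. rmod_hom (ob P l) (ob P (l - 1)) (h l)"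
    and ft: "\<forall>l. ftype (ob P l) (ob P l) (\<lambda>p. p - df P (l - 1) (h l p) - h (l + 1) (df P l p))"
    and F: "finite F" "\<forall>l. l \<notin> F \<longrightarrow> (\<forall>p\<in>carr (ob P l). p - df P (l - 1) (h l p) - h (l + 1) (df P l p) = 0)"
    using homotopy_data by (elim exE conjE)
  let ?Q = "\<lambda>l x. case x of (r, t, \<xi>) \<Rightarrow> (\<forall>k<r. t k \<in> carr (ob P l)) \<and> (\<forall>k<r. rmod_hom (ob P l) regm (\<xi> k)) \<and>
     (\<forall>p\<in>carr (ob P l). p - df P (l - 1) (h l p) - h (l + 1) (df P l p) = (\<Sum>k<r. ract (ob P l) (t k) (\<xi> k p)))
     \<and> (l \<notin> F \<longrightarrow> r = (0::nat))"
  have "\<exists>x. ?Q l x" for l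
  proof (cases "l \<in> F")
    case True
    from ft have "ftype (ob P l) (ob P l) (\<lambda>p. p - df P (l - 1) (h l p) - h (l + 1) (df P l p))" by blast
    then obtain r :: nat and t \<xi> where "(\<forall>k<r. t k \<in> carr (ob P l)) \<and> (\<forall>k<r. rmod_hom (ob P l) regm (\<xi> k)) \<and>
     (\<forall>p\<in>carr (ob P l). p - df P (l - 1) (h l p) - h (l + 1) (df P l p) = (\<Sum>k<r. ract (ob P l) (t k) (\<xi> k p)))"
      unfolding ftype_def by (elim exE)
    then show ?thesis using True by (intro exI[of _ "(r, t, \<xi>)"]) simp
  next
    case False
    \<comment> \<open>With zero generators the lists are never evaluated.\<close>
    then show ?thesis using F(2) by (intro exI[of _ "(0, undefined, undefined)"]) simp
  qed
  then have "\<exists>x. \<forall>l. ?Q l (x l)" by (intro choice allI)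
  then obtain x where x: "\<forall>l. ?Q l (x l)" by (elim exE)
  show ?thesis
    by (rule exI[of _ h], rule exI[of _ "\<lambda>l. fst (x l)"], rule exI[of _ "\<lambda>l. fst (snd (x l))"],
        rule exI[of _ "\<lambda>l. snd (snd (x l))"], rule exI[of _ F]) (use x h F(1) in \<open>auto simp: split_beta\<close>)
qed

end

text \<open>The choices made in \<open>finite_data\<close> become parameters, so that the elements
  and vectors built from them can be named and shared by the Ext and Tor computations.\<close>

locale fin_data = res_data sA n e \<chi> sB M \<phi> P \<pi> \<Phi> bb
  for sA :: "'k::field \<Rightarrow> 'a::{ring,monoid_mult} \<Rightarrow> 'a" and n e \<chi>
    and sB :: "'k \<Rightarrow> 'b::{ring,monoid_mult} \<Rightarrow> 'b" and M :: "('k, 'a, 'm::ab_group_add, 'b) cpx" and \<phi>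
    and P :: "('k, 'a, 'p::ab_group_add, 'b) cpx" and \<pi> \<Phi> and bb :: 'b +
  fixes h :: "int \<Rightarrow> 'p \<Rightarrow> 'p" and r :: "int \<Rightarrow> nat" and t :: "int \<Rightarrow> nat \<Rightarrow> 'p"
    and \<xi> :: "int \<Rightarrow> nat \<Rightarrow> 'p \<Rightarrow> 'a" and F :: "int set"
  assumes h: "\<And>l. rmod_hom (ob P l) (ob P (l - 1)) (h l)"
    and t: "\<And>l k. k < r l \<Longrightarrow> t l k \<in> carr (ob P l)"
    and xi: "\<And>l k. k < r l \<Longrightarrow> rmod_hom (ob P l) regm (\<xi> l k)"
    and eps_eq: "\<And>l p. p \<in> carr (ob P l) \<Longrightarrow>
      p - df P (l - 1) (h l p) - h (l + 1) (df P l p) = (\<Sum>k<r l. ract (ob P l) (t l k) (\<xi> l k p))"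
    and F: "finite F" "\<And>l. l \<notin> F \<Longrightarrow> r l = 0"
begin

definition eps :: "int \<Rightarrow> 'p \<Rightarrow> 'p" where
  "eps l p = p - df P (l - 1) (h l p) - h (l + 1) (df P l p)"

text \<open>The lift with the idempotent of \<open>B\<close> absorbed. It is still an
  \<open>A\<close>-linear chain endomorphism, so it can be composed with \<open>eps\<close>, which
  is not \<open>B\<close>-linear in general.\<close>

definition Th :: "int \<Rightarrow> 'p \<Rightarrow> 'p" where "Th l p = \<Phi> l (lact (ob P l) bb p)"

text \<open>The Hattori--Stallings trace of the finite type endomorphism \<open>Th \<circ> eps\<close> in degree \<open>l\<close>.\<close>

definition hs_trace :: "int \<Rightarrow> 'a" where "hs_trace l = (\<Sum>k<r l. \<xi> l k (Th l (t l k)))"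

text \<open>The vector \<open>z\<close> for the idempotent \<open>bb\<close>; the alternating sum is
  finite because \<open>hs_trace\<close> vanishes outside \<open>F\<close>.\<close>

definition hs_char :: "nat \<Rightarrow> 'k" where "hs_char w = euler (\<lambda>l. \<chi> w (hs_trace l))"

lemma hs_trace_0: "l \<notin> F \<Longrightarrow> hs_trace l = 0" unfolding hs_trace_def by (simp add: F(2))

lemma hs_char_eq: "w < n \<Longrightarrow> hs_char w = (\<Sum>l\<in>F. signed l (\<chi> w (hs_trace l)))"
  unfolding hs_char_def by (rule euler_superset[OF F(1)]) (simp add: hs_trace_0 chi_0)

lemmas Pb = bcD(1)[OF Pc] and Prm = bcD(5)[OF Pc]

lemma dfP: "rmod_hom (ob P (l - 1)) (ob P l) (df P (l - 1))"
  using bcD(2)[OF Pc, of "l - 1"] by simp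

lemma hP: "rmod_hom (ob P (l + 1)) (ob P l) (h (l + 1))"
  using h[of "l + 1"] by simp

lemma eps_hom: "rmod_hom (ob P l) (ob P l) (eps l)"
  unfolding eps_def
  by (rule hom_plus(2)[OF Prm hom_plus(2)[OF Prm hom_id hom_comp[OF h dfP]] hom_comp[OF bcD(2)[OF Pc] hP]])

lemma eps_endo: "PC.endo eps"
proof (rule PC.endoI)
  fix l p assume p: "p \<in> carr (ob P l)"
  note S = subspD[OF PC.vs PC.V]
  have a: "df P (l - 1) (h l p) \<in> carr (ob P l)" by (rule hom_in[OF dfP hom_in[OF h p]])
  have b: "df P l p \<in> carr (ob P (l + 1))" by (rule PC.d(2)[OF p])
  have c: "h (l + 1) (df P l p) \<in> carr (ob P l)" by (rule hom_in[OF hP b])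
  have "df P l (eps l p) = df P l (p - df P (l - 1) (h l p)) - df P l (h (l + 1) (df P l p))"
    unfolding eps_def by (rule lin_on_diff[OF PC.vs PC.V PC.d(1) S(3)[OF p a] c])
  also have "df P l (p - df P (l - 1) (h l p)) = df P l p - df P l (df P (l - 1) (h l p))"
    by (rule lin_on_diff[OF PC.vs PC.V PC.d(1) p a])
  also have "df P l (df P (l - 1) (h l p)) = 0"
    using PC.dd[OF hom_in[OF h p]] by simp
  finally have 1: "df P l (eps l p) = df P l p - df P l (h (l + 1) (df P l p))" by simp
  have "h (l + 1 + 1) (df P (l + 1) (df P l p)) = 0"
    using PC.dd[OF p] lin_on_0[OF PC.vs PC.V hom_lin[OF h]] by simp
  then have "eps (l + 1) (df P l p) = df P l p - df P l (h (l + 1) (df P l p))"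
    unfolding eps_def by simp
  then show "df P l (eps l p) = eps (l + 1) (df P l p)" using 1 by simp
qed (use hom_lin[OF eps_hom] hom_in[OF eps_hom] in blast)+

text \<open>On cocycles the term \<open>h d\<close> disappears, so \<open>1 - eps\<close> reduces to
  \<open>d h\<close>.\<close>

lemma eps_cyc: "p \<in> PC.cyc l \<Longrightarrow> p - eps l p \<in> PC.bd l"
proof -
  assume "p \<in> PC.cyc l"
  then have p: "p \<in> carr (ob P l)" "df P l p = 0" unfolding PC.cyc_def by simp_all
  have "p - eps l p = df P (l - 1) (h l p)"
    unfolding eps_def p(2) using lin_on_0[OF PC.vs PC.V hom_lin[OF h]] by simp
  then show ?thesis unfolding PC.bd_def using hom_in[OF h p(1)] by blast
qed

lemma Th_endo: "PC.endo Th"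
  unfolding Th_def by (rule PC.endo_comp[OF complex_endos(3)[OF Pc Phi] complex_endos(1)[OF Pc]])

lemma Th_hom: "rmod_hom (ob P l) (ob P l) (Th l)"
  unfolding Th_def by (rule hom_comp[OF bm_hom[OF Pb] cmD(1)[OF Phi]])

lemma Th_eps:
  assumes "p \<in> carr (ob P l)"
  shows "Th l (eps l p) = (\<Sum>k<r l. ract (ob P l) (Th l (t l k)) (\<xi> l k p))"
proof -
  have "Th l (eps l p) = (\<Sum>k<r l. Th l (ract (ob P l) (t l k) (\<xi> l k p)))"
    unfolding eps_def eps_eq[OF assms]
    by (rule lin_on_sum[OF PC.vs PC.V hom_lin[OF Th_hom]]) (use t rmD(3)[OF Prm] in auto)
  also have "\<dots> = (\<Sum>k<r l. ract (ob P l) (Th l (t l k)) (\<xi> l k p))"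
    by (rule sum.cong) (use t hom_ract[OF Th_hom] in auto)
  finally show ?thesis .
qed

lemma Tht: "k < r l \<Longrightarrow> Th l (t l k) \<in> carr (ob P l)"
  by (rule hom_in[OF Th_hom t])

lemma trace_P:
  assumes v: "v < n"
  shows "fr_trace (scl (ob P l)) (carr (ob P l)) (\<lambda>p. ract (ob P l) (Th l (eps l p)) (e v))
     = (\<Sum>w<n. of_int (cart v w) * \<chi> w (hs_trace l))"
proof -
  have "fr_trace (scl (ob P l)) (carr (ob P l)) (\<lambda>p. ract (ob P l) (Th l (eps l p)) (e v))
     = lin_trace sA UNIV (\<lambda>x. (\<Sum>k<r l. \<xi> l k (Th l (t l k))) * x * e v)"
  proof (rule ftype_trace[OF Prm Tht xi])
    fix p assume p: "p \<in> carr (ob P l)"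
    have "ract (ob P l) (Th l (eps l p)) (e v) = (\<Sum>k<r l. ract (ob P l) (ract (ob P l) (Th l (t l k)) (\<xi> l k p)) (e v))"
      unfolding Th_eps[OF p] by (rule rm_sum[OF Prm]) (use Tht rmD(3)[OF Prm] in auto)
    also have "\<dots> = (\<Sum>k<r l. ract (ob P l) (Th l (t l k)) (\<xi> l k p * e v))"
      by (rule sum.cong) (use Tht rmD(6)[OF Prm] in auto)
    finally show "ract (ob P l) (Th l (eps l p)) (e v) = (\<Sum>k<r l. ract (ob P l) (Th l (t l k)) (\<xi> l k p * e v))" .
  qed
  then show ?thesis unfolding hs_trace_def[symmetric] trace_regular[OF v] .
qed

lemma pi_q: "p \<in> carr (ob P l) \<Longrightarrow>
   \<pi> l (ract (ob P l) (lact (ob P l) bb p) c) = ract (ob M l) (lact (ob M l) bb (\<pi> l p)) c"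
  using hom_ract[OF cmD(1)[OF qi(1)] bmD(2)[OF Pb]] cmD(2)[OF qi(1)] by simp

text \<open>The isomorphism \<open>cm\<close> on cohomology intertwines the two operators:
  \<open>\<pi>\<close> respects both actions, and \<open>\<Phi>\<close> lifts \<open>\<phi>\<close>
  up to homotopy. The element \<open>c\<close> of \<open>A\<close> is arbitrary here.\<close>

lemma trace_H:
  "fr_trace (scl (ob M l)) (MC.H l) (\<lambda>x. MC.pr l (\<phi> l (ract (ob M l) (lact (ob M l) bb x) c)))
   = fr_trace (scl (ob P l)) (PC.H l) (\<lambda>x. PC.pr l (\<Phi> l (ract (ob P l) (lact (ob P l) bb x) c)))"
proof -
  define qM where "qM l x = ract (ob M l) (lact (ob M l) bb x) c" for l x
  define qP where "qP l x = ract (ob P l) (lact (ob P l) bb x) c" for l x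
  have qM: "MC.endo qM" unfolding qM_def by (rule MC.endo_comp[OF complex_endos(2,1)[OF Mc]])
  have qP: "PC.endo qP" unfolding qP_def by (rule PC.endo_comp[OF complex_endos(2,1)[OF Pc]])
  define TM where "TM l x = \<phi> l (qM l x)" for l x
  define TP where "TP l x = \<Phi> l (qP l x)" for l x
  have TM: "MC.endo TM" unfolding TM_def by (rule MC.endo_comp[OF complex_endos(3)[OF Mc phi] qM])
  have TP: "PC.endo TP" unfolding TP_def by (rule PC.endo_comp[OF complex_endos(3)[OF Pc Phi] qP])
  obtain hh where hh: "\<And>l. rmod_hom (ob P l) (ob M (l - 1)) (hh l)"
    "\<And>l x. x \<in> carr (ob P l) \<Longrightarrow> \<pi> l (\<Phi> l x) - \<phi> l (\<pi> l x) = df M (l - 1) (hh l x) + hh (l + 1) (df P l x)"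
    using lift unfolding lifts_endomorphism_def by blast
  have diff: "\<pi> l (TP l x) - TM l (\<pi> l x) \<in> MC.bd l" if x: "x \<in> PC.cyc l" for x
  proof -
    have xP: "x \<in> carr (ob P l)" using x PC.cyc_V by blast
    have "qP l x \<in> PC.cyc l" using PC.endoD(5)[OF qP] x by blast
    then have y: "qP l x \<in> carr (ob P l)" "df P l (qP l x) = 0" unfolding PC.cyc_def by simp_all
    have "\<pi> l (TP l x) - TM l (\<pi> l x) = \<pi> l (\<Phi> l (qP l x)) - \<phi> l (\<pi> l (qP l x))"
      unfolding TP_def TM_def qP_def qM_def pi_q[OF xP] ..
    \<comment> \<open>The homotopy is only \<open>A\<close>-linear and is therefore applied after
      both actions. Since \<open>qP l x\<close> is again a cocycle, only the coboundary term
      remains.\<close>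
    also have "\<dots> = df M (l - 1) (hh l (qP l x))"
      using hh(2)[OF y(1)] y(2) lin_on_0[OF PC.vs PC.V hom_lin[OF hh(1)]] by simp
    finally show ?thesis unfolding MC.bd_def using hom_in[OF hh(1) y(1)] by blast
  qed
  have lTP: "lin_on (scl (ob P l)) (PC.H l) (scl (ob P l)) (\<lambda>x. PC.pr l (TP l x))"
    by (rule lin_on_comp[OF lin_on_subset[OF PC.endoD(1)[OF TP] H_P(2)] subset_UNIV pr_lin(2)])
  have iTP: "(\<lambda>x. PC.pr l (TP l x)) ` PC.H l \<subseteq> PC.H l"
    unfolding PC.H_def using PC.endoD(5)[OF TP] H_P(1)[unfolded PC.H_def] by blast
  have HM: "MC.H l \<subseteq> MC.cyc l" "MC.H l \<subseteq> carr (ob M l)" using MC.H_cyc MC.cyc_V by blast+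
  have lTM: "lin_on (scl (ob M l)) (MC.H l) (scl (ob M l)) (\<lambda>x. MC.pr l (TM l x))"
    by (rule lin_on_comp[OF lin_on_subset[OF MC.endoD(1)[OF TM] HM(2)] subset_UNIV pr_lin(1)])
  have iTM: "(\<lambda>x. MC.pr l (TM l x)) ` MC.H l \<subseteq> MC.H l"
    unfolding MC.H_def using MC.endoD(5)[OF TM] HM(1)[unfolded MC.H_def] by blast
  have "lin_trace (scl (ob P l)) (PC.H l) (\<lambda>x. PC.pr l (TP l x)) =
      lin_trace (scl (ob M l)) (cm l ` PC.H l) (\<lambda>x. MC.pr l (TM l x))"
  proof (rule lin_trace_iso[OF PC.vs MC.vs H_P_fdim lin_on_subset[OF cm_lin H_P(2)] _ lTP iTP])
    show "inj_on (cm l) (PC.H l)" using cm_bij unfolding bij_betw_def by blast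
    fix x assume x: "x \<in> PC.H l"
    have xc: "x \<in> PC.cyc l" using H_P(1) x by blast
    have Tc: "TP l x \<in> PC.cyc l" using PC.endoD(5)[OF TP] xc by blast
    have "\<pi> l (PC.pr l (TP l x)) - \<pi> l (TP l x) = \<pi> l (PC.pr l (TP l x) - TP l x)"
    proof (rule lin_on_diff[OF PC.vs PC.V hom_lin[OF cmD(1)[OF qi(1)]], symmetric])
      show "PC.pr l (TP l x) \<in> carr (ob P l)" unfolding PC.pr_def
        using quot_proj_in[OF PC.vs PC.bd_sub PC.cyc_sub PC.bd_cyc Tc] PC.cyc_V by blast
      show "TP l x \<in> carr (ob P l)" using Tc PC.cyc_V by blast
    qed
    also have "\<dots> \<in> MC.bd l"
      by (rule pi_bd) (simp add: PC.pr_def quot_proj_diff(2)[OF PC.vs PC.bd_sub])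
    finally have a: "MC.pr l (\<pi> l (PC.pr l (TP l x))) = MC.pr l (\<pi> l (TP l x))"
      unfolding MC.pr_def using quot_proj_diff(1)[OF MC.vs MC.bd_sub] by blast
    have b: "MC.pr l (\<pi> l (TP l x)) = MC.pr l (TM l (\<pi> l x))"
      using diff[OF xc] unfolding MC.pr_def using quot_proj_diff(1)[OF MC.vs MC.bd_sub] by blast
    have c: "MC.pr l (TM l (MC.pr l (\<pi> l x))) = MC.pr l (TM l (\<pi> l x))"
      unfolding MC.pr_def
      by (rule quot_proj_cong[OF MC.vs MC.bd_sub MC.cyc_sub MC.bd_cyc pi_cyc[OF xc] MC.endoD(4,6)[OF TM]])
    show "MC.pr l (TM l (cm l x)) = cm l (PC.pr l (TP l x))"
      unfolding cm_def a b c ..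
  qed
  also have "cm l ` PC.H l = MC.H l" using cm_bij unfolding bij_betw_def by blast
  finally have "fr_trace (scl (ob M l)) (MC.H l) (\<lambda>x. MC.pr l (TM l x)) = fr_trace (scl (ob P l)) (PC.H l) (\<lambda>x. PC.pr l (TP l x))"
    unfolding fr_trace_fdim[OF MC.vs H_M_fdim lTM iTM] fr_trace_fdim[OF PC.vs H_P_fdim lTP iTP] ..
  then show ?thesis unfolding TM_def TP_def qM_def qP_def .
qed

text \<open>The trace travels from \<open>M\<close> to its cohomology, across the quasi-isomorphism
  to the cohomology of \<open>P\<close>, and from there to \<open>P\<close> itself. The Hopf formula
  is used at both ends; on \<open>P\<close> it requires the finite rank operator \<open>T\<close> in
  place of the lift \<open>TP\<close>.\<close>

lemma trace_M:
  assumes v: "v < n"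
  shows "euler (\<lambda>l. lin_trace (scl (ob M l)) ((\<lambda>x. ract (ob M l) (lact (ob M l) bb x) (e v)) ` carr (ob M l)) (\<phi> l))
    = (\<Sum>w<n. of_int (cart v w) * hs_char w)"
proof -
  note Mb = bcD(1)[OF Mc] and Mrm = bcD(5)[OF Mc]
  have bbM: "lact (ob M l) bb (lact (ob M l) bb x) = lact (ob M l) bb x" if "x \<in> carr (ob M l)" for l x
    using bmD(5)[OF Mb that, of bb bb] bb by simp
  define qM where "qM l x = ract (ob M l) (lact (ob M l) bb x) (e v)" for l x
  have qM: "MC.endo qM" unfolding qM_def by (rule MC.endo_comp[OF complex_endos(2,1)[OF Mc]])
  define TM where "TM l x = \<phi> l (qM l x)" for l x
  have TM: "MC.endo TM" unfolding TM_def by (rule MC.endo_comp[OF complex_endos(3)[OF Mc phi] qM])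
  note fphi = complex_endos(3)[OF Mc phi]
  have 1: "lin_trace (scl (ob M l)) (qM l ` carr (ob M l)) (\<phi> l) = fr_trace (scl (ob M l)) (carr (ob M l)) (TM l)" for l
    unfolding TM_def
  proof (rule lin_trace_idem[OF MC.vs MC.V MC.endoD(1)[OF qM]])
    show "qM l ` carr (ob M l) \<subseteq> carr (ob M l)" using MC.endoD(2)[OF qM] by blast
    show "fdim (scl (ob M l)) (qM l ` carr (ob M l))" by (rule fdim_image[OF MC.vs MC.vs M_fdim MC.endoD(1)[OF qM]])
    show "lin_on (scl (ob M l)) (carr (ob M l)) (scl (ob M l)) (\<phi> l)" by (rule MC.endoD(1)[OF fphi])
    show "\<phi> l ` carr (ob M l) \<subseteq> carr (ob M l)" using MC.endoD(2)[OF fphi] by blast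
    fix x assume x: "x \<in> carr (ob M l)"
    have bx: "lact (ob M l) bb x \<in> carr (ob M l)" by (rule bmD(2)[OF Mb x])
    show "qM l (qM l x) = qM l x"
      unfolding qM_def bmD(7)[OF Mb bx, symmetric] bbM[OF x] rmD(6)[OF Mrm bx, symmetric] e_idem[OF v] ..
    show "qM l (\<phi> l x) = \<phi> l (qM l x)"
      unfolding qM_def using cmD(2)[OF phi x] hom_ract[OF cmD(1)[OF phi] bx] by simp
  qed
  have fT: "fdim (scl (ob M l)) (TM l ` carr (ob M l))" for l
    by (rule fdim_image[OF MC.vs MC.vs M_fdim MC.endoD(1)[OF TM]])
  have fin: "finite {l. \<exists>x\<in>carr (ob M l). TM l x \<noteq> 0}"
  proof (rule finite_subset)
    show "finite {l. carr (ob M l) \<noteq> {0}}" using M unfolding bounded_fd_complex_def by blast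
    show "{l. \<exists>x\<in>carr (ob M l). TM l x \<noteq> 0} \<subseteq> {l. carr (ob M l) \<noteq> {0}}"
      using MC.endoD(7)[OF TM] by auto
  qed
  define qP where "qP l x = ract (ob P l) (lact (ob P l) bb x) (e v)" for l x
  have qP: "PC.endo qP" unfolding qP_def by (rule PC.endo_comp[OF complex_endos(2,1)[OF Pc]])
  define TP where "TP l x = \<Phi> l (qP l x)" for l x
  have TP: "PC.endo TP" unfolding TP_def by (rule PC.endo_comp[OF complex_endos(3)[OF Pc Phi] qP])
  define T where "T l x = TP l (eps l x)" for l x
  have T: "PC.endo T" unfolding T_def by (rule PC.endo_comp[OF TP eps_endo])
  have Teq: "T l p = ract (ob P l) (Th l (eps l p)) (e v)" if p: "p \<in> carr (ob P l)" for l p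
    unfolding T_def TP_def qP_def Th_def
    using hom_ract[OF cmD(1)[OF Phi] bmD(2)[OF Pb PC.endoD(2)[OF eps_endo p]]] by simp
  have ft: "ftype (ob P l) (ob P l) (eps l)" for l
    by (rule ftypeI[of "r l" "t l" _ _ "\<xi> l"]) (use t xi eps_eq in \<open>auto simp: eps_def\<close>)
  have fP: "fdim (scl (ob P l)) (T l ` carr (ob P l))" for l
  proof -
    obtain U where U: "fdim (scl (ob P l)) U" "eps l ` carr (ob P l) \<subseteq> U" "U \<subseteq> carr (ob P l)"
      using ftype_fdim[OF ft Prm] by blast
    show ?thesis
      by (rule fdim_subset[OF PC.vs fdim_image[OF PC.vs PC.vs U(1) lin_on_subset[OF PC.endoD(1)[OF TP] U(3)]]
          lin_on_image[OF PC.vs PC.vs PC.V PC.endoD(1)[OF T]]])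
        (use U(2) in \<open>auto simp: T_def\<close>)
  qed
  have T0: "T l p = 0" if "l \<notin> F" "p \<in> carr (ob P l)" for l p
  proof -
    have "eps l p = 0" unfolding eps_def eps_eq[OF that(2)] F(2)[OF that(1)] by simp
    then show ?thesis unfolding T_def using PC.endoD(7)[OF TP] by simp
  qed
  have finP: "finite {l. \<exists>x\<in>carr (ob P l). T l x \<noteq> 0}"
    by (rule finite_subset[OF _ F(1)]) (use T0 in blast)
  \<comment> \<open>Correcting by \<open>eps\<close> is invisible on cohomology, because
    \<open>TP\<close> preserves coboundaries.\<close>
  have 2: "fr_trace (scl (ob P l)) (PC.H l) (\<lambda>x. PC.pr l (TP l x)) = fr_trace (scl (ob P l)) (PC.H l) (\<lambda>x. PC.pr l (T l x))" for l
  proof (rule fr_trace_cong[OF PC.vs])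
    have lTP: "lin_on (scl (ob P l)) (PC.H l) (scl (ob P l)) (\<lambda>x. PC.pr l (TP l x))"
      by (rule lin_on_comp[OF lin_on_subset[OF PC.endoD(1)[OF TP] H_P(2)] subset_UNIV pr_lin(2)])
    show "fdim (scl (ob P l)) ((\<lambda>x. PC.pr l (TP l x)) ` PC.H l)"
      by (rule fdim_image[OF PC.vs PC.vs H_P_fdim lTP])
    show "(\<lambda>x. PC.pr l (TP l x)) ` PC.H l \<subseteq> PC.H l"
      unfolding PC.H_def using PC.endoD(5)[OF TP] H_P(1)[unfolded PC.H_def] by blast
    fix x assume "x \<in> PC.H l"
    then have x: "x \<in> PC.cyc l" "x \<in> carr (ob P l)" using H_P by blast+
    have "TP l x - T l x = TP l (x - eps l x)"
      unfolding T_def by (rule lin_on_diff[OF PC.vs PC.V PC.endoD(1)[OF TP] x(2) PC.endoD(2)[OF eps_endo x(2)], symmetric])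
    also have "\<dots> \<in> PC.bd l" using PC.endoD(6)[OF TP] eps_cyc[OF x(1)] by blast
    finally show "PC.pr l (TP l x) = PC.pr l (T l x)"
      unfolding PC.pr_def using quot_proj_diff(1)[OF PC.vs PC.bd_sub] by blast
  qed
  have 3: "fr_trace (scl (ob P l)) (carr (ob P l)) (T l) = (\<Sum>w<n. of_int (cart v w) * \<chi> w (hs_trace l))" for l
  proof -
    have "fr_trace (scl (ob P l)) (carr (ob P l)) (T l) = fr_trace (scl (ob P l)) (carr (ob P l)) (\<lambda>p. ract (ob P l) (Th l (eps l p)) (e v))"
      by (rule fr_trace_cong[OF PC.vs fP]) (use PC.endoD(2)[OF T] Teq in auto)
    then show ?thesis unfolding trace_P[OF v] .
  qed
  have "euler (\<lambda>l. lin_trace (scl (ob M l)) (qM l ` carr (ob M l)) (\<phi> l))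
      = euler (\<lambda>l. fr_trace (scl (ob M l)) (MC.H l) (\<lambda>x. MC.pr l (TM l x)))"
    unfolding 1 by (rule MC.hopf_trace[OF TM fT fin])
  also have "\<dots> = euler (\<lambda>l. fr_trace (scl (ob P l)) (PC.H l) (\<lambda>x. PC.pr l (TP l x)))"
    unfolding TM_def TP_def qM_def qP_def trace_H ..
  also have "\<dots> = euler (\<lambda>l. fr_trace (scl (ob P l)) (carr (ob P l)) (T l))"
    unfolding 2 by (rule PC.hopf_trace[OF T fP finP, symmetric])
  also have "\<dots> = (\<Sum>l\<in>F. signed l (\<Sum>w<n. of_int (cart v w) * \<chi> w (hs_trace l)))"
    unfolding 3 by (rule euler_superset[OF F(1)]) (auto simp: hs_trace_0 chi_0 intro!: sum.neutral)
  also have "\<dots> = (\<Sum>l\<in>F. \<Sum>w<n. of_int (cart v w) * signed l (\<chi> w (hs_trace l)))"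
    by (rule sum.cong) (auto simp: signed_def sum_negf[symmetric])
  also have "\<dots> = (\<Sum>w<n. of_int (cart v w) * hs_char w)"
    by (subst sum.swap) (simp add: hs_char_eq sum_distrib_left)
  finally show ?thesis unfolding qM_def .
qed

text \<open>Chain endomorphisms that are also \<open>A\<close>-linear: exactly those that act on the
  Hom and tensor complexes over \<open>A\<close>.\<close>

definition P_endo :: "(int \<Rightarrow> 'p \<Rightarrow> 'p) \<Rightarrow> bool" where
  "P_endo \<alpha> \<longleftrightarrow> PC.endo \<alpha> \<and> (\<forall>l. rmod_hom (ob P l) (ob P l) (\<alpha> l))"

lemma P_endoD: "P_endo \<alpha> \<Longrightarrow> rmod_hom (ob P l) (ob P l) (\<alpha> l)"
  "P_endo \<alpha> \<Longrightarrow> x \<in> carr (ob P l) \<Longrightarrow> df P l (\<alpha> l x) = \<alpha> (l + 1) (df P l x)"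
  "P_endo \<alpha> \<Longrightarrow> x \<in> carr (ob P l) \<Longrightarrow> \<alpha> l x \<in> carr (ob P l)"
  unfolding P_endo_def using PC.endoD(2,3) by blast+

lemma P_endo_id: "P_endo (\<lambda>i x. x)" unfolding P_endo_def
  by (intro conjI allI hom_id PC.endoI) (auto simp: lin_on_id)

lemma P_endo_comp: "P_endo \<alpha> \<Longrightarrow> P_endo \<alpha>' \<Longrightarrow> P_endo (\<lambda>i x. \<alpha> i (\<alpha>' i x))"
  unfolding P_endo_def using PC.endo_comp hom_comp by blast

lemma P_endo_eps: "P_endo eps" unfolding P_endo_def using eps_endo eps_hom by blast

lemma P_endo_Th: "P_endo Th" unfolding P_endo_def using Th_endo Th_hom by blast

lemma P_endo_Phi: "P_endo \<Phi>" unfolding P_endo_def using complex_endos(3)[OF Pc Phi] cmD(1)[OF Phi] by blast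

lemma P_endo_bb: "P_endo (\<lambda>l. lact (ob P l) bb)" unfolding P_endo_def using complex_endos(1)[OF Pc] bm_hom[OF Pb] by blast

end

section \<open>Traces on Ext\<close>

lemma signed_signed: "signed (i + l) x = signed i (signed l x)" "signed (- i) x = signed i x"
  by (auto simp: signed_def)

lemma signed_sum: "signed l (sum f I) = (\<Sum>i\<in>I. signed l (f i))"
  by (simp add: signed_def sum_negf)

lemma signed_mult: "signed l (c * x) = c * signed l (x::'k::field)"
  by (simp add: signed_def)

lemma euler_shift_int:
  assumes "finite {l. G l \<noteq> (0::'k::field)}"
  shows "euler (\<lambda>l. G (i + l)) = signed i (euler G)" "finite {l. G (i + l) \<noteq> 0}"
proof -
  define S where "S = {l. G l \<noteq> 0}"
  have fin: "finite S" using assms unfolding S_def .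
  have sub: "{l. G (i + l) \<noteq> 0} \<subseteq> (\<lambda>s. s - i) ` S" by (force simp: S_def image_iff)
  then show "finite {l. G (i + l) \<noteq> 0}" using fin finite_subset by blast
  have "euler (\<lambda>l. G (i + l)) = (\<Sum>l\<in>(\<lambda>s. s - i) ` S. signed l (G (i + l)))"
    by (rule euler_superset) (use fin sub in auto)
  also have "\<dots> = (\<Sum>s\<in>S. signed (s - i) (G s))"
    by (subst sum.reindex) (auto simp: inj_on_def)
  also have "\<dots> = (\<Sum>s\<in>S. signed i (signed s (G s)))"
    by (rule sum.cong) (auto simp: signed_def)
  also have "\<dots> = signed i (euler G)"
    unfolding signed_sum[symmetric] by (subst euler_superset[OF fin]) (auto simp: S_def)
  finally show "euler (\<lambda>l. G (i + l)) = signed i (euler G)" .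
qed

lemma euler_sum:
  assumes "finite I" "\<And>i. i \<in> I \<Longrightarrow> finite {l. G i l \<noteq> (0::'k::field)}"
  shows "euler (\<lambda>l. \<Sum>i\<in>I. G i l) = (\<Sum>i\<in>I. euler (G i))"
proof -
  define S where "S = (\<Union>i\<in>I. {l. G i l \<noteq> 0})"
  have S: "finite S" unfolding S_def using assms by blast
  have 1: "euler (G i) = (\<Sum>l\<in>S. signed l (G i l))" if "i \<in> I" for i
    by (rule euler_superset[OF S]) (use that in \<open>auto simp: S_def\<close>)
  have "euler (\<lambda>l. \<Sum>i\<in>I. G i l) = (\<Sum>l\<in>S. signed l (\<Sum>i\<in>I. G i l))"
    by (rule euler_superset[OF S]) (auto simp: S_def intro!: sum.neutral)
  also have "\<dots> = (\<Sum>i\<in>I. \<Sum>l\<in>S. signed l (G i l))"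
    unfolding signed_sum by (rule sum.swap)
  finally show ?thesis using 1 by simp
qed

lemma euler_scale:
  assumes "finite {l. G l \<noteq> (0::'k::field)}"
  shows "euler (\<lambda>l. c * G l) = c * euler G" "finite {l. c * G l \<noteq> 0}"
proof -
  show "finite {l. c * G l \<noteq> 0}" by (rule finite_subset[OF _ assms]) auto
  have "euler (\<lambda>l. c * G l) = (\<Sum>l\<in>{l. G l \<noteq> 0}. signed l (c * G l))"
    by (rule euler_superset[OF assms]) simp
  also have "\<dots> = c * euler G"
    unfolding signed_mult sum_distrib_left[symmetric] by (subst euler_superset[OF assms]) auto
  finally show "euler (\<lambda>l. c * G l) = c * euler G" .
qed

text \<open>The sign of \<open>l\<close> is the product of the signs of \<open>i\<close> and of the
  shifted degree, so the double sum factors. Components of Hom land in \<open>N\<close> of degree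
  \<open>i + l\<close>, those of the tensor product in degree \<open>l - i\<close>; only the parity
  of the shift matters.\<close>

lemma euler_convolution:
  assumes "finite F" "finite I" and y: "\<And>v. v \<in> I \<Longrightarrow> finite {l. y v l \<noteq> (0::'k::field)}"
  shows "euler (\<lambda>l. \<Sum>i\<in>F. \<Sum>v\<in>I. c v i * y v (i + l)) = (\<Sum>v\<in>I. (\<Sum>i\<in>F. signed i (c v i)) * euler (y v))"
    and "euler (\<lambda>l. \<Sum>i\<in>F. \<Sum>v\<in>I. c v i * y v (- i + l)) = (\<Sum>v\<in>I. (\<Sum>i\<in>F. signed i (c v i)) * euler (y v))"
proof -
  have gen: "euler (\<lambda>l. \<Sum>i\<in>F. \<Sum>v\<in>I. c v i * y v (\<epsilon> i + l)) = (\<Sum>v\<in>I. (\<Sum>i\<in>F. signed i (c v i)) * euler (y v))"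
    if \<epsilon>: "\<And>i x. signed (\<epsilon> i) x = signed i (x::'k)" for \<epsilon> :: "int \<Rightarrow> int"
  proof -
    have f: "finite {l. c v i * y v (\<epsilon> i + l) \<noteq> 0}" if "v \<in> I" for v i
      by (rule euler_scale(2)[OF euler_shift_int(2)[OF y[OF that]]])
    have "euler (\<lambda>l. \<Sum>i\<in>F. \<Sum>v\<in>I. c v i * y v (\<epsilon> i + l)) = (\<Sum>i\<in>F. euler (\<lambda>l. \<Sum>v\<in>I. c v i * y v (\<epsilon> i + l)))"
    proof (rule euler_sum[OF assms(1)])
      fix i
      show "finite {l. (\<Sum>v\<in>I. c v i * y v (\<epsilon> i + l)) \<noteq> 0}"
      proof (rule finite_subset)
        show "finite (\<Union>v\<in>I. {l. c v i * y v (\<epsilon> i + l) \<noteq> 0})" using f assms(2) by blast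
        show "{l. (\<Sum>v\<in>I. c v i * y v (\<epsilon> i + l)) \<noteq> 0} \<subseteq> (\<Union>v\<in>I. {l. c v i * y v (\<epsilon> i + l) \<noteq> 0})"
        proof
          fix l assume "l \<in> {l. (\<Sum>v\<in>I. c v i * y v (\<epsilon> i + l)) \<noteq> 0}"
          then have "(\<Sum>v\<in>I. c v i * y v (\<epsilon> i + l)) \<noteq> 0" by simp
          then obtain v where "v \<in> I" "c v i * y v (\<epsilon> i + l) \<noteq> 0" by (rule sum.not_neutral_contains_not_neutral)
          then show "l \<in> (\<Union>v\<in>I. {l. c v i * y v (\<epsilon> i + l) \<noteq> 0})" by blast
        qed
      qed
    qed
    also have "\<dots> = (\<Sum>i\<in>F. \<Sum>v\<in>I. euler (\<lambda>l. c v i * y v (\<epsilon> i + l)))"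
      by (rule sum.cong[OF refl], rule euler_sum[OF assms(2) f])
    also have "\<dots> = (\<Sum>i\<in>F. \<Sum>v\<in>I. signed i (c v i) * euler (y v))"
    proof (intro sum.cong refl)
      fix i v assume v: "v \<in> I"
      have "euler (\<lambda>l. c v i * y v (\<epsilon> i + l)) = c v i * signed i (euler (y v))"
        unfolding euler_scale(1)[OF euler_shift_int(2)[OF y[OF v]]] euler_shift_int(1)[OF y[OF v]] \<epsilon> ..
      then show "euler (\<lambda>l. c v i * y v (\<epsilon> i + l)) = signed i (c v i) * euler (y v)"
        by (simp add: signed_def)
    qed
    also have "\<dots> = (\<Sum>v\<in>I. (\<Sum>i\<in>F. signed i (c v i)) * euler (y v))"
      by (subst sum.swap) (simp add: sum_distrib_right)
    finally show ?thesis .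
  qed
  show "euler (\<lambda>l. \<Sum>i\<in>F. \<Sum>v\<in>I. c v i * y v (i + l)) = (\<Sum>v\<in>I. (\<Sum>i\<in>F. signed i (c v i)) * euler (y v))"
    using gen[of "\<lambda>i. i"] by simp
  show "euler (\<lambda>l. \<Sum>i\<in>F. \<Sum>v\<in>I. c v i * y v (- i + l)) = (\<Sum>v\<in>I. (\<Sum>i\<in>F. signed i (c v i)) * euler (y v))"
    by (rule gen[OF signed_signed(2)])
qed

lemma (in fd_alg) hom_neg:
  assumes "right_module sA Y" "rmod_hom X Y f"
  shows "rmod_hom X Y (\<lambda>x. - f x)"
  by (rule homI[OF lin_on_plus(3)[OF rmD(1)[OF assms(1)] hom_lin[OF assms(2)] hom_lin[OF assms(2)]]])
    (use assms in \<open>simp_all add: hom_in hom_ract subspD(4)[OF rmD(1,2)] lin_on_neg[OF rmD(1) rmD(2) rm_lin]\<close>)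

text \<open>Moves the two idempotents of a matrix entry into the operator, so that the trace is
  taken on the full module, where \<open>trace_action\<close> applies.\<close>

lemma (in fd_alg) bimodule_trace:
  assumes X: "bimodule sS sA X" and f: "fdim (scl X) (carr X)" and \<phi>: "bimod_hom X X \<phi>"
    and b: "b * b = b" and c: "c * c = c"
  shows "lin_trace (scl X) ((\<lambda>x. ract X (lact X b x) c) ` carr X) \<phi>
    = lin_trace (scl X) (carr X) (\<lambda>x. ract X (\<phi> (lact X b x)) c)"
proof -
  note rm = bmD(1)[OF X]
  note v = rmD(1)[OF rm] and s = rmD(2)[OF rm]
  have hom: "rmod_hom X X \<phi>" and comm: "\<And>x s. x \<in> carr X \<Longrightarrow> \<phi> (lact X s x) = lact X s (\<phi> x)"
    using \<phi> unfolding bimod_hom_def by simp_all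
  let ?q = "\<lambda>x. ract X (lact X b x) c"
  have bx: "lact X b x \<in> carr X" if "x \<in> carr X" for x by (rule bmD(2)[OF X that])
  have q: "lin_on (scl X) (carr X) (scl X) ?q"
    by (rule lin_on_comp[OF hom_lin[OF bm_hom[OF X]] _ rm_lin[OF rm]]) (use bx in auto)
  have qX: "?q x \<in> carr X" if "x \<in> carr X" for x by (rule rmD(3)[OF rm bx[OF that]])
  have l: "lin_on (scl X) (carr X) (scl X) (\<lambda>x. \<phi> (?q x))"
    by (rule lin_on_comp[OF q _ hom_lin[OF hom]]) (use qX in auto)
  have "lin_trace (scl X) (?q ` carr X) \<phi> = fr_trace (scl X) (carr X) (\<lambda>x. \<phi> (?q x))"
  proof (rule lin_trace_idem[OF v s q])
    show "?q ` carr X \<subseteq> carr X" using qX by blast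
    show "fdim (scl X) (?q ` carr X)" by (rule fdim_image[OF v v f q])
    show "lin_on (scl X) (carr X) (scl X) \<phi>" by (rule hom_lin[OF hom])
    show "\<phi> ` carr X \<subseteq> carr X" using hom_in[OF hom] by blast
    fix x assume x: "x \<in> carr X"
    have bb: "lact X b (lact X b x) = lact X b x" using bmD(5)[OF X x, of b b] b by simp
    show "?q (?q x) = ?q x"
      unfolding bmD(7)[OF X bx[OF x], symmetric] bb rmD(6)[OF rm bx[OF x], symmetric] c ..
    show "?q (\<phi> x) = \<phi> (?q x)" using comm[OF x] hom_ract[OF hom bx[OF x]] by simp
  qed
  also have "\<dots> = lin_trace (scl X) (carr X) (\<lambda>x. \<phi> (?q x))"
    by (rule fr_trace_fdim[OF v f l]) (use qX hom_in[OF hom] in auto)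
  also have "\<dots> = lin_trace (scl X) (carr X) (\<lambda>x. ract X (\<phi> (lact X b x)) c)"
    by (rule lin_trace_cong[OF v f]) (use hom_ract[OF hom bx] in auto)
  finally show ?thesis .
qed

locale ext_data = fin_data sA n e \<chi> sB M \<phi> P \<pi> \<Phi> bb h r t \<xi> F
  for sA :: "'k::field \<Rightarrow> 'a::{ring,monoid_mult} \<Rightarrow> 'a" and n e \<chi>
    and sB :: "'k \<Rightarrow> 'b::{ring,monoid_mult} \<Rightarrow> 'b" and M :: "('k, 'a, 'm::ab_group_add, 'b) cpx" and \<phi>
    and P :: "('k, 'a, 'p::ab_group_add, 'b) cpx" and \<pi> \<Phi> and bb :: 'b
    and h :: "int \<Rightarrow> 'p \<Rightarrow> 'p" and r :: "int \<Rightarrow> nat" and t :: "int \<Rightarrow> nat \<Rightarrow> 'p"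
    and \<xi> :: "int \<Rightarrow> nat \<Rightarrow> 'p \<Rightarrow> 'a" and F :: "int set" +
  fixes sC :: "'k \<Rightarrow> 'c::{ring,monoid_mult} \<Rightarrow> 'c" and N :: "('k, 'a, 'n::ab_group_add, 'c) cpx" and \<psi> and gg :: 'c
  assumes N: "bounded_fd_complex sC sA N" and psi: "chain_map N N \<psi>" and gg: "gg * gg = gg"
begin

lemma Nc: "bimodule_complex sC sA N" using N unfolding bounded_fd_complex_def by blast

sublocale NC: vs_complex "\<lambda>l. scl (ob N l)" "\<lambda>l. carr (ob N l)" "df N" by (rule complex_vs[OF Nc])

lemma N_fdim: "fdim (scl (ob N l)) (carr (ob N l))"
  using N fin_dim_fdim[OF NC.vs] unfolding bounded_fd_complex_def by blast

lemmas Nb = bcD(1)[OF Nc] and Nrm = bcD(5)[OF Nc]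

abbreviation K where "K \<equiv> hom_cpx P N"

lemma carr_K: "f \<in> carr (ob K l) \<longleftrightarrow> (\<forall>i. rmod_hom (ob P i) (ob N (i + l)) (f i) \<and> (\<forall>x. x \<notin> carr (ob P i) \<longrightarrow> f i x = 0))"
  by (simp add: hom_cpx_def)

lemma KI:
  assumes "\<And>i. rmod_hom (ob P i) (ob N (i + l)) (f i)" "\<And>i x. x \<notin> carr (ob P i) \<Longrightarrow> f i x = 0"
  shows "f \<in> carr (ob K l)"
  unfolding carr_K using assms by blast

lemma KD:
  assumes "f \<in> carr (ob K l)"
  shows "rmod_hom (ob P i) (ob N (i + l)) (f i)" "x \<notin> carr (ob P i) \<Longrightarrow> f i x = 0"
  using assms unfolding carr_K by blast+

text \<open>Elements of \<open>hom_cpx\<close> are normalised to vanish outside the carriers; the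
  truncation is harmless because a homomorphism is only tested on the carrier.\<close>

lemma hom_if:
  assumes "rmod_hom (ob P i) Y f"
  shows "rmod_hom (ob P i) Y (\<lambda>x. if x \<in> carr (ob P i) then f x else 0)"
  using assms subspD(2,5)[OF PC.vs PC.V] rmD(3)[OF Prm] unfolding rmod_hom_def by simp

lemma scl_K: "scl (ob K l) c f i x = scl (ob N (i + l)) c (f i x)"
  by (simp add: hom_cpx_def)

lemma df_K: "df K l f i x = (if x \<in> carr (ob P i) then df N (i + l) (f i x) - signed l (f (i + 1) (df P i x)) else 0)"
  by (simp add: hom_cpx_def signed_def)

lemma hom_signed: "rmod_hom X (ob N j) f \<Longrightarrow> rmod_hom X (ob N j) (\<lambda>x. signed l (f x))"
  using hom_neg[OF Nrm[of j]] by (cases "even l") (simp_all add: signed_def)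

lemma dfN_shift: "rmod_hom (ob N (i + l)) (ob N (i + (l + 1))) (df N (i + l))"
  using bcD(2)[OF Nc, of "i + l"] by (simp add: add.assoc)

lemma K_next: "f \<in> carr (ob K l) \<Longrightarrow> rmod_hom (ob P i) (ob N (i + (l + 1))) (\<lambda>x. f (i + 1) (df P i x))"
  using hom_comp[OF bcD(2)[OF Pc, of i] KD(1)[of f l "i + 1"]] by (simp add: algebra_simps)

lemma scl_signed: "scl (ob N j) c (signed l x) = signed l (scl (ob N j) c x)"
  using module.scale_minus_right[OF NC.vs[of j, folded module_iff_vector_space]] by (simp add: signed_def)

lemma K_vs: "vs_complex (\<lambda>l. scl (ob K l)) (\<lambda>l. carr (ob K l)) (df K)"
proof (rule vs_complex.intro)
  fix l
  show vs: "vector_space (scl (ob K l))"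
  proof
    fix a b and x y :: "int \<Rightarrow> 'p \<Rightarrow> 'n"
    note v = NC.vs[folded module_iff_vector_space]
    show "scl (ob K l) a (x + y) = scl (ob K l) a x + scl (ob K l) a y"
      by (intro ext) (simp add: scl_K module.scale_right_distrib[OF v])
    show "scl (ob K l) (a + b) x = scl (ob K l) a x + scl (ob K l) b x"
      by (intro ext) (simp add: scl_K module.scale_left_distrib[OF v])
    show "scl (ob K l) a (scl (ob K l) b x) = scl (ob K l) (a * b) x"
      by (intro ext) (simp add: scl_K module.scale_scale[OF v])
    show "scl (ob K l) 1 x = x"
      by (intro ext) (simp add: scl_K module.scale_one[OF v])
  qed
  show "subsp (scl (ob K l)) (carr (ob K l))"
  proof (rule subspI[OF vs])
    show "0 \<in> carr (ob K l)"
      by (rule KI) (use hom_zero[OF Prm Nrm] in \<open>simp_all add: zero_fun_def\<close>)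
    show "f + g \<in> carr (ob K l)" if f: "f \<in> carr (ob K l)" and g: "g \<in> carr (ob K l)" for f g
      by (rule KI) (use hom_plus(1)[OF Nrm KD(1)[OF f] KD(1)[OF g]] KD(2)[OF f] KD(2)[OF g] in \<open>simp_all add: plus_fun_def\<close>)
    show "scl (ob K l) c f \<in> carr (ob K l)" if f: "f \<in> carr (ob K l)" for c f
    proof (rule KI)
      fix i
      show "rmod_hom (ob P i) (ob N (i + l)) (scl (ob K l) c f i)"
        by (rule homI) (use hom_in[OF KD(1)[OF f]] hom_ract[OF KD(1)[OF f]] in
          \<open>simp_all add: scl_K subspD(5)[OF NC.vs NC.V] rm_scale[OF Nrm] lin_on_scaled[OF NC.vs hom_lin[OF KD(1)[OF f]], unfolded lin_on_def] lin_on_def\<close>)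
      show "scl (ob K l) c f i x = 0" if "x \<notin> carr (ob P i)" for x
        using KD(2)[OF f that] module.scale_zero_right[OF NC.vs[folded module_iff_vector_space]] by (simp add: scl_K)
    qed
  qed
  show "lin_on (scl (ob K l)) (carr (ob K l)) (scl (ob K (l + 1))) (df K l)"
  proof (rule lin_onI)
    fix f g assume f: "f \<in> carr (ob K l)" and g: "g \<in> carr (ob K l)"
    show "df K l (f + g) = df K l f + df K l g"
    proof (intro ext)
      fix i x
      have "df N (i + l) (f i x + g i x) = df N (i + l) (f i x) + df N (i + l) (g i x)" if "x \<in> carr (ob P i)"
        by (rule lin_on_add[OF NC.d(1) hom_in[OF KD(1)[OF f] that] hom_in[OF KD(1)[OF g] that]])
      then show "df K l (f + g) i x = (df K l f + df K l g) i x" by (simp add: df_K)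
    qed
  next
    fix c f assume f: "f \<in> carr (ob K l)"
    note sd = module.scale_right_diff_distrib[OF NC.vs[folded module_iff_vector_space]]
    show "df K l (scl (ob K l) c f) = scl (ob K (l + 1)) c (df K l f)"
    proof (intro ext)
      fix i x
      have e: "i + 1 + l = i + (l + 1)" by simp
      have "df N (i + l) (scl (ob N (i + l)) c (f i x)) = scl (ob N (i + (l + 1))) c (df N (i + l) (f i x))" if "x \<in> carr (ob P i)"
        by (rule lin_on_scale[OF hom_lin[OF dfN_shift] hom_in[OF KD(1)[OF f] that]])
      then show "df K l (scl (ob K l) c f) i x = scl (ob K (l + 1)) c (df K l f) i x"
        using module.scale_zero_right[OF NC.vs[folded module_iff_vector_space]] unfolding df_K scl_K e by (simp add: sd scl_signed)
    qed
  qed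
  fix f assume f: "f \<in> carr (ob K l)"
  show dfK: "df K l f \<in> carr (ob K (l + 1))"
  proof (rule KI)
    fix i
    have "rmod_hom (ob P i) (ob N (i + (l + 1))) (\<lambda>x. if x \<in> carr (ob P i) then df N (i + l) (f i x) - signed l (f (i + 1) (df P i x)) else 0)"
      by (rule hom_if[OF hom_plus(2)[OF Nrm hom_comp[OF KD(1)[OF f] dfN_shift] hom_signed[OF K_next[OF f]]]])
    then show "rmod_hom (ob P i) (ob N (i + (l + 1))) (df K l f i)" by (simp add: df_K[abs_def])
  qed (simp add: df_K)
  \<comment> \<open>Apart from the squares of the two differentials, the mixed term
    \<open>d f d\<close> occurs twice, with the opposite signs belonging to \<open>l\<close> and
    \<open>l + 1\<close>.\<close>
  show "df K (l + 1) (df K l f) = 0"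
  proof (intro ext)
    fix i x
    show "df K (l + 1) (df K l f) i x = (0 :: int \<Rightarrow> 'p \<Rightarrow> 'n) i x"
    proof (cases "x \<in> carr (ob P i)")
      case True
      have dx: "df P i x \<in> carr (ob P (i + 1))" by (rule PC.d(2)[OF True])
      have y: "f i x \<in> carr (ob N (i + l))" by (rule hom_in[OF KD(1)[OF f] True])
      have z: "f (i + 1) (df P i x) \<in> carr (ob N (i + l + 1))" using hom_in[OF K_next[OF f] True] by (simp add: add.assoc)
      have sz: "signed l (f (i + 1) (df P i x)) \<in> carr (ob N (i + l + 1))"
        using z subspD(4)[OF NC.vs NC.V z] by (simp add: signed_def)
      have "f (i + 1 + 1) (df P (i + 1) (df P i x)) = 0"
        unfolding PC.dd[OF True] by (rule lin_on_0[OF PC.vs PC.V hom_lin[OF KD(1)[OF f]]])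
      then have 1: "df K l f (i + 1) (df P i x) = df N (i + l + 1) (f (i + 1) (df P i x))"
        using dx by (simp add: df_K algebra_simps)
      have "df N (i + l + 1) (df K l f i x) = df N (i + l + 1) (df N (i + l) (f i x)) - df N (i + l + 1) (signed l (f (i + 1) (df P i x)))"
        using True unfolding df_K by (simp add: lin_on_diff[OF NC.vs NC.V NC.d(1) NC.d(2)[OF y] sz])
      also have "df N (i + l + 1) (signed l (f (i + 1) (df P i x))) = signed l (df N (i + l + 1) (f (i + 1) (df P i x)))"
        using lin_on_neg[OF NC.vs NC.V NC.d(1) z] by (simp add: signed_def)
      also have "df N (i + l + 1) (df N (i + l) (f i x)) = 0" by (rule NC.dd[OF y])
      finally have 2: "df N (i + l + 1) (df K l f i x) = - signed l (df N (i + l + 1) (f (i + 1) (df P i x)))" by simp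
      have "df K (l + 1) (df K l f) i x = df N (i + (l + 1)) (df K l f i x) - signed (l + 1) (df K l f (i + 1) (df P i x))"
        using True by (simp only: df_K[of "l + 1"] if_True)
      also have "i + (l + 1) = i + l + 1" by simp
      finally show ?thesis unfolding 1 2 by simp
    qed (simp add: df_K[of "l + 1"])
  qed
qed

sublocale KC: vs_complex "\<lambda>l. scl (ob K l)" "\<lambda>l. carr (ob K l)" "df K" by (rule K_vs)

text \<open>The operator \<open>f \<mapsto> \<beta> f \<alpha>\<close>. Both module actions on the
  Hom complex, the induced map and the correction by \<open>eps\<close> are all of this form, so one
  set of lemmas covers them.\<close>

definition oper :: "(int \<Rightarrow> 'p \<Rightarrow> 'p) \<Rightarrow> (int \<Rightarrow> 'n \<Rightarrow> 'n) \<Rightarrow> int \<Rightarrow> (int \<Rightarrow> 'p \<Rightarrow> 'n) \<Rightarrow> int \<Rightarrow> 'p \<Rightarrow> 'n" where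
  "oper \<alpha> \<beta> l f i x = (if x \<in> carr (ob P i) then \<beta> (i + l) (f i (\<alpha> i x)) else 0)"

definition N_endo :: "(int \<Rightarrow> 'n \<Rightarrow> 'n) \<Rightarrow> bool" where
  "N_endo \<beta> \<longleftrightarrow> NC.endo \<beta> \<and> (\<forall>l. rmod_hom (ob N l) (ob N l) (\<beta> l))"

lemma N_endoD: "N_endo \<beta> \<Longrightarrow> rmod_hom (ob N l) (ob N l) (\<beta> l)"
  "N_endo \<beta> \<Longrightarrow> y \<in> carr (ob N l) \<Longrightarrow> df N l (\<beta> l y) = \<beta> (l + 1) (df N l y)"
  "N_endo \<beta> \<Longrightarrow> y \<in> carr (ob N l) \<Longrightarrow> \<beta> l y \<in> carr (ob N l)"
  unfolding N_endo_def using NC.endoD(2,3) by blast+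

lemma oper_carr:
  assumes a: "P_endo \<alpha>" and b: "N_endo \<beta>" and f: "f \<in> carr (ob K l)"
  shows "oper \<alpha> \<beta> l f \<in> carr (ob K l)"
proof (rule KI)
  fix i
  have "rmod_hom (ob P i) (ob N (i + l)) (\<lambda>x. if x \<in> carr (ob P i) then \<beta> (i + l) (f i (\<alpha> i x)) else 0)"
    by (rule hom_if[OF hom_comp[OF hom_comp[OF P_endoD(1)[OF a] KD(1)[OF f]] N_endoD(1)[OF b]]])
  then show "rmod_hom (ob P i) (ob N (i + l)) (oper \<alpha> \<beta> l f i)" by (simp add: oper_def[abs_def])
qed (simp add: oper_def)

lemma oper_lin:
  assumes a: "P_endo \<alpha>" and b: "N_endo \<beta>"
  shows "lin_on (scl (ob K l)) (carr (ob K l)) (scl (ob K l)) (oper \<alpha> \<beta> l)"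
proof (rule lin_onI)
  fix f g assume f: "f \<in> carr (ob K l)" and g: "g \<in> carr (ob K l)"
  show "oper \<alpha> \<beta> l (f + g) = oper \<alpha> \<beta> l f + oper \<alpha> \<beta> l g"
  proof (intro ext)
    fix i x
    have "\<beta> (i + l) (f i (\<alpha> i x) + g i (\<alpha> i x)) = \<beta> (i + l) (f i (\<alpha> i x)) + \<beta> (i + l) (g i (\<alpha> i x))" if "x \<in> carr (ob P i)"
      by (rule lin_on_add[OF hom_lin[OF N_endoD(1)[OF b]]]) (use KD(1)[OF f] KD(1)[OF g] hom_in P_endoD(3)[OF a that] in blast)+
    then show "oper \<alpha> \<beta> l (f + g) i x = (oper \<alpha> \<beta> l f + oper \<alpha> \<beta> l g) i x" by (simp add: oper_def)
  qed
next
  fix c f assume f: "f \<in> carr (ob K l)"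
  show "oper \<alpha> \<beta> l (scl (ob K l) c f) = scl (ob K l) c (oper \<alpha> \<beta> l f)"
  proof (intro ext)
    fix i x
    have "\<beta> (i + l) (scl (ob N (i + l)) c (f i (\<alpha> i x))) = scl (ob N (i + l)) c (\<beta> (i + l) (f i (\<alpha> i x)))" if "x \<in> carr (ob P i)"
      by (rule lin_on_scale[OF hom_lin[OF N_endoD(1)[OF b]]]) (use KD(1)[OF f] hom_in P_endoD(3)[OF a that] in blast)
    then show "oper \<alpha> \<beta> l (scl (ob K l) c f) i x = scl (ob K l) c (oper \<alpha> \<beta> l f) i x"
      using module.scale_zero_right[OF NC.vs[folded module_iff_vector_space]] by (simp add: oper_def scl_K)
  qed
qed

lemma oper_endo:
  assumes a: "P_endo \<alpha>" and b: "N_endo \<beta>"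
  shows "KC.endo (oper \<alpha> \<beta>)"
proof (rule KC.endoI)
  fix l f assume f: "f \<in> carr (ob K l)"
  show "oper \<alpha> \<beta> l f \<in> carr (ob K l)" by (rule oper_carr[OF a b f])
  show "df K l (oper \<alpha> \<beta> l f) = oper \<alpha> \<beta> (l + 1) (df K l f)"
  proof (intro ext)
    fix i x
    show "df K l (oper \<alpha> \<beta> l f) i x = oper \<alpha> \<beta> (l + 1) (df K l f) i x"
    proof (cases "x \<in> carr (ob P i)")
      case True
      note ax = P_endoD(3)[OF a True]
      have y: "f i (\<alpha> i x) \<in> carr (ob N (i + l))" by (rule hom_in[OF KD(1)[OF f] ax])
      have z: "f (i + 1) (df P i (\<alpha> i x)) \<in> carr (ob N (i + l + 1))" using hom_in[OF K_next[OF f] ax] by (simp add: add.assoc)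
      have sz: "signed l (f (i + 1) (df P i (\<alpha> i x))) \<in> carr (ob N (i + l + 1))"
        using z subspD(4)[OF NC.vs NC.V z] by (simp add: signed_def)
      have e: "i + 1 + l = i + l + 1" "i + (l + 1) = i + l + 1" by simp_all
      have "df K l (oper \<alpha> \<beta> l f) i x = df N (i + l) (\<beta> (i + l) (f i (\<alpha> i x))) - signed l (\<beta> (i + l + 1) (f (i + 1) (\<alpha> (i + 1) (df P i x))))"
        using True PC.d(2)[OF True] unfolding df_K oper_def e by simp
      also have "\<dots> = \<beta> (i + l + 1) (df N (i + l) (f i (\<alpha> i x))) - signed l (\<beta> (i + l + 1) (f (i + 1) (df P i (\<alpha> i x))))"
        unfolding N_endoD(2)[OF b y] P_endoD(2)[OF a True] ..
      also have "signed l (\<beta> (i + l + 1) (f (i + 1) (df P i (\<alpha> i x)))) = \<beta> (i + l + 1) (signed l (f (i + 1) (df P i (\<alpha> i x))))"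
        using lin_on_neg[OF NC.vs NC.V hom_lin[OF N_endoD(1)[OF b]] z] by (simp add: signed_def)
      also have "\<beta> (i + l + 1) (df N (i + l) (f i (\<alpha> i x))) - \<dots> = \<beta> (i + l + 1) (df N (i + l) (f i (\<alpha> i x)) - signed l (f (i + 1) (df P i (\<alpha> i x))))"
        by (rule lin_on_diff[OF NC.vs NC.V hom_lin[OF N_endoD(1)[OF b]] NC.d(2)[OF y] sz, symmetric])
      also have "\<dots> = oper \<alpha> \<beta> (l + 1) (df K l f) i x"
        using True ax unfolding df_K oper_def e by simp
      finally show ?thesis .
    qed (simp add: df_K oper_def)
  qed
qed (rule oper_lin[OF a b])

lemma oper_comp:
  assumes "P_endo \<alpha>"
  shows "oper \<alpha> \<beta> l (oper \<alpha>' \<beta>' l f) = oper (\<lambda>i x. \<alpha>' i (\<alpha> i x)) (\<lambda>j y. \<beta> j (\<beta>' j y)) l f"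
  by (intro ext) (simp add: oper_def P_endoD(3)[OF assms])

lemma N_endo_id: "N_endo (\<lambda>i x. x)" unfolding N_endo_def
  by (intro conjI allI hom_id NC.endoI) (auto simp: lin_on_id)

lemma N_endo_comp: "N_endo \<alpha> \<Longrightarrow> N_endo \<alpha>' \<Longrightarrow> N_endo (\<lambda>i x. \<alpha> i (\<alpha>' i x))"
  unfolding N_endo_def using NC.endo_comp hom_comp by blast

lemma N_endo_psi: "N_endo \<psi>" unfolding N_endo_def using complex_endos(3)[OF Nc psi] cmD(1)[OF psi] by blast
lemma N_endo_gg: "N_endo (\<lambda>l. lact (ob N l) gg)" unfolding N_endo_def using complex_endos(1)[OF Nc] bm_hom[OF Nb] by blast

text \<open>The homotopy \<open>h\<close> acts on the Hom complex by precomposition. For a cocycle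
  \<open>f\<close> of degree \<open>l\<close> the commutation of \<open>f\<close> with the
  differentials carries the sign of \<open>l\<close>, and so does the coboundary of
  \<open>f h\<close>.\<close>

lemma oper_eps_cyc:
  assumes f: "f \<in> KC.cyc l"
  shows "f - oper eps (\<lambda>i x. x) l f \<in> KC.bd l"
proof -
  have fK: "f \<in> carr (ob K l)" and fd: "df K l f = 0" using f unfolding KC.cyc_def by simp_all
  have cyc: "df N (i + l) (f i x) = signed l (f (i + 1) (df P i x))" if "x \<in> carr (ob P i)" for i x
    using fun_cong[OF fun_cong[OF fd, of i], of x] that by (simp add: df_K)
  \<comment> \<open>The cochain \<open>f h\<close> of degree \<open>l - 1\<close>; its coboundary is
    \<open>f - f eps\<close> up to the sign of \<open>l\<close>.\<close>
  define g where "g i x = (if x \<in> carr (ob P i) then f (i - 1) (h i x) else 0)" for i x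
  have e: "i - 1 + l = i + (l - 1)" for i by simp
  have gK: "g \<in> carr (ob K (l - 1))"
  proof (rule KI)
    fix i
    have "rmod_hom (ob P i) (ob N (i + (l - 1))) (\<lambda>x. if x \<in> carr (ob P i) then f (i - 1) (h i x) else 0)"
      by (rule hom_if[OF hom_comp[OF h KD(1)[OF fK, of "i - 1", unfolded e]]])
    then show "rmod_hom (ob P i) (ob N (i + (l - 1))) (g i)" by (simp add: g_def[abs_def])
  qed (simp add: g_def)
  have opK: "oper eps (\<lambda>i x. x) l f \<in> carr (ob K l)" by (rule oper_carr[OF P_endo_eps N_endo_id fK])
  have dg: "df K (l - 1) g i x = signed l (f i x - oper eps (\<lambda>i x. x) l f i x)" for i x
  proof (cases "x \<in> carr (ob P i)")
    case True
    have hx: "h i x \<in> carr (ob P (i - 1))" by (rule hom_in[OF h True])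
    have dhx: "df P (i - 1) (h i x) \<in> carr (ob P i)" by (rule hom_in[OF dfP hx])
    have dx: "df P i x \<in> carr (ob P (i + 1))" by (rule PC.d(2)[OF True])
    have hdx: "h (i + 1) (df P i x) \<in> carr (ob P i)" by (rule hom_in[OF hP dx])
    have "df K (l - 1) g i x = df N (i + (l - 1)) (f (i - 1) (h i x)) - signed (l - 1) (f i (h (i + 1) (df P i x)))"
      using True dx by (simp add: df_K g_def)
    also have "df N (i + (l - 1)) (f (i - 1) (h i x)) = signed l (f i (df P (i - 1) (h i x)))"
      using cyc[OF hx] unfolding e by simp
    also have "\<dots> - signed (l - 1) (f i (h (i + 1) (df P i x))) = signed l (f i (df P (i - 1) (h i x)) + f i (h (i + 1) (df P i x)))"
      by (simp add: signed_def)
    also have "f i (df P (i - 1) (h i x)) + f i (h (i + 1) (df P i x)) = f i (df P (i - 1) (h i x) + h (i + 1) (df P i x))"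
      by (rule lin_on_add[OF hom_lin[OF KD(1)[OF fK]] dhx hdx, symmetric])
    also have "df P (i - 1) (h i x) + h (i + 1) (df P i x) = x - eps i x" unfolding eps_def by simp
    also have "f i (x - eps i x) = f i x - f i (eps i x)"
      by (rule lin_on_diff[OF PC.vs PC.V hom_lin[OF KD(1)[OF fK]] True hom_in[OF eps_hom True]])
    finally show ?thesis using True by (simp add: oper_def)
  next
    case False
    then show ?thesis by (simp add: df_K oper_def KD(2)[OF fK])
  qed
  have "df K (l - 1) g = (if even l then f - oper eps (\<lambda>i x. x) l f else - (f - oper eps (\<lambda>i x. x) l f))"
    by (intro ext) (simp add: dg signed_def)
  moreover have "df K (l - 1) g \<in> KC.bd l" unfolding KC.bd_def using gK by blast
  ultimately show ?thesis using subspD(4)[OF KC.vs KC.bd_sub, of "df K (l - 1) g" l] by (cases "even l") auto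
qed

text \<open>The operator is a finite sum of maps that factor through single terms of
  \<open>N\<close>: evaluate \<open>f\<close> at \<open>\<alpha> (t i k)\<close>, then form the map
  \<open>x \<mapsto> \<beta> y \<xi> i k x\<close>. Cyclicity leaves right multiplication by
  \<open>\<xi> i k (\<alpha> (t i k))\<close> on \<open>N\<close>, combined with
  \<open>\<beta>\<close>. So the rank is finite although Hom itself may be infinite
  dimensional.\<close>

lemma oper_eps_trace:
  assumes a: "P_endo \<alpha>" and b: "N_endo \<beta>"
  defines "T \<equiv> oper (\<lambda>i x. \<alpha> i (eps i x)) \<beta>"
  shows "fdim (scl (ob K l)) (T l ` carr (ob K l))"
    and "fr_trace (scl (ob K l)) (carr (ob K l)) (T l) =
      (\<Sum>i\<in>F. lin_trace (scl (ob N (i + l))) (carr (ob N (i + l)))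
        (\<lambda>y. ract (ob N (i + l)) (\<beta> (i + l) y) (\<Sum>k<r i. \<xi> i k (\<alpha> i (t i k)))))"
proof -
  have ae: "P_endo (\<lambda>i x. \<alpha> i (eps i x))" by (rule P_endo_comp[OF a P_endo_eps])
  define I where "I = Sigma F (\<lambda>i. {..<r i})"
  have I: "finite I" unfolding I_def using F(1) by simp
  define tt where "tt i k = \<alpha> i (t i k)" for i k
  have tt: "tt i k \<in> carr (ob P i)" if "k < r i" for i k unfolding tt_def by (rule P_endoD(3)[OF a t[OF that]])
  \<comment> \<open>\<open>A q\<close> is evaluation at the generator with index \<open>q\<close>,
    and \<open>B q\<close> below rebuilds a cochain concentrated in the single component
    \<open>fst q\<close>.\<close>
  define A where "A q f = f (fst q) (tt (fst q) (snd q))" for q :: "int \<times> nat" and f :: "int \<Rightarrow> 'p \<Rightarrow> 'n"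
  define B where "B q y i x = (if i = fst q \<and> x \<in> carr (ob P i) then ract (ob N (i + l)) (\<beta> (i + l) y) (\<xi> i (snd q) x) else 0)"
    for q :: "int \<times> nat" and y i x
  have A: "lin_on (scl (ob K l)) (carr (ob K l)) (scl (ob N (fst q + l))) (A q)" for q
    by (simp add: lin_on_def A_def scl_K)
  have AN: "A q ` carr (ob K l) \<subseteq> carr (ob N (fst q + l))" if "q \<in> I" for q
    using that hom_in[OF KD(1) tt] unfolding I_def A_def by auto
  have B: "lin_on (scl (ob N (fst q + l))) (carr (ob N (fst q + l))) (scl (ob K l)) (B q)" for q
  proof (rule lin_onI)
    fix y z assume y: "y \<in> carr (ob N (fst q + l))" and z: "z \<in> carr (ob N (fst q + l))"
    show "B q (y + z) = B q y + B q z"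
      by (intro ext) (auto simp: B_def lin_on_add[OF hom_lin[OF N_endoD(1)[OF b]] y z]
          rmD(4)[OF Nrm N_endoD(3)[OF b y] N_endoD(3)[OF b z]])
  next
    fix c y assume y: "y \<in> carr (ob N (fst q + l))"
    show "B q (scl (ob N (fst q + l)) c y) = scl (ob K l) c (B q y)"
      using module.scale_zero_right[OF NC.vs[folded module_iff_vector_space]]
      by (intro ext) (auto simp: B_def scl_K lin_on_scale[OF hom_lin[OF N_endoD(1)[OF b]] y]
          rm_scale[OF Nrm N_endoD(3)[OF b y]])
  qed
  have BK: "B q y \<in> carr (ob K l)" if q: "q \<in> I" and y: "y \<in> carr (ob N (fst q + l))" for q y
  proof (rule KI)
    fix i
    show "rmod_hom (ob P i) (ob N (i + l)) (B q y i)"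
    proof (cases "i = fst q")
      case True
      have x: "rmod_hom (ob P i) regm (\<xi> i (snd q))" using q True unfolding I_def by (auto intro: xi)
      have y': "rmod_hom regm (ob N (i + l)) (ract (ob N (i + l)) (\<beta> (i + l) y))"
        by (rule homI) (use True y N_endoD(3)[OF b] rm_lin_r[OF Nrm] rmD(3)[OF Nrm] rmD(6)[OF Nrm] in auto)
      have "rmod_hom (ob P i) (ob N (i + l)) (\<lambda>x. if x \<in> carr (ob P i) then ract (ob N (i + l)) (\<beta> (i + l) y) (\<xi> i (snd q) x) else 0)"
        by (rule hom_if[OF hom_comp[OF x y']])
      moreover have "B q y i = (\<lambda>x. if x \<in> carr (ob P i) then ract (ob N (i + l)) (\<beta> (i + l) y) (\<xi> i (snd q) x) else 0)"
        using True by (intro ext) (simp add: B_def)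
      ultimately show ?thesis by simp
    next
      case False
      then show ?thesis using hom_zero[OF Prm Nrm] by (simp add: B_def[abs_def])
    qed
  qed (simp add: B_def)
  have T: "T l f = (\<Sum>q\<in>I. B q (A q f))" if f: "f \<in> carr (ob K l)" for f
  proof (intro ext)
    fix i x
    have sum_app: "(\<Sum>q\<in>J. G q) i x = (\<Sum>q\<in>J. G q i x)" for G :: "int \<times> nat \<Rightarrow> int \<Rightarrow> 'p \<Rightarrow> 'n" and J
      by (induction J rule: infinite_finite_induct) auto
    show "T l f i x = (\<Sum>q\<in>I. B q (A q f)) i x"
    proof (cases "x \<in> carr (ob P i)")
      case True
      have fi: "rmod_hom (ob P i) (ob N (i + l)) (\<lambda>y. \<beta> (i + l) (f i (\<alpha> i y)))"
        by (rule hom_comp[OF hom_comp[OF P_endoD(1)[OF a] KD(1)[OF f]] N_endoD(1)[OF b]])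
      have "T l f i x = \<beta> (i + l) (f i (\<alpha> i (\<Sum>k<r i. ract (ob P i) (t i k) (\<xi> i k x))))"
        using True unfolding T_def oper_def eps_def eps_eq[OF True] by simp
      also have "\<dots> = (\<Sum>k<r i. \<beta> (i + l) (f i (\<alpha> i (ract (ob P i) (t i k) (\<xi> i k x)))))"
        by (rule lin_on_sum[OF PC.vs PC.V hom_lin[OF fi]]) (use t rmD(3)[OF Prm] in auto)
      also have "\<dots> = (\<Sum>k<r i. ract (ob N (i + l)) (\<beta> (i + l) (f i (tt i k))) (\<xi> i k x))"
        unfolding tt_def by (rule sum.cong) (use hom_ract[OF fi] t in auto)
      finally have 1: "T l f i x = (\<Sum>k<r i. ract (ob N (i + l)) (\<beta> (i + l) (f i (tt i k))) (\<xi> i k x))" .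
      have "(\<Sum>q\<in>I. B q (A q f)) i x = (\<Sum>i'\<in>F. \<Sum>k<r i'. B (i', k) (A (i', k) f) i x)"
        unfolding sum_app I_def by (subst sum.Sigma) (use F(1) in auto)
      also have "\<dots> = (\<Sum>i'\<in>F. if i' = i then (\<Sum>k<r i. ract (ob N (i + l)) (\<beta> (i + l) (f i (tt i k))) (\<xi> i k x)) else 0)"
        by (rule sum.cong) (auto simp: B_def A_def True)
      also have "\<dots> = (\<Sum>k<r i. ract (ob N (i + l)) (\<beta> (i + l) (f i (tt i k))) (\<xi> i k x))"
        using F by simp
      finally show ?thesis unfolding 1 ..
    next
      case False
      then show ?thesis unfolding sum_app by (simp add: T_def oper_def B_def)
    qed
  qed
  have BA: "lin_on (scl (ob K l)) (carr (ob K l)) (scl (ob K l)) (\<lambda>f. B q (A q f))" if "q \<in> I" for q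
    by (rule lin_on_comp[OF A AN[OF that] B])
  have BAK: "(\<lambda>f. B q (A q f)) ` carr (ob K l) \<subseteq> carr (ob K l)" if "q \<in> I" for q
    using BK[OF that] AN[OF that] by blast
  have fBA: "fdim (scl (ob K l)) ((\<lambda>f. B q (A q f)) ` carr (ob K l))" if "q \<in> I" for q
    by (rule fdim_subset[OF KC.vs fdim_image[OF NC.vs KC.vs N_fdim B] lin_on_image[OF KC.vs KC.vs KC.V BA[OF that]]])
      (use AN[OF that] in blast)
  note sums = fr_trace_sum[OF KC.vs KC.V I BA BAK fBA]
  have im: "T l ` carr (ob K l) = (\<lambda>f. \<Sum>q\<in>I. B q (A q f)) ` carr (ob K l)"
    by (rule image_cong[OF refl T])
  show fT: "fdim (scl (ob K l)) (T l ` carr (ob K l))" unfolding im by (rule sums(2))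
  have "fr_trace (scl (ob K l)) (carr (ob K l)) (T l) = fr_trace (scl (ob K l)) (carr (ob K l)) (\<lambda>f. \<Sum>q\<in>I. B q (A q f))"
    by (rule fr_trace_cong[OF KC.vs fT _ T]) (use oper_carr[OF ae b] in \<open>auto simp: T_def\<close>)
  also have "\<dots> = (\<Sum>q\<in>I. fr_trace (scl (ob K l)) (carr (ob K l)) (\<lambda>f. B q (A q f)))" by (rule sums(1))
  also have "\<dots> = (\<Sum>q\<in>I. lin_trace (scl (ob N (fst q + l))) (carr (ob N (fst q + l))) (\<lambda>y. A q (B q y)))"
    by (rule sum.cong[OF refl], rule fr_trace_cyclic[OF KC.vs NC.vs KC.V N_fdim A _ B]) (use AN BK in blast)+
  also have "\<dots> = (\<Sum>q\<in>I. lin_trace (scl (ob N (fst q + l))) (carr (ob N (fst q + l)))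
      (\<lambda>y. ract (ob N (fst q + l)) (\<beta> (fst q + l) y) (\<xi> (fst q) (snd q) (tt (fst q) (snd q)))))"
    by (rule sum.cong[OF refl], rule lin_trace_cong[OF NC.vs N_fdim])
      (use tt in \<open>auto simp: A_def B_def I_def\<close>)
  also have "\<dots> = (\<Sum>i\<in>F. \<Sum>k<r i. lin_trace (scl (ob N (i + l))) (carr (ob N (i + l)))
      (\<lambda>y. ract (ob N (i + l)) (\<beta> (i + l) y) (\<xi> i k (tt i k))))"
    unfolding I_def by (subst sum.Sigma) (use F(1) in \<open>auto simp: split_beta\<close>)
  also have "\<dots> = (\<Sum>i\<in>F. lin_trace (scl (ob N (i + l))) (carr (ob N (i + l)))
      (\<lambda>y. \<Sum>k<r i. ract (ob N (i + l)) (\<beta> (i + l) y) (\<xi> i k (tt i k))))"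
    by (rule sum.cong[OF refl], rule lin_trace_sum[OF NC.vs N_fdim, symmetric])
      (use N_endoD(3)[OF b] rmD(3)[OF Nrm] in auto)
  also have "\<dots> = (\<Sum>i\<in>F. lin_trace (scl (ob N (i + l))) (carr (ob N (i + l)))
      (\<lambda>y. ract (ob N (i + l)) (\<beta> (i + l) y) (\<Sum>k<r i. \<xi> i k (tt i k))))"
    by (rule sum.cong[OF refl], rule lin_trace_cong[OF NC.vs N_fdim], rule rm_sum_r[OF Nrm N_endoD(3)[OF b], symmetric])
  finally show "fr_trace (scl (ob K l)) (carr (ob K l)) (T l) =
      (\<Sum>i\<in>F. lin_trace (scl (ob N (i + l))) (carr (ob N (i + l)))
        (\<lambda>y. ract (ob N (i + l)) (\<beta> (i + l) y) (\<Sum>k<r i. \<xi> i k (\<alpha> i (t i k)))))" unfolding tt_def .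
qed

text \<open>The contribution of degree \<open>s\<close> to entry \<open>(v, gg)\<close> of the trace
  matrix of \<open>\<psi>\<close>.\<close>

definition psi_trace :: "nat \<Rightarrow> int \<Rightarrow> 'k" where
  "psi_trace v s = lin_trace (scl (ob N s)) ((\<lambda>x. ract (ob N s) (lact (ob N s) gg x) (e v)) ` carr (ob N s)) (\<psi> s)"

lemma N_finite: "finite {l. carr (ob N l) \<noteq> {0}}" using N unfolding bounded_fd_complex_def by blast

lemma psi_trace_finite: "finite {s. psi_trace v s \<noteq> 0}"
proof (rule finite_subset[OF _ N_finite], clarify)
  fix s assume "psi_trace v s \<noteq> 0" and c: "carr (ob N s) = {0}"
  have "lact (ob N s) gg 0 = 0" "\<psi> s 0 = 0"
    using lin_on_0[OF NC.vs NC.V hom_lin[OF N_endoD(1)]] N_endo_gg N_endo_psi by blast+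
  then have "psi_trace v s = fr_trace (scl (ob N s)) {0} (\<psi> s)"
    unfolding psi_trace_def fr_trace_def c by (simp add: rm_0[OF Nrm])
  also have "\<dots> = 0" by (rule fr_trace_zero[OF NC.vs fdim_subsp[OF NC.vs fdim_zero[OF NC.vs]]]) (simp add: \<open>\<psi> s 0 = 0\<close>)
  finally show False using \<open>psi_trace v s \<noteq> 0\<close> by simp
qed

lemma psi_trace_eq: "v < n \<Longrightarrow> psi_trace v s = lin_trace (scl (ob N s)) (carr (ob N s)) (\<lambda>y. ract (ob N s) (\<psi> s (lact (ob N s) gg y)) (e v))"
  unfolding psi_trace_def
  by (rule bimodule_trace[OF Nb N_fdim _ gg e_idem]) (use psi in \<open>auto simp: chain_map_def\<close>)

lemma N_action:
  "lin_trace (scl (ob N s)) (carr (ob N s)) (\<lambda>y. ract (ob N s) (\<psi> s (lact (ob N s) gg y)) a)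
    = (\<Sum>v<n. \<chi> v a * psi_trace v s)"
proof -
  have hom: "rmod_hom (ob N s) (ob N s) (\<lambda>y. \<psi> s (lact (ob N s) gg y))"
    by (rule hom_comp[OF N_endoD(1)[OF N_endo_gg] N_endoD(1)[OF N_endo_psi]])
  have "lin_trace (scl (ob N s)) (carr (ob N s)) (\<lambda>y. ract (ob N s) (\<psi> s (lact (ob N s) gg y)) a)
    = (\<Sum>v<n. \<chi> v a * lin_trace (scl (ob N s)) (carr (ob N s)) (\<lambda>y. ract (ob N s) (\<psi> s (lact (ob N s) gg y)) (e v)))"
  proof (rule trace_action[OF NC.vs N_fdim, where \<rho> = "\<lambda>a y. ract (ob N s) y a" and \<psi> = "\<lambda>y. \<psi> s (lact (ob N s) gg y)"])
    show "ract (ob N s) x (b ^ Suc m) = ract (ob N s) (ract (ob N s) x (b ^ m)) b" if "x \<in> carr (ob N s)" for b m x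
      using rmD(6)[OF Nrm that, of "b ^ m" b] by (simp add: power_commutes)
  qed (use rm_lin[OF Nrm] rmD(3,5,7,8)[OF Nrm] hom_lin[OF hom] hom_in[OF hom] hom_ract[OF hom] in auto)
  then show ?thesis using psi_trace_eq by simp
qed

text \<open>\<open>lefschetz\<close> is applied to the operator with both idempotents absorbed and
  corrected by \<open>eps\<close>. Its degreewise traces are convolutions of the residues of
  \<open>hs_trace\<close> with \<open>psi_trace\<close>, and the alternating sum separates
  them.\<close>

lemma ext_trace:
  "euler (\<lambda>l. lin_trace (scl (ob K l))
      ((\<lambda>x. KC.pr l (ract (ob K l) (KC.pr l (lact (ob K l) gg x)) bb)) ` KC.H l) (\<lambda>x. KC.pr l (hom_map P \<Phi> \<psi> l x)))
   = (\<Sum>v<n. hs_char v * euler (psi_trace v))"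
proof -
  have lam: "lact (ob K l) gg f = oper (\<lambda>i x. x) (\<lambda>l. lact (ob N l) gg) l f" for l f
    by (intro ext) (simp add: hom_cpx_def oper_def)
  have rho: "ract (ob K l) f bb = oper (\<lambda>l. lact (ob P l) bb) (\<lambda>i x. x) l f" for l f
    by (intro ext) (simp add: hom_cpx_def oper_def)
  have theta: "hom_map P \<Phi> \<psi> l f = oper \<Phi> \<psi> l f" for l f
    by (intro ext) (simp add: hom_map_def oper_def)
  define \<beta> where "\<beta> l y = \<psi> l (lact (ob N l) gg y)" for l y
  have b: "N_endo \<beta>" unfolding \<beta>_def by (rule N_endo_comp[OF N_endo_psi N_endo_gg])
  define T where "T = oper (\<lambda>i x. Th i (eps i x)) \<beta>"
  have Tpe: "P_endo (\<lambda>i x. Th i (eps i x))" by (rule P_endo_comp[OF P_endo_Th P_endo_eps])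
  have T: "KC.endo T" unfolding T_def by (rule oper_endo[OF Tpe b])
  have fT: "fdim (scl (ob K l)) (T l ` carr (ob K l))" for l
    unfolding T_def by (rule oper_eps_trace(1)[OF P_endo_Th b])
  have trT: "fr_trace (scl (ob K l)) (carr (ob K l)) (T l) = (\<Sum>i\<in>F. \<Sum>v<n. \<chi> v (hs_trace i) * psi_trace v (i + l))" for l
    unfolding T_def oper_eps_trace(2)[OF P_endo_Th b] hs_trace_def[symmetric] unfolding \<beta>_def N_action ..
  have fin: "finite {l. \<exists>f\<in>carr (ob K l). T l f \<noteq> 0}"
  proof (rule finite_subset)
    show "finite (\<Union>i\<in>F. (\<lambda>s. s - i) ` {s. carr (ob N s) \<noteq> {0}})" using F(1) N_finite by simp
    show "{l. \<exists>f\<in>carr (ob K l). T l f \<noteq> 0} \<subseteq> (\<Union>i\<in>F. (\<lambda>s. s - i) ` {s. carr (ob N s) \<noteq> {0}})"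
    proof
      fix l assume "l \<in> {l. \<exists>f\<in>carr (ob K l). T l f \<noteq> 0}"
      then obtain f where f: "f \<in> carr (ob K l)" "T l f \<noteq> 0" by blast
      then obtain i x where ix: "T l f i x \<noteq> 0" by (auto simp: fun_eq_iff)
      then have x: "x \<in> carr (ob P i)" by (auto simp: T_def oper_def split: if_splits)
      have Tf: "T l f \<in> carr (ob K l)" by (rule KC.endoD(2)[OF T f(1)])
      have ne: "carr (ob N (i + l)) \<noteq> {0}" using hom_in[OF KD(1)[OF Tf] x] ix by auto
      have "i \<in> F"
      proof (rule ccontr)
        assume "i \<notin> F"
        then have "eps i x = 0" unfolding eps_def eps_eq[OF x] by (simp add: F(2))
        then have "T l f i x = \<beta> (i + l) (f i (Th i 0))" using x by (simp add: T_def oper_def)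
        also have "\<dots> = 0"
          using lin_on_0[OF PC.vs PC.V hom_lin[OF Th_hom]] lin_on_0[OF PC.vs PC.V hom_lin[OF KD(1)[OF f(1)]]]
            lin_on_0[OF NC.vs NC.V hom_lin[OF N_endoD(1)[OF b]]] by simp
        finally show False using ix by simp
      qed
      then show "l \<in> (\<Union>i\<in>F. (\<lambda>s. s - i) ` {s. carr (ob N s) \<noteq> {0}})"
        using ne by (intro UN_I[of i] image_eqI[of _ _ "i + l"]) simp_all
    qed
  qed
  have fH: "fdim (scl (ob K l)) (KC.H l)" for l
  proof (rule KC.fdim_H[where E = "oper eps (\<lambda>i x. x) l"])
    show "fdim (scl (ob K l)) (oper eps (\<lambda>i x. x) l ` carr (ob K l))"
      using oper_eps_trace(1)[OF P_endo_id N_endo_id, of l] by simp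
    show "oper eps (\<lambda>i x. x) l x \<in> carr (ob K l)" if "x \<in> carr (ob K l)" for x
      by (rule oper_carr[OF P_endo_eps N_endo_id that])
    show "oper eps (\<lambda>i x. x) l x - x \<in> KC.bd l" if "x \<in> KC.cyc l" for x
      using subspD(4)[OF KC.vs KC.bd_sub oper_eps_cyc[OF that]] by simp
  qed
  have bbP: "lact (ob P i) bb (lact (ob P i) bb x) = lact (ob P i) bb x" if "x \<in> carr (ob P i)" for i x
    using bmD(5)[OF Pb that, of bb bb] bb by simp
  have ggN: "lact (ob N i) gg (lact (ob N i) gg x) = lact (ob N i) gg x" if "x \<in> carr (ob N i)" for i x
    using bmD(5)[OF Nb that, of gg gg] gg by simp
  have "euler (\<lambda>l. lin_trace (scl (ob K l))
      ((\<lambda>x. KC.pr l (ract (ob K l) (KC.pr l (lact (ob K l) gg x)) bb)) ` KC.H l) (\<lambda>x. KC.pr l (hom_map P \<Phi> \<psi> l x)))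
   = euler (\<lambda>l. fr_trace (scl (ob K l)) (carr (ob K l)) (T l))"
    unfolding lam rho theta
  proof (rule KC.lefschetz[OF T fT fin oper_endo[OF P_endo_id N_endo_gg] oper_endo[OF P_endo_bb N_endo_id] oper_endo[OF P_endo_Phi N_endo_psi] _ _ _ _ _ fH])
    fix l f assume f: "f \<in> carr (ob K l)"
    note in_K = oper_carr[OF _ _ f] hom_in[OF KD(1)[OF f]]
    show "oper (\<lambda>i x. x) (\<lambda>l. lact (ob N l) gg) l (oper (\<lambda>i x. x) (\<lambda>l. lact (ob N l) gg) l f) = oper (\<lambda>i x. x) (\<lambda>l. lact (ob N l) gg) l f"
      unfolding oper_comp[OF P_endo_id] by (intro ext) (simp add: oper_def ggN in_K(2))
    show "oper (\<lambda>l. lact (ob P l) bb) (\<lambda>i x. x) l (oper (\<lambda>l. lact (ob P l) bb) (\<lambda>i x. x) l f) = oper (\<lambda>l. lact (ob P l) bb) (\<lambda>i x. x) l f"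
      unfolding oper_comp[OF P_endo_bb] by (intro ext) (simp add: oper_def bbP)
    show "oper (\<lambda>i x. x) (\<lambda>l. lact (ob N l) gg) l (oper (\<lambda>l. lact (ob P l) bb) (\<lambda>i x. x) l f) = oper (\<lambda>l. lact (ob P l) bb) (\<lambda>i x. x) l (oper (\<lambda>i x. x) (\<lambda>l. lact (ob N l) gg) l f)"
      unfolding oper_comp[OF P_endo_id] oper_comp[OF P_endo_bb] ..
    show "oper (\<lambda>i x. x) (\<lambda>l. lact (ob N l) gg) l (oper \<Phi> \<psi> l f) = oper \<Phi> \<psi> l (oper (\<lambda>i x. x) (\<lambda>l. lact (ob N l) gg) l f)"
      unfolding oper_comp[OF P_endo_id] oper_comp[OF P_endo_Phi]
      by (intro ext) (simp add: oper_def cmD(2)[OF psi in_K(2)] P_endoD(3)[OF P_endo_Phi])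
    show "oper (\<lambda>l. lact (ob P l) bb) (\<lambda>i x. x) l (oper \<Phi> \<psi> l f) = oper \<Phi> \<psi> l (oper (\<lambda>l. lact (ob P l) bb) (\<lambda>i x. x) l f)"
      unfolding oper_comp[OF P_endo_bb] oper_comp[OF P_endo_Phi]
      by (intro ext) (simp add: oper_def cmD(2)[OF Phi])
  next
    fix l f assume f: "f \<in> KC.cyc l"
    have fK: "f \<in> carr (ob K l)" using f KC.cyc_V by blast
    have Tc: "oper Th \<beta> l f \<in> KC.cyc l" using KC.endoD(5)[OF oper_endo[OF P_endo_Th b]] f by blast
    have 1: "oper \<Phi> \<psi> l (oper (\<lambda>l. lact (ob P l) bb) (\<lambda>i x. x) l (oper (\<lambda>i x. x) (\<lambda>l. lact (ob N l) gg) l f)) = oper Th \<beta> l f"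
      unfolding oper_comp[OF P_endo_Phi] oper_comp[OF P_endo_bb]
      by (intro ext) (simp add: oper_def Th_def \<beta>_def cmD(2)[OF Phi])
    \<comment> \<open>Precomposition reverses the order, so \<open>eps\<close> acts last on cochains
      and the comparison is made at the cocycle \<open>oper Th \<beta> l f\<close>.\<close>
    have 2: "T l f = oper eps (\<lambda>i x. x) l (oper Th \<beta> l f)"
      unfolding T_def oper_comp[OF P_endo_eps] ..
    show "oper \<Phi> \<psi> l (oper (\<lambda>l. lact (ob P l) bb) (\<lambda>i x. x) l (oper (\<lambda>i x. x) (\<lambda>l. lact (ob N l) gg) l f)) - T l f \<in> KC.bd l"
      unfolding 1 2 by (rule oper_eps_cyc[OF Tc])
  qed
  also have "\<dots> = (\<Sum>v<n. (\<Sum>i\<in>F. signed i (\<chi> v (hs_trace i))) * euler (psi_trace v))"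
    unfolding trT by (rule euler_convolution(1)[OF F(1)]) (use psi_trace_finite in auto)
  also have "\<dots> = (\<Sum>v<n. hs_char v * euler (psi_trace v))"
    by (rule sum.cong) (auto simp: hs_char_eq)
  finally show ?thesis .
qed

end

section \<open>Traces on Tor\<close>

lemma lookup_free_scale [simp]: "Poly_Mapping.lookup (free_scale c u) z = c * Poly_Mapping.lookup u z"
  unfolding free_scale_def by (simp add: Poly_Mapping.map.rep_eq when_def)

lemma free_vs: "vector_space (free_scale :: 'k::field \<Rightarrow> ('z \<Rightarrow>\<^sub>0 'k) \<Rightarrow> _)"
  by unfold_locales (auto intro!: poly_mapping_eqI simp: lookup_add algebra_simps)

text \<open>The linear extension of a map on generators, with values in any vector space;
  \<open>lin_ext\<close> is the case of free values. The general target is needed for contractions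
  from the tensor complex to \<open>N\<close>.\<close>

definition gext :: "('k::field \<Rightarrow> 'w::ab_group_add \<Rightarrow> 'w) \<Rightarrow> ('z \<Rightarrow> 'w) \<Rightarrow> ('z \<Rightarrow>\<^sub>0 'k) \<Rightarrow> 'w" where
  "gext s g u = (\<Sum>z\<in>Poly_Mapping.keys u. s (Poly_Mapping.lookup u z) (g z))"

lemma gext_superset:
  assumes "vector_space s" "finite S" "Poly_Mapping.keys u \<subseteq> S"
  shows "gext s g u = (\<Sum>z\<in>S. s (Poly_Mapping.lookup u z) (g z))"
  unfolding gext_def
  by (rule sum.mono_neutral_left)
    (use assms module.scale_zero_left[OF assms(1)[folded module_iff_vector_space]] in \<open>auto simp: in_keys_iff\<close>)

lemma gext_lin:
  fixes s :: "'k::field \<Rightarrow> 'w::ab_group_add \<Rightarrow> 'w" and g :: "'z \<Rightarrow> 'w"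
  assumes v: "vector_space s"
  shows "lin_on free_scale U s (gext s g)"
proof (rule lin_onI)
  interpret vector_space s by (rule v)
  fix u w :: "'z \<Rightarrow>\<^sub>0 'k"
  let ?S = "Poly_Mapping.keys u \<union> Poly_Mapping.keys w"
  have "gext s g (u + w) = (\<Sum>z\<in>?S. s (Poly_Mapping.lookup (u + w) z) (g z))"
    by (rule gext_superset[OF v]) (use Poly_Mapping.keys_add[of u w] in auto)
  also have "\<dots> = (\<Sum>z\<in>?S. s (Poly_Mapping.lookup u z) (g z)) + (\<Sum>z\<in>?S. s (Poly_Mapping.lookup w z) (g z))"
    by (simp add: lookup_add scale_left_distrib sum.distrib)
  also have "\<dots> = gext s g u + gext s g w"
    by (subst (1 2) gext_superset[OF v, of ?S]) auto
  finally show "gext s g (u + w) = gext s g u + gext s g w" .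
next
  interpret vector_space s by (rule v)
  fix c and u :: "'z \<Rightarrow>\<^sub>0 'k"
  have "gext s g (free_scale c u) = (\<Sum>z\<in>Poly_Mapping.keys u. s (Poly_Mapping.lookup (free_scale c u) z) (g z))"
    by (rule gext_superset[OF v]) (auto simp: in_keys_iff)
  then show "gext s g (free_scale c u) = s c (gext s g u)"
    by (simp add: gext_def scale_sum_right)
qed

lemma gext_gen: "vector_space s \<Longrightarrow> gext s g (gen z) = g z"
  unfolding gext_def using module.scale_one module_iff_vector_space by force

lemma lin_ext_gext: "lin_ext g = gext free_scale g"
  by (rule ext) (simp add: lin_ext_def gext_def)

lemma gext_linear_comp:
  assumes "lin_on free_scale UNIV s p" "vector_space s"
  shows "p (gext free_scale g u) = gext s (\<lambda>z. p (g z)) u"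
proof -
  have "p (gext free_scale g u) = (\<Sum>z\<in>Poly_Mapping.keys u. p (free_scale (Poly_Mapping.lookup u z) (g z)))"
    unfolding gext_def
    by (rule lin_on_sum[OF free_vs _ assms(1)]) (auto simp: module.subspace_UNIV[OF free_vs[folded module_iff_vector_space]])
  then show ?thesis unfolding gext_def using lin_on_scale[OF assms(1)] by simp
qed

lemma free_decomp: "u = (\<Sum>z\<in>Poly_Mapping.keys u. free_scale (Poly_Mapping.lookup u z) (gen z))"
proof (rule poly_mapping_eqI)
  fix z
  have "Poly_Mapping.lookup (\<Sum>w\<in>Poly_Mapping.keys u. free_scale (Poly_Mapping.lookup u w) (gen w)) z
      = (\<Sum>w\<in>Poly_Mapping.keys u. if w = z then Poly_Mapping.lookup u w else 0)"
    by (simp add: lookup_sum lookup_single when_def if_distrib cong: if_cong)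
  then show "Poly_Mapping.lookup u z = Poly_Mapping.lookup (\<Sum>w\<in>Poly_Mapping.keys u. free_scale (Poly_Mapping.lookup u w) (gen w)) z"
    by (simp add: in_keys_iff)
qed

text \<open>Here \<open>N\<close> is a right module over \<open>sC\<close>, so its module facts come
  from \<open>fd_alg\<close> for \<open>sC\<close>, whereas its left \<open>A\<close>-action enters
  through the balancing relations.\<close>

locale tor_data = fin_data sA n e \<chi> sB M \<phi> P \<pi> \<Phi> bb h r t \<xi> F + C: fd_alg sC
  for sA :: "'k::field \<Rightarrow> 'a::{ring,monoid_mult} \<Rightarrow> 'a" and n e \<chi>
    and sB :: "'k \<Rightarrow> 'b::{ring,monoid_mult} \<Rightarrow> 'b" and M :: "('k, 'a, 'm::ab_group_add, 'b) cpx" and \<phi>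
    and P :: "('k, 'a, 'p::ab_group_add, 'b) cpx" and \<pi> \<Phi> and bb :: 'b
    and h :: "int \<Rightarrow> 'p \<Rightarrow> 'p" and r :: "int \<Rightarrow> nat" and t :: "int \<Rightarrow> nat \<Rightarrow> 'p"
    and \<xi> :: "int \<Rightarrow> nat \<Rightarrow> 'p \<Rightarrow> 'a" and F :: "int set"
    and sC :: "'k \<Rightarrow> 'c::{ring,monoid_mult} \<Rightarrow> 'c" +
  fixes N :: "('k, 'c, 'n::ab_group_add, 'a) cpx" and \<psi> and gg :: 'c
  assumes N: "bounded_fd_complex sA sC N" and psi: "chain_map N N \<psi>" and gg: "gg * gg = gg"
begin

lemma Nc: "bimodule_complex sA sC N" using N unfolding bounded_fd_complex_def by blast

sublocale NC: vs_complex "\<lambda>l. scl (ob N l)" "\<lambda>l. carr (ob N l)" "df N" by (rule C.complex_vs[OF Nc])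

lemma N_fdim: "fdim (scl (ob N l)) (carr (ob N l))"
  using N fin_dim_fdim[OF NC.vs] unfolding bounded_fd_complex_def by blast

lemma N_finite: "finite {l. carr (ob N l) \<noteq> {0}}" using N unfolding bounded_fd_complex_def by blast

lemmas Nb = C.bcD(1)[OF Nc] and Nrm = C.bcD(5)[OF Nc]

section \<open>The tensor product and its universal property\<close>

definition Rel :: "int \<Rightarrow> ((int \<times> 'p \<times> 'n) \<Rightarrow>\<^sub>0 'k) set" where "Rel l = tensor_rel P N l"
definition Fr :: "int \<Rightarrow> ((int \<times> 'p \<times> 'n) \<Rightarrow>\<^sub>0 'k) set" where "Fr l = carr (tensor_free P N l)"
definition pp :: "int \<Rightarrow> ((int \<times> 'p \<times> 'n) \<Rightarrow>\<^sub>0 'k) \<Rightarrow> ((int \<times> 'p \<times> 'n) \<Rightarrow>\<^sub>0 'k)" where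
  "pp l = quot_proj free_scale (Rel l)"
text \<open>The class of the pure tensor of \<open>x\<close> and \<open>y\<close>, as an element of
  the complement that realises the quotient.\<close>

definition ten :: "int \<Rightarrow> int \<Rightarrow> 'p \<Rightarrow> 'n \<Rightarrow> ((int \<times> 'p \<times> 'n) \<Rightarrow>\<^sub>0 'k)" where
  "ten l i x y = pp l (gen (i, x, y))"

abbreviation K where "K \<equiv> tensor_cpx P N"

lemma Rel_sub: "subsp free_scale (Rel l)"
  unfolding Rel_def tensor_rel_def by (rule module.subspace_span[OF free_vs[folded module_iff_vector_space]])

lemma pp_linear: "Vector_Spaces.linear free_scale free_scale (pp l)"
  unfolding pp_def by (rule quot_proj(1)[OF free_vs Rel_sub])

lemma pp_lin: "lin_on free_scale U free_scale (pp l)"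
  by (rule lin_on_linear[OF pp_linear])

lemma pp_eq: "u - w \<in> Rel l \<Longrightarrow> pp l u = pp l w"
  unfolding pp_def using quot_proj_diff(1)[OF free_vs Rel_sub] by blast

lemma pp_simps: "pp l (u + w) = pp l u + pp l w" "pp l (u - w) = pp l u - pp l w" "pp l (free_scale c u) = free_scale c (pp l u)"
  "pp l (- u) = - pp l u" "pp l 0 = 0"
proof -
  interpret p: Vector_Spaces.linear free_scale free_scale "pp l" by (rule pp_linear)
  show "pp l (u + w) = pp l u + pp l w" "pp l (u - w) = pp l u - pp l w" "pp l (free_scale c u) = free_scale c (pp l u)"
  "pp l (- u) = - pp l u" "pp l 0 = 0" by (simp_all add: p.add p.diff p.scale p.neg)
qed

lemma K_simps: "carr (ob K l) = pp l ` Fr l" "scl (ob K l) = free_scale"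
  by (simp_all add: tensor_cpx_def quot_def Fr_def pp_def Rel_def tensor_free_def)

lemma rel_base:
  assumes "x \<in> carr (ob P i)" "y \<in> carr (ob N (l - i))"
  shows "x' \<in> carr (ob P i) \<Longrightarrow> gen (i, x + x', y) - gen (i, x, y) - gen (i, x', y) \<in> Rel l"
    "y' \<in> carr (ob N (l - i)) \<Longrightarrow> gen (i, x, y + y') - gen (i, x, y) - gen (i, x, y') \<in> Rel l"
    "gen (i, scl (ob P i) c x, y) - free_scale c (gen (i, x, y)) \<in> Rel l"
    "gen (i, x, scl (ob N (l - i)) c y) - free_scale c (gen (i, x, y)) \<in> Rel l"
    "gen (i, ract (ob P i) x a, y) - gen (i, x, lact (ob N (l - i)) a y) \<in> Rel l"
  unfolding Rel_def tensor_rel_def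
  by (rule module.span_base[OF free_vs[folded module_iff_vector_space]], use assms in blast)+

lemma ten_simps:
  assumes x: "x \<in> carr (ob P i)" and y: "y \<in> carr (ob N (l - i))"
  shows "x' \<in> carr (ob P i) \<Longrightarrow> ten l i (x + x') y = ten l i x y + ten l i x' y"
    "y' \<in> carr (ob N (l - i)) \<Longrightarrow> ten l i x (y + y') = ten l i x y + ten l i x y'"
    "ten l i (scl (ob P i) c x) y = free_scale c (ten l i x y)"
    "ten l i x (scl (ob N (l - i)) c y) = free_scale c (ten l i x y)"
    "ten l i (ract (ob P i) x a) y = ten l i x (lact (ob N (l - i)) a y)"
proof -
  note R = rel_base[OF x y]
  show "ten l i (x + x') y = ten l i x y + ten l i x' y" if "x' \<in> carr (ob P i)"
    unfolding ten_def pp_simps[symmetric] by (rule pp_eq) (use R(1)[OF that] in \<open>simp add: diff_diff_eq\<close>)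
  show "ten l i x (y + y') = ten l i x y + ten l i x y'" if "y' \<in> carr (ob N (l - i))"
    unfolding ten_def pp_simps[symmetric] by (rule pp_eq) (use R(2)[OF that] in \<open>simp add: diff_diff_eq\<close>)
  show "ten l i (scl (ob P i) c x) y = free_scale c (ten l i x y)"
    unfolding ten_def pp_simps[symmetric] by (rule pp_eq[OF R(3)])
  show "ten l i x (scl (ob N (l - i)) c y) = free_scale c (ten l i x y)"
    unfolding ten_def pp_simps[symmetric] by (rule pp_eq[OF R(4)])
  show "ten l i (ract (ob P i) x a) y = ten l i x (lact (ob N (l - i)) a y)"
    unfolding ten_def by (rule pp_eq[OF R(5)])
qed

lemma ten_lin_l: "y \<in> carr (ob N (l - i)) \<Longrightarrow> lin_on (scl (ob P i)) (carr (ob P i)) free_scale (\<lambda>x. ten l i x y)"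
  by (rule lin_onI) (simp_all add: ten_simps)

lemma ten_lin_r: "x \<in> carr (ob P i) \<Longrightarrow> lin_on (scl (ob N (l - i))) (carr (ob N (l - i))) free_scale (ten l i x)"
  by (rule lin_onI) (simp_all add: ten_simps)

lemma ten_in: "x \<in> carr (ob P i) \<Longrightarrow> y \<in> carr (ob N (l - i)) \<Longrightarrow> ten l i x y \<in> carr (ob K l)"
  unfolding ten_def K_simps Fr_def tensor_free_def by (rule imageI) simp

definition balanced :: "int \<Rightarrow> ('k \<Rightarrow> 'w::ab_group_add \<Rightarrow> 'w) \<Rightarrow> (int \<Rightarrow> 'p \<Rightarrow> 'n \<Rightarrow> 'w) \<Rightarrow> bool" where
  "balanced l s g \<longleftrightarrow> vector_space s \<and>
    (\<forall>i. \<forall>y\<in>carr (ob N (l - i)). lin_on (scl (ob P i)) (carr (ob P i)) s (\<lambda>x. g i x y)) \<and>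
    (\<forall>i. \<forall>x\<in>carr (ob P i). lin_on (scl (ob N (l - i))) (carr (ob N (l - i))) s (g i x)) \<and>
    (\<forall>i a. \<forall>x\<in>carr (ob P i). \<forall>y\<in>carr (ob N (l - i)). g i (ract (ob P i) x a) y = g i x (lact (ob N (l - i)) a y))"

text \<open>The map given by the universal property. It is defined on the whole free space and
  evaluated on chosen representatives; for balanced families \<open>tlift_pp\<close> makes the
  choice irrelevant.\<close>

definition tlift :: "('k \<Rightarrow> 'w::ab_group_add \<Rightarrow> 'w) \<Rightarrow> (int \<Rightarrow> 'p \<Rightarrow> 'n \<Rightarrow> 'w) \<Rightarrow> ((int \<times> 'p \<times> 'n) \<Rightarrow>\<^sub>0 'k) \<Rightarrow> 'w" where
  "tlift s g = gext s (\<lambda>(i, x, y). g i x y)"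

lemma Fr_iff: "u \<in> Fr l \<longleftrightarrow> (\<forall>(i, x, y)\<in>Poly_Mapping.keys u. x \<in> carr (ob P i) \<and> y \<in> carr (ob N (l - i)))"
  unfolding Fr_def tensor_free_def by auto

lemma Fr_sub: "subsp free_scale (Fr l)"
proof (rule subspI[OF free_vs])
  show "0 \<in> Fr l" unfolding Fr_iff by simp
  show "u + w \<in> Fr l" if "u \<in> Fr l" "w \<in> Fr l" for u w
    using that Poly_Mapping.keys_add[of u w] unfolding Fr_iff by blast
  show "free_scale c u \<in> Fr l" if "u \<in> Fr l" for c u
  proof -
    have "Poly_Mapping.keys (free_scale c u) \<subseteq> Poly_Mapping.keys u" by (auto simp: in_keys_iff)
    then show ?thesis using that unfolding Fr_iff by blast
  qed
qed

lemma tlift_lin: "vector_space s \<Longrightarrow> lin_on free_scale U s (tlift s g)"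
  unfolding tlift_def by (rule gext_lin)

lemma balancedD:
  assumes "balanced l s g"
  shows "vector_space s" "y \<in> carr (ob N (l - i)) \<Longrightarrow> lin_on (scl (ob P i)) (carr (ob P i)) s (\<lambda>x. g i x y)"
    "x \<in> carr (ob P i) \<Longrightarrow> lin_on (scl (ob N (l - i))) (carr (ob N (l - i))) s (g i x)"
    "x \<in> carr (ob P i) \<Longrightarrow> y \<in> carr (ob N (l - i)) \<Longrightarrow> g i (ract (ob P i) x a) y = g i x (lact (ob N (l - i)) a y)"
  using assms unfolding balanced_def by simp_all

text \<open>The kernel of the lift is a subspace, so only the five kinds of generating relations
  have to be checked, each being one clause of balancedness.\<close>

lemma tlift_Rel:
  assumes b: "balanced l s g" and u: "u \<in> Rel l"
  shows "tlift s g u = 0"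
proof -
  note v = balancedD(1)[OF b]
  have UN: "subsp free_scale UNIV" by (rule module.subspace_UNIV[OF free_vs[folded module_iff_vector_space]])
  note L = tlift_lin[OF v, of UNIV g]
  note d = lin_on_diff[OF free_vs UN L UNIV_I UNIV_I] and sc = lin_on_scale[OF L UNIV_I]
  have G: "tlift s g (gen (i, x, y)) = g i x y" for i x y
    unfolding tlift_def by (simp add: gext_gen[OF v])
  have sub: "subsp free_scale {u \<in> UNIV. tlift s g u = 0}" by (rule lin_on_kernel[OF free_vs v UN L])
  have "Rel l \<subseteq> {u \<in> UNIV. tlift s g u = 0}"
    unfolding Rel_def tensor_rel_def
    by (rule module.span_minimal[OF free_vs[folded module_iff_vector_space] _ sub])
      (auto simp: d sc G lin_on_add[OF balancedD(2)[OF b]] lin_on_add[OF balancedD(3)[OF b]]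
        lin_on_scale[OF balancedD(2)[OF b]] lin_on_scale[OF balancedD(3)[OF b]] balancedD(4)[OF b])
  then show ?thesis using u by blast
qed

lemma tlift_pp:
  assumes b: "balanced l s g"
  shows "tlift s g (pp l u) = tlift s g u"
proof -
  note v = balancedD(1)[OF b]
  have UN: "subsp free_scale UNIV" by (rule module.subspace_UNIV[OF free_vs[folded module_iff_vector_space]])
  have "tlift s g (pp l u) - tlift s g u = tlift s g (pp l u - u)"
    using lin_on_diff[OF free_vs UN tlift_lin[OF v] UNIV_I UNIV_I] by simp
  also have "\<dots> = 0" by (rule tlift_Rel[OF b]) (simp add: pp_def quot_proj_diff(2)[OF free_vs Rel_sub])
  finally show ?thesis by simp
qed

lemma tlift_ten: "balanced l s g \<Longrightarrow> tlift s g (ten l i x y) = g i x y"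
  unfolding ten_def tlift_pp by (simp add: tlift_def gext_gen[OF balancedD(1)])

lemma K_sub: "subsp free_scale (carr (ob K l))"
  unfolding K_simps by (rule lin_on_image[OF free_vs free_vs Fr_sub pp_lin])

lemma ten_span:
  assumes u: "u \<in> carr (ob K l)"
  shows "\<exists>S c. finite S \<and> (\<forall>(i, x, y)\<in>S. x \<in> carr (ob P i) \<and> y \<in> carr (ob N (l - i)))
     \<and> u = (\<Sum>(i, x, y)\<in>S. free_scale (c (i, x, y)) (ten l i x y))"
proof -
  obtain w where w: "w \<in> Fr l" "u = pp l w" using u unfolding K_simps by blast
  have UN: "subsp free_scale UNIV" by (rule module.subspace_UNIV[OF free_vs[folded module_iff_vector_space]])
  have "u = pp l (\<Sum>z\<in>Poly_Mapping.keys w. free_scale (Poly_Mapping.lookup w z) (gen z))"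
    unfolding w(2) using free_decomp[of w] by simp
  also have "\<dots> = (\<Sum>z\<in>Poly_Mapping.keys w. pp l (free_scale (Poly_Mapping.lookup w z) (gen z)))"
    by (rule lin_on_sum[OF free_vs UN pp_lin]) simp
  also have "\<dots> = (\<Sum>(i, x, y)\<in>Poly_Mapping.keys w. free_scale (Poly_Mapping.lookup w (i, x, y)) (ten l i x y))"
    by (rule sum.cong) (auto simp: pp_simps ten_def)
  finally show ?thesis using w(1) unfolding Fr_iff
    by (intro exI[of _ "Poly_Mapping.keys w"] exI[of _ "Poly_Mapping.lookup w"]) simp
qed

text \<open>Pure tensors span the complex, so identities of linear operators are reduced to them;
  every structural equation for the tensor complex below is proved this way.\<close>

lemma ten_eqI:
  assumes v: "vector_space s" and f: "lin_on free_scale (carr (ob K l)) s f" and g: "lin_on free_scale (carr (ob K l)) s g"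
    and eq: "\<And>i x y. x \<in> carr (ob P i) \<Longrightarrow> y \<in> carr (ob N (l - i)) \<Longrightarrow> f (ten l i x y) = g (ten l i x y)"
    and u: "u \<in> carr (ob K l)"
  shows "f u = g u"
proof -
  note S = subspD[OF free_vs K_sub]
  obtain S c where Sc: "finite S" "\<forall>(i, x, y)\<in>S. x \<in> carr (ob P i) \<and> y \<in> carr (ob N (l - i))"
    "u = (\<Sum>(i, x, y)\<in>S. free_scale (c (i, x, y)) (ten l i x y))" using ten_span[OF u] by (elim exE conjE)
  have in_K: "(case z of (i, x, y) \<Rightarrow> free_scale (c (i, x, y)) (ten l i x y)) \<in> carr (ob K l)" if "z \<in> S" for z
    using Sc(2) that by (auto intro!: S(5) ten_in)
  have "f u = (\<Sum>z\<in>S. f (case z of (i, x, y) \<Rightarrow> free_scale (c (i, x, y)) (ten l i x y)))"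
    unfolding Sc(3) by (rule lin_on_sum[OF free_vs K_sub f in_K])
  also have "\<dots> = (\<Sum>z\<in>S. g (case z of (i, x, y) \<Rightarrow> free_scale (c (i, x, y)) (ten l i x y)))"
    by (rule sum.cong[OF refl])
      (use Sc(2) in \<open>auto simp: lin_on_scale[OF f ten_in] lin_on_scale[OF g ten_in] eq\<close>)
  also have "\<dots> = g u"
    unfolding Sc(3) by (rule lin_on_sum[OF free_vs K_sub g in_K, symmetric])
  finally show ?thesis .
qed

lemma ten_closed:
  assumes W: "vector_space s" "subsp s W" and f: "lin_on free_scale (carr (ob K l)) s f"
    and cl: "\<And>i x y. x \<in> carr (ob P i) \<Longrightarrow> y \<in> carr (ob N (l - i)) \<Longrightarrow> f (ten l i x y) \<in> W"
    and u: "u \<in> carr (ob K l)"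
  shows "f u \<in> W"
proof -
  note S = subspD[OF free_vs K_sub]
  obtain S c where Sc: "finite S" "\<forall>(i, x, y)\<in>S. x \<in> carr (ob P i) \<and> y \<in> carr (ob N (l - i))"
    "u = (\<Sum>(i, x, y)\<in>S. free_scale (c (i, x, y)) (ten l i x y))" using ten_span[OF u] by (elim exE conjE)
  have in_K: "(case z of (i, x, y) \<Rightarrow> free_scale (c (i, x, y)) (ten l i x y)) \<in> carr (ob K l)" if "z \<in> S" for z
    using Sc(2) that by (auto intro!: S(5) ten_in)
  have "f u = (\<Sum>z\<in>S. f (case z of (i, x, y) \<Rightarrow> free_scale (c (i, x, y)) (ten l i x y)))"
    unfolding Sc(3) by (rule lin_on_sum[OF free_vs K_sub f in_K])
  also have "\<dots> \<in> W"
    by (rule subspD(6)[OF W]) (use Sc(2) in \<open>auto simp: lin_on_scale[OF f ten_in] intro!: subspD(5)[OF W] cl\<close>)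
  finally show ?thesis .
qed

lemma pp_lift: "pp l' (lin_ext g u) = tlift free_scale (\<lambda>i x y. pp l' (g (i, x, y))) u"
  unfolding lin_ext_gext tlift_def gext_linear_comp[OF pp_lin free_vs]
  by (rule arg_cong[where f = "\<lambda>g. gext free_scale g u"]) auto

definition N_endo :: "(int \<Rightarrow> 'n \<Rightarrow> 'n) \<Rightarrow> bool" where
  "N_endo \<beta> \<longleftrightarrow> NC.endo \<beta> \<and> (\<forall>l. \<forall>y\<in>carr (ob N l). \<forall>a. \<beta> l (lact (ob N l) a y) = lact (ob N l) a (\<beta> l y))"

lemma N_endoD: "N_endo \<beta> \<Longrightarrow> lin_on (scl (ob N l)) (carr (ob N l)) (scl (ob N l)) (\<beta> l)"
  "N_endo \<beta> \<Longrightarrow> y \<in> carr (ob N l) \<Longrightarrow> df N l (\<beta> l y) = \<beta> (l + 1) (df N l y)"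
  "N_endo \<beta> \<Longrightarrow> y \<in> carr (ob N l) \<Longrightarrow> \<beta> l y \<in> carr (ob N l)"
  "N_endo \<beta> \<Longrightarrow> y \<in> carr (ob N l) \<Longrightarrow> \<beta> l (lact (ob N l) a y) = lact (ob N l) a (\<beta> l y)"
  unfolding N_endo_def using NC.endoD(1,2,3) by blast+

text \<open>The operator \<open>\<alpha> \<otimes> \<beta>\<close> in degree zero. As in the Hom
  case it uniformly describes the two actions, the induced map and the correction by
  \<open>eps\<close>.\<close>

definition toper :: "(int \<Rightarrow> 'p \<Rightarrow> 'p) \<Rightarrow> (int \<Rightarrow> 'n \<Rightarrow> 'n) \<Rightarrow> int \<Rightarrow> ((int \<times> 'p \<times> 'n) \<Rightarrow>\<^sub>0 'k) \<Rightarrow> ((int \<times> 'p \<times> 'n) \<Rightarrow>\<^sub>0 'k)" where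
  "toper \<alpha> \<beta> l u = pp l (lin_ext (\<lambda>(i, x, y). gen (i, \<alpha> i x, \<beta> (l - i) y)) u)"

lemma toper_lift: "toper \<alpha> \<beta> l = tlift free_scale (\<lambda>i x y. ten l i (\<alpha> i x) (\<beta> (l - i) y))"
  by (rule ext) (simp add: toper_def pp_lift ten_def)

lemma toper_lin: "lin_on free_scale U free_scale (toper \<alpha> \<beta> l)"
  unfolding toper_lift by (rule tlift_lin[OF free_vs])

lemma toper_ten:
  assumes a: "P_endo \<alpha>" and b: "N_endo \<beta>"
  shows "toper \<alpha> \<beta> l (ten l i x y) = ten l i (\<alpha> i x) (\<beta> (l - i) y)"
proof -
  have "balanced l free_scale (\<lambda>i x y. ten l i (\<alpha> i x) (\<beta> (l - i) y))"
    unfolding balanced_def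
  proof (intro conjI allI ballI free_vs)
    fix i y assume y: "y \<in> carr (ob N (l - i))"
    show "lin_on (scl (ob P i)) (carr (ob P i)) free_scale (\<lambda>x. ten l i (\<alpha> i x) (\<beta> (l - i) y))"
      by (rule lin_on_comp[OF hom_lin[OF P_endoD(1)[OF a]] _ ten_lin_l[OF N_endoD(3)[OF b y]]]) (use P_endoD(3)[OF a] in blast)
  next
    fix i x assume x: "x \<in> carr (ob P i)"
    show "lin_on (scl (ob N (l - i))) (carr (ob N (l - i))) free_scale (\<lambda>y. ten l i (\<alpha> i x) (\<beta> (l - i) y))"
      by (rule lin_on_comp[OF N_endoD(1)[OF b] _ ten_lin_r[OF P_endoD(3)[OF a x]]]) (use N_endoD(3)[OF b] in blast)
  next
    fix i c x y assume x: "x \<in> carr (ob P i)" and y: "y \<in> carr (ob N (l - i))"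
    show "ten l i (\<alpha> i (ract (ob P i) x c)) (\<beta> (l - i) y) = ten l i (\<alpha> i x) (\<beta> (l - i) (lact (ob N (l - i)) c y))"
      unfolding hom_ract[OF P_endoD(1)[OF a] x] N_endoD(4)[OF b y] by (rule ten_simps(5)[OF P_endoD(3)[OF a x] N_endoD(3)[OF b y]])
  qed
  then show ?thesis unfolding toper_lift by (rule tlift_ten)
qed

lemma df_K_lift: "df K l = tlift free_scale (\<lambda>i x y. ten (l + 1) (i + 1) (df P i x) y + signed i (ten (l + 1) i x (df N (l - i) y)))"
proof
  fix u
  have "df K l u = pp (l + 1) (lin_ext (\<lambda>(i, x, y). gen (i + 1, df P i x, y)
            + (if even i then gen (i, x, df N (l - i) y) else - gen (i, x, df N (l - i) y))) u)"
    by (simp add: tensor_cpx_def pp_def Rel_def)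
  also have "\<dots> = tlift free_scale (\<lambda>i x y. ten (l + 1) (i + 1) (df P i x) y + signed i (ten (l + 1) i x (df N (l - i) y))) u"
    unfolding pp_lift by (rule arg_cong[where f = "\<lambda>g. tlift free_scale g u"])
      (auto simp: fun_eq_iff pp_simps ten_def signed_def)
  finally show "df K l u = tlift free_scale (\<lambda>i x y. ten (l + 1) (i + 1) (df P i x) y + signed i (ten (l + 1) i x (df N (l - i) y))) u" .
qed

lemma lin_on_signed: "lin_on s V free_scale f \<Longrightarrow> lin_on s V free_scale (\<lambda>x. signed i (f x))"
  using lin_on_plus(3)[OF free_vs] by (cases "even i") (simp_all add: signed_def)

lemma dfN: "y \<in> carr (ob N (l - i)) \<Longrightarrow> df N (l - i) y \<in> carr (ob N (l + 1 - i))"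
  using NC.d(2)[of y "l - i"] by (simp add: algebra_simps)

lemma df_balanced: "balanced l free_scale (\<lambda>i x y. ten (l + 1) (i + 1) (df P i x) y + signed i (ten (l + 1) i x (df N (l - i) y)))"
  unfolding balanced_def
proof (intro conjI allI ballI free_vs)
  fix i y assume y: "y \<in> carr (ob N (l - i))"
  have y': "y \<in> carr (ob N (l + 1 - (i + 1)))" using y by simp
  show "lin_on (scl (ob P i)) (carr (ob P i)) free_scale (\<lambda>x. ten (l + 1) (i + 1) (df P i x) y + signed i (ten (l + 1) i x (df N (l - i) y)))"
    by (rule lin_on_plus(1)[OF free_vs lin_on_comp[OF PC.d(1) _ ten_lin_l[OF y']] lin_on_signed[OF ten_lin_l[OF dfN[OF y]]]])
      (use PC.d(2) in blast)
next
  fix i x assume x: "x \<in> carr (ob P i)"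
  have dl: "lin_on (scl (ob N (l - i))) (carr (ob N (l - i))) (scl (ob N (l + 1 - i))) (df N (l - i))"
    using NC.d(1)[of "l - i"] by (simp add: algebra_simps)
  have 1: "lin_on (scl (ob N (l - i))) (carr (ob N (l - i))) free_scale (\<lambda>y. ten (l + 1) (i + 1) (df P i x) y)"
    using ten_lin_r[OF PC.d(2)[OF x], of "l + 1"] by simp
  show "lin_on (scl (ob N (l - i))) (carr (ob N (l - i))) free_scale (\<lambda>y. ten (l + 1) (i + 1) (df P i x) y + signed i (ten (l + 1) i x (df N (l - i) y)))"
    by (rule lin_on_plus(1)[OF free_vs 1 lin_on_signed[OF lin_on_comp[OF dl _ ten_lin_r[OF x]]]])
      (use dfN in blast)
next
  fix i a x y assume x: "x \<in> carr (ob P i)" and y: "y \<in> carr (ob N (l - i))"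
  have "ten (l + 1) (i + 1) (df P i (ract (ob P i) x a)) y = ten (l + 1) (i + 1) (df P i x) (lact (ob N (l - i)) a y)"
    unfolding hom_ract[OF bcD(2)[OF Pc] x] using ten_simps(5)[OF PC.d(2)[OF x], of y "l + 1" a] y by simp
  moreover have "df N (l - i) (lact (ob N (l - i)) a y) = lact (ob N (l + 1 - i)) a (df N (l - i) y)"
    using C.bcD(3)[OF Nc y, of a] by (simp add: algebra_simps)
  ultimately show "ten (l + 1) (i + 1) (df P i (ract (ob P i) x a)) y + signed i (ten (l + 1) i (ract (ob P i) x a) (df N (l - i) y))
    = ten (l + 1) (i + 1) (df P i x) (lact (ob N (l - i)) a y) + signed i (ten (l + 1) i x (df N (l - i) (lact (ob N (l - i)) a y)))"
    using ten_simps(5)[OF x dfN[OF y], of a] by simp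
qed

lemma df_ten: "df K l (ten l i x y) = ten (l + 1) (i + 1) (df P i x) y + signed i (ten (l + 1) i x (df N (l - i) y))"
  unfolding df_K_lift by (rule tlift_ten[OF df_balanced])

lemma df_lin: "lin_on free_scale U free_scale (df K l)"
  unfolding df_K_lift by (rule tlift_lin[OF free_vs])

lemma signed_in: "w \<in> carr (ob K l) \<Longrightarrow> signed i w \<in> carr (ob K l)"
  using subspD(4)[OF free_vs K_sub] by (simp add: signed_def)

lemma lin_signed:
  assumes "lin_on free_scale UNIV free_scale f"
  shows "f (signed i w) = signed i (f w)"
proof -
  have "f (- w) = - f w"
    by (rule lin_on_neg[OF free_vs module.subspace_UNIV[OF free_vs[folded module_iff_vector_space]] assms UNIV_I])
  then show ?thesis by (simp add: signed_def)
qed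

lemma ten_0: "x \<in> carr (ob P i) \<Longrightarrow> ten l i x 0 = 0" "y \<in> carr (ob N (l - i)) \<Longrightarrow> ten l i 0 y = 0"
  using lin_on_0[OF NC.vs NC.V ten_lin_r] lin_on_0[OF PC.vs PC.V ten_lin_l] by blast+

lemma K_vs: "vs_complex (\<lambda>l. scl (ob K l)) (\<lambda>l. carr (ob K l)) (df K)"
  unfolding K_simps(2)
proof (rule vs_complex.intro)
  fix l
  show "vector_space free_scale" by (rule free_vs)
  show "subsp free_scale (carr (ob K l))" by (rule K_sub)
  show "lin_on free_scale (carr (ob K l)) free_scale (df K l)" by (rule df_lin)
  fix u assume u: "u \<in> carr (ob K l)"
  show dK: "df K l u \<in> carr (ob K (l + 1))"
  proof (rule ten_closed[OF free_vs K_sub df_lin _ u])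
    fix i x y assume x: "x \<in> carr (ob P i)" and y: "y \<in> carr (ob N (l - i))"
    have "ten (l + 1) (i + 1) (df P i x) y \<in> carr (ob K (l + 1))" by (rule ten_in[OF PC.d(2)[OF x]]) (use y in simp)
    then show "df K l (ten l i x y) \<in> carr (ob K (l + 1))"
      unfolding df_ten by (rule subspD(2)[OF free_vs K_sub _ signed_in[OF ten_in[OF x dfN[OF y]]]])
  qed
  show "df K (l + 1) (df K l u) = 0"
  proof (rule ten_eqI[OF free_vs _ _ _ u, where g = "\<lambda>_. 0" and f = "\<lambda>u. df K (l + 1) (df K l u)"])
    show "lin_on free_scale (carr (ob K l)) free_scale (\<lambda>u. df K (l + 1) (df K l u))"
      by (rule lin_on_comp[OF df_lin subset_UNIV df_lin])
    show "lin_on free_scale (carr (ob K l)) free_scale (\<lambda>_. 0)"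
      by (simp add: lin_on_def module.scale_zero_right[OF free_vs[folded module_iff_vector_space]])
    fix i x y assume x: "x \<in> carr (ob P i)" and y: "y \<in> carr (ob N (l - i))"
    have y2: "y \<in> carr (ob N (l + 1 + 1 - (i + 1 + 1)))" using y by simp
    have 1: "ten (l + 1 + 1) (i + 1 + 1) (df P (i + 1) (df P i x)) y = 0"
      unfolding PC.dd[OF x] by (rule ten_0(2)[OF y2])
    have e: "l + 1 - (i + 1) = l - i" "l + 1 - i = l - i + 1" by simp_all
    have 2: "ten (l + 1 + 1) i x (df N (l + 1 - i) (df N (l - i) y)) = 0"
      unfolding e NC.dd[OF y] by (rule ten_0(1)[OF x])
    have "df K (l + 1) (df K l (ten l i x y)) = df K (l + 1) (ten (l + 1) (i + 1) (df P i x) y) + signed i (df K (l + 1) (ten (l + 1) i x (df N (l - i) y)))"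
      unfolding df_ten[of l] lin_on_add[OF df_lin UNIV_I UNIV_I] lin_signed[OF df_lin] ..
    \<comment> \<open>The two mixed terms \<open>d x \<otimes> d y\<close> cancel, since
      \<open>d x\<close> lives one degree higher than \<open>x\<close> and so carries the opposite
      sign.\<close>
    also have "\<dots> = 0" unfolding df_ten[of "l + 1"] 1 2 e(1) by (simp add: signed_def)
    finally show "df K (l + 1) (df K l (ten l i x y)) = 0" .
  qed
qed

sublocale KC: vs_complex "\<lambda>l. scl (ob K l)" "\<lambda>l. carr (ob K l)" "df K" by (rule K_vs)

lemma toper_in:
  assumes a: "P_endo \<alpha>" and b: "N_endo \<beta>" and u: "u \<in> carr (ob K l)"
  shows "toper \<alpha> \<beta> l u \<in> carr (ob K l)"
  by (rule ten_closed[OF free_vs K_sub toper_lin _ u])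
    (simp add: toper_ten[OF a b] ten_in P_endoD(3)[OF a] N_endoD(3)[OF b])

lemma toper_endo:
  assumes a: "P_endo \<alpha>" and b: "N_endo \<beta>"
  shows "KC.endo (toper \<alpha> \<beta>)"
proof (rule KC.endoI, unfold K_simps(2))
  fix l u assume u: "u \<in> carr (ob K l)"
  show "toper \<alpha> \<beta> l u \<in> carr (ob K l)" by (rule toper_in[OF a b u])
  show "df K l (toper \<alpha> \<beta> l u) = toper \<alpha> \<beta> (l + 1) (df K l u)"
  proof (rule ten_eqI[OF free_vs _ _ _ u, where f = "\<lambda>u. df K l (toper \<alpha> \<beta> l u)" and g = "\<lambda>u. toper \<alpha> \<beta> (l + 1) (df K l u)"])
    show "lin_on free_scale (carr (ob K l)) free_scale (\<lambda>u. df K l (toper \<alpha> \<beta> l u))"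
      by (rule lin_on_comp[OF toper_lin subset_UNIV df_lin])
    show "lin_on free_scale (carr (ob K l)) free_scale (\<lambda>u. toper \<alpha> \<beta> (l + 1) (df K l u))"
      by (rule lin_on_comp[OF df_lin subset_UNIV toper_lin])
    fix i x y assume x: "x \<in> carr (ob P i)" and y: "y \<in> carr (ob N (l - i))"
    have e: "l + 1 - (i + 1) = l - i" "l + 1 - i = l - i + 1" by simp_all
    show "df K l (toper \<alpha> \<beta> l (ten l i x y)) = toper \<alpha> \<beta> (l + 1) (df K l (ten l i x y))"
      unfolding toper_ten[OF a b] df_ten lin_on_add[OF toper_lin UNIV_I UNIV_I] lin_signed[OF toper_lin]
        P_endoD(2)[OF a x] N_endoD(2)[OF b y] e ..
  qed
qed (rule toper_lin)

lemma toper_comp: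
  assumes a: "P_endo \<alpha>" and b: "N_endo \<beta>" and a': "P_endo \<alpha>'" and b': "N_endo \<beta>'"
    and c: "P_endo (\<lambda>i x. \<alpha> i (\<alpha>' i x))" and c': "N_endo (\<lambda>j y. \<beta> j (\<beta>' j y))" and u: "u \<in> carr (ob K l)"
  shows "toper \<alpha> \<beta> l (toper \<alpha>' \<beta>' l u) = toper (\<lambda>i x. \<alpha> i (\<alpha>' i x)) (\<lambda>j y. \<beta> j (\<beta>' j y)) l u"
proof (rule ten_eqI[OF free_vs _ toper_lin _ u, where f = "\<lambda>u. toper \<alpha> \<beta> l (toper \<alpha>' \<beta>' l u)"])
  show "lin_on free_scale (carr (ob K l)) free_scale (\<lambda>u. toper \<alpha> \<beta> l (toper \<alpha>' \<beta>' l u))"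
    by (rule lin_on_comp[OF toper_lin subset_UNIV toper_lin])
qed (simp add: toper_ten[OF a b] toper_ten[OF a' b'] toper_ten[OF c c'])

lemma toper_cong:
  assumes a: "P_endo \<alpha>" and b: "N_endo \<beta>" and a': "P_endo \<alpha>'" and b': "N_endo \<beta>'"
    and "\<And>i x. x \<in> carr (ob P i) \<Longrightarrow> \<alpha> i x = \<alpha>' i x" "\<And>j y. y \<in> carr (ob N j) \<Longrightarrow> \<beta> j y = \<beta>' j y"
    and u: "u \<in> carr (ob K l)"
  shows "toper \<alpha> \<beta> l u = toper \<alpha>' \<beta>' l u"
  by (rule ten_eqI[OF free_vs toper_lin toper_lin _ u]) (simp add: toper_ten[OF a b] toper_ten[OF a' b'] assms(5,6))

end

text \<open>Tor is graded homologically while the tensor complex is graded cohomologically; negating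
  the degree preserves its parity.\<close>

lemma euler_uminus: "euler (\<lambda>l. G (- l)) = euler (G :: int \<Rightarrow> 'k::ab_group_add)"
  unfolding euler_def
  by (rule Sum_any.reindex_cong[of uminus, symmetric]) (auto simp: bij_def signed_def fun_eq_iff surj_def inj_def intro: exI[of _ "- _"])

context tor_data
begin

lemma N_endo_id: "N_endo (\<lambda>i x. x)" unfolding N_endo_def
  by (intro conjI allI NC.endoI) (auto simp: lin_on_id)

lemma N_endo_comp: "N_endo \<beta> \<Longrightarrow> N_endo \<beta>' \<Longrightarrow> N_endo (\<lambda>i x. \<beta> i (\<beta>' i x))"
  unfolding N_endo_def using NC.endo_comp NC.endoD(2) by simp

lemma N_endo_psi: "N_endo \<psi>" unfolding N_endo_def using C.complex_endos(3)[OF Nc psi] C.cmD(2)[OF psi] by blast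
lemma N_endo_gg: "N_endo (\<lambda>l y. ract (ob N l) y gg)" unfolding N_endo_def using C.complex_endos(2)[OF Nc] C.bmD(7)[OF Nb] by blast

text \<open>The contraction is \<open>h \<otimes> 1\<close>. The homotopy equation for it holds on
  the whole tensor complex, and the cocycle condition only removes the term with
  \<open>d u\<close>.\<close>

lemma toper_eps_cyc:
  assumes u: "u \<in> KC.cyc l"
  shows "u - toper eps (\<lambda>i x. x) l u \<in> KC.bd l"
proof -
  have uK: "u \<in> carr (ob K l)" and du: "df K l u = 0" using u unfolding KC.cyc_def by simp_all
  define Hm where "Hm l = tlift free_scale (\<lambda>i x y. ten (l - 1) (i - 1) (h i x) y)" for l
  have Hl: "lin_on free_scale U free_scale (Hm l)" for U l unfolding Hm_def by (rule tlift_lin[OF free_vs])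
  have Hten: "Hm l (ten l i x y) = ten (l - 1) (i - 1) (h i x) y" for l i x y
    unfolding Hm_def
  proof (rule tlift_ten, unfold balanced_def, intro conjI allI ballI free_vs)
    fix i y assume "y \<in> carr (ob N (l - i))"
    then have y: "y \<in> carr (ob N (l - 1 - (i - 1)))" by simp
    show "lin_on (scl (ob P i)) (carr (ob P i)) free_scale (\<lambda>x. ten (l - 1) (i - 1) (h i x) y)"
      by (rule lin_on_comp[OF hom_lin[OF h] _ ten_lin_l[OF y]]) (use hom_in[OF h] in blast)
  next
    fix i x assume x: "x \<in> carr (ob P i)"
    show "lin_on (scl (ob N (l - i))) (carr (ob N (l - i))) free_scale (ten (l - 1) (i - 1) (h i x))"
      using ten_lin_r[OF hom_in[OF h x], of "l - 1"] by simp
  next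
    fix i a x y assume x: "x \<in> carr (ob P i)" and "y \<in> carr (ob N (l - i))"
    then have y: "y \<in> carr (ob N (l - 1 - (i - 1)))" by simp
    show "ten (l - 1) (i - 1) (h i (ract (ob P i) x a)) y = ten (l - 1) (i - 1) (h i x) (lact (ob N (l - i)) a y)"
      unfolding hom_ract[OF h x] using ten_simps(5)[OF hom_in[OF h x] y] by simp
  qed
  have Hin: "Hm l u \<in> carr (ob K (l - 1))"
    by (rule ten_closed[OF free_vs K_sub Hl _ uK], unfold Hten, rule ten_in[OF hom_in[OF h]]) simp_all
  have "u - toper eps (\<lambda>i x. x) l u = df K (l - 1) (Hm l u) + Hm (l + 1) (df K l u)"
  proof (rule ten_eqI[OF free_vs _ _ _ uK, where f = "\<lambda>u. u - toper eps (\<lambda>i x. x) l u" and g = "\<lambda>u. df K (l - 1) (Hm l u) + Hm (l + 1) (df K l u)"])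
    show "lin_on free_scale (carr (ob K l)) free_scale (\<lambda>u. u - toper eps (\<lambda>i x. x) l u)"
      by (rule lin_on_plus(2)[OF free_vs lin_on_id toper_lin])
    show "lin_on free_scale (carr (ob K l)) free_scale (\<lambda>u. df K (l - 1) (Hm l u) + Hm (l + 1) (df K l u))"
      by (rule lin_on_plus(1)[OF free_vs lin_on_comp[OF Hl subset_UNIV df_lin] lin_on_comp[OF df_lin subset_UNIV Hl]])
    fix i x y assume x: "x \<in> carr (ob P i)" and y: "y \<in> carr (ob N (l - i))"
    have ex: "eps i x \<in> carr (ob P i)" by (rule hom_in[OF eps_hom x])
    have a: "df P (i - 1) (h i x) \<in> carr (ob P i)" by (rule hom_in[OF dfP hom_in[OF h x]])
    have b: "h (i + 1) (df P i x) \<in> carr (ob P i)" by (rule hom_in[OF hP PC.d(2)[OF x]])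
    have e: "l - 1 - (i - 1) = l - i" "l - 1 + 1 = l" "i - 1 + 1 = i" "l + 1 - 1 = l" "i + 1 - 1 = i" by simp_all
    have "ten l i x y - toper eps (\<lambda>i x. x) l (ten l i x y) = ten l i (x - eps i x) y"
      unfolding toper_ten[OF P_endo_eps N_endo_id] by (rule lin_on_diff[OF PC.vs PC.V ten_lin_l[OF y] x ex, symmetric])
    also have "x - eps i x = df P (i - 1) (h i x) + h (i + 1) (df P i x)" unfolding eps_def by simp
    also have "ten l i (df P (i - 1) (h i x) + h (i + 1) (df P i x)) y = ten l i (df P (i - 1) (h i x)) y + ten l i (h (i + 1) (df P i x)) y"
      by (rule ten_simps(1)[OF a y b])
    \<comment> \<open>The terms involving the differential of \<open>N\<close> cancel, because
      \<open>h\<close> lowers the degree of \<open>x\<close> by one and thereby flips the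
      sign.\<close>
    also have "\<dots> = df K (l - 1) (Hm l (ten l i x y)) + Hm (l + 1) (df K l (ten l i x y))"
      unfolding Hten df_ten lin_on_add[OF Hl UNIV_I UNIV_I] lin_signed[OF Hl] e by (simp add: signed_def)
    finally show "ten l i x y - toper eps (\<lambda>i x. x) l (ten l i x y) = df K (l - 1) (Hm l (ten l i x y)) + Hm (l + 1) (df K l (ten l i x y))" .
  qed
  also have "Hm (l + 1) (df K l u) = 0"
    unfolding du by (rule lin_on_0[OF free_vs K_sub Hl])
  finally show ?thesis unfolding KC.bd_def using Hin by simp
qed

text \<open>Again a finite sum of maps through single terms of \<open>N\<close>:
  \<open>x \<otimes> y\<close> goes to \<open>\<xi> i k x\<close> acting on
  \<open>\<beta> y\<close>, and \<open>y\<close> goes back to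
  \<open>\<alpha> (t i k) \<otimes> y\<close>. Balancing moves the coordinate across the tensor
  sign. The last claim bounds the support of the operator, which is needed for the Hopf
  formula.\<close>

lemma toper_eps_trace:
  assumes a: "P_endo \<alpha>" and b: "N_endo \<beta>"
  defines "T \<equiv> toper (\<lambda>i x. \<alpha> i (eps i x)) \<beta>"
  shows "fdim free_scale (T l ` carr (ob K l))"
    and "fr_trace free_scale (carr (ob K l)) (T l) =
      (\<Sum>i\<in>F. lin_trace (scl (ob N (l - i))) (carr (ob N (l - i)))
        (\<lambda>y. lact (ob N (l - i)) (\<Sum>k<r i. \<xi> i k (\<alpha> i (t i k))) (\<beta> (l - i) y)))"
    and "(\<And>i. i \<in> F \<Longrightarrow> carr (ob N (l - i)) = {0}) \<Longrightarrow> u \<in> carr (ob K l) \<Longrightarrow> T l u = 0"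
proof -
  have ae: "P_endo (\<lambda>i x. \<alpha> i (eps i x))" by (rule P_endo_comp[OF a P_endo_eps])
  define I where "I = Sigma F (\<lambda>i. {..<r i})"
  have I: "finite I" unfolding I_def using F(1) by simp
  define tt where "tt i k = \<alpha> i (t i k)" for i k
  have tt: "tt i k \<in> carr (ob P i)" if "k < r i" for i k unfolding tt_def by (rule P_endoD(3)[OF a t[OF that]])
  \<comment> \<open>The family whose lift is the contraction \<open>A q\<close> to \<open>N\<close>;
    it sees only the summand with index \<open>fst q\<close>.\<close>
  define ga where "ga q i x y = (if i = fst q then lact (ob N (l - fst q)) (\<xi> i (snd q) x) (\<beta> (l - i) y) else 0)"
    for q :: "int \<times> nat" and i x y
  have lact_lin: "lin_on sA UNIV (scl (ob N j)) (\<lambda>s. lact (ob N j) s y)" if "y \<in> carr (ob N j)" for j y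
    by (rule lin_onI) (simp_all add: C.bmD(4,8)[OF Nb that])
  have lact_lin2: "lin_on (scl (ob N j)) (carr (ob N j)) (scl (ob N j)) (lact (ob N j) s)" for j s
    by (rule hom_lin[OF C.bm_hom[OF Nb]])
  have zl: "lin_on s U (scl (ob N j)) (\<lambda>x. 0)" for s :: "'k \<Rightarrow> 'q::ab_group_add \<Rightarrow> 'q" and U j
    by (simp add: lin_on_def module.scale_zero_right[OF NC.vs[folded module_iff_vector_space]])
  have qxi: "rmod_hom (ob P (fst q)) regm (\<xi> (fst q) (snd q))" if "q \<in> I" for q
    using that unfolding I_def by (auto intro: xi)
  have ga: "balanced l (scl (ob N (l - fst q))) (ga q)" if q: "q \<in> I" for q
    unfolding balanced_def
  proof (intro conjI allI ballI NC.vs)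
    fix i y assume y: "y \<in> carr (ob N (l - i))"
    show "lin_on (scl (ob P i)) (carr (ob P i)) (scl (ob N (l - fst q))) (\<lambda>x. ga q i x y)"
    proof (cases "i = fst q")
      case True
      have "lin_on (scl (ob P (fst q))) (carr (ob P (fst q))) (scl (ob N (l - fst q))) (\<lambda>x. lact (ob N (l - fst q)) (\<xi> (fst q) (snd q) x) (\<beta> (l - fst q) y))"
        by (rule lin_on_comp[OF hom_lin[OF qxi[OF q], unfolded regm_simps] subset_UNIV lact_lin]) (use N_endoD(3)[OF b] y True in simp)
      then show ?thesis unfolding ga_def using True by simp
    qed (simp add: ga_def zl)
  next
    fix i x assume x: "x \<in> carr (ob P i)"
    show "lin_on (scl (ob N (l - i))) (carr (ob N (l - i))) (scl (ob N (l - fst q))) (ga q i x)"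
    proof (cases "i = fst q")
      case True
      have "lin_on (scl (ob N (l - i))) (carr (ob N (l - i))) (scl (ob N (l - i))) (\<lambda>y. lact (ob N (l - i)) (\<xi> i (snd q) x) (\<beta> (l - i) y))"
        by (rule lin_on_comp[OF N_endoD(1)[OF b] _ lact_lin2]) (use N_endoD(3)[OF b] in blast)
      moreover have "ga q i x = (\<lambda>y. lact (ob N (l - i)) (\<xi> i (snd q) x) (\<beta> (l - i) y))"
        using True by (intro ext) (simp add: ga_def)
      ultimately show ?thesis using True by simp
    next
      case False
      then have "ga q i x = (\<lambda>y. 0)" by (intro ext) (simp add: ga_def)
      then show ?thesis by (simp add: zl)
    qed
  next
    fix i c x y assume x: "x \<in> carr (ob P i)" and y: "y \<in> carr (ob N (l - i))"
    show "ga q i (ract (ob P i) x c) y = ga q i x (lact (ob N (l - i)) c y)"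
    proof (cases "i = fst q")
      case True
      have x': "x \<in> carr (ob P (fst q))" and y': "y \<in> carr (ob N (l - fst q))" using x y True by simp_all
      show ?thesis unfolding ga_def using True hom_ract[OF qxi[OF q] x']
        by (simp add: N_endoD(4)[OF b y'] C.bmD(5)[OF Nb N_endoD(3)[OF b y']])
    qed (simp add: ga_def)
  qed
  define A where "A q = tlift (scl (ob N (l - fst q))) (ga q)" for q
  define B where "B q y = ten l (fst q) (tt (fst q) (snd q)) y" for q :: "int \<times> nat" and y
  have A: "lin_on free_scale U (scl (ob N (l - fst q))) (A q)" for q U unfolding A_def by (rule tlift_lin[OF NC.vs])
  have Aten: "A q (ten l i x y) = ga q i x y" if "q \<in> I" for q i x y unfolding A_def by (rule tlift_ten[OF ga[OF that]])
  have AN: "A q ` carr (ob K l) \<subseteq> carr (ob N (l - fst q))" if q: "q \<in> I" for q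
  proof (intro image_subsetI)
    fix u assume u: "u \<in> carr (ob K l)"
    show "A q u \<in> carr (ob N (l - fst q))"
    proof (rule ten_closed[OF NC.vs NC.V A _ u])
      fix i x y assume "x \<in> carr (ob P i)" "y \<in> carr (ob N (l - i))"
      then show "A q (ten l i x y) \<in> carr (ob N (l - fst q))"
        unfolding Aten[OF q] ga_def using C.bmD(2)[OF Nb] N_endoD(3)[OF b] subspD(1)[OF NC.vs NC.V] by auto
    qed
  qed
  have ttI: "tt (fst q) (snd q) \<in> carr (ob P (fst q))" if "q \<in> I" for q using that tt unfolding I_def by auto
  have B: "lin_on (scl (ob N (l - fst q))) (carr (ob N (l - fst q))) free_scale (B q)" if "q \<in> I" for q
    using ten_lin_r[OF ttI[OF that], of l] unfolding B_def .
  have BK: "B q y \<in> carr (ob K l)" if "q \<in> I" "y \<in> carr (ob N (l - fst q))" for q y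
    unfolding B_def by (rule ten_in[OF ttI[OF that(1)] that(2)])
  have BA: "lin_on free_scale (carr (ob K l)) free_scale (\<lambda>f. B q (A q f))" if "q \<in> I" for q
    by (rule lin_on_comp[OF A AN[OF that] B[OF that]])
  have T: "T l u = (\<Sum>q\<in>I. B q (A q u))" if u: "u \<in> carr (ob K l)" for u
  proof (rule ten_eqI[OF free_vs _ _ _ u, where f = "T l" and g = "\<lambda>u. \<Sum>q\<in>I. B q (A q u)"])
    show "lin_on free_scale (carr (ob K l)) free_scale (T l)" unfolding T_def by (rule toper_lin)
    show "lin_on free_scale (carr (ob K l)) free_scale (\<lambda>u. \<Sum>q\<in>I. B q (A q u))" by (rule lin_on_sums[OF free_vs BA])
    fix i x y assume x: "x \<in> carr (ob P i)" and y: "y \<in> carr (ob N (l - i))"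
    note bet = N_endoD(3)[OF b y]
    have ee: "eps i x = (\<Sum>k<r i. ract (ob P i) (t i k) (\<xi> i k x))"
      unfolding eps_def by (rule eps_eq[OF x])
    have hom: "lin_on (scl (ob P i)) (carr (ob P i)) free_scale (\<lambda>z. ten l i (\<alpha> i z) (\<beta> (l - i) y))"
      by (rule lin_on_comp[OF hom_lin[OF P_endoD(1)[OF a]] _ ten_lin_l[OF bet]]) (use P_endoD(3)[OF a] in blast)
    have "T l (ten l i x y) = ten l i (\<alpha> i (\<Sum>k<r i. ract (ob P i) (t i k) (\<xi> i k x))) (\<beta> (l - i) y)"
      unfolding T_def toper_ten[OF ae b] ee ..
    also have "\<dots> = (\<Sum>k<r i. ten l i (\<alpha> i (ract (ob P i) (t i k) (\<xi> i k x))) (\<beta> (l - i) y))"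
      by (rule lin_on_sum[OF PC.vs PC.V hom]) (use t rmD(3)[OF Prm] in auto)
    also have "\<dots> = (\<Sum>k<r i. ten l i (tt i k) (lact (ob N (l - i)) (\<xi> i k x) (\<beta> (l - i) y)))"
      by (rule sum.cong) (use t hom_ract[OF P_endoD(1)[OF a]] ten_simps(5)[OF tt bet] in \<open>auto simp: tt_def\<close>)
    finally have 1: "T l (ten l i x y) = (\<Sum>k<r i. ten l i (tt i k) (lact (ob N (l - i)) (\<xi> i k x) (\<beta> (l - i) y)))" .
    have "(\<Sum>q\<in>I. B q (A q (ten l i x y))) = (\<Sum>q\<in>I. B q (ga q i x y))"
      by (rule sum.cong) (simp_all add: Aten)
    also have "\<dots> = (\<Sum>i'\<in>F. \<Sum>k<r i'. B (i', k) (ga (i', k) i x y))"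
      unfolding I_def by (subst sum.Sigma) (use F(1) in auto)
    also have "\<dots> = (\<Sum>i'\<in>F. if i' = i then (\<Sum>k<r i. ten l i (tt i k) (lact (ob N (l - i)) (\<xi> i k x) (\<beta> (l - i) y))) else 0)"
      by (rule sum.cong) (auto simp: B_def ga_def ten_0(1)[OF tt])
    also have "\<dots> = (\<Sum>k<r i. ten l i (tt i k) (lact (ob N (l - i)) (\<xi> i k x) (\<beta> (l - i) y)))"
      using F by simp
    finally show "T l (ten l i x y) = (\<Sum>q\<in>I. B q (A q (ten l i x y)))" unfolding 1 ..
  qed
  have BAK: "(\<lambda>f. B q (A q f)) ` carr (ob K l) \<subseteq> carr (ob K l)" if "q \<in> I" for q
    using BK[OF that] AN[OF that] by blast
  have fBA: "fdim free_scale ((\<lambda>f. B q (A q f)) ` carr (ob K l))" if "q \<in> I" for q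
    by (rule fdim_subset[OF free_vs fdim_image[OF NC.vs free_vs N_fdim B[OF that]] lin_on_image[OF free_vs free_vs K_sub BA[OF that]]])
      (use AN[OF that] in blast)
  note sums = fr_trace_sum[OF free_vs K_sub I BA BAK fBA]
  have im: "T l ` carr (ob K l) = (\<lambda>f. \<Sum>q\<in>I. B q (A q f)) ` carr (ob K l)"
    by (rule image_cong[OF refl T])
  show fT: "fdim free_scale (T l ` carr (ob K l))" unfolding im by (rule sums(2))
  have "fr_trace free_scale (carr (ob K l)) (T l) = fr_trace free_scale (carr (ob K l)) (\<lambda>f. \<Sum>q\<in>I. B q (A q f))"
    by (rule fr_trace_cong[OF free_vs fT _ T]) (use toper_in[OF ae b] in \<open>auto simp: T_def\<close>)
  also have "\<dots> = (\<Sum>q\<in>I. fr_trace free_scale (carr (ob K l)) (\<lambda>f. B q (A q f)))" by (rule sums(1))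
  also have "\<dots> = (\<Sum>q\<in>I. lin_trace (scl (ob N (l - fst q))) (carr (ob N (l - fst q))) (\<lambda>y. A q (B q y)))"
    by (rule sum.cong[OF refl], rule fr_trace_cyclic[OF free_vs NC.vs K_sub N_fdim A _ B]) (use AN BK in blast)+
  also have "\<dots> = (\<Sum>q\<in>I. lin_trace (scl (ob N (l - fst q))) (carr (ob N (l - fst q)))
      (\<lambda>y. lact (ob N (l - fst q)) (\<xi> (fst q) (snd q) (tt (fst q) (snd q))) (\<beta> (l - fst q) y)))"
    by (rule sum.cong[OF refl], rule lin_trace_cong[OF NC.vs N_fdim])
      (simp add: B_def Aten ga_def)
  also have "\<dots> = (\<Sum>i\<in>F. \<Sum>k<r i. lin_trace (scl (ob N (l - i))) (carr (ob N (l - i)))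
      (\<lambda>y. lact (ob N (l - i)) (\<xi> i k (tt i k)) (\<beta> (l - i) y)))"
    unfolding I_def by (subst sum.Sigma) (use F(1) in \<open>auto simp: split_beta\<close>)
  also have "\<dots> = (\<Sum>i\<in>F. lin_trace (scl (ob N (l - i))) (carr (ob N (l - i)))
      (\<lambda>y. \<Sum>k<r i. lact (ob N (l - i)) (\<xi> i k (tt i k)) (\<beta> (l - i) y)))"
    by (rule sum.cong[OF refl], rule lin_trace_sum[OF NC.vs N_fdim, symmetric])
      (use N_endoD(3)[OF b] C.bmD(2)[OF Nb] in auto)
  also have "\<dots> = (\<Sum>i\<in>F. lin_trace (scl (ob N (l - i))) (carr (ob N (l - i)))
      (\<lambda>y. lact (ob N (l - i)) (\<Sum>k<r i. \<xi> i k (tt i k)) (\<beta> (l - i) y)))"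
    by (rule sum.cong[OF refl], rule lin_trace_cong[OF NC.vs N_fdim],
        rule lin_on_sum[OF vsA vsA_UNIV lact_lin[OF N_endoD(3)[OF b]], symmetric]) auto
  finally show "fr_trace free_scale (carr (ob K l)) (T l) =
      (\<Sum>i\<in>F. lin_trace (scl (ob N (l - i))) (carr (ob N (l - i)))
        (\<lambda>y. lact (ob N (l - i)) (\<Sum>k<r i. \<xi> i k (\<alpha> i (t i k))) (\<beta> (l - i) y)))" unfolding tt_def .
  show "T l u = 0" if z: "\<And>i. i \<in> F \<Longrightarrow> carr (ob N (l - i)) = {0}" and u: "u \<in> carr (ob K l)"
  proof -
    have "B q (A q u) = 0" if q: "q \<in> I" for q
    proof -
      have "fst q \<in> F" using q unfolding I_def by auto
      then have "A q u = 0" using AN[OF q] u z by blast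
      then show ?thesis unfolding B_def using ten_0(1)[OF ttI[OF q]] by simp
    qed
    then show ?thesis unfolding T[OF u] by simp
  qed
qed

definition psi_trace :: "nat \<Rightarrow> int \<Rightarrow> 'k" where
  "psi_trace v s = lin_trace (scl (ob N s)) ((\<lambda>x. ract (ob N s) (lact (ob N s) (e v) x) gg) ` carr (ob N s)) (\<psi> s)"

lemma psi_trace_finite: "finite {s. psi_trace v s \<noteq> 0}"
proof (rule finite_subset[OF _ N_finite], clarify)
  fix s assume "psi_trace v s \<noteq> 0" and c: "carr (ob N s) = {0}"
  have "lact (ob N s) (e v) 0 = 0" "\<psi> s 0 = 0"
    using lin_on_0[OF NC.vs NC.V hom_lin[OF C.bm_hom[OF Nb]]] lin_on_0[OF NC.vs NC.V N_endoD(1)[OF N_endo_psi]] by blast+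
  then have "psi_trace v s = fr_trace (scl (ob N s)) {0} (\<psi> s)"
    unfolding psi_trace_def fr_trace_def c by (simp add: C.rm_0[OF Nrm])
  also have "\<dots> = 0" by (rule fr_trace_zero[OF NC.vs fdim_subsp[OF NC.vs fdim_zero[OF NC.vs]]]) (simp add: \<open>\<psi> s 0 = 0\<close>)
  finally show False using \<open>psi_trace v s \<noteq> 0\<close> by simp
qed

text \<open>\<open>trace_action\<close> expects the acting element of \<open>A\<close> outermost;
  the left action of \<open>e v\<close> therefore moves past \<open>\<psi>\<close> and the right
  action of \<open>gg\<close>.\<close>

lemma psi_trace_eq:
  assumes v: "v < n"
  shows "psi_trace v s = lin_trace (scl (ob N s)) (carr (ob N s)) (\<lambda>y. lact (ob N s) (e v) (\<psi> s (ract (ob N s) y gg)))"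
proof -
  have "psi_trace v s = lin_trace (scl (ob N s)) (carr (ob N s)) (\<lambda>y. ract (ob N s) (\<psi> s (lact (ob N s) (e v) y)) gg)"
    unfolding psi_trace_def
    by (rule C.bimodule_trace[OF Nb N_fdim _ e_idem[OF v] gg]) (use psi in \<open>auto simp: chain_map_def\<close>)
  also have "\<dots> = lin_trace (scl (ob N s)) (carr (ob N s)) (\<lambda>y. lact (ob N s) (e v) (\<psi> s (ract (ob N s) y gg)))"
  proof (rule lin_trace_cong[OF NC.vs N_fdim])
    fix y assume y: "y \<in> carr (ob N s)"
    have "ract (ob N s) (\<psi> s (lact (ob N s) (e v) y)) gg = lact (ob N s) (e v) (ract (ob N s) (\<psi> s y) gg)"
      unfolding C.cmD(2)[OF psi y] by (rule C.bmD(7)[OF Nb hom_in[OF C.cmD(1)[OF psi] y]])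
    also have "ract (ob N s) (\<psi> s y) gg = \<psi> s (ract (ob N s) y gg)"
      by (rule hom_ract[OF C.cmD(1)[OF psi] y, symmetric])
    finally show "ract (ob N s) (\<psi> s (lact (ob N s) (e v) y)) gg = lact (ob N s) (e v) (\<psi> s (ract (ob N s) y gg))" .
  qed
  finally show ?thesis .
qed

lemma N_action:
  "lin_trace (scl (ob N s)) (carr (ob N s)) (\<lambda>y. lact (ob N s) a (\<psi> s (ract (ob N s) y gg)))
    = (\<Sum>v<n. \<chi> v a * psi_trace v s)"
proof -
  have L: "N_endo (\<lambda>l y. \<psi> l (ract (ob N l) y gg))" by (rule N_endo_comp[OF N_endo_psi N_endo_gg])
  have "lin_trace (scl (ob N s)) (carr (ob N s)) (\<lambda>y. lact (ob N s) a (\<psi> s (ract (ob N s) y gg)))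
    = (\<Sum>v<n. \<chi> v a * lin_trace (scl (ob N s)) (carr (ob N s)) (\<lambda>y. lact (ob N s) (e v) (\<psi> s (ract (ob N s) y gg))))"
    by (rule trace_action[OF NC.vs N_fdim, where \<rho> = "\<lambda>a y. lact (ob N s) a y" and \<psi> = "\<lambda>y. \<psi> s (ract (ob N s) y gg)"])
      (use hom_lin[OF C.bm_hom[OF Nb]] C.bmD(2,4,5,6,8)[OF Nb] N_endoD(1,3,4)[OF L] in auto)
  then show ?thesis using psi_trace_eq by simp
qed

text \<open>The same use of \<open>lefschetz\<close> as for Ext, with the shift \<open>- i\<close>
  in the convolution instead of \<open>i\<close>.\<close>

lemma tor_trace:
  "euler (\<lambda>l. lin_trace (scl (ob K l))
      ((\<lambda>x. KC.pr l (ract (ob K l) (KC.pr l (lact (ob K l) bb x)) gg)) ` KC.H l) (\<lambda>x. KC.pr l (tensor_map P N \<Phi> \<psi> l x)))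
   = (\<Sum>v<n. hs_char v * euler (psi_trace v))"
proof -
  have lam: "lact (ob K l) bb u = toper (\<lambda>l. lact (ob P l) bb) (\<lambda>i x. x) l u" for l u
    by (simp add: tensor_cpx_def quot_def tensor_free_def toper_def pp_def Rel_def)
  have rho: "ract (ob K l) u gg = toper (\<lambda>i x. x) (\<lambda>l y. ract (ob N l) y gg) l u" for l u
    by (simp add: tensor_cpx_def quot_def tensor_free_def toper_def pp_def Rel_def)
  have theta: "tensor_map P N \<Phi> \<psi> l u = toper \<Phi> \<psi> l u" for l u
    by (simp add: tensor_map_def toper_def pp_def Rel_def)
  define \<beta> where "\<beta> l y = \<psi> l (ract (ob N l) y gg)" for l y
  have b: "N_endo \<beta>" unfolding \<beta>_def by (rule N_endo_comp[OF N_endo_psi N_endo_gg])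
  define T where "T = toper (\<lambda>i x. Th i (eps i x)) \<beta>"
  have Te: "P_endo (\<lambda>i x. Th i (eps i x))" by (rule P_endo_comp[OF P_endo_Th P_endo_eps])
  have T: "KC.endo T" unfolding T_def by (rule toper_endo[OF Te b])
  have fT: "fdim (scl (ob K l)) (T l ` carr (ob K l))" for l
    unfolding T_def K_simps(2) by (rule toper_eps_trace(1)[OF P_endo_Th b])
  have trT: "fr_trace (scl (ob K l)) (carr (ob K l)) (T l) = (\<Sum>i\<in>F. \<Sum>v<n. \<chi> v (hs_trace i) * psi_trace v (- i + l))" for l
    unfolding T_def K_simps(2) toper_eps_trace(2)[OF P_endo_Th b] hs_trace_def[symmetric] unfolding \<beta>_def N_action by simp
  have fin: "finite {l. \<exists>f\<in>carr (ob K l). T l f \<noteq> 0}"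
  proof (rule finite_subset)
    show "finite (\<Union>i\<in>F. (\<lambda>s. s + i) ` {s. carr (ob N s) \<noteq> {0}})" using F(1) N_finite by simp
    show "{l. \<exists>f\<in>carr (ob K l). T l f \<noteq> 0} \<subseteq> (\<Union>i\<in>F. (\<lambda>s. s + i) ` {s. carr (ob N s) \<noteq> {0}})"
    proof (rule subsetI, rule ccontr)
      fix l assume "l \<in> {l. \<exists>f\<in>carr (ob K l). T l f \<noteq> 0}"
        and no: "l \<notin> (\<Union>i\<in>F. (\<lambda>s. s + i) ` {s. carr (ob N s) \<noteq> {0}})"
      then obtain f where f: "f \<in> carr (ob K l)" "T l f \<noteq> 0" by blast
      have "carr (ob N (l - i)) = {0}" if i: "i \<in> F" for i
      proof (rule ccontr)
        assume "carr (ob N (l - i)) \<noteq> {0}"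
        then have "l \<in> (\<lambda>s. s + i) ` {s. carr (ob N s) \<noteq> {0}}" by (intro image_eqI[of _ _ "l - i"]) simp_all
        then show False using no i by blast
      qed
      then have "T l f = 0" unfolding T_def by (rule toper_eps_trace(3)[OF P_endo_Th b _ f(1)])
      then show False using f(2) by simp
    qed
  qed
  have fH: "fdim (scl (ob K l)) (KC.H l)" for l
  proof (rule KC.fdim_H[where E = "toper eps (\<lambda>i x. x) l"])
    show "fdim (scl (ob K l)) (toper eps (\<lambda>i x. x) l ` carr (ob K l))"
      unfolding K_simps(2) using toper_eps_trace(1)[OF P_endo_id N_endo_id, of l] by simp
    show "toper eps (\<lambda>i x. x) l x \<in> carr (ob K l)" if "x \<in> carr (ob K l)" for x
      by (rule toper_in[OF P_endo_eps N_endo_id that])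
    show "toper eps (\<lambda>i x. x) l x - x \<in> KC.bd l" if "x \<in> KC.cyc l" for x
      using subspD(4)[OF KC.vs KC.bd_sub toper_eps_cyc[OF that]] by simp
  qed
  have bbP: "lact (ob P i) bb (lact (ob P i) bb x) = lact (ob P i) bb x" if "x \<in> carr (ob P i)" for i x
    using bmD(5)[OF Pb that, of bb bb] bb by simp
  have ggN: "ract (ob N i) (ract (ob N i) x gg) gg = ract (ob N i) x gg" if "x \<in> carr (ob N i)" for i x
    using C.rmD(6)[OF Nrm that, of gg gg] gg by simp
  note tc = toper_comp and TT = P_endo_comp and LL = N_endo_comp
  have "euler (\<lambda>l. lin_trace (scl (ob K l))
      ((\<lambda>x. KC.pr l (ract (ob K l) (KC.pr l (lact (ob K l) bb x)) gg)) ` KC.H l) (\<lambda>x. KC.pr l (tensor_map P N \<Phi> \<psi> l x)))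
   = euler (\<lambda>l. fr_trace (scl (ob K l)) (carr (ob K l)) (T l))"
    unfolding lam rho theta
  proof (rule KC.lefschetz[OF T fT fin toper_endo[OF P_endo_bb N_endo_id] toper_endo[OF P_endo_id N_endo_gg] toper_endo[OF P_endo_Phi N_endo_psi] _ _ _ _ _ fH])
    fix l u assume u: "u \<in> carr (ob K l)"
    show "toper (\<lambda>l. lact (ob P l) bb) (\<lambda>i x. x) l (toper (\<lambda>l. lact (ob P l) bb) (\<lambda>i x. x) l u) = toper (\<lambda>l. lact (ob P l) bb) (\<lambda>i x. x) l u"
      by (subst tc[OF P_endo_bb N_endo_id P_endo_bb N_endo_id TT[OF P_endo_bb P_endo_bb] N_endo_id u])
        (rule toper_cong[OF TT[OF P_endo_bb P_endo_bb] N_endo_id P_endo_bb N_endo_id bbP refl u])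
    show "toper (\<lambda>i x. x) (\<lambda>l y. ract (ob N l) y gg) l (toper (\<lambda>i x. x) (\<lambda>l y. ract (ob N l) y gg) l u) = toper (\<lambda>i x. x) (\<lambda>l y. ract (ob N l) y gg) l u"
      by (subst tc[OF P_endo_id N_endo_gg P_endo_id N_endo_gg P_endo_id LL[OF N_endo_gg N_endo_gg] u])
        (rule toper_cong[OF P_endo_id LL[OF N_endo_gg N_endo_gg] P_endo_id N_endo_gg refl ggN u])
    show "toper (\<lambda>l. lact (ob P l) bb) (\<lambda>i x. x) l (toper (\<lambda>i x. x) (\<lambda>l y. ract (ob N l) y gg) l u) = toper (\<lambda>i x. x) (\<lambda>l y. ract (ob N l) y gg) l (toper (\<lambda>l. lact (ob P l) bb) (\<lambda>i x. x) l u)"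
      unfolding tc[OF P_endo_bb N_endo_id P_endo_id N_endo_gg P_endo_bb N_endo_gg u] tc[OF P_endo_id N_endo_gg P_endo_bb N_endo_id P_endo_bb N_endo_gg u] ..
    show "toper (\<lambda>l. lact (ob P l) bb) (\<lambda>i x. x) l (toper \<Phi> \<psi> l u) = toper \<Phi> \<psi> l (toper (\<lambda>l. lact (ob P l) bb) (\<lambda>i x. x) l u)"
      unfolding tc[OF P_endo_bb N_endo_id P_endo_Phi N_endo_psi TT[OF P_endo_bb P_endo_Phi] N_endo_psi u] tc[OF P_endo_Phi N_endo_psi P_endo_bb N_endo_id TT[OF P_endo_Phi P_endo_bb] N_endo_psi u]
      by (rule toper_cong[OF TT[OF P_endo_bb P_endo_Phi] N_endo_psi TT[OF P_endo_Phi P_endo_bb] N_endo_psi _ refl u]) (simp add: cmD(2)[OF Phi])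
    show "toper (\<lambda>i x. x) (\<lambda>l y. ract (ob N l) y gg) l (toper \<Phi> \<psi> l u) = toper \<Phi> \<psi> l (toper (\<lambda>i x. x) (\<lambda>l y. ract (ob N l) y gg) l u)"
      unfolding tc[OF P_endo_id N_endo_gg P_endo_Phi N_endo_psi P_endo_Phi LL[OF N_endo_gg N_endo_psi] u] tc[OF P_endo_Phi N_endo_psi P_endo_id N_endo_gg P_endo_Phi LL[OF N_endo_psi N_endo_gg] u]
      by (rule toper_cong[OF P_endo_Phi LL[OF N_endo_gg N_endo_psi] P_endo_Phi LL[OF N_endo_psi N_endo_gg] refl _ u]) (simp add: hom_ract[OF C.cmD(1)[OF psi]])
  next
    fix l u assume u: "u \<in> KC.cyc l"
    have uK: "u \<in> carr (ob K l)" using u KC.cyc_V by blast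
    have Tc: "toper Th \<beta> l u \<in> KC.cyc l" using KC.endoD(5)[OF toper_endo[OF P_endo_Th b]] u by blast
    have TcK: "toper Th \<beta> l u \<in> carr (ob K l)" using Tc KC.cyc_V by blast
    have 0: "toper (\<lambda>l. lact (ob P l) bb) (\<lambda>i x. x) l u \<in> carr (ob K l)" by (rule toper_in[OF P_endo_bb N_endo_id uK])
    have 1: "toper \<Phi> \<psi> l (toper (\<lambda>i x. x) (\<lambda>l y. ract (ob N l) y gg) l (toper (\<lambda>l. lact (ob P l) bb) (\<lambda>i x. x) l u)) = toper Th \<beta> l u"
      unfolding tc[OF P_endo_id N_endo_gg P_endo_bb N_endo_id P_endo_bb N_endo_gg uK]
        tc[OF P_endo_Phi N_endo_psi P_endo_bb N_endo_gg TT[OF P_endo_Phi P_endo_bb] LL[OF N_endo_psi N_endo_gg] uK]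
      by (rule toper_cong[OF TT[OF P_endo_Phi P_endo_bb] LL[OF N_endo_psi N_endo_gg] P_endo_Th b _ _ uK]) (simp_all add: Th_def \<beta>_def)
    have eK: "toper eps (\<lambda>i x. x) l u \<in> carr (ob K l)" by (rule toper_in[OF P_endo_eps N_endo_id uK])
    \<comment> \<open>The tensor product is covariant in \<open>P\<close>, so \<open>eps\<close>
      acts before \<open>Th\<close>; the difference is \<open>toper Th \<beta>\<close> of a
      coboundary, which stays a coboundary.\<close>
    have 2: "T l u = toper Th \<beta> l (toper eps (\<lambda>i x. x) l u)"
      unfolding T_def by (rule tc[OF P_endo_Th b P_endo_eps N_endo_id Te b uK, symmetric])
    have "toper Th \<beta> l u - T l u = toper Th \<beta> l (u - toper eps (\<lambda>i x. x) l u)"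
      unfolding 2 by (rule lin_on_diff[OF free_vs K_sub toper_lin uK eK, symmetric])
    also have "\<dots> \<in> KC.bd l" using KC.endoD(6)[OF toper_endo[OF P_endo_Th b]] toper_eps_cyc[OF u] by blast
    finally show "toper \<Phi> \<psi> l (toper (\<lambda>i x. x) (\<lambda>l y. ract (ob N l) y gg) l (toper (\<lambda>l. lact (ob P l) bb) (\<lambda>i x. x) l u)) - T l u \<in> KC.bd l"
      unfolding 1 .
  qed
  also have "\<dots> = (\<Sum>v<n. (\<Sum>i\<in>F. signed i (\<chi> v (hs_trace i))) * euler (psi_trace v))"
    unfolding trT by (rule euler_convolution(2)[OF F(1)]) (use psi_trace_finite in auto)
  also have "\<dots> = (\<Sum>v<n. hs_char v * euler (psi_trace v))"
    by (rule sum.cong) (auto simp: hs_char_eq)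
  finally show ?thesis .
qed

end

section \<open>The trace formulas\<close>

text \<open>Over the field of rationals a one-sided inverse of a square matrix is two-sided, and the
  equation descends because the entries embed injectively.\<close>

lemma int_mat_left_inverse:
  fixes A B :: "int mat"
  assumes A: "A \<in> carrier_mat n n" and B: "B \<in> carrier_mat n n" and AB: "A * B = 1\<^sub>m n"
  shows "B * A = 1\<^sub>m n"
proof -
  let ?h = "map_mat (of_int :: int \<Rightarrow> rat)"
  have "?h A * ?h B = ?h (A * B)" by (rule of_int_hom.mat_hom_mult[OF A B, symmetric])
  also have "\<dots> = 1\<^sub>m n" unfolding AB by (rule of_int_hom.mat_hom_one)
  finally have "?h B * ?h A = 1\<^sub>m n"
    by (rule mat_mult_left_right_inverse[OF map_carrier_mat[THEN iffD2, OF A] map_carrier_mat[THEN iffD2, OF B]])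
  then have "?h (B * A) = ?h (1\<^sub>m n)" unfolding of_int_hom.mat_hom_mult[OF B A] of_int_hom.mat_hom_one .
  then show ?thesis by (rule of_int_hom.mat_hom_inj)
qed

lemma inverse_mat_eq:
  fixes A B :: "int mat"
  assumes A: "A \<in> carrier_mat n n" and B: "B \<in> carrier_mat n n" and AB: "A * B = 1\<^sub>m n"
  shows "inverse_mat A = B"
  unfolding inverse_mat_def
proof (rule the_equality)
  have BA: "B * A = 1\<^sub>m n" by (rule int_mat_left_inverse[OF A B AB])
  show "B \<in> carrier_mat (dim_row A) (dim_row A) \<and> inverts_mat A B \<and> inverts_mat B A"
    using A B AB BA by (simp add: inverts_mat_def)
  fix D assume D: "D \<in> carrier_mat (dim_row A) (dim_row A) \<and> inverts_mat A D \<and> inverts_mat D A"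
  then have Dn: "D \<in> carrier_mat n n" and DA: "D * A = 1\<^sub>m n" using A by (auto simp: inverts_mat_def)
  have "D = D * (A * B)" unfolding AB using Dn by simp
  also have "\<dots> = (D * A) * B" by (rule assoc_mult_mat[OF Dn A B, symmetric])
  also have "\<dots> = B" unfolding DA using B by simp
  finally show "D = B" .
qed

text \<open>Both forms expand to the same double sum, the pairing of the solution of the Cartan
  system for \<open>x\<close> with \<open>y\<close>. Hence Ext and Tor end with the same
  calculation, up to transposing the entry.\<close>

lemma euler_form_index:
  assumes D: "inverse_mat C \<in> carrier_mat n n" and x: "x \<in> carrier_mat n m" and y: "y \<in> carrier_mat n p"
    and ij: "i < m" "j < p"
  shows "euler_form C x y $$ (i, j) = (\<Sum>v<n. (\<Sum>w<n. of_int (inverse_mat C $$ (v, w)) * x $$ (w, i)) * y $$ (v, j))"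
    and "euler_form_op C y x $$ (j, i) = (\<Sum>v<n. (\<Sum>w<n. of_int (inverse_mat C $$ (v, w)) * x $$ (w, i)) * y $$ (v, j))"
proof -
  have "euler_form C x y $$ (i, j) = (\<Sum>w<n. x $$ (w, i) * (\<Sum>v<n. of_int (inverse_mat C $$ (v, w)) * y $$ (v, j)))"
    unfolding euler_form_def using assms by (auto simp: scalar_prod_def lessThan_atLeast0 intro!: sum.cong)
  also have "\<dots> = (\<Sum>w<n. \<Sum>v<n. of_int (inverse_mat C $$ (v, w)) * x $$ (w, i) * y $$ (v, j))"
    by (simp only: sum_distrib_left mult_ac)
  also have "\<dots> = (\<Sum>v<n. (\<Sum>w<n. of_int (inverse_mat C $$ (v, w)) * x $$ (w, i)) * y $$ (v, j))"
    by (subst sum.swap) (simp only: sum_distrib_right)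
  finally show "euler_form C x y $$ (i, j) = (\<Sum>v<n. (\<Sum>w<n. of_int (inverse_mat C $$ (v, w)) * x $$ (w, i)) * y $$ (v, j))" .
  have "euler_form_op C y x $$ (j, i) = (\<Sum>v<n. y $$ (v, j) * (\<Sum>w<n. of_int (inverse_mat C $$ (v, w)) * x $$ (w, i)))"
    unfolding euler_form_op_def using assms by (auto simp: scalar_prod_def lessThan_atLeast0 intro!: sum.cong)
  then show "euler_form_op C y x $$ (j, i) = (\<Sum>v<n. (\<Sum>w<n. of_int (inverse_mat C $$ (v, w)) * x $$ (w, i)) * y $$ (v, j))"
    by (simp only: mult.commute)
qed

context res_data
begin

lemma resolved:
  "\<exists>h r t \<xi> F. fin_data sA n e \<chi> sB M \<phi> P \<pi> \<Phi> bb h r t \<xi> F"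
proof -
  obtain h and r :: "int \<Rightarrow> nat" and t \<xi> F where "(\<forall>l. rmod_hom (ob P l) (ob P (l - 1)) (h l))
     \<and> (\<forall>l. \<forall>k<r l. t l k \<in> carr (ob P l)) \<and> (\<forall>l. \<forall>k<r l. rmod_hom (ob P l) regm (\<xi> l k))
     \<and> (\<forall>l. \<forall>p\<in>carr (ob P l). p - df P (l - 1) (h l p) - h (l + 1) (df P l p) = (\<Sum>k<r l. ract (ob P l) (t l k) (\<xi> l k p)))
     \<and> finite F \<and> (\<forall>l. l \<notin> F \<longrightarrow> r l = 0)"
    by (rule exE[OF finite_data]) (elim exE, rule that, assumption)
  then have "fin_data sA n e \<chi> sB M \<phi> P \<pi> \<Phi> bb h r t \<xi> F"
    by (intro fin_data.intro fin_data_axioms.intro res_data_axioms) simp_all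
  then show ?thesis by blast
qed

end

context basic_alg
begin

text \<open>The resolutions of the simple modules give a right inverse, while solving for
  \<open>z\<close> requires a left inverse; the passage happens over the integers.\<close>

lemma cartan_inverse:
  assumes "finite_global_dimension sA"
  defines "D \<equiv> inverse_mat (cartan_matrix sA n e)"
  shows "D \<in> carrier_mat n n" "\<And>v u. v < n \<Longrightarrow> u < n \<Longrightarrow> (\<Sum>w<n. D $$ (v, w) * cart w u) = (if v = u then 1 else 0)"
proof -
  obtain Z :: "nat \<Rightarrow> nat \<Rightarrow> int" where Z: "\<And>v u. v < n \<Longrightarrow> u < n \<Longrightarrow> (\<Sum>w<n. cart v w * Z w u) = (if v = u then 1 else 0)"
    using cart_right_inverse[OF assms(1)] by blast
  define A where "A = cartan_matrix sA n e"
  define B where "B = mat n n (\<lambda>(i, j). Z i j)"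
  have A: "A \<in> carrier_mat n n" and B: "B \<in> carrier_mat n n" unfolding A_def B_def cartan_matrix_def by simp_all
  have Ai: "A $$ (v, w) = cart v w" if "v < n" "w < n" for v w using that unfolding A_def cartan_matrix_def cart_def by simp
  have AB: "A * B = 1\<^sub>m n"
  proof (rule eq_matI)
    fix v u assume "v < dim_row (1\<^sub>m n :: int mat)" "u < dim_col (1\<^sub>m n :: int mat)"
    then have vu: "v < n" "u < n" by simp_all
    have "(A * B) $$ (v, u) = (\<Sum>w<n. A $$ (v, w) * B $$ (w, u))"
      using A B vu by (auto simp: scalar_prod_def lessThan_atLeast0 intro!: sum.cong)
    also have "\<dots> = (\<Sum>w<n. cart v w * Z w u)" by (rule sum.cong) (use vu Ai in \<open>auto simp: B_def\<close>)
    finally show "(A * B) $$ (v, u) = 1\<^sub>m n $$ (v, u)" using Z[OF vu] vu by simp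
  qed (use A B in auto)
  have D: "D = B" unfolding D_def A_def[symmetric] by (rule inverse_mat_eq[OF A B AB])
  show "D \<in> carrier_mat n n" unfolding D by (rule B)
  show "(\<Sum>w<n. D $$ (v, w) * cart w u) = (if v = u then 1 else 0)" if vu: "v < n" "u < n" for v u
  proof -
    have "(\<Sum>w<n. B $$ (v, w) * cart w u) = (B * A) $$ (v, u)"
      using A B vu Ai by (auto simp: scalar_prod_def lessThan_atLeast0 intro!: sum.cong)
    then show ?thesis unfolding D int_mat_left_inverse[OF A B AB] using vu by simp
  qed
qed

text \<open>The integral identity for the left inverse is mapped into \<open>k\<close> only after
  the inversion, so the characteristic of \<open>k\<close> does not interfere.\<close>

lemma cartan_solve:
  fixes x z :: "nat \<Rightarrow> 'k"
  assumes g: "finite_global_dimension sA" and x: "\<And>v. v < n \<Longrightarrow> x v = (\<Sum>w<n. of_int (cart v w) * z w)" and v: "v < n"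
  shows "(\<Sum>w<n. of_int (inverse_mat (cartan_matrix sA n e) $$ (v, w)) * x w) = z v"
proof -
  let ?D = "inverse_mat (cartan_matrix sA n e)"
  have "(\<Sum>w<n. of_int (?D $$ (v, w)) * x w) = (\<Sum>w<n. \<Sum>u<n. of_int (?D $$ (v, w) * cart w u) * z u)"
    by (rule sum.cong) (auto simp: x sum_distrib_left mult.assoc)
  also have "\<dots> = (\<Sum>u<n. of_int (\<Sum>w<n. ?D $$ (v, w) * cart w u) * z u)"
    by (subst sum.swap) (simp add: sum_distrib_right)
  also have "\<dots> = (\<Sum>u<n. if v = u then z u else 0)"
    by (rule sum.cong) (use cartan_inverse(2)[OF g v] in auto)
  also have "\<dots> = z v" using v by simp
  finally show ?thesis .
qed

lemma trace_matrix_cpx_index: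
  assumes "i < a" "j < b"
  shows "trace_matrix_cpx a r b s X \<theta> $$ (i, j) =
    euler (\<lambda>l. lin_trace (scl (ob X l)) ((\<lambda>x. ract (ob X l) (lact (ob X l) (s j) x) (r i)) ` carr (ob X l)) (\<theta> l))"
  unfolding trace_matrix_cpx_def alternating_sum_index[OF assms] trace_matrix_def using assms by simp

text \<open>Entry \<open>(i, j)\<close> instantiates the trace computation at the idempotents
  \<open>f i\<close> and \<open>g j\<close>. \<open>trace_M\<close> says that column
  \<open>i\<close> of the trace matrix of \<open>\<phi>\<close> is the Cartan matrix applied to
  \<open>hs_char\<close>, and inverting it identifies the coefficients in
  \<open>ext_trace\<close>.\<close>

lemma Ext_formula:
  assumes gl: "finite_global_dimension sA"
    and M: "bounded_fd_complex sB sA M" "chain_map M M \<phi>" and N: "bounded_fd_complex sC sA N" "chain_map N N \<psi>"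
    and P: "projective_resolution sB sA P M \<pi>" "lifts_endomorphism P M \<pi> \<phi> \<Phi>"
    and f: "\<And>i. i < m \<Longrightarrow> f i * f i = f i" and g: "\<And>j. j < p \<Longrightarrow> g j * g j = g j"
  shows "alternating_sum m p (\<lambda>l. trace_matrix m f p g (Ext P N l) (Ext_map P N \<Phi> \<psi> l))
          = euler_form (cartan_matrix sA n e) (trace_matrix_cpx n e m f M \<phi>) (trace_matrix_cpx n e p g N \<psi>)"
proof (rule eq_matI)
  let ?C = "cartan_matrix sA n e" and ?x = "trace_matrix_cpx n e m f M \<phi>" and ?y = "trace_matrix_cpx n e p g N \<psi>"
  have x: "?x \<in> carrier_mat n m" and y: "?y \<in> carrier_mat n p" by (simp_all add: trace_matrix_cpx_def alternating_sum_def)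
  note D = cartan_inverse(1)[OF gl]
  fix i j assume "i < dim_row (euler_form ?C ?x ?y)" "j < dim_col (euler_form ?C ?x ?y)"
  then have ij: "i < m" "j < p" using x y D by (simp_all add: euler_form_def)
  have "res_data sA n e \<chi> sB M \<phi> P \<pi> \<Phi> (f i)"
    by (intro res_data.intro res_data_axioms.intro basic_alg_axioms gl M P f[OF ij(1)])
  then interpret R: res_data sA n e \<chi> sB M \<phi> P \<pi> \<Phi> "f i" .
  obtain h r t \<xi> F where fd: "fin_data sA n e \<chi> sB M \<phi> P \<pi> \<Phi> (f i) h r t \<xi> F" using R.resolved by blast
  interpret E: ext_data sA n e \<chi> sB M \<phi> P \<pi> \<Phi> "f i" h r t \<xi> F sC N \<psi> "g j"
    by (intro ext_data.intro ext_data_axioms.intro fd N g[OF ij(2)])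
  have xv: "?x $$ (v, i) = (\<Sum>w<n. of_int (cart v w) * E.hs_char w)" if "v < n" for v
    unfolding trace_matrix_cpx_index[OF that ij(1)] by (rule E.trace_M[OF that])
  have yv: "?y $$ (v, j) = euler (E.psi_trace v)" if "v < n" for v
    unfolding trace_matrix_cpx_index[OF that ij(2)] E.psi_trace_def[abs_def] ..
  have map: "Ext_map P N \<Phi> \<psi> l = (\<lambda>x. E.KC.pr l (hom_map P \<Phi> \<psi> l x))" for l
    unfolding Ext_map_def by (rule ext) (rule cohomology_map_pr[OF E.K_vs])
  have "alternating_sum m p (\<lambda>l. trace_matrix m f p g (Ext P N l) (Ext_map P N \<Phi> \<psi> l)) $$ (i, j) = (\<Sum>v<n. E.hs_char v * euler (E.psi_trace v))"
    unfolding alternating_sum_index[OF ij] map unfolding Ext_def trace_cohomology[OF E.K_vs ij] by (rule E.ext_trace)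
  also have "\<dots> = euler_form ?C ?x ?y $$ (i, j)"
    unfolding euler_form_index(1)[OF D x y ij]
    by (rule sum.cong) (simp_all add: cartan_solve[OF gl xv] yv)
  finally show "alternating_sum m p (\<lambda>l. trace_matrix m f p g (Ext P N l) (Ext_map P N \<Phi> \<psi> l)) $$ (i, j) = euler_form ?C ?x ?y $$ (i, j)" .
qed (simp_all add: alternating_sum_def euler_form_def trace_matrix_cpx_def)

text \<open>Parallel to Ext, with the entry indices exchanged and the degree negated. The trace
  matrix of \<open>\<psi>\<close> has its rows indexed by the idempotents of \<open>C\<close>,
  whence the transpose.\<close>

lemma Tor_formula:
  assumes gl: "finite_global_dimension sA" and C: "fd_algebra sC"
    and M: "bounded_fd_complex sB sA M" "chain_map M M \<phi>" and N: "bounded_fd_complex sA sC N" "chain_map N N \<psi>"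
    and P: "projective_resolution sB sA P M \<pi>" "lifts_endomorphism P M \<pi> \<phi> \<Phi>"
    and f: "\<And>i. i < m \<Longrightarrow> f i * f i = f i" and g: "\<And>j. j < p \<Longrightarrow> g j * g j = g j"
  shows "alternating_sum p m (\<lambda>l. trace_matrix p g m f (Tor P N l) (Tor_map P N \<Phi> \<psi> l))
          = euler_form_op (cartan_matrix sA n e)
              (transpose_mat (trace_matrix_cpx p g n e N \<psi>)) (trace_matrix_cpx n e m f M \<phi>)"
proof (rule eq_matI)
  let ?C = "cartan_matrix sA n e" and ?x = "trace_matrix_cpx n e m f M \<phi>"
    and ?y = "transpose_mat (trace_matrix_cpx p g n e N \<psi>)"
  have x: "?x \<in> carrier_mat n m" and y: "?y \<in> carrier_mat n p" by (simp_all add: trace_matrix_cpx_def alternating_sum_def)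
  note D = cartan_inverse(1)[OF gl]
  fix j i assume "j < dim_row (euler_form_op ?C ?y ?x)" "i < dim_col (euler_form_op ?C ?y ?x)"
  then have ij: "i < m" "j < p" using x y D by (simp_all add: euler_form_op_def)
  have "res_data sA n e \<chi> sB M \<phi> P \<pi> \<Phi> (f i)"
    by (intro res_data.intro res_data_axioms.intro basic_alg_axioms gl M P f[OF ij(1)])
  then interpret R: res_data sA n e \<chi> sB M \<phi> P \<pi> \<Phi> "f i" .
  obtain h r t \<xi> F where fd: "fin_data sA n e \<chi> sB M \<phi> P \<pi> \<Phi> (f i) h r t \<xi> F" using R.resolved by blast
  interpret E: tor_data sA n e \<chi> sB M \<phi> P \<pi> \<Phi> "f i" h r t \<xi> F sC N \<psi> "g j"
    by (intro tor_data.intro tor_data_axioms.intro fd fd_alg.intro C N g[OF ij(2)])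
  have xv: "?x $$ (v, i) = (\<Sum>w<n. of_int (cart v w) * E.hs_char w)" if "v < n" for v
    unfolding trace_matrix_cpx_index[OF that ij(1)] by (rule E.trace_M[OF that])
  have yv: "?y $$ (v, j) = euler (E.psi_trace v)" if "v < n" for v
  proof -
    have "?y $$ (v, j) = trace_matrix_cpx p g n e N \<psi> $$ (j, v)"
      using y that ij by simp
    then show ?thesis unfolding trace_matrix_cpx_index[OF ij(2) that] E.psi_trace_def[abs_def] .
  qed
  have map: "Tor_map P N \<Phi> \<psi> l = (\<lambda>x. E.KC.pr (- l) (tensor_map P N \<Phi> \<psi> (- l) x))" for l
    unfolding Tor_map_def by (rule ext) (rule E.C.cohomology_map_pr[OF E.K_vs])
  have "alternating_sum p m (\<lambda>l. trace_matrix p g m f (Tor P N l) (Tor_map P N \<Phi> \<psi> l)) $$ (j, i) = (\<Sum>v<n. E.hs_char v * euler (E.psi_trace v))"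
    unfolding alternating_sum_index[OF ij(2,1)] map unfolding Tor_def E.C.trace_cohomology[OF E.K_vs ij(2,1)] E.tor_trace[symmetric]
    by (rule euler_uminus)
  also have "\<dots> = euler_form_op ?C ?y ?x $$ (j, i)"
    unfolding euler_form_index(2)[OF D x y ij]
    by (rule sum.cong) (simp_all add: cartan_solve[OF gl xv] yv del: index_transpose_mat)
  finally show "alternating_sum p m (\<lambda>l. trace_matrix p g m f (Tor P N l) (Tor_map P N \<Phi> \<psi> l)) $$ (j, i) = euler_form_op ?C ?y ?x $$ (j, i)" .
qed (simp_all add: alternating_sum_def euler_form_op_def trace_matrix_cpx_def)

end

theorem theorem9:
  fixes sA :: "'k::field \<Rightarrow> 'a::{ring,monoid_mult} \<Rightarrow> 'a"
    and sB :: "'k \<Rightarrow> 'b::{ring,monoid_mult} \<Rightarrow> 'b"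
    and sC :: "'k \<Rightarrow> 'c::{ring,monoid_mult} \<Rightarrow> 'c"
    and e :: "nat \<Rightarrow> 'a" and f :: "nat \<Rightarrow> 'b" and g :: "nat \<Rightarrow> 'c"
    and n m p :: nat
  assumes "fd_algebra sA" "elementary sA" "finite_global_dimension sA"
    and "fd_algebra sB" "elementary sB"
    and "fd_algebra sC" "elementary sC"
    and "complete_primitive_idempotents n e"
    and "complete_primitive_idempotents m f"
    and "complete_primitive_idempotents p g"
  shows
    "(\<forall>(M :: ('k, 'a, 'm::ab_group_add, 'b) cpx) \<phi>
       (N :: ('k, 'a, 'n::ab_group_add, 'c) cpx) \<psi>
       (P :: ('k, 'a, 'p::ab_group_add, 'b) cpx) \<pi> \<Phi>.
        bounded_fd_complex sB sA M \<and> chain_map M M \<phi>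
      \<and> bounded_fd_complex sC sA N \<and> chain_map N N \<psi>
      \<and> projective_resolution sB sA P M \<pi> \<and> lifts_endomorphism P M \<pi> \<phi> \<Phi>
      \<longrightarrow> alternating_sum m p (\<lambda>l. trace_matrix m f p g (Ext P N l) (Ext_map P N \<Phi> \<psi> l))
          = euler_form (cartan_matrix sA n e)
              (trace_matrix_cpx n e m f M \<phi>) (trace_matrix_cpx n e p g N \<psi>))
   \<and> (\<forall>(M :: ('k, 'a, 'm::ab_group_add, 'b) cpx) \<phi>
       (N :: ('k, 'c, 'n::ab_group_add, 'a) cpx) \<psi>
       (P :: ('k, 'a, 'p::ab_group_add, 'b) cpx) \<pi> \<Phi>.
        bounded_fd_complex sB sA M \<and> chain_map M M \<phi>
      \<and> bounded_fd_complex sA sC N \<and> chain_map N N \<psi>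
      \<and> projective_resolution sB sA P M \<pi> \<and> lifts_endomorphism P M \<pi> \<phi> \<Phi>
      \<longrightarrow> alternating_sum p m (\<lambda>l. trace_matrix p g m f (Tor P N l) (Tor_map P N \<Phi> \<psi> l))
          = euler_form_op (cartan_matrix sA n e)
              (transpose_mat (trace_matrix_cpx p g n e N \<psi>)) (trace_matrix_cpx n e m f M \<phi>))"
proof -
  obtain \<chi> where "basic_alg sA n e \<chi>"
    using elementary_basic_alg[OF assms(1,2,8)] by blast
  then interpret basic_alg sA n e \<chi> .
  have f: "f i * f i = f i" if "i < m" for i
    using assms(9) that unfolding complete_primitive_idempotents_def primitive_idempotent_def by blast
  have g: "g j * g j = g j" if "j < p" for j
    using assms(10) that unfolding complete_primitive_idempotents_def primitive_idempotent_def by blast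
  show ?thesis
    apply (intro conjI allI impI)
    subgoal by (elim conjE) (rule Ext_formula[OF assms(3) _ _ _ _ _ _ f g])
    subgoal by (elim conjE) (rule Tor_formula[OF assms(3,6) _ _ _ _ _ _ f g])
    done
qed

end
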